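(* Let $d\ge3$ and let $\mathbb P$, $\theta^\omega$ and the random conductance model on $\mathbb Z^d$ be as in the context. Suppose there exist $m_0>d$, $p\in\bigl(\max\{1,\frac d{m_0-2}\},\infty\bigr]$ and $q\in(1,\infty]$ with $\frac1p+\frac1q<\frac2d$ such that $\theta^\omega(0),\mu^\omega_{m_0}(0)\in L^p(\mathbb P)$ and $\nu^\omega(0)\in L^q(\mathbb P)$. Define $$\mathcal M_0^\omega:=\sup_{R\ge1}\Bigl(\bigl(\|1\vee\mu^\omega_{m_0}\|_{p,B(R)}+\|1\vee\theta^\omega\|_{p,B(R)}\bigr)\cdot\|1\vee\nu^\omega\|_{q,B(R)}\Bigr),$$ $$\mathcal M_1^\omega:=\bigl(\mathcal M_0^\omega\bigr)^{(1+m_0\gamma)/\beta}\Bigl(1+\frac{\mu^\omega_{m_0}(0)}{\theta^\omega(0)}\Bigr),$$ where $\beta,\gamma\in(0,1)$ are the exponents defined in the context. Then $\mathcal M_1^\omega<\infty$ for $\mathbb P$-a.e. $\omega$, and there exists a non-random constant $C_4\in(0,\infty)$ such that for every $\omega\in\Omega$ and every $t>0$, $$p^\omega(t,0,0)\le C_4\,\mathcal M_1^\omega\,t^{-d/2}$$ (the inequality being void when $\mathcal M_1^\omega=\infty$).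
   Context: Consider $\mathbb Z^d$ with nearest-neighbour edges ($x\sim y$ iff $|x-y|_1=1$), graph distance $\mathrm{dist}(x,y)=|x-y|_1$, and balls $B(R):=\{y\in\mathbb Z^d:\mathrm{dist}(0,y)\le\lfloor R\rfloor\}$. For finite $A$ and $1\le p<\infty$, $\|f\|_{p,A}:=\bigl(\frac1{|A|}\sum_{y\in A}|f(y)|^p\bigr)^{1/p}$ and $\|f\|_{\infty,A}:=\max_A|f|$. Environment: $\bar{\boldsymbol E}:=\{\{x,y\}:x,y\in\mathbb Z^d,\ x\ne y\}$, $\Omega:=(0,\infty)^{\bar{\boldsymbol E}}$ with product Borel $\sigma$-algebra $\mathcal F$; write $\omega(x,y)=\omega(\{x,y\})$. Shifts: $(\tau_z\omega)(x,y):=\omega(\{x+z,y+z\})$. For $m\ge0$, $\mu^\omega_m(x):=\sum_{y\in\mathbb Z^d}\omega(x,y)\,\mathrm{dist}(x,y)^m$ (with $\omega(x,x):=0$) and $\nu^\omega(x):=\sum_{y\sim x}\omega(x,y)^{-1}$. $\mathbb P$ is a probability measure on $(\Omega,\mathcal F)$ that is stationary and ergodic under the shifts: $\mathbb P\circ\tau_x^{-1}=\mathbb P$ for all $x$, and $\mathbb P[A]\in\{0,1\}$ whenever $\tau_x(A)=A$ for all $x\in\mathbb Z^d$. The speed measure $\theta^\omega:\mathbb Z^d\to(0,\infty)$ is a (possibly $\omega$-dependent) function that is stationary: $\theta^\omega(x+y)=\theta^{\tau_y\omega}(x)$ for all $x,y$ and $\mathbb P$-a.e. $\omega$. Process: whenever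 $\sum_y\omega(x,y)<\infty$ for all $x$, the form $\frac12\sum_{x,y}\omega(x,y)(f(y)-f(x))^2$ on finitely supported functions extends (by closure) to a regular Dirichlet form on $L^2(\mathbb Z^d,\theta^\omega)$; $X^\omega$ is the associated Hunt process with law $\mathrm P^\omega_x$ when started at $x$, with generator $\mathcal L^\omega f(x)=\frac1{\theta^\omega(x)}\sum_{y\in\mathbb Z^d}\omega(x,y)(f(y)-f(x))$ on finitely supported $f$, and $p^\omega(t,x,y):=\mathrm P^\omega_x[X^\omega_t=y]/\theta^\omega(y)$. Exponents: with $a:=\frac dp+\frac dq$, $a':=2-\frac dp-\frac dq$, $\sigma:=2dm_0+a'm_0+2ad+a'd$, put $\alpha:=\frac{2dm_0}\sigma$, $\beta:=\frac{a'm_0}\sigma$, $\gamma:=\frac{2ad+a'd}\sigma$. *)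

theory Defs
  imports "HOL-Probability.Probability" "HOL-Probability.Essential_Supremum"
begin

section \<open>The lattice\<close>

type_synonym 'd site = "int ^ 'd"

definition l1_dist :: "'d::finite site \<Rightarrow> 'd site \<Rightarrow> int" where
  "l1_dist x y = (\<Sum>i\<in>UNIV. \<bar>x $ i - y $ i\<bar>)"

definition lattice_ball :: "real \<Rightarrow> 'd::finite site set" where
  "lattice_ball R = {y. l1_dist 0 y \<le> \<lfloor>R\<rfloor>}"


section \<open>Integrability and averaged norms\<close>

text \<open>All functions whose norms occur are nonnegative, possibly with the value \<open>\<infinity>\<close>. Exponents
  \<open>p \<in> [1, \<infinity>]\<close> are extended nonnegative reals.\<close>

text \<open>For \<open>r > 0\<close> only.\<close>
definition epowr :: "ennreal \<Rightarrow> real \<Rightarrow> ennreal" where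
  "epowr x r = (if x = \<infinity> then \<infinity> else ennreal (enn2real x powr r))"

definition in_Lp :: "'a measure \<Rightarrow> ennreal \<Rightarrow> ('a \<Rightarrow> ennreal) \<Rightarrow> bool" where
  "in_Lp M p f \<longleftrightarrow> f \<in> borel_measurable M \<and>
     (if p = \<infinity> then esssup M f < \<infinity> else (\<integral>\<^sup>+ x. epowr (f x) (enn2real p) \<partial>M) < \<infinity>)"

definition avg_norm :: "ennreal \<Rightarrow> 'a set \<Rightarrow> ('a \<Rightarrow> ennreal) \<Rightarrow> ennreal" where
  "avg_norm p A f =
     (if p = \<infinity> then Max (f ` A)
      else epowr ((\<Sum>y\<in>A. epowr (f y) (enn2real p)) / of_nat (card A)) (1 / enn2real p))"


section \<open>The random environment\<close>

type_synonym 'd env = "'d site set \<Rightarrow> real"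

definition bonds :: "'d::finite site set set" where
  "bonds = {{x, y} |x y. x \<noteq> y}"

text \<open>The space of this measure (only its \<open>\<sigma>\<close>-algebra matters) is \<open>\<Omega> = (0,\<infinity>)\<^sup>E\<close>, with \<open>E\<close> the set
  of bonds; environments take the value \<open>undefined\<close> outside \<open>bonds\<close>.\<close>
definition env_space :: "'d::finite env measure" where
  "env_space = PiM bonds (\<lambda>_. restrict_space borel {0<..})"

definition cond :: "'d::finite env \<Rightarrow> 'd site \<Rightarrow> 'd site \<Rightarrow> real" where
  "cond \<omega> x y = (if x = y then 0 else \<omega> {x, y})"

definition env_shift :: "'d::finite site \<Rightarrow> 'd env \<Rightarrow> 'd env" where
  "env_shift z \<omega> = restrict (\<lambda>e. \<omega> ((\<lambda>v. v + z) ` e)) bonds"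

definition mu :: "real \<Rightarrow> 'd::finite env \<Rightarrow> 'd site \<Rightarrow> ennreal" where
  "mu m \<omega> x = (\<Sum>\<^sub>\<infinity>y. ennreal (cond \<omega> x y * of_int (l1_dist x y) powr m))"

definition nu :: "'d::finite env \<Rightarrow> 'd site \<Rightarrow> real" where
  "nu \<omega> x = (\<Sum>y | l1_dist x y = 1. inverse (cond \<omega> x y))"

definition stationary_law :: "'d::finite env measure \<Rightarrow> bool" where
  "stationary_law PP \<longleftrightarrow> (\<forall>z. distr PP env_space (env_shift z) = PP)"

definition ergodic_law :: "'d::finite env measure \<Rightarrow> bool" where
  "ergodic_law PP \<longleftrightarrow>
     (\<forall>A\<in>sets env_space. (\<forall>z. env_shift z ` A = A) \<longrightarrow> measure PP A \<in> {0, 1})"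

definition stationary_speed ::
    "'d::finite env measure \<Rightarrow> ('d env \<Rightarrow> 'd site \<Rightarrow> real) \<Rightarrow> bool" where
  "stationary_speed PP \<theta> \<longleftrightarrow>
     (\<forall>x y. AE \<omega> in PP. \<theta> \<omega> (x + y) = \<theta> (env_shift y \<omega>) x)"


section \<open>The Dirichlet form\<close>

text \<open>In this section \<open>\<theta>\<close> is the speed measure of a fixed environment.\<close>

definition L2 :: "('d::finite site \<Rightarrow> real) \<Rightarrow> ('d site \<Rightarrow> real) set" where
  "L2 \<theta> = {f. (\<lambda>x. \<theta> x * (f x)\<^sup>2) summable_on UNIV}"

definition L2_inner ::
    "('d::finite site \<Rightarrow> real) \<Rightarrow> ('d site \<Rightarrow> real) \<Rightarrow> ('d site \<Rightarrow> real) \<Rightarrow> real" where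
  "L2_inner \<theta> f g = (\<Sum>\<^sub>\<infinity>x. \<theta> x * f x * g x)"

definition L2_nrm :: "('d::finite site \<Rightarrow> real) \<Rightarrow> ('d site \<Rightarrow> real) \<Rightarrow> real" where
  "L2_nrm \<theta> f = sqrt (L2_inner \<theta> f f)"

definition fin_supp :: "('d::finite site \<Rightarrow> real) set" where
  "fin_supp = {f. finite {x. f x \<noteq> 0}}"

text \<open>Used for finitely supported \<open>f\<close> and \<open>g\<close> only, where the double series converges absolutely
  as soon as the sums \<open>\<Sum>y. \<omega>(x,y)\<close> are finite.\<close>
definition energy ::
    "'d::finite env \<Rightarrow> ('d site \<Rightarrow> real) \<Rightarrow> ('d site \<Rightarrow> real) \<Rightarrow> real" where
  "energy \<omega> f g =
     1/2 * (\<Sum>\<^sub>\<infinity>(x, y). cond \<omega> x y * (f y - f x) * (g y - g x))"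

text \<open>The sequence \<open>un\<close> is Cauchy for the energy and converges to \<open>u\<close> in \<open>L\<^sup>2(\<theta>)\<close>; the functions
  \<open>u\<close> admitting such a sequence form the domain of the closure of \<open>energy\<close>.\<close>
definition form_approx :: "'d::finite env \<Rightarrow> ('d site \<Rightarrow> real) \<Rightarrow>
    ('d site \<Rightarrow> real) \<Rightarrow> (nat \<Rightarrow> 'd site \<Rightarrow> real) \<Rightarrow> bool" where
  "form_approx \<omega> \<theta> u un \<longleftrightarrow>
     range un \<subseteq> fin_supp \<and>
     (\<forall>e>0. \<exists>N. \<forall>m\<ge>N. \<forall>n\<ge>N.
        energy \<omega> (\<lambda>x. un m x - un n x) (\<lambda>x. un m x - un n x) < e) \<and>
     (\<lambda>n. L2_nrm \<theta> (\<lambda>x. un n x - u x)) \<longlonglongrightarrow> 0"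

definition form_dom :: "'d::finite env \<Rightarrow> ('d site \<Rightarrow> real) \<Rightarrow> ('d site \<Rightarrow> real) set" where
  "form_dom \<omega> \<theta> = {u \<in> L2 \<theta>. \<exists>un. form_approx \<omega> \<theta> u un}"

definition closed_form :: "'d::finite env \<Rightarrow> ('d site \<Rightarrow> real) \<Rightarrow>
    ('d site \<Rightarrow> real) \<Rightarrow> ('d site \<Rightarrow> real) \<Rightarrow> real" where
  "closed_form \<omega> \<theta> u v =
     (THE r. \<exists>un vn. form_approx \<omega> \<theta> u un \<and> form_approx \<omega> \<theta> v vn \<and>
        (\<lambda>n. energy \<omega> (un n) (vn n)) \<longlonglongrightarrow> r)"

text \<open>\<open>T\<close> is the symmetric strongly continuous contraction semigroup on \<open>L\<^sup>2(\<theta>)\<close> of the closed form: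
  its generator \<open>A\<close> has its domain inside the form domain, and \<open>\<E>(u,v) = - \<langle>Au, v\<rangle>\<close>. In the last
  clause \<open>w\<close> is \<open>Au\<close>. The values \<open>T t f\<close> with \<open>t \<le> 0\<close> or \<open>f\<close> outside \<open>L\<^sup>2(\<theta>)\<close> are irrelevant.\<close>
definition form_semigroup :: "'d::finite env \<Rightarrow> ('d site \<Rightarrow> real) \<Rightarrow>
    (real \<Rightarrow> ('d site \<Rightarrow> real) \<Rightarrow> 'd site \<Rightarrow> real) \<Rightarrow> bool" where
  "form_semigroup \<omega> \<theta> T \<longleftrightarrow>
     (\<forall>t>0. \<forall>f\<in>L2 \<theta>. T t f \<in> L2 \<theta> \<and> L2_nrm \<theta> (T t f) \<le> L2_nrm \<theta> f) \<and>
     (\<forall>t>0. \<forall>f\<in>L2 \<theta>. \<forall>g\<in>L2 \<theta>. \<forall>a b.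
        T t (\<lambda>x. a * f x + b * g x) = (\<lambda>x. a * T t f x + b * T t g x)) \<and>
     (\<forall>t>0. \<forall>f\<in>L2 \<theta>. \<forall>g\<in>L2 \<theta>. L2_inner \<theta> (T t f) g = L2_inner \<theta> f (T t g)) \<and>
     (\<forall>s>0. \<forall>t>0. \<forall>f\<in>L2 \<theta>. T (s + t) f = T s (T t f)) \<and>
     (\<forall>f\<in>L2 \<theta>. ((\<lambda>t. L2_nrm \<theta> (\<lambda>x. T t f x - f x)) \<longlongrightarrow> 0) (at_right 0)) \<and>
     (\<forall>u\<in>L2 \<theta>. \<forall>w\<in>L2 \<theta>.
        ((\<lambda>t. L2_nrm \<theta> (\<lambda>x. (T t u x - u x) / t - w x)) \<longlongrightarrow> 0) (at_right 0) \<longrightarrow>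
        u \<in> form_dom \<omega> \<theta> \<and>
        (\<forall>v\<in>form_dom \<omega> \<theta>. closed_form \<omega> \<theta> u v = - L2_inner \<theta> w v))"


section \<open>Hunt processes on the lattice\<close>

text \<open>Canonical realisation on path space. The state space is the one-point compactification of
  the discrete lattice; \<open>None\<close> is the cemetery. Time runs through \<open>[0,\<infinity>]\<close>, with \<open>X\<^sub>\<infinity>\<close> the cemetery.\<close>

type_synonym 'd state = "'d site option"
type_synonym 'd path = "ennreal \<Rightarrow> 'd state"

definition state_top :: "'d::finite state topology" where
  "state_top = Alexandroff_compactification (discrete_topology UNIV)"

definition paths :: "'d::finite path set" where
  "paths = {w. w \<infinity> = None \<and>
     (\<forall>s t. w s = None \<and> s \<le> t \<longrightarrow> w t = None) \<and>
     (\<forall>t<\<infinity>. limitin state_top w (w t) (at_right t)) \<and>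
     (\<forall>t. 0 < t \<and> t < \<infinity> \<longrightarrow> (\<exists>l. limitin state_top w l (at_left t)))}"

definition path_sigma :: "ennreal \<Rightarrow> 'd::finite path measure" where
  "path_sigma t = sigma paths {{w\<in>paths. w s = z} |s z. s \<le> t}"

text \<open>The right-continuous filtration \<open>\<F>\<^sub>t\<^sub>+\<close>; at \<open>t = \<infinity>\<close> it is the full \<open>\<sigma>\<close>-algebra.\<close>
definition path_filtration :: "ennreal \<Rightarrow> 'd::finite path measure" where
  "path_filtration t =
     sigma paths {A \<in> sets (path_sigma \<infinity>). \<forall>u>t. A \<in> sets (path_sigma u)}"

text \<open>\<open>P z\<close> is the law of the process started at \<open>z\<close>. The last two clauses are the strong Markov
  property (which contains the simple Markov property) and quasi-left-continuity.\<close>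
definition hunt_process :: "('d::finite state \<Rightarrow> 'd path measure) \<Rightarrow> bool" where
  "hunt_process P \<longleftrightarrow>
     (\<forall>z. prob_space (P z) \<and> space (P z) = paths \<and> sets (P z) = sets (path_sigma \<infinity>)) \<and>
     (\<forall>z. AE w in P z. w 0 = z) \<and>
     (\<forall>z z' s T A. s < \<infinity> \<and> stopping_time path_filtration T \<and>
        A \<in> sets (filtration.pre_sigma paths path_filtration T) \<longrightarrow>
        emeasure (P z) {w\<in>A. T w < \<infinity> \<and> w (T w + s) = z'} =
        (\<integral>\<^sup>+ w. emeasure (P (w (T w))) {w'\<in>paths. w' s = z'} *
                indicator {w\<in>A. T w < \<infinity>} w \<partial>P z)) \<and>
     (\<forall>z. \<forall>T :: nat \<Rightarrow> 'd path \<Rightarrow> ennreal.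
        (\<forall>n. stopping_time path_filtration (T n)) \<and> (\<forall>w\<in>paths. incseq (\<lambda>n. T n w)) \<longrightarrow>
        (AE w in P z. (SUP n. T n w) < \<infinity> \<longrightarrow>
           limitin state_top (\<lambda>n. w (T n w)) (w (SUP n. T n w)) sequentially))"

text \<open>Functions on the lattice are extended by \<open>0\<close> to the cemetery. All points are charged by \<open>\<theta>\<close>,
  so that there are no exceptional sets and the identity holds at every point.\<close>
definition hunt_process_of_form :: "'d::finite env \<Rightarrow> ('d site \<Rightarrow> real) \<Rightarrow>
    ('d state \<Rightarrow> 'd path measure) \<Rightarrow> bool" where
  "hunt_process_of_form \<omega> \<theta> P \<longleftrightarrow> hunt_process P \<and>
     (\<exists>T. form_semigroup \<omega> \<theta> T \<and>
        (\<forall>t>0. \<forall>f\<in>L2 \<theta>. bounded (range f) \<longrightarrow>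
           (\<forall>x. T t f x =
              (\<integral>w. (case w (ennreal t) of None \<Rightarrow> 0 | Some y \<Rightarrow> f y) \<partial>P (Some x)))))"

definition heat_kernel :: "('d::finite site \<Rightarrow> real) \<Rightarrow> ('d state \<Rightarrow> 'd path measure) \<Rightarrow>
    real \<Rightarrow> 'd site \<Rightarrow> 'd site \<Rightarrow> real" where
  "heat_kernel \<theta> P t x y = measure (P (Some x)) {w\<in>paths. w (ennreal t) = Some y} / \<theta> y"


section \<open>Exponents and the random constants\<close>

text \<open>\<open>d/p\<close> as a real number, with \<open>d/\<infinity> = 0\<close>.\<close>
definition dim_ratio :: "nat \<Rightarrow> ennreal \<Rightarrow> real" where
  "dim_ratio d p = enn2real (of_nat d / p)"

definition exp_a :: "nat \<Rightarrow> ennreal \<Rightarrow> ennreal \<Rightarrow> real" where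
  "exp_a d p q = dim_ratio d p + dim_ratio d q"

definition exp_a' :: "nat \<Rightarrow> ennreal \<Rightarrow> ennreal \<Rightarrow> real" where
  "exp_a' d p q = 2 - dim_ratio d p - dim_ratio d q"

definition exp_sigma :: "nat \<Rightarrow> real \<Rightarrow> ennreal \<Rightarrow> ennreal \<Rightarrow> real" where
  "exp_sigma d m0 p q =
     2 * d * m0 + exp_a' d p q * m0 + 2 * exp_a d p q * d + exp_a' d p q * d"

definition exp_beta :: "nat \<Rightarrow> real \<Rightarrow> ennreal \<Rightarrow> ennreal \<Rightarrow> real" where
  "exp_beta d m0 p q = exp_a' d p q * m0 / exp_sigma d m0 p q"

definition exp_gamma :: "nat \<Rightarrow> real \<Rightarrow> ennreal \<Rightarrow> ennreal \<Rightarrow> real" where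
  "exp_gamma d m0 p q = (2 * exp_a d p q * d + exp_a' d p q * d) / exp_sigma d m0 p q"

definition M0 :: "real \<Rightarrow> ennreal \<Rightarrow> ennreal \<Rightarrow>
    ('d::finite env \<Rightarrow> 'd site \<Rightarrow> real) \<Rightarrow> 'd env \<Rightarrow> ennreal" where
  "M0 m0 p q \<theta> \<omega> = (SUP R\<in>{1::real..}.
     (avg_norm p (lattice_ball R) (\<lambda>x. max 1 (mu m0 \<omega> x)) +
      avg_norm p (lattice_ball R) (\<lambda>x. max 1 (ennreal (\<theta> \<omega> x)))) *
     avg_norm q (lattice_ball R) (\<lambda>x. max 1 (ennreal (nu \<omega> x))))"

definition M1 :: "real \<Rightarrow> ennreal \<Rightarrow> ennreal \<Rightarrow>
    ('d::finite env \<Rightarrow> 'd site \<Rightarrow> real) \<Rightarrow> 'd env \<Rightarrow> ennreal" where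
  "M1 m0 p q \<theta> \<omega> =
     epowr (M0 m0 p q \<theta> \<omega>)
       ((1 + m0 * exp_gamma CARD('d) m0 p q) / exp_beta CARD('d) m0 p q) *
     (1 + mu m0 \<omega> 0 / ennreal (\<theta> \<omega> 0))"

end

theory Submission
  imports Defs
begin

text \<open>On-diagonal bounds are proved for killed random walks on finite balls run with the implicit
  Euler scheme, with constants that depend neither on the ball nor on the step, and then passed to
  the limit: the finite chains are Galerkin approximations of the resolvents, and the implicit Euler
  scheme converges to the semigroup.

  For a finite chain whose speed measure \<open>\<theta>'\<close> dominates \<open>1\<close>, \<open>\<mu>\<close> and \<open>\<theta>\<close>, Nash's argument applies: the
  moment of order \<open>m > d\<close> of the squared density controls its mass far from the origin, and near the
  origin a Sobolev inequality weighted by \<open>\<theta>'\<close>, with exponent \<open>b = 2 + a'/d\<close> and constants given by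
  the averaged norms, controls it by the Dirichlet form. The bound is transferred to \<open>\<theta> \<le> \<theta>'\<close> by
  comparing time sums of the kernels through the Green potential. This gives
  \<open>p(t,0,0) \<le> C M\<^sub>0\<^sup>k t\<^sup>-\<^sup>d\<^sup>/\<^sup>2\<close> with \<open>k = 1 + 4d/a'\<close> for all \<open>t > 0\<close>, and \<open>k\<close> is at most the exponent
  \<open>(1 + m\<^sub>0\<gamma>)/\<beta>\<close> of \<open>M\<^sub>1\<close>.

  That \<open>M\<^sub>1\<close> is almost surely finite is a maximal inequality for averages over balls, which only needs
  stationarity.\<close>

section \<open>Balls in the lattice\<close>

text \<open>Jumps of any length occur, and the averaged norms control balls about the origin only,
  so a uniform Sobolev constant is available only there. What confines the walk is the moment of
  order \<open>m\<close>. Its source term is of order t^((m-d)/2-1), which adds up to t^((m-d)/2)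
  because \<open>m > d\<close>. The decay is closed by a bootstrap. Let L be the largest value, up
  to a given time, of t^(d/2) times the squared norm of the density. The moment is then O(L
  t^((m-d)/2)) and the Dirichlet form O(L t^(-d/2-1)), both linear in L with constants free of the
  environment. Cutting space at a radius of order sqrt t and the density at a level of order L
  t^(-d/2) leaves L \<le> L/2 + C Z L^(2-b/2) with Z = \<open>KV * K powr (b / 2)\<close>. As
  \<open>b > 2\<close>, L is at most a multiple of Z^(2/(b-2)). Since Z is of order M_0^(1+b/2), the
  exponent of M_0 becomes (1+b/2) 2/(b-2) = k. Implicit steps keep this algebraic: each estimate
  tests one resolvent equation, with the solution (dissipation), with a weighted multiple of it
  (moment) or with 1 (mass).\<close>

lemma l1_dist_nonneg: "0 \<le> l1_dist x y"
  by (simp add: l1_dist_def sum_nonneg)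

lemma l1_dist_commute: "l1_dist x y = l1_dist y x"
  by (simp add: l1_dist_def abs_minus_commute)

lemma l1_dist_triangle: "l1_dist x z \<le> l1_dist x y + l1_dist y z"
  unfolding l1_dist_def sum.distrib[symmetric] by (intro sum_mono) linarith

lemma l1_dist_eq_0_iff: "l1_dist x y = 0 \<longleftrightarrow> x = y"
  by (auto simp: l1_dist_def sum_nonneg_eq_0_iff vec_eq_iff)

lemma l1_dist_ge_1: "x \<noteq> y \<Longrightarrow> 1 \<le> l1_dist x y"
  using l1_dist_nonneg[of x y] l1_dist_eq_0_iff[of x y] by linarith

lemma l1_dist_add_right: "l1_dist (x + z) (y + z) = l1_dist x y"
  by (simp add: l1_dist_def)

lemma l1_dist_self_add: "l1_dist x (x + z) = l1_dist 0 z"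
  by (simp add: l1_dist_def)

lemma l1_dist_zero_add_le: "l1_dist 0 (x + y) \<le> l1_dist 0 x + l1_dist 0 y"
  using l1_dist_triangle[of 0 "x + y" x] by (simp add: l1_dist_self_add)

lemma l1_dist_0_axis [simp]: "l1_dist 0 (axis i k) = \<bar>k\<bar>"
  by (simp add: l1_dist_def axis_def if_distrib[of abs] cong: if_cong)

lemma box_finite_card:
  fixes A :: "'d::finite \<Rightarrow> int set"
  assumes "\<And>i. finite (A i)"
  shows "finite {x :: 'd site. \<forall>i. x $ i \<in> A i}"
    and "card {x :: 'd site. \<forall>i. x $ i \<in> A i} = (\<Prod>i\<in>UNIV. card (A i))"
proof -
  have b: "bij_betw (\<lambda>x. ($) x) {x :: 'd site. \<forall>i. x $ i \<in> A i} (PiE UNIV A)"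
    by (rule bij_betw_byWitness[where f' = vec_lambda]) auto
  show "finite {x :: 'd site. \<forall>i. x $ i \<in> A i}"
    using bij_betw_finite[OF b] assms by (simp add: finite_PiE)
  show "card {x :: 'd site. \<forall>i. x $ i \<in> A i} = (\<Prod>i\<in>UNIV. card (A i))"
    using bij_betw_same_card[OF b] by (simp add: card_PiE)
qed

definition nat_ball :: "nat \<Rightarrow> 'd::finite site set" where
  "nat_ball n = {y. l1_dist 0 y \<le> int n}"

lemma lattice_ball_eq_nat_ball: "0 \<le> R \<Longrightarrow> lattice_ball R = nat_ball (nat \<lfloor>R\<rfloor>)"
  by (simp add: lattice_ball_def nat_ball_def)

lemma zero_in_nat_ball [simp]: "0 \<in> nat_ball n"
  by (simp add: nat_ball_def l1_dist_def)

lemma nat_ball_subset_box: "nat_ball n \<subseteq> {x. \<forall>i. x $ i \<in> {- int n..int n}}"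
proof safe
  fix x :: "'a site" and i assume "x \<in> nat_ball n"
  then have "(\<Sum>i\<in>UNIV. \<bar>x $ i\<bar>) \<le> int n"
    by (simp add: nat_ball_def l1_dist_def)
  moreover have "\<bar>x $ i\<bar> \<le> (\<Sum>i\<in>UNIV. \<bar>x $ i\<bar>)"
    by (rule member_le_sum) auto
  ultimately have "\<bar>x $ i\<bar> \<le> int n" by linarith
  then show "x $ i \<in> {- int n..int n}" by auto
qed

lemma finite_nat_ball [simp]: "finite (nat_ball n)"
  by (rule finite_subset[OF nat_ball_subset_box box_finite_card(1)]) simp

lemma card_nat_ball_pos: "0 < card (nat_ball n :: 'd::finite site set)"
  using zero_in_nat_ball[of n, where 'a = 'd] by (auto simp: card_gt_0_iff simp del: zero_in_nat_ball)

lemma card_nat_ball_le: "n \<ge> 1 \<Longrightarrow> card (nat_ball n :: 'd::finite site set) \<le> (3 * n) ^ CARD('d)"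
proof -
  assume n: "n \<ge> 1"
  have "card (nat_ball n :: 'd site set) \<le> card {x :: 'd site. \<forall>i. x $ i \<in> {- int n..int n}}"
    by (rule card_mono[OF box_finite_card(1) nat_ball_subset_box]) simp
  also have "\<dots> = (2 * n + 1) ^ CARD('d)"
    by (subst box_finite_card(2)) (auto simp: nat_add_distrib nat_mult_distrib)
  also have "\<dots> \<le> (3 * n) ^ CARD('d)"
    using n by (intro power_mono) auto
  finally show ?thesis .
qed

text \<open>The ball contains a box with n div d + 1 points per side, and this is at least n/d: the
  extra end point makes up for the rounding. Together with \<open>card_nat_ball_le\<close> this
  yields volume doubling.\<close>

lemma card_nat_ball_ge: "(n / CARD('d)) ^ CARD('d) \<le> real (card (nat_ball n :: 'd::finite site set))"
proof -
  let ?k = "n div CARD('d)"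
  have sub: "{x :: 'd site. \<forall>i. x $ i \<in> {0..int ?k}} \<subseteq> nat_ball n"
  proof
    fix x :: "'d site" assume x: "x \<in> {x. \<forall>i. x $ i \<in> {0..int ?k}}"
    have "l1_dist 0 x \<le> (\<Sum>i\<in>(UNIV::'d set). int ?k)"
      unfolding l1_dist_def using x by (intro sum_mono) (auto simp: zero_vec_def)
    also have "\<dots> = int (CARD('d) * ?k)" by simp
    also have "\<dots> \<le> int n" by (metis of_nat_le_iff times_div_less_eq_dividend)
    finally show "x \<in> nat_ball n" by (simp add: nat_ball_def)
  qed
  have "n < CARD('d) * (?k + 1)"
    using dividend_less_times_div[of "CARD('d)" n] by simp
  then have "real n \<le> real (CARD('d) * (?k + 1))"
    by linarith
  then have "n / CARD('d) \<le> real (?k + 1)"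
    by (simp add: divide_le_eq algebra_simps)
  then have "(n / CARD('d)) ^ CARD('d) \<le> real (?k + 1) ^ CARD('d)"
    by (intro power_mono) auto
  also have "\<dots> = real (card {x :: 'd site. \<forall>i. x $ i \<in> {0..int ?k}})"
    by (subst box_finite_card(2)) (auto simp: nat_add_distrib)
  also have "\<dots> \<le> real (card (nat_ball n :: 'd site set))"
    using card_mono[OF _ sub] by simp
  finally show ?thesis .
qed

abbreviation e1 :: "'d::finite \<Rightarrow> 'd site" where "e1 i \<equiv> axis i 1"

section \<open>A weighted Sobolev inequality\<close>

definition cube :: "nat \<Rightarrow> 'd::finite site set" where
  "cube n = {z. \<forall>i. 0 \<le> z $ i \<and> z $ i < 2 ^ n}"

lemma cube_eq_box: "cube n = {z. \<forall>i. z $ i \<in> {0..<2 ^ n}}"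
  by (auto simp: cube_def)

lemma finite_cube [simp]: "finite (cube n)"
  unfolding cube_eq_box by (rule box_finite_card) simp

lemma card_cube: "card (cube n :: 'd::finite site set) = 2 ^ (n * CARD('d))"
proof -
  have "card (cube n :: 'd site set) = (\<Prod>i\<in>(UNIV::'d set). card {0..<(2::int) ^ n})"
    unfolding cube_eq_box by (rule box_finite_card) simp
  then show ?thesis
    by (simp add: power_mult nat_power_eq)
qed

lemma cube_l1_norm: "z \<in> cube n \<Longrightarrow> l1_dist 0 z \<le> int (CARD('d) * 2 ^ n)" for z :: "'d::finite site"
proof -
  assume z: "z \<in> cube n"
  have "l1_dist 0 z \<le> (\<Sum>i\<in>(UNIV::'d set). 2 ^ n)"
    unfolding l1_dist_def using z
    by (intro sum_mono) (auto simp: cube_def intro: less_imp_le)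
  then show ?thesis by simp
qed

text \<open>The vectors \<open>2 ^ n *s chi I\<close> are the corners at which translates of
  \<open>cube n\<close> tile \<open>cube (Suc n)\<close>. Indexing them by sets of coordinates
  permits induction over the coordinates.\<close>

definition chi :: "'d::finite set \<Rightarrow> 'd site" where
  "chi I = (\<chi> i. if i \<in> I then 1 else 0)"

lemma chi_insert: "i \<notin> I \<Longrightarrow> chi (insert i I) = chi I + e1 i"
  by (auto simp: chi_def axis_def vec_eq_iff)

definition grad :: "('d::finite site \<Rightarrow> real) \<Rightarrow> 'd site \<Rightarrow> real" where
  "grad f y = (\<Sum>i\<in>UNIV. \<bar>f (y + e1 i) - f y\<bar>)"

lemma grad_nonneg: "0 \<le> grad f y"
  by (simp add: grad_def sum_nonneg)

lemma axis_of_nat_Suc: "axis i (int (Suc l)) = axis i (int l) + e1 i"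
  by (auto simp: axis_def vec_eq_iff)

lemma straight_diff_le:
  fixes f :: "'d::finite site \<Rightarrow> real"
  shows
  "\<bar>f (y + axis i (int L)) - f y\<bar> \<le> (\<Sum>l<L. \<bar>f (y + axis i (int l) + e1 i) - f (y + axis i (int l))\<bar>)"
proof (induction L)
  case 0
  have "axis i (0::int) = 0" by (simp add: axis_def vec_eq_iff)
  then have "y + axis i (int 0) = y" by simp
  then show ?case by (simp only: lessThan_0 sum.empty diff_self abs_zero order_refl)
next
  case (Suc L)
  have "f (y + axis i (int (Suc L))) = f (y + axis i (int L) + e1 i)"
    by (simp only: axis_of_nat_Suc add.assoc)
  then show ?case using Suc by simp
qed

text \<open>Telescoping along a segment of 2^n unit steps in direction \<open>i\<close>: for each
  step the base points form a translate of \<open>cube n\<close>. The condition on \<open>I\<close>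
  keeps this translate inside \<open>cube (Suc n)\<close>, because coordinate \<open>i\<close> has
  not been shifted yet.\<close>

lemma shift_one_direction:
  fixes f :: "'d::finite site \<Rightarrow> real"
  assumes "i \<notin> I"
  shows "(\<Sum>z\<in>cube n. \<bar>f (x + z + axis i (2 ^ n) + 2 ^ n *s chi I) - f (x + z + 2 ^ n *s chi I)\<bar>)
    \<le> 2 ^ n * (\<Sum>w\<in>cube (Suc n). \<bar>f (x + w + e1 i) - f (x + w)\<bar>)" (is "?L \<le> _")
proof -
  have "?L \<le> (\<Sum>z\<in>cube n. \<Sum>l<2 ^ n.
      \<bar>f (x + (z + 2 ^ n *s chi I + axis i (int l)) + e1 i) - f (x + (z + 2 ^ n *s chi I + axis i (int l)))\<bar>)"
    using straight_diff_le[of f "x + _ + 2 ^ n *s chi I" i "2 ^ n"]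
    by (intro sum_mono) (simp add: algebra_simps)
  also have "\<dots> = (\<Sum>l<2 ^ n. \<Sum>z\<in>cube n.
      \<bar>f (x + (z + 2 ^ n *s chi I + axis i (int l)) + e1 i) - f (x + (z + 2 ^ n *s chi I + axis i (int l)))\<bar>)"
    by (rule sum.swap)
  also have "\<dots> \<le> (\<Sum>l<(2::nat) ^ n. \<Sum>w\<in>cube (Suc n). \<bar>f (x + w + e1 i) - f (x + w)\<bar>)"
  proof (rule sum_mono)
    fix l assume l: "l \<in> {..<(2::nat) ^ n}"
    let ?s = "\<lambda>z. z + 2 ^ n *s chi I + axis i (int l)"
    have inj: "inj_on ?s (cube n)" by (auto simp: inj_on_def)
    have l': "int l < 2 ^ n" using l by (metis lessThan_iff of_nat_less_iff of_nat_numeral of_nat_power)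
    have sub: "?s ` cube n \<subseteq> cube (Suc n)"
    proof safe
      fix z :: "'d site" assume "z \<in> cube n"
      then have z: "0 \<le> z $ j" "z $ j < 2 ^ n" for j by (auto simp: cube_def)
      have zl: "z $ i + int l < 2 * 2 ^ n" using z[of i] l' by linarith
      show "?s z \<in> cube (Suc n)"
        unfolding cube_def mem_Collect_eq
      proof
        fix j show "0 \<le> ?s z $ j \<and> ?s z $ j < 2 ^ Suc n"
          using zl assms z[of j] by (cases "j = i"; cases "j \<in> I") (auto simp: chi_def axis_def)
      qed
    qed
    have "(\<Sum>z\<in>cube n. \<bar>f (x + ?s z + e1 i) - f (x + ?s z)\<bar>)
      = (\<Sum>w\<in>?s ` cube n. \<bar>f (x + w + e1 i) - f (x + w)\<bar>)"
      by (simp add: sum.reindex[OF inj])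
    also have "\<dots> \<le> (\<Sum>w\<in>cube (Suc n). \<bar>f (x + w + e1 i) - f (x + w)\<bar>)"
      by (rule sum_mono2[OF finite_cube sub]) auto
    finally show "(\<Sum>z\<in>cube n. \<bar>f (x + ?s z + e1 i) - f (x + ?s z)\<bar>)
      \<le> (\<Sum>w\<in>cube (Suc n). \<bar>f (x + w + e1 i) - f (x + w)\<bar>)" .
  qed
  finally show ?thesis by simp
qed

text \<open>The displacement is performed one coordinate at a time, each at the price of
  \<open>shift_one_direction\<close>.\<close>

lemma shift_chi:
  fixes f :: "'d::finite site \<Rightarrow> real"
  shows "(\<Sum>z\<in>cube n. \<bar>f (x + z + 2 ^ n *s chi I) - f (x + z)\<bar>)
    \<le> 2 ^ n * (\<Sum>w\<in>cube (Suc n). \<Sum>i\<in>I. \<bar>f (x + w + e1 i) - f (x + w)\<bar>)"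
proof (induction I rule: finite_induct[OF finite])
  case 1
  have "chi {} = (0 :: 'd site)" by (simp add: chi_def vec_eq_iff)
  then show ?case by simp
next
  case (2 i I)
  have s: "2 ^ n *s chi (insert i I) = axis i (2 ^ n) + 2 ^ n *s chi I"
    unfolding chi_insert[OF 2(2)] by (auto simp: vec_eq_iff axis_def algebra_simps)
  have "(\<Sum>z\<in>cube n. \<bar>f (x + z + 2 ^ n *s chi (insert i I)) - f (x + z)\<bar>) \<le>
    (\<Sum>z\<in>cube n. \<bar>f (x + z + axis i (2 ^ n) + 2 ^ n *s chi I) - f (x + z + 2 ^ n *s chi I)\<bar>
      + \<bar>f (x + z + 2 ^ n *s chi I) - f (x + z)\<bar>)"
    unfolding s add.assoc[symmetric] by (intro sum_mono) linarith
  also have "\<dots> \<le> 2 ^ n * (\<Sum>w\<in>cube (Suc n). \<bar>f (x + w + e1 i) - f (x + w)\<bar>)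
      + 2 ^ n * (\<Sum>w\<in>cube (Suc n). \<Sum>i\<in>I. \<bar>f (x + w + e1 i) - f (x + w)\<bar>)"
    unfolding sum.distrib by (intro add_mono shift_one_direction 2)
  also have "\<dots> = 2 ^ n * (\<Sum>w\<in>cube (Suc n). \<Sum>i\<in>insert i I. \<bar>f (x + w + e1 i) - f (x + w)\<bar>)"
    using 2 by (simp add: sum.distrib algebra_simps)
  finally show ?case .
qed

text \<open>Splitting off the leading binary digit of every coordinate: \<open>I\<close> collects
  the coordinates that are at least 2^n, and \<open>z\<close> is the remainder.\<close>

lemma sum_cube_Suc:
  fixes g :: "'d::finite site \<Rightarrow> real"
  shows "(\<Sum>w\<in>cube (Suc n). g w) = (\<Sum>I\<in>UNIV. \<Sum>z\<in>cube n. g (z + 2 ^ n *s chi I))"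
proof -
  have "(\<Sum>I\<in>UNIV. \<Sum>z\<in>cube n. g (z + 2 ^ n *s chi I))
      = (\<Sum>(I, z)\<in>UNIV \<times> cube n. g (z + 2 ^ n *s chi I))"
    by (rule sum.cartesian_product)
  also have "\<dots> = (\<Sum>w\<in>cube (Suc n). g w)"
  proof (rule sum.reindex_bij_witness[where i = "\<lambda>w. ({i. 2 ^ n \<le> w $ i}, w - 2 ^ n *s chi {i. 2 ^ n \<le> w $ i})"
        and j = "\<lambda>(I, z). z + 2 ^ n *s chi I"], goal_cases)
    case (1 a)
    then obtain I z where a: "a = (I, z)" "z \<in> cube n" by auto
    have "{i. 2 ^ n \<le> (z + 2 ^ n *s chi I) $ i} = I"
      using a(2) by (auto simp: cube_def chi_def not_le[symmetric] split: if_splits)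
    then show ?case by (simp add: a)
  next
    case (2 a)
    then obtain I z where a: "a = (I, z)" "z \<in> cube n" by auto
    then show ?case by (auto simp: cube_def chi_def intro: less_trans)
  next
    case (3 b) then show ?case by simp
  next
    case (4 b) then show ?case by (auto simp: cube_def chi_def)
  next
    case (5 a) then show ?case by auto
  qed
  finally show ?thesis ..
qed

definition cavg :: "nat \<Rightarrow> ('d::finite site \<Rightarrow> real) \<Rightarrow> 'd site \<Rightarrow> real" where
  "cavg n f x = (\<Sum>z\<in>cube n. f (x + z)) / 2 ^ (n * CARD('d))"

text \<open>A Poincare type comparison of neighbouring scales: the average over the large cube is
  the mean of the averages over its tiles, and \<open>shift_chi\<close> compares each tile with the
  one at the corner.\<close>

lemma cavg_diff_le:
  fixes f :: "'d::finite site \<Rightarrow> real"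
  shows "\<bar>cavg (Suc n) f x - cavg n f x\<bar>
    \<le> 2 ^ n / 2 ^ (n * CARD('d)) * (\<Sum>w\<in>cube (Suc n). grad f (x + w))" (is "_ \<le> ?R")
proof -
  let ?c = "2 ^ (n * CARD('d)) :: real" and ?N = "2 ^ CARD('d) :: real"
  have cardP: "real (card (UNIV :: 'd set set)) = ?N" by (simp add: card_UNIV_set)
  have "cavg (Suc n) f x = (\<Sum>I\<in>UNIV. \<Sum>z\<in>cube n. f (x + z + 2 ^ n *s chi I)) / (?N * ?c)"
    by (simp add: cavg_def sum_cube_Suc add.assoc power_add)
  moreover have "cavg n f x = (\<Sum>I\<in>(UNIV :: 'd set set). \<Sum>z\<in>cube n. f (x + z)) / (?N * ?c)"
    by (simp add: cavg_def cardP card_UNIV_set)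
  ultimately have "cavg (Suc n) f x - cavg n f x
      = (\<Sum>I\<in>UNIV. \<Sum>z\<in>cube n. f (x + z + 2 ^ n *s chi I) - f (x + z)) / (?N * ?c)"
    by (simp add: sum_subtractf diff_divide_distrib)
  then have "\<bar>cavg (Suc n) f x - cavg n f x\<bar>
      = \<bar>\<Sum>I\<in>UNIV. \<Sum>z\<in>cube n. f (x + z + 2 ^ n *s chi I) - f (x + z)\<bar> / (?N * ?c)"
    by simp
  also have "\<dots> \<le> (\<Sum>I\<in>UNIV. \<Sum>z\<in>cube n. \<bar>f (x + z + 2 ^ n *s chi I) - f (x + z)\<bar>) / (?N * ?c)"
    by (intro divide_right_mono order.trans[OF sum_abs] sum_mono sum_abs) auto
  also have "\<dots> \<le> (\<Sum>I\<in>(UNIV :: 'd set set). 2 ^ n * (\<Sum>w\<in>cube (Suc n). grad f (x + w))) / (?N * ?c)"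
    by (intro divide_right_mono sum_mono order.trans[OF shift_chi] mult_left_mono)
       (auto simp: grad_def intro!: sum_mono2)
  also have "\<dots> = ?R" by (simp add: cardP card_UNIV_set)
  finally show ?thesis .
qed

lemma cavg_0: "cavg 0 f x = f x"
proof -
  have "cube 0 = {0 :: 'a site}" by (auto simp: cube_def vec_eq_iff) (smt (verit))
  then show ?thesis by (simp add: cavg_def)
qed

lemma cavg_le_l1:
  fixes f :: "'d::finite site \<Rightarrow> real"
  assumes "finite S" "\<And>x. x \<notin> S \<Longrightarrow> f x = 0"
  shows "\<bar>cavg n f x\<bar> \<le> (\<Sum>y\<in>S. \<bar>f y\<bar>) / 2 ^ (n * CARD('d))"
proof -
  have "\<bar>\<Sum>z\<in>cube n. f (x + z)\<bar> \<le> (\<Sum>z\<in>cube n. \<bar>f (x + z)\<bar>)" by (rule sum_abs)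
  also have "\<dots> = (\<Sum>y\<in>(+) x ` cube n. \<bar>f y\<bar>)" by (simp add: sum.reindex)
  also have "\<dots> = (\<Sum>y\<in>(+) x ` cube n \<inter> S. \<bar>f y\<bar>)"
    using assms by (intro sum.mono_neutral_right) auto
  also have "\<dots> \<le> (\<Sum>y\<in>S. \<bar>f y\<bar>)" using assms by (intro sum_mono2) auto
  finally show ?thesis by (simp add: cavg_def divide_right_mono)
qed

text \<open>Telescoping of the averages, starting from scale 0 where they return \<open>f\<close>.
  The sum over the scales is a dyadic form of the Riesz potential of order one of the gradient.
  Finite support makes the coarsest average a term that vanishes as \<open>N\<close> grows.\<close>

lemma potential_bound:
  fixes f :: "'d::finite site \<Rightarrow> real"
  assumes "finite S" "\<And>x. x \<notin> S \<Longrightarrow> f x = 0"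
  shows "\<bar>f x\<bar> \<le> (\<Sum>y\<in>S. \<bar>f y\<bar>) / 2 ^ (N * CARD('d))
    + (\<Sum>n<N. 2 ^ n / 2 ^ (n * CARD('d)) * (\<Sum>w\<in>cube (Suc n). grad f (x + w)))"
proof -
  have "cavg N f x - cavg 0 f x = (\<Sum>n<N. cavg (Suc n) f x - cavg n f x)"
    by (rule sum_lessThan_telescope[symmetric])
  then have "\<bar>f x\<bar> \<le> \<bar>cavg N f x\<bar> + \<bar>\<Sum>n<N. cavg (Suc n) f x - cavg n f x\<bar>"
    by (simp add: cavg_0)
  moreover have "\<bar>\<Sum>n<N. cavg (Suc n) f x - cavg n f x\<bar>
      \<le> (\<Sum>n<N. 2 ^ n / 2 ^ (n * CARD('d)) * (\<Sum>w\<in>cube (Suc n). grad f (x + w)))"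
    by (intro order.trans[OF sum_abs] sum_mono cavg_diff_le)
  ultimately show ?thesis using cavg_le_l1[where f = f and S = S and n = N and x = x, OF assms] by linarith
qed

text \<open>Hoelder's inequality gives this for a weight whose averaged \<open>p\<close>-norms on
  all balls are of order \<open>K\<close>, with \<open>P\<close> = 1/p; the value
  \<open>P = 0\<close> covers \<open>p = \<infinity>\<close>. It retains what sums over cubes need:
  a gain for small subsets of a large ball.\<close>

definition spread :: "real \<Rightarrow> real \<Rightarrow> ('d::finite site \<Rightarrow> real) \<Rightarrow> bool" where
  "spread P K V \<longleftrightarrow> (\<forall>x. 0 \<le> V x) \<and> 0 \<le> K \<and>
     (\<forall>n\<ge>1. \<forall>A\<subseteq>nat_ball n.
        sum V A \<le> K * real (card A) powr (1 - P) * real n powr (real CARD('d) * P))"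

lemma spreadD:
  fixes V :: "'d::finite site \<Rightarrow> real"
  assumes "spread P K V" "1 \<le> n" "A \<subseteq> nat_ball n" "real (card A) \<le> c" "P \<le> 1"
  shows "sum V A \<le> K * c powr (1 - P) * real n powr (real CARD('d) * P)"
proof -
  have "sum V A \<le> K * real (card A) powr (1 - P) * real n powr (real CARD('d) * P)"
    using assms(1-3) by (auto simp: spread_def)
  also have "\<dots> \<le> K * c powr (1 - P) * real n powr (real CARD('d) * P)"
    using assms(1,4,5) by (intro mult_right_mono mult_left_mono powr_mono2) (auto simp: spread_def)
  finally show ?thesis .
qed

lemma powr_two_power: "(2 ^ n) powr a = ((2::real) powr a) ^ n"
  by (induction n) (simp_all add: powr_mult)

text \<open>The two cases are \<open>y \<le> e * x\<close> and its negation, with \<open>e\<close>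
  such that (1 + e)^b = \<mu>. The factor may be arbitrarily close to 1, so that adding scales one
  at a time loses less than the geometric growth between them.\<close>

lemma powr_add_le:
  fixes b \<mu> :: real
  assumes "1 < \<mu>" "0 < b"
  shows "\<exists>C>0. \<forall>x\<ge>0. \<forall>y\<ge>0. (x + y) powr b \<le> \<mu> * x powr b + C * y powr b"
proof -
  define e where "e = \<mu> powr (1 / b) - 1"
  have e: "e > 0" unfolding e_def using assms by (simp add: gr_one_powr)
  have mu: "(1 + e) powr b = \<mu>" using assms by (simp add: e_def powr_powr)
  show ?thesis
  proof (intro exI[of _ "(1 / e + 1) powr b"] conjI allI impI)
    show "0 < (1 / e + 1) powr b" using e by (simp add: add_pos_pos less_imp_neq[symmetric])
    fix x y :: real assume xy: "0 \<le> x" "0 \<le> y"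
    show "(x + y) powr b \<le> \<mu> * x powr b + (1 / e + 1) powr b * y powr b"
    proof (cases "y \<le> e * x")
      case True
      then have "(x + y) powr b \<le> ((1 + e) * x) powr b"
        using xy assms by (intro powr_mono2) (auto simp: algebra_simps)
      also have "\<dots> = \<mu> * x powr b" using xy e by (simp add: powr_mult mu)
      finally show ?thesis by (simp add: add_increasing2)
    next
      case False
      then have "x \<le> y / e" using e by (simp add: field_simps)
      then have "(x + y) powr b \<le> ((1 / e + 1) * y) powr b"
        using xy assms by (intro powr_mono2) (auto simp: algebra_simps)
      also have "\<dots> = (1 / e + 1) powr b * y powr b" using xy e by (simp add: powr_mult)
      finally show ?thesis using assms by (simp add: add_increasing)
    qed
  qed
qed

lemma cube_translate_subset_nat_ball:
  fixes x :: "'d::finite site"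
  assumes "x \<in> nat_ball R" "R \<le> L" "2 ^ n \<le> L" "(1 + 2 * CARD('d)) * L \<le> L'"
  shows "(+) x ` cube (Suc n) \<subseteq> nat_ball L'"
proof
  fix y assume "y \<in> (+) x ` cube (Suc n)"
  then obtain w where w: "y = x + w" "w \<in> cube (Suc n)" by auto
  have "l1_dist 0 w \<le> int (CARD('d) * 2 ^ Suc n)" by (rule cube_l1_norm[OF w(2)])
  also have "\<dots> \<le> int (CARD('d) * (2 * L))"
    unfolding of_nat_le_iff using assms(3) by (intro mult_left_mono) auto
  finally have "l1_dist 0 y \<le> int R + int (CARD('d) * (2 * L))"
    using l1_dist_zero_add_le[of x w] assms(1) w(1) by (simp add: nat_ball_def)
  also have "\<dots> \<le> int ((1 + 2 * CARD('d)) * L)"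
    using assms(2) by (simp add: algebra_simps)
  also have "\<dots> \<le> int L'" using assms(4) by (simp only: of_nat_le_iff)
  finally show "y \<in> nat_ball L'" by (simp add: nat_ball_def)
qed

text \<open>In the application \<open>\<nu>\<close> bounds the sum of the inverse conductances at a
  site, \<open>\<Gamma>\<close> is the local edge energy and \<open>D\<close> the total energy. The
  last assumption is then Cauchy-Schwarz over the edges at a site.\<close>

locale sobolev_data =
  fixes d P Q :: real and KV K D :: real and V \<nu> \<Gamma> f :: "'d::finite site \<Rightarrow> real" and S :: "'d site set"
  assumes dim: "d = real CARD('d)" "3 \<le> d"
    and PQ: "0 \<le> P" "0 \<le> Q" "P + Q < 2 / d"
    and V: "spread P KV V" and nu: "spread Q K \<nu>"
    and S: "finite S" "\<And>x. x \<notin> S \<Longrightarrow> f x = 0"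
    and Gamma: "\<And>y. 0 \<le> \<Gamma> y" "\<And>A. finite A \<Longrightarrow> sum \<Gamma> A \<le> D"
    and grad: "\<And>y. (grad f y)\<^sup>2 \<le> \<nu> y * \<Gamma> y"
begin

abbreviation "c1 \<equiv> 1 + 2 * d"

definition shell :: "nat \<Rightarrow> 'd site \<Rightarrow> real" where
  "shell n x = 2 ^ n / 2 ^ (n * CARD('d)) * (\<Sum>w\<in>cube (Suc n). grad f (x + w))"

definition local_energy :: "nat \<Rightarrow> 'd site \<Rightarrow> real" where
  "local_energy n x = (\<Sum>w\<in>cube (Suc n). \<Gamma> (x + w))"

lemma nonneg: "0 \<le> KV" "0 \<le> K" "0 \<le> V x" "0 \<le> \<nu> x" "0 \<le> D"
  using V nu Gamma(2)[of "{}"] by (auto simp: spread_def)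

lemma PQ_le: "P \<le> 1" "Q \<le> 1"
proof -
  have "2 / d \<le> 1" using dim by (simp add: divide_le_eq)
  then show "P \<le> 1" "Q \<le> 1" using PQ by linarith+
qed

lemma shell_nonneg: "0 \<le> shell n x"
  by (simp add: shell_def sum_nonneg grad_nonneg)

lemma local_energy_nonneg: "0 \<le> local_energy n x"
  by (simp add: local_energy_def sum_nonneg Gamma)

lemma local_energy_le: "local_energy n x \<le> D"
proof -
  have "local_energy n x = sum \<Gamma> ((+) x ` cube (Suc n))"
    by (simp add: local_energy_def sum.reindex)
  then show ?thesis by (simp add: Gamma)
qed

lemma card_cube_Suc_powr: "real (card (cube (Suc n) :: 'd site set)) = (2 * 2 ^ n) powr d"
  by (simp add: dim(1) card_cube powr_realpow power_mult[symmetric] flip: power_Suc)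

lemma scale_powr: "2 ^ n / 2 ^ (n * CARD('d)) = (2 ^ n :: real) powr (1 - d)"
  by (simp add: dim(1) powr_diff powr_realpow power_mult)

text \<open>Cauchy-Schwarz separates \<open>\<nu>\<close> from \<open>\<Gamma>\<close>. Since
  \<open>spread\<close> speaks of balls about the origin only, the cube at \<open>x\<close> is
  placed in a ball of radius \<open>c1 * L\<close>, whence the power of \<open>L\<close>.\<close>

lemma shell_sq_le:
  assumes "x \<in> nat_ball R" "R \<le> L" "2 ^ n \<le> L" "1 \<le> L"
  shows "(shell n x)\<^sup>2 \<le> (2 ^ n) powr (2 - 2 * d) * (K * (2 * 2 ^ n) powr (d * (1 - Q)) * (c1 * L) powr (d * Q))
     * local_energy n x"
proof -
  define L' where "L' = (1 + 2 * CARD('d)) * L"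
  have L': "real L' = c1 * L" "1 \<le> L'" using assms(4) by (auto simp: L'_def dim(1) algebra_simps)
  have A: "(+) x ` cube (Suc n) \<subseteq> nat_ball L'"
    by (rule cube_translate_subset_nat_ball[OF assms(1-3)]) (simp add: L'_def)
  have nu_le: "(\<Sum>w\<in>cube (Suc n). \<nu> (x + w)) \<le> K * (2 * 2 ^ n) powr (d * (1 - Q)) * (c1 * L) powr (d * Q)"
  proof -
    have "(\<Sum>w\<in>cube (Suc n). \<nu> (x + w)) = sum \<nu> ((+) x ` cube (Suc n))" by (simp add: sum.reindex)
    also have "\<dots> \<le> K * ((2 * 2 ^ n) powr d) powr (1 - Q) * real L' powr (d * Q)"
      by (rule spreadD[OF nu L'(2) A _ PQ_le(2), folded dim(1)]) (simp add: card_image card_cube_Suc_powr)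
    finally show ?thesis by (simp add: powr_powr L' dim(1))
  qed
  have "(\<Sum>w\<in>cube (Suc n). grad f (x + w))\<^sup>2 \<le> (\<Sum>w\<in>cube (Suc n). sqrt (\<nu> (x + w)) * sqrt (\<Gamma> (x + w)))\<^sup>2"
    using grad by (intro power_mono sum_mono)
      (auto simp: sum_nonneg grad_nonneg real_le_rsqrt simp flip: real_sqrt_mult)
  also have "\<dots> \<le> (\<Sum>w\<in>cube (Suc n). (sqrt (\<nu> (x + w)))\<^sup>2) * (\<Sum>w\<in>cube (Suc n). (sqrt (\<Gamma> (x + w)))\<^sup>2)"
    by (rule Cauchy_Schwarz_ineq_sum)
  also have "\<dots> = (\<Sum>w\<in>cube (Suc n). \<nu> (x + w)) * local_energy n x"
    by (simp add: nonneg Gamma local_energy_def)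
  also have "\<dots> \<le> (K * (2 * 2 ^ n) powr (d * (1 - Q)) * (c1 * L) powr (d * Q)) * local_energy n x"
    by (rule mult_right_mono[OF nu_le local_energy_nonneg])
  finally have "((2 ^ n) powr (1 - d))\<^sup>2 * (\<Sum>w\<in>cube (Suc n). grad f (x + w))\<^sup>2
     \<le> ((2 ^ n) powr (1 - d))\<^sup>2 * ((K * (2 * 2 ^ n) powr (d * (1 - Q)) * (c1 * L) powr (d * Q)) * local_energy n x)"
    by (intro mult_left_mono) auto
  moreover have "((2 ^ n) powr (1 - d))\<^sup>2 = (2 ^ n :: real) powr (2 - 2 * d)"
    by (simp add: power2_eq_square flip: powr_add)
  ultimately show ?thesis
    by (simp add: shell_def scale_powr power_mult_distrib mult.assoc)
qed

text \<open>After exchanging the sums, a fixed \<open>y\<close> is seen from at most as many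
  \<open>x\<close> as the cube has points, and \<open>spread\<close> bounds the weight of such a
  small set.\<close>

lemma sum_V_local_energy_le:
  assumes "1 \<le> R"
  shows "(\<Sum>x\<in>nat_ball R. V x * local_energy n x)
    \<le> D * (KV * (2 * 2 ^ n) powr (d * (1 - P)) * real R powr (d * P))" (is "_ \<le> D * ?B")
proof -
  define Y :: "'d site set" where "Y = (\<Union>x\<in>nat_ball R. (+) x ` cube (Suc n))"
  have Y: "finite Y" by (simp add: Y_def)
  have "(\<Sum>x\<in>nat_ball R. V x * local_energy n x)
      = (\<Sum>x\<in>nat_ball R. \<Sum>y\<in>(+) x ` cube (Suc n). V x * \<Gamma> y)"
    by (simp add: local_energy_def sum_distrib_left sum.reindex)
  also have "\<dots> = (\<Sum>x\<in>nat_ball R. \<Sum>y\<in>Y. if y \<in> (+) x ` cube (Suc n) then V x * \<Gamma> y else 0)"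
  proof (rule sum.cong[OF refl])
    fix x :: "'d site" assume "x \<in> nat_ball R"
    then have "Y \<inter> (+) x ` cube (Suc n) = (+) x ` cube (Suc n)" by (auto simp: Y_def)
    with sum.inter_restrict[OF Y, of "\<lambda>y. V x * \<Gamma> y" "(+) x ` cube (Suc n)"]
    show "(\<Sum>y\<in>(+) x ` cube (Suc n). V x * \<Gamma> y)
      = (\<Sum>y\<in>Y. if y \<in> (+) x ` cube (Suc n) then V x * \<Gamma> y else 0)" by simp
  qed
  also have "\<dots> = (\<Sum>y\<in>Y. \<Sum>x\<in>nat_ball R. if y \<in> (+) x ` cube (Suc n) then V x * \<Gamma> y else 0)"
    by (rule sum.swap)
  also have "\<dots> = (\<Sum>y\<in>Y. \<Gamma> y * sum V {x \<in> nat_ball R. y \<in> (+) x ` cube (Suc n)})"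
    by (intro sum.cong refl) (simp add: sum.inter_filter[symmetric] sum_distrib_left mult.commute)
  also have "\<dots> \<le> (\<Sum>y\<in>Y. \<Gamma> y * ?B)"
  proof (intro sum_mono mult_left_mono Gamma(1))
    fix y :: "'d site"
    let ?A = "{x \<in> nat_ball R. y \<in> (+) x ` cube (Suc n)}"
    have "?A \<subseteq> (\<lambda>w. y - w) ` cube (Suc n)" by (auto simp: image_iff)
    from order.trans[OF card_mono[OF finite_imageI[OF finite_cube] this] card_image_le[OF finite_cube]]
    have "real (card ?A) \<le> real (card (cube (Suc n) :: 'd site set))" by (rule of_nat_mono)
    then have "real (card ?A) \<le> (2 * 2 ^ n) powr d" by (simp only: card_cube_Suc_powr)
    from spreadD[OF V assms _ this PQ_le(1)]
    have "sum V ?A \<le> KV * ((2 * 2 ^ n) powr d) powr (1 - P) * real R powr (real CARD('d) * P)" by blast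
    then show "sum V ?A \<le> ?B" by (simp add: powr_powr dim(1))
  qed
  also have "\<dots> = sum \<Gamma> Y * ?B" by (simp add: sum_distrib_right)
  also have "\<dots> \<le> D * ?B" by (intro mult_right_mono Gamma Y) (simp add: nonneg)
  finally show ?thesis .
qed


text \<open>Scales below \<open>R\<close>. Local energies are at most \<open>D\<close>, so a power
  \<open>b / 2 > 1\<close> of one of them can be reduced to the first power and summed against
  \<open>V\<close>. The powers of the scale combine to \<open>\<eta>\<close>; if it is positive, the
  largest of these scales dominates.\<close>

lemma shell_inner_le:
  assumes R: "1 \<le> R" "2 ^ n \<le> R" and b: "2 < b"
  defines "\<eta> \<equiv> b * (1 - d) + b / 2 * (d * (1 - Q)) + d * (1 - P)"
  shows "(\<Sum>x\<in>nat_ball R. V x * shell n x powr b)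
    \<le> 2 powr (b / 2 * (d * (1 - Q)) + d * (1 - P)) * c1 powr (b / 2 * (d * Q))
      * (KV * K powr (b / 2) * D powr (b / 2)) * real R powr (b / 2 * (d * Q) + d * P) * (2 ^ n) powr \<eta>"
proof -
  let ?X = "2 ^ n :: real"
  define A where "A = ?X powr (2 - 2 * d) * (K * (2 * ?X) powr (d * (1 - Q)) * (c1 * R) powr (d * Q))"
  have A0: "0 \<le> A" by (simp add: A_def nonneg)
  have "shell n x powr b \<le> A powr (b / 2) * D powr (b / 2 - 1) * local_energy n x"
    if "x \<in> nat_ball R" for x
  proof -
    let ?G = "local_energy n x"
    have "shell n x powr b = ((shell n x)\<^sup>2) powr (b / 2)"
      using shell_nonneg[of n x] by (simp add: powr_powr flip: powr_numeral)
    also have "\<dots> \<le> (A * ?G) powr (b / 2)"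
      using shell_sq_le[OF that order_refl R(2,1)] b
      by (intro powr_mono2) (auto simp: A_def)
    also have "\<dots> = A powr (b / 2) * (?G powr (b / 2 - 1) * ?G)"
      using local_energy_nonneg[of n x] A0 b powr_add[of ?G "b / 2 - 1" 1]
      by (cases "?G = 0") (auto simp: powr_mult)
    also have "\<dots> \<le> A powr (b / 2) * (D powr (b / 2 - 1) * ?G)"
      using local_energy_nonneg[of n x] b
      by (intro mult_left_mono mult_right_mono powr_mono2 local_energy_le) auto
    finally show ?thesis by (simp add: mult.assoc)
  qed
  then have "(\<Sum>x\<in>nat_ball R. V x * shell n x powr b)
      \<le> (\<Sum>x\<in>nat_ball R. V x * (A powr (b / 2) * D powr (b / 2 - 1) * local_energy n x))"
    by (intro sum_mono mult_left_mono nonneg)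
  also have "\<dots> = A powr (b / 2) * D powr (b / 2 - 1) * (\<Sum>x\<in>nat_ball R. V x * local_energy n x)"
    by (simp add: sum_distrib_left mult_ac)
  also have "\<dots> \<le> A powr (b / 2) * D powr (b / 2 - 1)
      * (D * (KV * (2 * ?X) powr (d * (1 - P)) * real R powr (d * P)))"
    by (intro mult_left_mono sum_V_local_energy_le R) auto
  also have "\<dots> = A powr (b / 2) * D powr (b / 2) * (KV * (2 * ?X) powr (d * (1 - P)) * real R powr (d * P))"
    using b powr_add[of D "b / 2 - 1" 1] nonneg(5) by (cases "D = 0") auto
  also have "A powr (b / 2) = ?X powr ((2 - 2 * d) * (b / 2)) * (K powr (b / 2)
      * ((2 * ?X) powr (d * (1 - Q) * (b / 2)) * (c1 powr (d * Q * (b / 2)) * real R powr (d * Q * (b / 2)))))"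
    using nonneg(2) dim by (simp add: A_def powr_mult powr_powr mult.assoc)
  also have "?X powr ((2 - 2 * d) * (b / 2)) * (K powr (b / 2)
      * ((2 * ?X) powr (d * (1 - Q) * (b / 2)) * (c1 powr (d * Q * (b / 2)) * real R powr (d * Q * (b / 2)))))
      * D powr (b / 2) * (KV * (2 * ?X) powr (d * (1 - P)) * real R powr (d * P))
    = (2 powr (d * (1 - Q) * (b / 2)) * 2 powr (d * (1 - P))) * c1 powr (d * Q * (b / 2))
      * (KV * K powr (b / 2) * D powr (b / 2)) * (real R powr (d * Q * (b / 2)) * real R powr (d * P))
      * (?X powr ((2 - 2 * d) * (b / 2)) * ?X powr (d * (1 - Q) * (b / 2)) * ?X powr (d * (1 - P)))"
    by (simp add: powr_mult mult_ac)
  also have "\<dots> = 2 powr (d * (1 - Q) * (b / 2) + d * (1 - P)) * c1 powr (d * Q * (b / 2))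
      * (KV * K powr (b / 2) * D powr (b / 2)) * real R powr (d * Q * (b / 2) + d * P)
      * ?X powr ((2 - 2 * d) * (b / 2) + d * (1 - Q) * (b / 2) + d * (1 - P))"
    by (simp only: powr_add)
  also have "(2 - 2 * d) * (b / 2) + d * (1 - Q) * (b / 2) + d * (1 - P) = \<eta>"
    by (simp add: \<eta>_def field_simps)
  finally show ?thesis by (simp add: mult_ac)
qed

text \<open>Scales above \<open>R\<close>, where the cube itself determines the radius of the
  surrounding ball. Then \<open>Q\<close> cancels in the power of the scale, and the decay
  2^(n(1-d/2)) is summable because d \<ge> 3, so that a pointwise bound is enough.\<close>

lemma shell_outer_le:
  assumes "x \<in> nat_ball R" "R \<le> 2 ^ n"
  shows "shell n x \<le> sqrt (2 powr (d * (1 - Q)) * c1 powr (d * Q) * (K * D)) * (2 powr (1 - d / 2)) ^ n"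
proof -
  let ?X = "2 ^ n :: real" and ?c = "2 powr (d * (1 - Q)) * c1 powr (d * Q)"
  have "(shell n x)\<^sup>2 \<le> ?X powr (2 - 2 * d) * (K * (2 * ?X) powr (d * (1 - Q)) * (c1 * real (2 ^ n)) powr (d * Q))
     * local_energy n x"
    by (rule shell_sq_le[OF assms]) auto
  also have "\<dots> \<le> ?X powr (2 - 2 * d) * (K * (2 * ?X) powr (d * (1 - Q)) * (c1 * real (2 ^ n)) powr (d * Q)) * D"
    by (intro mult_left_mono local_energy_le) (simp add: nonneg)
  also have "\<dots> = ?c * (K * D) * (?X powr (2 - 2 * d) * ?X powr (d * (1 - Q)) * ?X powr (d * Q))"
    using dim by (simp add: powr_mult mult_ac)
  also have "?X powr (2 - 2 * d) * ?X powr (d * (1 - Q)) * ?X powr (d * Q) = ?X powr ((1 - d / 2) + (1 - d / 2))"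
  proof -
    have "2 - 2 * d + d * (1 - Q) + d * Q = (1 - d / 2) + (1 - d / 2)" by (simp add: algebra_simps)
    then show ?thesis by (simp only: powr_add[symmetric])
  qed
  also have "\<dots> = (?X powr (1 - d / 2))\<^sup>2" by (simp only: powr_add power2_eq_square)
  also have "?X powr (1 - d / 2) = (2 powr (1 - d / 2)) ^ n"
    by (simp add: powr_two_power)
  finally have "(shell n x)\<^sup>2 \<le> ?c * (K * D) * ((2 powr (1 - d / 2)) ^ n)\<^sup>2" .
  then have "shell n x \<le> sqrt (?c * (K * D) * ((2 powr (1 - d / 2)) ^ n)\<^sup>2)"
    by (rule real_le_rsqrt)
  then show ?thesis by (simp add: real_sqrt_mult)
qed

end

text \<open>Adding one scale costs the factor 2^(\<eta>/2) from \<open>powr_add_le\<close>, less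
  than the growth 2^\<eta> from one scale to the next. So a bound by a fixed multiple of the last
  scale reproduces itself.\<close>

lemma sum_powr_dyadic:
  fixes b \<eta> :: real
  assumes "0 < \<eta>" "0 < b"
  shows "\<exists>C>0. \<forall>(A :: 'a set) V F Y r. (\<forall>x\<in>A. 0 \<le> V x) \<and> (\<forall>n x. 0 \<le> F n x) \<and> 0 \<le> Y \<and>
     (\<forall>n<r. (\<Sum>x\<in>A. V x * F n x powr b) \<le> Y * (2 ^ n) powr \<eta>) \<longrightarrow>
     (\<Sum>x\<in>A. V x * (\<Sum>n<r. F n x) powr b) \<le> C * Y * (2 ^ r) powr \<eta>"
proof -
  have m: "1 < (2::real) powr (\<eta> / 2)" using assms by simp
  obtain c where c: "c > 0" "\<And>x y :: real. 0 \<le> x \<Longrightarrow> 0 \<le> y \<Longrightarrow>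
      (x + y) powr b \<le> 2 powr (\<eta> / 2) * x powr b + c * y powr b"
    using powr_add_le[OF m assms(2)] by blast
  define g where "g = (2::real) powr \<eta> - 2 powr (\<eta> / 2)"
  have g: "g > 0" unfolding g_def using assms by simp
  \<comment> \<open>\<open>C\<close> solves
    \<open>2 powr (\<eta> / 2) * C + c = C * 2 powr \<eta>\<close>, the equation that closes the
    induction.\<close>
  define C where "C = c / g"
  have C: "C > 0" "C * g = c" using c g by (auto simp: C_def)
  have "(\<Sum>x\<in>A. V x * (\<Sum>n<r. F n x) powr b) \<le> C * Y * (2 ^ r) powr \<eta>"
    if h: "\<forall>x\<in>A. 0 \<le> V x" "\<forall>n x. 0 \<le> F n x" "0 \<le> Y"
      "\<forall>n<r. (\<Sum>x\<in>A. V x * F n x powr b) \<le> Y * (2 ^ n) powr \<eta>"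
    for A :: "'a set" and V F Y r
    using h(4)
  proof (induction r)
    case 0 then show ?case using C h(3) by simp
  next
    case (Suc r)
    have "(\<Sum>x\<in>A. V x * (\<Sum>n<Suc r. F n x) powr b)
      \<le> (\<Sum>x\<in>A. V x * (2 powr (\<eta> / 2) * (\<Sum>n<r. F n x) powr b + c * F r x powr b))"
      using h(1,2) by (intro sum_mono mult_left_mono) (auto intro!: c(2) sum_nonneg)
    also have "\<dots> = 2 powr (\<eta> / 2) * (\<Sum>x\<in>A. V x * (\<Sum>n<r. F n x) powr b) + c * (\<Sum>x\<in>A. V x * F r x powr b)"
      by (simp add: sum.distrib sum_distrib_left algebra_simps)
    also have "\<dots> \<le> 2 powr (\<eta> / 2) * (C * Y * (2 ^ r) powr \<eta>) + c * (Y * (2 ^ r) powr \<eta>)"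
      using Suc c by (intro add_mono mult_left_mono) auto
    also have "\<dots> = (2 powr (\<eta> / 2) * C + C * g) * Y * (2 ^ r) powr \<eta>"
      by (simp add: C algebra_simps)
    also have "\<dots> = C * Y * (2 ^ Suc r) powr \<eta>"
      by (simp add: g_def powr_mult algebra_simps)
    finally show ?case .
  qed
  then show ?thesis using C(1) by blast
qed


text \<open>Small scales are summed in the weighted norm and large ones pointwise; they meet at the
  first power of two that is not below \<open>R\<close>. In the final power of \<open>R\<close> the
  exponents \<open>P\<close> and \<open>Q\<close> cancel, leaving the one dictated by
  scaling.\<close>

theorem weighted_sobolev:
  fixes d P Q b :: real
  assumes "d = real CARD('d::finite)" "3 \<le> d" "0 \<le> P" "0 \<le> Q" "P + Q < 2 / d"
    and b: "2 < b" "0 < b * (1 - d) + b / 2 * (d * (1 - Q)) + d * (1 - P)"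
  shows "\<exists>C>0. \<forall>KV K D V \<nu> \<Gamma> (f :: 'd site \<Rightarrow> real) S R.
    sobolev_data d P Q KV K D V \<nu> \<Gamma> f S \<and> 1 \<le> R \<longrightarrow>
    (\<Sum>x\<in>nat_ball R. V x * \<bar>f x\<bar> powr b)
      \<le> C * (KV * K powr (b / 2) * D powr (b / 2)) * real R powr (b - b * d / 2 + d)"
proof -
  define \<eta> where "\<eta> = b * (1 - d) + b / 2 * (d * (1 - Q)) + d * (1 - P)"
  define ci where "ci = 2 powr (b / 2 * (d * (1 - Q)) + d * (1 - P)) * (1 + 2 * d) powr (b / 2 * (d * Q))"
  define co where "co = sqrt (2 powr (d * (1 - Q)) * (1 + 2 * d) powr (d * Q))"
  define \<rho> where "\<rho> = (2::real) powr (1 - d / 2)"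
  have eta: "\<eta> > 0" using b by (simp add: \<eta>_def)
  have "(2::real) powr (1 - d / 2) < 2 powr 0" using assms(2) by (intro powr_less_mono) auto
  then have rho: "0 < \<rho>" "\<rho> < 1" by (auto simp: \<rho>_def)
  have b0: "0 < b" using b(1) by simp
  obtain C1 where C1: "C1 > 0" "\<forall>(A :: 'd site set) V F Y r. (\<forall>x\<in>A. 0 \<le> V x) \<and> (\<forall>n x. 0 \<le> F n x) \<and> 0 \<le> Y \<and>
     (\<forall>n<r. (\<Sum>x\<in>A. V x * F n x powr b) \<le> Y * (2 ^ n) powr \<eta>) \<longrightarrow>
     (\<Sum>x\<in>A. V x * (\<Sum>n<r. F n x) powr b) \<le> C1 * Y * (2 ^ r) powr \<eta>"
    using sum_powr_dyadic[OF eta b0, where 'a = "'d site"] by (elim exE conjE) (rule that)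
  obtain C2 where C2: "C2 > 0" "\<And>x y :: real. 0 \<le> x \<Longrightarrow> 0 \<le> y \<Longrightarrow> (x + y) powr b \<le> 2 * x powr b + C2 * y powr b"
    using powr_add_le[OF _ b0, of 2] by auto
  define C where "C = 2 * (C1 * ci * 2 powr \<eta>) + C2 * ((co / (1 - \<rho>)) powr b * 3 powr (d * (1 - P)))"
  have Cpos: "C > 0"
    unfolding C_def using C1(1) C2(1) assms(2) by (intro add_pos_nonneg) (auto simp: ci_def)
  have "(\<Sum>x\<in>nat_ball R. V x * \<bar>f x\<bar> powr b)
      \<le> C * (KV * K powr (b / 2) * D powr (b / 2)) * real R powr (b - b * d / 2 + d)"
    if sd: "sobolev_data d P Q KV K D V \<nu> \<Gamma> f S" and R: "1 \<le> R"
    for KV K D V \<nu> \<Gamma> and f :: "'d site \<Rightarrow> real" and S R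
  proof -
    interpret sobolev_data d P Q KV K D V \<nu> \<Gamma> f S by (fact sd)
    let ?Z = "KV * K powr (b / 2) * D powr (b / 2)"
    have Z0: "0 \<le> ?Z" by (simp add: nonneg)
    define r where "r = (LEAST n. R \<le> 2 ^ n)"
    have r1: "R \<le> 2 ^ r"
      unfolding r_def by (rule LeastI[of _ R]) (simp add: less_imp_le)
    then have r1': "real R \<le> 2 ^ r" by (metis of_nat_le_iff of_nat_numeral of_nat_power)
    have r2: "2 ^ n \<le> R" if "n < r" for n
      using not_less_Least[of n "\<lambda>n. R \<le> 2 ^ n"] that by (simp add: r_def)
    have r3: "(2::real) ^ r \<le> 2 * R"
    proof (cases r)
      case (Suc k)
      then have "2 ^ k \<le> R" using r2[of k] by simp
      then have "(2::real) ^ k \<le> real R" by (metis of_nat_le_iff of_nat_numeral of_nat_power)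
      then show ?thesis by (simp add: Suc)
    qed (use R in auto)
    \<comment> \<open>Bound for all scales from \<open>r\<close> on: a geometric series of ratio
      \<open>\<rho>\<close>, whose first power satisfies
      \<open>\<rho> ^ r \<le> real R powr (1 - d / 2)\<close>.\<close>
    define H where "H = co * sqrt (K * D) * (real R powr (1 - d / 2) / (1 - \<rho>))"
    have co0: "co \<ge> 0" by (simp add: co_def)
    have H0: "H \<ge> 0" unfolding H_def using rho co0 by (intro mult_nonneg_nonneg divide_nonneg_nonneg) (auto simp: nonneg)
    have "\<rho> ^ r = (2 ^ r) powr (1 - d / 2)"
      by (simp add: \<rho>_def powr_two_power)
    also have "\<dots> \<le> real R powr (1 - d / 2)"
      using assms(2) R r1' by (intro powr_mono2') auto
    finally have rhor: "\<rho> ^ r \<le> real R powr (1 - d / 2)" .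
    \<comment> \<open>The arbitrary \<open>e\<close> absorbs the average at the coarsest scale,
      which tends to 0 but need not vanish for any particular \<open>N\<close>.\<close>
    have pt: "\<bar>f x\<bar> \<le> (\<Sum>n<r. shell n x) + H" if x: "x \<in> nat_ball R" for x
    proof (rule field_le_epsilon)
      fix e :: real assume "0 < e"
      let ?s = "\<Sum>y\<in>S. \<bar>f y\<bar>"
      have "(\<lambda>N. ?s * (1 / 2 ^ CARD('d)) ^ N) \<longlonglongrightarrow> ?s * 0"
        by (intro tendsto_mult tendsto_const LIMSEQ_realpow_zero) (auto simp: one_less_power)
      then have "\<forall>\<^sub>F N in sequentially. ?s * (1 / 2 ^ CARD('d)) ^ N < e"
        using \<open>0 < e\<close> by (intro order_tendstoD) auto
      then obtain N0 where "\<And>N. N \<ge> N0 \<Longrightarrow> ?s * (1 / 2 ^ CARD('d)) ^ N < e"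
        by (auto simp: eventually_sequentially)
      then obtain N where N: "r \<le> N" "?s * (1 / 2 ^ CARD('d)) ^ N < e"
        by (metis max.cobounded1 max.cobounded2)
      have "\<bar>f x\<bar> \<le> ?s / 2 ^ (N * CARD('d)) + (\<Sum>n<N. shell n x)"
        unfolding shell_def by (rule potential_bound) (use S in auto)
      also have "?s / 2 ^ (N * CARD('d)) = ?s * (1 / 2 ^ CARD('d)) ^ N"
        by (simp add: power_divide mult.commute flip: power_mult)
      also have "(\<Sum>n<N. shell n x) = (\<Sum>n<r. shell n x) + (\<Sum>n\<in>{r..<N}. shell n x)"
        using N(1) by (simp add: sum.atLeastLessThan_concat lessThan_atLeast0)
      also have "(\<Sum>n\<in>{r..<N}. shell n x) \<le> (\<Sum>n\<in>{r..<N}. co * sqrt (K * D) * \<rho> ^ n)"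
      proof (rule sum_mono)
        fix n assume "n \<in> {r..<N}"
        then have "R \<le> 2 ^ n" using r1 by (meson atLeastLessThan_iff le_trans one_le_numeral power_increasing)
        then show "shell n x \<le> co * sqrt (K * D) * \<rho> ^ n"
          using shell_outer_le[OF x] by (simp add: co_def \<rho>_def real_sqrt_mult mult_ac)
      qed
      also have "(\<Sum>n\<in>{r..<N}. co * sqrt (K * D) * \<rho> ^ n) = co * sqrt (K * D) * (\<Sum>n\<in>{r..<N}. \<rho> ^ n)"
        by (simp add: sum_distrib_left)
      also have "(\<Sum>n\<in>{r..<N}. \<rho> ^ n) \<le> \<rho> ^ r / (1 - \<rho>)"
      proof -
        have "(\<Sum>n<r. \<rho> ^ n) + (\<Sum>n\<in>{r..<N}. \<rho> ^ n) = (\<Sum>n<N. \<rho> ^ n)"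
          using N(1) by (simp add: sum.atLeastLessThan_concat lessThan_atLeast0)
        then have "(\<Sum>n\<in>{r..<N}. \<rho> ^ n) = (1 - \<rho> ^ N) / (1 - \<rho>) - (1 - \<rho> ^ r) / (1 - \<rho>)"
          using rho by (simp add: sum_gp_strict)
        also have "\<dots> = (\<rho> ^ r - \<rho> ^ N) / (1 - \<rho>)" by (simp add: diff_divide_distrib)
        also have "\<dots> \<le> \<rho> ^ r / (1 - \<rho>)" using rho by (intro divide_right_mono) auto
        finally show ?thesis .
      qed
      also have "\<dots> \<le> real R powr (1 - d / 2) / (1 - \<rho>)"
        using rho rhor by (intro divide_right_mono) auto
      finally show "\<bar>f x\<bar> \<le> (\<Sum>n<r. shell n x) + H + e"
        using N(2) co0 by (simp add: H_def mult_left_mono nonneg)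
    qed
    have inner: "(\<Sum>x\<in>nat_ball R. V x * (\<Sum>n<r. shell n x) powr b)
        \<le> C1 * (ci * ?Z * real R powr (b / 2 * (d * Q) + d * P)) * (2 ^ r) powr \<eta>"
      using shell_inner_le[OF R r2 b(1)]
      by (intro C1(2)[rule_format] conjI) (auto simp: nonneg shell_nonneg ci_def \<eta>_def)
    also have "\<dots> \<le> C1 * (ci * ?Z * real R powr (b / 2 * (d * Q) + d * P)) * (2 * R) powr \<eta>"
      using C1(1) Z0 eta r3 by (intro mult_left_mono powr_mono2) (auto simp: ci_def)
    also have "\<dots> = C1 * ci * 2 powr \<eta> * ?Z * (real R powr (b / 2 * (d * Q) + d * P) * real R powr \<eta>)"
      by (simp add: powr_mult mult_ac)
    also have "real R powr (b / 2 * (d * Q) + d * P) * real R powr \<eta> = real R powr (b - b * d / 2 + d)"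
      unfolding powr_add[symmetric] \<eta>_def by (rule arg_cong[where f = "\<lambda>a. real R powr a"]) (simp add: field_simps)
    finally have inner: "(\<Sum>x\<in>nat_ball R. V x * (\<Sum>n<r. shell n x) powr b)
      \<le> C1 * ci * 2 powr \<eta> * ?Z * real R powr (b - b * d / 2 + d)" .
    have sumV: "sum V (nat_ball R) \<le> KV * (3 powr (d * (1 - P)) * real R powr d)"
    proof -
      have "real (card (nat_ball R :: 'd site set)) \<le> real ((3 * R) ^ CARD('d))"
        by (rule of_nat_mono[OF card_nat_ball_le[OF R]])
      also have "\<dots> = (3 * R) powr d" using R assms(1) by (simp add: powr_realpow)
      finally have "real (card (nat_ball R :: 'd site set)) \<le> (3 * R) powr d" .
      from spreadD[OF V R order_refl this PQ_le(1)]
      have "sum V (nat_ball R) \<le> KV * ((3 * R) powr d) powr (1 - P) * real R powr (d * P)"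
        by (simp add: assms(1))
      also have "\<dots> = KV * 3 powr (d * (1 - P)) * (real R powr (d * (1 - P)) * real R powr (d * P))"
        by (simp add: powr_powr powr_mult)
      also have "real R powr (d * (1 - P)) * real R powr (d * P) = real R powr d"
        unfolding powr_add[symmetric] by (simp add: algebra_simps)
      finally show ?thesis by simp
    qed
    have Hb: "H powr b = (co / (1 - \<rho>)) powr b * (K powr (b / 2) * D powr (b / 2)) * real R powr (b - b * d / 2)"
    proof -
      have "H = (co / (1 - \<rho>)) * (sqrt (K * D) * real R powr (1 - d / 2))" by (simp add: H_def)
      then have "H powr b = (co / (1 - \<rho>)) powr b * (sqrt (K * D) powr b * (real R powr (1 - d / 2)) powr b)"
        using co0 rho by (simp add: powr_mult nonneg del: times_divide_eq_left)
      moreover have "sqrt (K * D) powr b = K powr (b / 2) * D powr (b / 2)"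
        by (simp add: nonneg powr_mult powr_powr flip: powr_half_sqrt)
      moreover have "(real R powr (1 - d / 2)) powr b = real R powr (b - b * d / 2)"
        by (simp add: powr_powr algebra_simps)
      ultimately show ?thesis by simp
    qed
    have "(\<Sum>x\<in>nat_ball R. V x * \<bar>f x\<bar> powr b)
      \<le> (\<Sum>x\<in>nat_ball R. V x * (2 * (\<Sum>n<r. shell n x) powr b + C2 * H powr b))"
    proof (intro sum_mono mult_left_mono nonneg)
      fix x :: "'d site" assume "x \<in> nat_ball R"
      then have "\<bar>f x\<bar> powr b \<le> ((\<Sum>n<r. shell n x) + H) powr b"
        using pt b(1) by (intro powr_mono2) auto
      also have "\<dots> \<le> 2 * (\<Sum>n<r. shell n x) powr b + C2 * H powr b"
        by (intro C2(2) sum_nonneg shell_nonneg H0)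
      finally show "\<bar>f x\<bar> powr b \<le> 2 * (\<Sum>n<r. shell n x) powr b + C2 * H powr b" .
    qed
    also have "\<dots> = 2 * (\<Sum>x\<in>nat_ball R. V x * (\<Sum>n<r. shell n x) powr b) + C2 * H powr b * sum V (nat_ball R)"
      by (simp add: algebra_simps sum.distrib sum_distrib_left sum_distrib_right)
    also have "\<dots> \<le> 2 * (C1 * ci * 2 powr \<eta> * ?Z * real R powr (b - b * d / 2 + d))
        + C2 * H powr b * (KV * (3 powr (d * (1 - P)) * real R powr d))"
      using C2(1) by (intro add_mono mult_left_mono inner sumV) auto
    also have "\<dots> = 2 * (C1 * ci * 2 powr \<eta> * ?Z * real R powr (b - b * d / 2 + d))
        + C2 * ((co / (1 - \<rho>)) powr b * 3 powr (d * (1 - P))) * ?Z * (real R powr (b - b * d / 2) * real R powr d)"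
      unfolding Hb by (simp add: mult_ac)
    also have "\<dots> = C * ?Z * real R powr (b - b * d / 2 + d)"
      by (simp add: powr_add[symmetric] C_def algebra_simps)
    finally show ?thesis .
  qed
  then show ?thesis using Cpos by blast
qed

section \<open>Finite killed chains\<close>

text \<open>\<open>r\<close> is the full rate of leaving a site, and its excess over the
  conductances within \<open>S\<close> is the killing. Being strictly positive, it makes the
  equation without a zero order term uniquely solvable, so that Green potentials exist.\<close>

locale killed_chain =
  fixes S :: "'a set" and c :: "'a \<Rightarrow> 'a \<Rightarrow> real" and r :: "'a \<Rightarrow> real"
  assumes finite_S: "finite S" and c_commute: "c x y = c y x" and c_nonneg: "0 \<le> c x y"
    and killing: "x \<in> S \<Longrightarrow> (\<Sum>y\<in>S. c x y) < r x"
begin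

definition gen :: "('a \<Rightarrow> real) \<Rightarrow> 'a \<Rightarrow> real" where
  "gen f x = (\<Sum>y\<in>S. c x y * f y) - r x * f x"

definition form :: "('a \<Rightarrow> real) \<Rightarrow> ('a \<Rightarrow> real) \<Rightarrow> real" where
  "form f g = (\<Sum>x\<in>S. r x * f x * g x) - (\<Sum>x\<in>S. \<Sum>y\<in>S. c x y * f x * g y)"

definition ip :: "('a \<Rightarrow> real) \<Rightarrow> ('a \<Rightarrow> real) \<Rightarrow> ('a \<Rightarrow> real) \<Rightarrow> real" where
  "ip \<theta> f g = (\<Sum>x\<in>S. \<theta> x * f x * g x)"

lemma r_pos: "x \<in> S \<Longrightarrow> 0 < r x"
  using killing[of x] sum_nonneg[of S "c x"] c_nonneg by fastforce

lemma form_commute: "form f g = form g f"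
proof -
  have "(\<Sum>x\<in>S. \<Sum>y\<in>S. c x y * f x * g y) = (\<Sum>x\<in>S. \<Sum>y\<in>S. c x y * g x * f y)"
    by (subst sum.swap) (simp add: c_commute mult_ac)
  then show ?thesis by (simp add: form_def mult_ac)
qed

lemma form_gen: "form f g = - (\<Sum>x\<in>S. gen f x * g x)"
proof -
  have "(\<Sum>x\<in>S. gen f x * g x) = (\<Sum>x\<in>S. \<Sum>y\<in>S. c x y * g x * f y) - (\<Sum>x\<in>S. r x * g x * f x)"
    unfolding gen_def left_diff_distrib sum_subtractf sum_distrib_right by (simp add: mult_ac)
  then show ?thesis unfolding form_commute[of f g] by (simp add: form_def)
qed

lemma form_diff_left: "form (\<lambda>x. f x - h x) g = form f g - form h g"
  by (simp add: form_def algebra_simps sum_subtractf)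

lemma form_diff_right: "form g (\<lambda>x. f x - h x) = form g f - form g h"
  by (simp add: form_commute[of g] form_diff_left)

lemma ip_commute: "ip \<theta> f g = ip \<theta> g f"
  by (simp add: ip_def mult_ac)

lemma ip_diff_left: "ip \<theta> (\<lambda>x. f x - h x) g = ip \<theta> f g - ip \<theta> h g"
  by (simp add: ip_def algebra_simps sum_subtractf)

lemma ip_diff_right: "ip \<theta> g (\<lambda>x. f x - h x) = ip \<theta> g f - ip \<theta> g h"
  by (simp add: ip_commute[of _ g] ip_diff_left)

text \<open>Symmetrisation separates the energy of the jumps inside \<open>S\<close> from that of
  the killing; both are visibly nonnegative.\<close>

lemma form_eq_squares:
  "form f f = 1/2 * (\<Sum>x\<in>S. \<Sum>y\<in>S. c x y * (f x - f y)\<^sup>2) + (\<Sum>x\<in>S. (r x - (\<Sum>y\<in>S. c x y)) * (f x)\<^sup>2)"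
proof -
  have sw: "(\<Sum>x\<in>S. \<Sum>y\<in>S. c x y * (f y)\<^sup>2) = (\<Sum>x\<in>S. \<Sum>y\<in>S. c x y * (f x)\<^sup>2)"
    by (subst sum.swap) (simp add: c_commute)
  have "(\<Sum>x\<in>S. \<Sum>y\<in>S. c x y * (f x - f y)\<^sup>2)
    = (\<Sum>x\<in>S. \<Sum>y\<in>S. c x y * (f x)\<^sup>2) + (\<Sum>x\<in>S. \<Sum>y\<in>S. c x y * (f y)\<^sup>2) - 2 * (\<Sum>x\<in>S. \<Sum>y\<in>S. c x y * f x * f y)"
    by (simp add: power2_diff algebra_simps sum.distrib sum_subtractf sum_distrib_left)
  moreover have "(\<Sum>x\<in>S. (r x - (\<Sum>y\<in>S. c x y)) * (f x)\<^sup>2)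
      = (\<Sum>x\<in>S. r x * f x * f x) - (\<Sum>x\<in>S. \<Sum>y\<in>S. c x y * (f x)\<^sup>2)"
    unfolding left_diff_distrib sum_subtractf sum_distrib_right power2_eq_square by (simp add: mult_ac)
  ultimately show ?thesis by (simp add: form_def sw diff_divide_distrib)
qed

lemma form_nonneg: "0 \<le> form f f"
  unfolding form_eq_squares
  by (intro add_nonneg_nonneg mult_nonneg_nonneg sum_nonneg)
     (auto simp: c_nonneg less_imp_le[OF killing])

text \<open>At a minimum of \<open>v\<close> the jump part of \<open>gen v\<close> is at least that
  of a constant function with this value. A negative minimum then contradicts the strict killing,
  even where \<open>a\<close> vanishes.\<close>

lemma maximum_principle:
  assumes "\<And>x. x \<in> S \<Longrightarrow> 0 \<le> a x" "\<And>x. x \<in> S \<Longrightarrow> 0 \<le> a x * v x - gen v x" "x \<in> S"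
  shows "0 \<le> v x"
proof (rule ccontr)
  assume "\<not> 0 \<le> v x"
  define z where "z = arg_min_on v S"
  have z: "z \<in> S" "\<And>y. y \<in> S \<Longrightarrow> v z \<le> v y"
    using arg_min_if_finite[OF finite_S, of v] arg_min_least[OF finite_S, of _ v] assms(3) by (auto simp: z_def)
  have vz: "v z < 0" using z(2)[OF assms(3)] \<open>\<not> 0 \<le> v x\<close> by linarith
  have "(\<Sum>y\<in>S. c z y) * v z \<le> (\<Sum>y\<in>S. c z y * v y)"
    unfolding sum_distrib_right by (intro sum_mono mult_left_mono z c_nonneg)
  then have "0 \<le> (a z + (r z - (\<Sum>y\<in>S. c z y))) * v z"
    using assms(2)[OF z(1)] by (simp add: gen_def algebra_simps)
  moreover have "0 < a z + (r z - (\<Sum>y\<in>S. c z y))"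
    using assms(1)[OF z(1)] killing[OF z(1)] by linarith
  ultimately show False using vz by (simp add: zero_le_mult_iff)
qed

lemma gen_diff: "gen (\<lambda>x. f x - g x) x = gen f x - gen g x"
  by (simp add: gen_def algebra_simps sum_subtractf)

lemma gen_scale: "gen (\<lambda>x. k * f x) x = k * gen f x"
  by (simp add: gen_def algebra_simps sum_distrib_left)

lemma solution_unique:
  assumes "\<And>x. x \<in> S \<Longrightarrow> 0 \<le> a x" "\<And>x. x \<in> S \<Longrightarrow> a x * v x - gen v x = a x * w x - gen w x" "x \<in> S"
  shows "v x = w x"
proof -
  have "0 \<le> v x - w x"
    by (rule maximum_principle[where a = a and x = x]) (use assms in \<open>auto simp: gen_diff algebra_simps\<close>)
  moreover have "0 \<le> w x - v x"
    by (rule maximum_principle[where a = a and x = x]) (use assms in \<open>auto simp: gen_diff algebra_simps\<close>)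
  ultimately show ?thesis by simp
qed

text \<open>Monotone iteration, bounded by a constant supersolution.\<close>

lemma solution_exists_nonneg:
  assumes a: "\<And>x. x \<in> S \<Longrightarrow> 0 \<le> a x" and g: "\<And>x. x \<in> S \<Longrightarrow> 0 \<le> g x"
  shows "\<exists>v. \<forall>x\<in>S. a x * v x - gen v x = g x"
proof -
  define \<Phi> where "\<Phi> v x = (g x + (\<Sum>y\<in>S. c x y * v y)) / (a x + r x)" for v x
  define V where "V n = (\<Phi> ^^ n) (\<lambda>_. 0)" for n
  have V_Suc: "V (Suc n) = \<Phi> (V n)" for n by (simp add: V_def)
  define k where "k x = r x - (\<Sum>y\<in>S. c x y)" for x
  have k: "x \<in> S \<Longrightarrow> 0 < k x" for x using killing by (simp add: k_def)
  define B where "B = (\<Sum>x\<in>S. g x / k x)"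
  have B: "g x \<le> k x * B" if "x \<in> S" for x
  proof -
    have "g x / k x \<le> B" unfolding B_def
      by (rule member_le_sum[OF that _ finite_S]) (use g k in \<open>auto intro: less_imp_le divide_nonneg_pos\<close>)
    then show ?thesis using k[OF that] by (simp add: field_simps)
  qed
  have B0: "0 \<le> B" unfolding B_def using g k by (intro sum_nonneg) (auto intro: divide_nonneg_pos)
  have den: "x \<in> S \<Longrightarrow> 0 < a x + r x" for x using a[of x] r_pos[of x] by linarith
  have bounds: "\<forall>x\<in>S. V n x \<le> V (Suc n) x \<and> V (Suc n) x \<le> B" for n
  proof (induction n)
    case 0
    have "(g x + (\<Sum>y\<in>S. c x y * 0)) / (a x + r x) \<le> B" if x: "x \<in> S" for x
    proof -
      have "k x \<le> r x" by (simp add: k_def sum_nonneg c_nonneg)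
      then have "k x * B \<le> (a x + r x) * B" using B0 a[OF x] by (intro mult_right_mono) auto
      then have "g x \<le> B * (a x + r x)" using B[OF x] by (simp add: mult.commute)
      then show ?thesis using den[OF x] by (simp add: divide_le_eq)
    qed
    then show ?case using g den by (auto simp: V_def \<Phi>_def intro: divide_nonneg_pos)
  next
    case (Suc n)
    have "V (Suc n) x \<le> V (Suc (Suc n)) x" if x: "x \<in> S" for x
    proof -
      have "\<Phi> (V n) x \<le> \<Phi> (V (Suc n)) x"
        unfolding \<Phi>_def using Suc x den[OF x]
        by (intro divide_right_mono add_mono sum_mono mult_left_mono c_nonneg) auto
      then show ?thesis by (simp only: V_Suc)
    qed
    moreover have "V (Suc (Suc n)) x \<le> B" if x: "x \<in> S" for x
    proof -
      have "(\<Sum>y\<in>S. c x y * V (Suc n) y) \<le> (\<Sum>y\<in>S. c x y * B)"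
        using Suc by (intro sum_mono mult_left_mono c_nonneg) auto
      also have "\<dots> = r x * B - k x * B" by (simp add: k_def algebra_simps sum_distrib_left)
      finally have "g x + (\<Sum>y\<in>S. c x y * V (Suc n) y) \<le> r x * B" using B[OF x] by linarith
      also have "\<dots> \<le> B * (a x + r x)" using a[OF x] B0 by (simp add: algebra_simps)
      finally show ?thesis unfolding V_Suc[of "Suc n"] \<Phi>_def using den[OF x] by (simp add: divide_le_eq)
    qed
    ultimately show ?case by blast
  qed
  have "\<exists>l. (\<lambda>n. V n x) \<longlonglongrightarrow> l" if x: "x \<in> S" for x
  proof -
    have "incseq (\<lambda>n. V n x)" using bounds x by (intro incseq_SucI) auto
    moreover have "V n x \<le> B" for n using bounds[of n] x by (meson order_trans)
    ultimately show ?thesis using incseq_convergent[of "\<lambda>n. V n x" B] by metis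
  qed
  then obtain v where v: "\<And>x. x \<in> S \<Longrightarrow> (\<lambda>n. V n x) \<longlonglongrightarrow> v x" by metis
  have "a x * v x - gen v x = g x" if x: "x \<in> S" for x
  proof -
    have "(\<lambda>n. \<Phi> (V n) x) \<longlonglongrightarrow> (g x + (\<Sum>y\<in>S. c x y * v y)) / (a x + r x)"
      unfolding \<Phi>_def using den[OF x] v by (intro tendsto_intros) auto
    then have "(\<lambda>n. V (Suc n) x) \<longlonglongrightarrow> (g x + (\<Sum>y\<in>S. c x y * v y)) / (a x + r x)"
      by (simp only: V_Suc)
    from LIMSEQ_unique[OF this LIMSEQ_Suc[OF v[OF x]]]
    have "(g x + (\<Sum>y\<in>S. c x y * v y)) / (a x + r x) = v x" .
    then show ?thesis using den[OF x] by (simp add: gen_def field_simps)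
  qed
  then show ?thesis by blast
qed

lemma solution_exists:
  assumes a: "\<And>x. x \<in> S \<Longrightarrow> 0 \<le> a x"
  shows "\<exists>v. (\<forall>x. x \<notin> S \<longrightarrow> v x = 0) \<and> (\<forall>x\<in>S. a x * v x - gen v x = g x)"
proof -
  obtain v1 where v1: "\<And>x. x \<in> S \<Longrightarrow> a x * v1 x - gen v1 x = max 0 (g x)"
    using solution_exists_nonneg[of a "\<lambda>x. max 0 (g x)"] a by auto
  obtain v2 where v2: "\<And>x. x \<in> S \<Longrightarrow> a x * v2 x - gen v2 x = max 0 (- g x)"
    using solution_exists_nonneg[of a "\<lambda>x. max 0 (- g x)"] a by auto
  define v where "v x = (if x \<in> S then v1 x - v2 x else 0)" for x
  have "gen v x = gen (\<lambda>x. v1 x - v2 x) x" if "x \<in> S" for x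
    using that by (simp add: gen_def v_def)
  then have "a x * v x - gen v x = g x" if "x \<in> S" for x
    using v1[OF that] v2[OF that] that by (simp add: gen_diff v_def algebra_simps max_def split: if_splits)
  then show ?thesis by (intro exI[of _ v]) (auto simp: v_def)
qed

definition solve :: "('a \<Rightarrow> real) \<Rightarrow> ('a \<Rightarrow> real) \<Rightarrow> 'a \<Rightarrow> real" where
  "solve a g = (SOME v. (\<forall>x. x \<notin> S \<longrightarrow> v x = 0) \<and> (\<forall>x\<in>S. a x * v x - gen v x = g x))"

lemma solve:
  assumes "\<And>x. x \<in> S \<Longrightarrow> 0 \<le> a x"
  shows "x \<notin> S \<Longrightarrow> solve a g x = 0" "x \<in> S \<Longrightarrow> a x * solve a g x - gen (solve a g) x = g x"
  using someI_ex[OF solution_exists[of a g], folded solve_def] assms by auto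

text \<open>One implicit step of size \<open>\<tau>\<close> for the generator \<open>gen\<close>
  divided by \<open>\<theta>\<close>, that is, the resolvent of the chain with speed measure
  \<open>\<theta>\<close> applied to \<open>u\<close>.\<close>

definition euler :: "('a \<Rightarrow> real) \<Rightarrow> real \<Rightarrow> ('a \<Rightarrow> real) \<Rightarrow> 'a \<Rightarrow> real" where
  "euler \<theta> \<tau> u = solve (\<lambda>x. \<theta> x / \<tau>) (\<lambda>x. \<theta> x / \<tau> * u x)"

end

locale speed_chain = killed_chain +
  fixes \<theta> :: "'a \<Rightarrow> real" and \<tau> :: real
  assumes theta_pos: "x \<in> S \<Longrightarrow> 0 < \<theta> x" and tau_pos: "0 < \<tau>"
begin

abbreviation "J \<equiv> euler \<theta> \<tau>"

lemma J_outside: "x \<notin> S \<Longrightarrow> J u x = 0"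
  unfolding euler_def by (rule solve) (simp_all add: theta_pos tau_pos less_imp_le)

lemma J_eq: "x \<in> S \<Longrightarrow> \<theta> x * (J u x - u x) = \<tau> * gen (J u) x"
  using solve(2)[of "\<lambda>x. \<theta> x / \<tau>" x "\<lambda>x. \<theta> x / \<tau> * u x"] theta_pos tau_pos
  by (simp add: euler_def less_imp_le field_simps)

lemma J_unique:
  assumes "\<And>x. x \<notin> S \<Longrightarrow> v x = 0" "\<And>x. x \<in> S \<Longrightarrow> \<theta> x * (v x - u x) = \<tau> * gen v x"
  shows "v = J u"
proof
  fix x show "v x = J u x"
  proof (cases "x \<in> S")
    case True
    show ?thesis
    proof (rule solution_unique[where a = "\<lambda>x. \<theta> x / \<tau>", OF _ _ True])
      fix x assume "x \<in> S"
      then show "\<theta> x / \<tau> * v x - gen v x = \<theta> x / \<tau> * J u x - gen (J u) x"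
        using assms(2)[of x] J_eq[of x u] tau_pos by (simp add: field_simps)
    qed (simp add: theta_pos tau_pos less_imp_le)
  qed (simp add: assms J_outside)
qed

lemma J_diff: "J (\<lambda>x. u x - w x) = (\<lambda>x. J u x - J w x)"
  by (rule J_unique[symmetric]) (auto simp: J_outside gen_diff J_eq[symmetric] algebra_simps)

lemma J_scale: "J (\<lambda>x. k * u x) = (\<lambda>x. k * J u x)"
proof (rule J_unique[symmetric])
  fix x assume "x \<in> S"
  then have "k * (\<theta> x * (J u x - u x)) = k * (\<tau> * gen (J u) x)" by (simp add: J_eq)
  then show "\<theta> x * (k * J u x - k * u x) = \<tau> * gen (\<lambda>x. k * J u x) x"
    by (simp add: gen_scale algebra_simps)
qed (simp add: J_outside)

lemma J_nonneg:
  assumes "\<And>x. x \<in> S \<Longrightarrow> 0 \<le> u x" shows "0 \<le> J u x"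
proof (cases "x \<in> S")
  case True
  show ?thesis
  proof (rule maximum_principle[where a = "\<lambda>x. \<theta> x / \<tau>", OF _ _ True])
    fix x assume x: "x \<in> S"
    have "\<theta> x / \<tau> * J u x - gen (J u) x = \<theta> x / \<tau> * u x"
      using J_eq[OF x, of u] tau_pos by (simp add: field_simps)
    then show "0 \<le> \<theta> x / \<tau> * J u x - gen (J u) x"
      using assms[OF x] theta_pos[OF x] tau_pos by simp
  qed (simp add: theta_pos tau_pos less_imp_le)
qed (simp add: J_outside)

text \<open>The weak form of a step. The choice of \<open>g\<close> decides what it yields:
  \<open>J u\<close> gives dissipation, \<open>J u - u\<close> monotonicity of the form, the
  constant 1 loss of mass.\<close>

lemma ip_J: "ip \<theta> (J u) g - ip \<theta> u g = - \<tau> * form (J u) g"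
proof -
  have "ip \<theta> (J u) g - ip \<theta> u g = (\<Sum>x\<in>S. (\<theta> x * (J u x - u x)) * g x)"
    by (simp add: ip_def sum_subtractf[symmetric] algebra_simps)
  then show ?thesis by (simp add: J_eq form_gen sum_distrib_left sum_negf mult_ac)
qed

lemma ip_nonneg: "0 \<le> ip \<theta> f f"
  unfolding ip_def by (intro sum_nonneg) (auto simp: theta_pos less_imp_le mult.assoc)

text \<open>Testing the step for \<open>u\<close> with \<open>J w\<close> and the step for
  \<open>w\<close> with \<open>J u\<close> produces the same form term.\<close>

lemma J_symmetric: "ip \<theta> (J u) w = ip \<theta> u (J w)"
  using ip_J[of u "J w"] ip_J[of w "J u"] form_commute[of "J u" "J w"]
  by (simp add: ip_commute[of \<theta> "J w"] ip_commute[of \<theta> w])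

lemma J_dissipation: "ip \<theta> (J u) (J u) + 2 * \<tau> * form (J u) (J u) \<le> ip \<theta> u u"
  using ip_J[of u "J u"] ip_nonneg[of "\<lambda>x. J u x - u x"] ip_commute[of \<theta> u "J u"]
  by (simp add: ip_diff_left ip_diff_right)

lemma J_contraction: "ip \<theta> (J u) (J u) \<le> ip \<theta> u u"
  using J_dissipation[of u] form_nonneg[of "J u"] tau_pos
  by (smt (verit) mult_nonneg_nonneg)

text \<open>Testing with \<open>J u - u\<close> gives
  \<open>form (J u) (J u) \<le> form (J u) u\<close>; positivity of the form at the difference does
  the rest.\<close>

lemma form_J_le: "form (J u) (J u) \<le> form u u"
proof -
  have "0 \<le> ip \<theta> (\<lambda>x. J u x - u x) (\<lambda>x. J u x - u x)" by (rule ip_nonneg)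
  also have "\<dots> = - \<tau> * (form (J u) (J u) - form (J u) u)"
    using ip_J[of u "\<lambda>x. J u x - u x"] by (simp add: ip_diff_left form_diff_right)
  finally have "form (J u) (J u) \<le> form (J u) u" using tau_pos by (simp add: mult_le_0_iff zero_le_mult_iff)
  moreover have "0 \<le> form (\<lambda>x. J u x - u x) (\<lambda>x. J u x - u x)" by (rule form_nonneg)
  ultimately show ?thesis by (simp add: form_diff_left form_diff_right form_commute[of u "J u"])
qed

lemma sum_J_le:
  assumes "\<And>x. x \<in> S \<Longrightarrow> 0 \<le> u x"
  shows "(\<Sum>x\<in>S. \<theta> x * J u x) \<le> (\<Sum>x\<in>S. \<theta> x * u x)"
proof -
  have "ip \<theta> (J u) (\<lambda>_. 1) - ip \<theta> u (\<lambda>_. 1) = - \<tau> * form (\<lambda>_. 1) (J u)"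
    using ip_J[of u "\<lambda>_. 1"] by (simp add: form_commute)
  \<comment> \<open>Against the constant 1 the jumps cancel and only the killing remains.\<close>
  also have "form (\<lambda>_. 1) (J u) = (\<Sum>x\<in>S. (r x - (\<Sum>y\<in>S. c x y)) * J u x)"
    by (simp add: form_gen gen_def sum_negf[symmetric] algebra_simps)
  also have "- \<tau> * \<dots> \<le> 0"
    using tau_pos assms killing
    by (intro mult_nonpos_nonneg sum_nonneg mult_nonneg_nonneg J_nonneg) (auto simp: less_imp_le)
  finally show ?thesis by (simp add: ip_def)
qed

lemma J_pow_symmetric: "ip \<theta> ((J ^^ n) u) w = ip \<theta> u ((J ^^ n) w)"
  by (induction n arbitrary: u) (simp_all add: funpow_swap1 J_symmetric)

lemma J_pow_nonneg: "(\<And>x. x \<in> S \<Longrightarrow> 0 \<le> u x) \<Longrightarrow> x \<in> S \<Longrightarrow> 0 \<le> (J ^^ n) u x"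
  by (induction n arbitrary: x) (auto intro: J_nonneg)

end

text \<open>The killing alone is coercive. The constant depends on the finite set \<open>S\<close>,
  so it may serve for qualitative limits but must not enter the final bounds.\<close>

lemma (in killed_chain) form_coercive:
  assumes "\<And>x. x \<in> S \<Longrightarrow> 0 < \<theta> x"
  shows "\<exists>k>0. \<forall>f. k * ip \<theta> f f \<le> form f f"
proof -
  let ?e = "\<lambda>x. (r x - (\<Sum>y\<in>S. c x y)) / \<theta> x"
  define k where "k = Min (insert 1 (?e ` S))"
  have k0: "k > 0" unfolding k_def using finite_S killing assms by (subst Min_gr_iff) auto
  have k: "k * \<theta> x \<le> r x - (\<Sum>y\<in>S. c x y)" if "x \<in> S" for x
  proof -
    have "k \<le> ?e x" unfolding k_def using finite_S that by (intro Min_le) auto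
    then show ?thesis using assms[OF that] by (simp add: field_simps)
  qed
  have "k * ip \<theta> f f \<le> form f f" for f
  proof -
    have "k * ip \<theta> f f = (\<Sum>x\<in>S. (k * \<theta> x) * (f x)\<^sup>2)"
      by (simp add: ip_def sum_distrib_left power2_eq_square mult_ac)
    also have "\<dots> \<le> (\<Sum>x\<in>S. (r x - (\<Sum>y\<in>S. c x y)) * (f x)\<^sup>2)"
      by (intro sum_mono mult_right_mono k) auto
    also have "\<dots> \<le> form f f"
      unfolding form_eq_squares by (simp add: sum_nonneg c_nonneg)
    finally show ?thesis .
  qed
  then show ?thesis using k0 by blast
qed

section \<open>Kernels and Green potentials of a finite chain\<close>

definition point_mass :: "'a \<Rightarrow> 'a \<Rightarrow> real" where
  "point_mass z = (\<lambda>x. if x = z then 1 else 0)"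

lemma point_mass_divide: "point_mass z x / k = (if x = z then 1 / k else 0)"
  by (simp add: point_mass_def)

context killed_chain begin

definition green :: "'a \<Rightarrow> 'a \<Rightarrow> real" where
  "green z = solve (\<lambda>_. 0) (point_mass z)"

lemma green_outside: "x \<notin> S \<Longrightarrow> green z x = 0"
  and green_eq: "x \<in> S \<Longrightarrow> gen (green z) x = - point_mass z x"
  using solve[of "\<lambda>_. 0" x "point_mass z"] by (auto simp: green_def)

lemma green_nonneg: "0 \<le> green z x"
proof (cases "x \<in> S")
  case True
  show ?thesis
    by (rule maximum_principle[where a = "\<lambda>_. 0", OF _ _ True]) (auto simp: green_eq point_mass_def)
qed (simp add: green_outside)

end

context speed_chain begin

text \<open>The transition density with respect to \<open>\<theta>\<close> after \<open>n\<close>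
  steps, whence the division by \<open>\<theta> z\<close>.\<close>

definition kernel :: "'a \<Rightarrow> nat \<Rightarrow> 'a \<Rightarrow> real" where
  "kernel z n = (J ^^ n) (\<lambda>x. point_mass z x / \<theta> z)"

lemma kernel_Suc: "kernel z (Suc n) = J (kernel z n)"
  by (simp add: kernel_def)

lemma kernel_nonneg: "z \<in> S \<Longrightarrow> x \<in> S \<Longrightarrow> 0 \<le> kernel z n x"
  unfolding kernel_def by (rule J_pow_nonneg) (auto simp: point_mass_def theta_pos less_imp_le)

lemma kernel_outside: "z \<in> S \<Longrightarrow> x \<notin> S \<Longrightarrow> kernel z n x = 0"
  by (cases n) (auto simp: kernel_def point_mass_def J_outside)

lemma ip_kernel_0: "z \<in> S \<Longrightarrow> ip \<theta> (kernel z 0) f = f z"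
  using finite_S theta_pos[of z] by (simp add: ip_def kernel_def point_mass_def if_distrib if_distribR sum.delta' cong: if_cong)

text \<open>Chapman-Kolmogorov on the diagonal: symmetry moves all steps to one side, and pairing
  with the initial kernel evaluates at \<open>z\<close>.\<close>

lemma ip_kernel: "z \<in> S \<Longrightarrow> ip \<theta> (kernel z m) (kernel z n) = kernel z (m + n) z"
proof -
  assume z: "z \<in> S"
  have "ip \<theta> (kernel z m) (kernel z n) = ip \<theta> (kernel z 0) ((J ^^ m) (kernel z n))"
    unfolding kernel_def[of z m] J_pow_symmetric by (simp add: kernel_def)
  also have "\<dots> = kernel z (m + n) z" by (simp add: ip_kernel_0[OF z] funpow_add kernel_def[of z "m + n"] kernel_def[of z n])
  finally show ?thesis .
qed

lemma kernel_mass_le_1: "z \<in> S \<Longrightarrow> (\<Sum>x\<in>S. \<theta> x * kernel z n x) \<le> 1"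
proof (induction n)
  case 0
  then show ?case using finite_S theta_pos[of z]
    by (simp add: kernel_def point_mass_divide if_distrib cong: if_cong)
next
  case (Suc n)
  then show ?case using sum_J_le[of "kernel z n"] kernel_nonneg[of z _ n] by (simp add: kernel_Suc)
qed

text \<open>On the diagonal the kernel is a pairing of two earlier kernels, as close in time as the
  parity of \<open>n\<close> allows. In both cases the comparison comes from the step equation
  tested with the later kernel and from positivity of the form.\<close>

lemma kernel_decreasing: "z \<in> S \<Longrightarrow> kernel z (Suc n) z \<le> kernel z n z"
proof -
  assume z: "z \<in> S"
  have cases: "\<exists>k. n = k + k \<or> n = k + Suc k"
    by (metis add_Suc_right evenE mult_2 oddE Suc_eq_plus1)
  then obtain k where "n = k + k \<or> n = k + Suc k" ..
  let ?v = "kernel z (Suc k)" and ?u = "kernel z k"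
  have e: "ip \<theta> ?v g - ip \<theta> ?u g = - \<tau> * form ?v g" for g
    unfolding kernel_Suc by (rule ip_J)
  have f: "0 \<le> \<tau> * form ?v ?v" using tau_pos form_nonneg by simp
  from \<open>n = k + k \<or> n = k + Suc k\<close> show ?thesis
  proof
    assume n: "n = k + k"
    have "0 \<le> ip \<theta> (\<lambda>x. ?v x - ?u x) (\<lambda>x. ?v x - ?u x)" by (rule ip_nonneg)
    then have "ip \<theta> ?v ?u \<le> ip \<theta> ?u ?u"
      using e[of ?v] f by (simp add: ip_diff_left ip_diff_right ip_commute[of \<theta> ?u ?v])
    then show ?thesis by (simp add: ip_kernel z n)
  next
    assume n: "n = k + Suc k"
    have "ip \<theta> ?v ?v \<le> ip \<theta> ?u ?v" using e[of ?v] f by linarith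
    then show ?thesis by (simp add: ip_kernel z n)
  qed
qed

lemma kernel_antimono: "z \<in> S \<Longrightarrow> m \<le> n \<Longrightarrow> kernel z n z \<le> kernel z m z"
  by (rule lift_Suc_antimono_le[of "\<lambda>n. kernel z n z"]) (auto intro: kernel_decreasing)

text \<open>This is the tail of the time sum of kernels, an expected occupation density after step
  \<open>n\<close>. Writing it as iterated resolvents of one function makes it accessible to the
  maximum principle.\<close>

definition green_flow :: "'a \<Rightarrow> nat \<Rightarrow> 'a \<Rightarrow> real" where
  "green_flow z n = (J ^^ n) (green z)"

lemma green_flow_Suc: "green_flow z (Suc n) = J (green_flow z n)"
  by (simp add: green_flow_def)

lemma green_flow_outside: "x \<notin> S \<Longrightarrow> green_flow z n x = 0"
  by (cases n) (auto simp: green_flow_def green_outside J_outside)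

lemma green_flow_nonneg: "0 \<le> green_flow z n x"
proof (cases "x \<in> S")
  case True then show ?thesis
    unfolding green_flow_def by (intro J_pow_nonneg) (auto simp: green_nonneg)
qed (simp add: green_flow_outside)

text \<open>Resolvent identity: an implicit step lowers the Green potential by \<open>\<tau>\<close>
  times the kernel at the end of that step, hence the index \<open>Suc n\<close>. The later steps
  follow by linearity of \<open>J\<close>.\<close>

lemma green_flow_step:
  assumes z: "z \<in> S"
  shows "(\<lambda>x. green_flow z n x - green_flow z (Suc n) x) = (\<lambda>x. \<tau> * kernel z (Suc n) x)"
proof (induction n)
  case 0
  have "(\<lambda>x. green z x - \<tau> * kernel z (Suc 0) x) = J (green z)"
  proof (rule J_unique)
    fix x assume x: "x \<in> S"
    have "\<theta> x * (kernel z (Suc 0) x - kernel z 0 x) = \<tau> * gen (kernel z (Suc 0)) x"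
      unfolding kernel_Suc using J_eq[OF x] .
    moreover have "\<theta> x * kernel z 0 x = point_mass z x"
      using theta_pos[OF z] by (simp add: kernel_def point_mass_def)
    ultimately show "\<theta> x * (green z x - \<tau> * kernel z (Suc 0) x - green z x)
      = \<tau> * gen (\<lambda>x. green z x - \<tau> * kernel z (Suc 0) x) x"
      using x by (simp add: gen_diff gen_scale green_eq algebra_simps)
  qed (simp add: green_outside kernel_outside[OF z])
  then have "green_flow z (Suc 0) x = green z x - \<tau> * kernel z (Suc 0) x" for x
    unfolding green_flow_def by (simp add: fun_eq_iff)
  then show ?case by (simp add: green_flow_def)
next
  case (Suc n)
  have "(\<lambda>x. green_flow z (Suc n) x - green_flow z (Suc (Suc n)) x)
      = J (\<lambda>x. green_flow z n x - green_flow z (Suc n) x)"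
    by (simp add: J_diff green_flow_Suc)
  also have "\<dots> = (\<lambda>x. \<tau> * kernel z (Suc (Suc n)) x)"
    unfolding Suc J_scale by (simp add: kernel_Suc)
  finally show ?case .
qed

lemma green_flow_telescope:
  assumes "z \<in> S" "m \<le> n"
  shows "green_flow z m x - green_flow z n x = (\<Sum>k\<in>{m<..n}. \<tau> * kernel z k x)"
  using assms(2)
proof (induction n rule: dec_induct)
  case (step n)
  have "{m<..Suc n} = insert (Suc n) {m<..n}" using step by auto
  then show ?case using step fun_cong[OF green_flow_step[OF assms(1), of n], of x] by simp
qed simp

text \<open>Dissipation and coercivity give geometric decay in norm. The rate depends on
  \<open>S\<close>, but only the limit is needed to identify the flow with the whole tail of the
  sum.\<close>

lemma green_flow_tendsto_0: "x \<in> S \<Longrightarrow> (\<lambda>n. green_flow z n x) \<longlonglongrightarrow> 0"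
proof -
  assume x: "x \<in> S"
  obtain k where k: "k > 0" "\<And>f. k * ip \<theta> f f \<le> form f f"
    using form_coercive[of \<theta>] theta_pos by blast
  define a where "a n = ip \<theta> (green_flow z n) (green_flow z n)" for n
  define q where "q = 1 / (1 + 2 * \<tau> * k)"
  have q: "0 < q" "q < 1" using k(1) tau_pos by (auto simp: q_def add_pos_pos)
  have "a (Suc n) \<le> q * a n" for n
  proof -
    have "2 * \<tau> * (k * a (Suc n)) \<le> 2 * \<tau> * form (green_flow z (Suc n)) (green_flow z (Suc n))"
      using k(2) tau_pos unfolding a_def by (intro mult_left_mono) auto
    then have "(1 + 2 * \<tau> * k) * a (Suc n) \<le> a n"
      using J_dissipation[of "green_flow z n"] by (simp add: a_def green_flow_Suc algebra_simps)
    then show ?thesis using k(1) tau_pos by (simp add: q_def field_simps add_pos_pos)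
  qed
  then have "a n \<le> q ^ n * a 0" for n
  proof (induction n)
    case (Suc n)
    have "a (Suc n) \<le> q * a n" by fact
    also have "\<dots> \<le> q * (q ^ n * a 0)" using Suc q by (intro mult_left_mono) auto
    finally show ?case by simp
  qed simp
  moreover have "(\<lambda>n. q ^ n * a 0) \<longlonglongrightarrow> 0 * a 0"
    using q by (intro tendsto_mult LIMSEQ_realpow_zero tendsto_const) auto
  moreover have "0 \<le> a n" for n by (simp add: a_def ip_nonneg)
  ultimately have "a \<longlonglongrightarrow> 0"
    by (intro tendsto_sandwich[of "\<lambda>_. 0" a _ "\<lambda>n. q ^ n * a 0"]) (auto intro!: always_eventually)
  have "(green_flow z n x)\<^sup>2 \<le> a n / \<theta> x" for n
  proof -
    have "\<theta> x * green_flow z n x * green_flow z n x \<le> a n"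
      unfolding a_def ip_def using theta_pos finite_S x
      by (intro member_le_sum[where f = "\<lambda>x. \<theta> x * green_flow z n x * green_flow z n x"])
         (auto simp: mult.assoc less_imp_le)
    then show ?thesis using theta_pos[OF x] by (simp add: field_simps power2_eq_square)
  qed
  moreover have "(\<lambda>n. a n / \<theta> x) \<longlonglongrightarrow> 0 / \<theta> x"
    using \<open>a \<longlonglongrightarrow> 0\<close> theta_pos[OF x] by (intro tendsto_intros) auto
  ultimately have "(\<lambda>n. (green_flow z n x)\<^sup>2) \<longlonglongrightarrow> 0"
    by (intro tendsto_sandwich[of "\<lambda>_. 0" "\<lambda>n. (green_flow z n x)\<^sup>2" _ "\<lambda>n. a n / \<theta> x"]) (auto intro!: always_eventually)
  then show ?thesis by simp
qed

end

text \<open>The Green potential is superharmonic, so its expectation decreases along the chain and is larger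
  for the slower one. This permits a speed measure that has no lower bound.\<close>

lemma green_flow_mono_speed:
  assumes "speed_chain S c r \<theta> \<tau>" "speed_chain S c r \<theta>' \<tau>" "z \<in> S"
    and le: "\<And>x. x \<in> S \<Longrightarrow> \<theta> x \<le> \<theta>' x"
  shows "speed_chain.green_flow S c r \<theta> \<tau> z n x \<le> speed_chain.green_flow S c r \<theta>' \<tau> z n x"
proof -
  interpret A: speed_chain S c r \<theta> \<tau> by fact
  interpret B: speed_chain S c r \<theta>' \<tau> by fact
  have "A.green_flow z n x \<le> B.green_flow z n x" if "x \<in> S" for x
    using that
  proof (induction n arbitrary: x)
    case 0 show ?case by (simp add: A.green_flow_def B.green_flow_def)
  next
    case (Suc n)
    have "0 \<le> B.green_flow z (Suc n) x - A.green_flow z (Suc n) x"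
    proof (rule A.maximum_principle[where a = "\<lambda>x. \<theta> x / \<tau>", OF _ _ Suc.prems])
      fix x assume x: "x \<in> S"
      show "0 \<le> \<theta> x / \<tau>" using A.theta_pos[OF x] A.tau_pos by simp
      have a: "\<theta> x * (A.green_flow z (Suc n) x - A.green_flow z n x) = \<tau> * A.gen (A.green_flow z (Suc n)) x"
        unfolding A.green_flow_Suc by (rule A.J_eq[OF x])
      have b: "\<theta>' x * (B.green_flow z (Suc n) x - B.green_flow z n x) = \<tau> * A.gen (B.green_flow z (Suc n)) x"
        unfolding B.green_flow_Suc by (rule B.J_eq[OF x])
      have dec: "B.green_flow z (Suc n) x - B.green_flow z n x \<le> 0"
        using fun_cong[OF B.green_flow_step[OF assms(3), of n], of x]
          B.kernel_nonneg[OF assms(3) x, of "Suc n"] B.tau_pos by (smt (verit) mult_nonneg_nonneg)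
      \<comment> \<open>The difference is nonpositive, so the smaller speed gives the larger
        product: the potential of the slow chain is a supersolution for the fast one.\<close>
      have "\<theta>' x * (B.green_flow z (Suc n) x - B.green_flow z n x)
          \<le> \<theta> x * (B.green_flow z (Suc n) x - B.green_flow z n x)"
        using le[OF x] dec by (rule mult_right_mono_neg)
      moreover have "0 \<le> \<theta> x * (B.green_flow z n x - A.green_flow z n x)"
        using Suc.IH[OF x] A.theta_pos[OF x] by simp
      ultimately have "0 \<le> \<theta> x * (B.green_flow z (Suc n) x - A.green_flow z (Suc n) x)
          - \<tau> * (A.gen (B.green_flow z (Suc n)) x - A.gen (A.green_flow z (Suc n)) x)"
        using a b by (simp add: algebra_simps)
      then have "0 \<le> (\<theta> x * (B.green_flow z (Suc n) x - A.green_flow z (Suc n) x)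
          - \<tau> * (A.gen (B.green_flow z (Suc n)) x - A.gen (A.green_flow z (Suc n)) x)) / \<tau>"
        using A.tau_pos by simp
      then show "0 \<le> \<theta> x / \<tau> * (B.green_flow z (Suc n) x - A.green_flow z (Suc n) x)
          - A.gen (\<lambda>x. B.green_flow z (Suc n) x - A.green_flow z (Suc n) x) x"
        using A.tau_pos by (simp add: A.gen_diff diff_divide_distrib)
    qed
    then show ?case by simp
  qed
  then show ?thesis by (cases "x \<in> S") (auto simp: A.green_flow_outside B.green_flow_outside)
qed

text \<open>Between different speeds only time sums are compared. Monotonicity on the diagonal
  bounds the kernel at step 2n by its mean over the steps after n. For the fast chain that sum is a
  difference of Green flows, which lies below the flow of the slow chain at n, and this in turn is
  the whole tail of its time sum.\<close>

lemma kernel_le_of_larger_speed: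
  assumes "speed_chain S c r \<theta> \<tau>" "speed_chain S c r \<theta>' \<tau>" "z \<in> S"
    and le: "\<And>x. x \<in> S \<Longrightarrow> \<theta> x \<le> \<theta>' x"
    and B: "\<And>N. n \<le> N \<Longrightarrow> (\<Sum>k\<in>{n<..N}. \<tau> * speed_chain.kernel S c r \<theta>' \<tau> z k z) \<le> B"
  shows "n * \<tau> * speed_chain.kernel S c r \<theta> \<tau> z (n + n) z \<le> B"
proof -
  interpret A: speed_chain S c r \<theta> \<tau> by fact
  interpret B: speed_chain S c r \<theta>' \<tau> by fact
  have "n * \<tau> * A.kernel z (n + n) z = (\<Sum>k\<in>{n<..n + n}. \<tau> * A.kernel z (n + n) z)" by simp
  also have "\<dots> \<le> (\<Sum>k\<in>{n<..n + n}. \<tau> * A.kernel z k z)"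
    using A.tau_pos assms(3) by (intro sum_mono mult_left_mono A.kernel_antimono) auto
  also have "\<dots> = A.green_flow z n z - A.green_flow z (n + n) z"
    by (rule A.green_flow_telescope[symmetric]) (use assms in auto)
  also have "\<dots> \<le> B.green_flow z n z"
    using green_flow_mono_speed[OF assms(1-4), of n z] A.green_flow_nonneg[of z "n + n" z] by linarith
  also have "\<dots> \<le> B"
  proof (rule tendsto_upperbound)
    show "(\<lambda>N. B.green_flow z n z - B.green_flow z N z) \<longlonglongrightarrow> B.green_flow z n z"
      using tendsto_diff[OF tendsto_const B.green_flow_tendsto_0[OF assms(3)]] by simp
    show "\<forall>\<^sub>F N in sequentially. B.green_flow z n z - B.green_flow z N z \<le> B"
      using B by (auto simp: B.green_flow_telescope[OF assms(3)] eventually_sequentially intro!: exI[of _ n])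
  qed simp
  finally show ?thesis .
qed

section \<open>Nash's argument for the implicit Euler scheme\<close>

text \<open>Each edge contributes both of its orientations to the right hand side, which the factor
  1/2 compensates. The oriented pairs are all distinct because no two unit vectors add up to
  0.\<close>

lemma sum_edges_le:
  fixes h :: "'d::finite site \<Rightarrow> 'd site \<Rightarrow> real"
  assumes "finite T" "\<And>x y. h x y = h y x" "\<And>x y. 0 \<le> h x y"
    and T: "\<And>y i. y \<in> A \<Longrightarrow> y \<in> T \<and> y + e1 i \<in> T"
  shows "(\<Sum>y\<in>A. \<Sum>i\<in>UNIV. h y (y + e1 i)) \<le> 1/2 * (\<Sum>x\<in>T. \<Sum>y\<in>T. h x y)"
proof -
  have "finite A" using T assms(1) by (meson finite_subset subsetI)
  let ?E = "(\<lambda>(y, i). (y, y + e1 i)) ` (A \<times> UNIV)" and ?E' = "(\<lambda>(y, i). (y + e1 i, y)) ` (A \<times> (UNIV :: 'd set))"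
  have ax: "e1 i = (e1 j :: 'd site) \<longleftrightarrow> i = j" for i j :: 'd by (simp add: axis_eq_axis)
  have inj: "inj_on (\<lambda>(y, i). (y, y + e1 i)) (A \<times> (UNIV :: 'd set))"
    "inj_on (\<lambda>(y, i). (y + e1 i, y)) (A \<times> (UNIV :: 'd set))"
    by (auto simp: inj_on_def ax)
  have disj: "?E \<inter> ?E' = {}"
  proof (rule ccontr)
    assume "?E \<inter> ?E' \<noteq> {}"
    then obtain p where p: "p \<in> ?E" "p \<in> ?E'" by blast
    obtain y :: "'d site" and i where y: "p = (y, y + e1 i)" using p(1) by auto
    obtain z :: "'d site" and j where z: "p = (z + e1 j, z)" using p(2) by auto
    have "y = y + (e1 i + e1 j)" using y z by (metis add.assoc prod.inject)
    then have "e1 i + e1 j = (0 :: 'd site)" by simp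
    then have "(e1 i + e1 j) $ i = (0 :: 'd site) $ i" by simp
    then show False by (simp add: axis_def split: if_splits)
  qed
  have "2 * (\<Sum>y\<in>A. \<Sum>i\<in>UNIV. h y (y + e1 i)) = (\<Sum>(x, y)\<in>?E. h x y) + (\<Sum>(x, y)\<in>?E'. h x y)"
    unfolding sum.reindex[OF inj(1)] sum.reindex[OF inj(2)]
    by (simp add: case_prod_unfold sum.cartesian_product assms(2)[of "_ + _"])
  also have "\<dots> = (\<Sum>(x, y)\<in>?E \<union> ?E'. h x y)"
    using disj \<open>finite A\<close> by (intro sum.union_disjoint[symmetric]) auto
  also have "\<dots> \<le> (\<Sum>(x, y)\<in>T \<times> T. h x y)"
    using T assms(1,3) by (intro sum_mono2) auto
  also have "\<dots> = (\<Sum>x\<in>T. \<Sum>y\<in>T. h x y)" by (simp add: sum.cartesian_product)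
  finally show ?thesis by simp
qed

text \<open>\<open>r\<close> stands for the total rate on the infinite lattice. It exceeds all
  finite partial sums strictly, so every finite set gives a killed chain.\<close>

locale conductances =
  fixes c :: "'d::finite site \<Rightarrow> 'd site \<Rightarrow> real" and r :: "'d site \<Rightarrow> real"
  assumes c_commute: "c x y = c y x" and c_nonneg: "0 \<le> c x y"
    and c_edge: "0 < c x (x + e1 i)" and total: "finite T \<Longrightarrow> (\<Sum>y\<in>T. c x y) < r x"
begin

lemma killed_chain: "finite S \<Longrightarrow> killed_chain S c r"
  by unfold_locales (auto simp: c_commute c_nonneg total)

definition edge_energy :: "('d site \<Rightarrow> real) \<Rightarrow> 'd site \<Rightarrow> real" where
  "edge_energy f y = (\<Sum>i\<in>UNIV. c y (y + e1 i) * (f (y + e1 i) - f y)\<^sup>2)"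

lemma edge_energy_nonneg: "0 \<le> edge_energy f y"
  by (simp add: edge_energy_def sum_nonneg c_nonneg)

text \<open>For functions vanishing off \<open>S\<close>, the jumps out of \<open>S\<close> are
  already counted as killing, so that a larger set gives the same value.\<close>

lemma form_superset:
  assumes "finite T" "S \<subseteq> T" "\<And>x. x \<notin> S \<Longrightarrow> f x = 0" "\<And>x. x \<notin> S \<Longrightarrow> g x = 0"
  shows "killed_chain.form T c r f g = killed_chain.form S c r f g"
proof -
  have S: "finite S" using assms finite_subset by blast
  have "(\<Sum>x\<in>T. r x * f x * g x) = (\<Sum>x\<in>S. r x * f x * g x)"
    by (rule sum.mono_neutral_right) (use assms in auto)
  moreover have "(\<Sum>x\<in>T. \<Sum>y\<in>T. c x y * f x * g y) = (\<Sum>x\<in>S. \<Sum>y\<in>T. c x y * f x * g y)"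
    by (rule sum.mono_neutral_right) (use assms in auto)
  moreover have "(\<Sum>y\<in>T. c x y * f x * g y) = (\<Sum>y\<in>S. c x y * f x * g y)" for x
    by (rule sum.mono_neutral_right) (use assms in auto)
  ultimately show ?thesis
    by (simp add: killed_chain.form_def[OF killed_chain] S assms(1))
qed

lemma sum_edge_energy_le:
  assumes "finite S" "\<And>x. x \<notin> S \<Longrightarrow> f x = 0" "finite A"
  shows "sum (edge_energy f) A \<le> killed_chain.form S c r f f"
proof -
  \<comment> \<open>\<open>T\<close> adds the end points of all edges starting in \<open>A\<close>,
    so that edges leaving \<open>S\<close> are counted as jumps inside \<open>T\<close>.\<close>
  define T where "T = S \<union> A \<union> (\<Union>i\<in>UNIV. (\<lambda>y. y + e1 i) ` A)"
  have T: "finite T" using assms by (simp add: T_def)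
  interpret T: killed_chain T c r by (rule killed_chain[OF T])
  have "sum (edge_energy f) A \<le> 1/2 * (\<Sum>x\<in>T. \<Sum>y\<in>T. c x y * (f x - f y)\<^sup>2)"
    unfolding edge_energy_def
    by (subst power2_commute, rule sum_edges_le[where h = "\<lambda>x y. c x y * (f x - f y)\<^sup>2"])
       (use T in \<open>auto simp: T_def c_nonneg c_commute power2_commute\<close>)
  also have "\<dots> \<le> T.form f f"
    unfolding T.form_eq_squares using T
    by (simp add: sum_nonneg total less_imp_le)
  also have "\<dots> = killed_chain.form S c r f f"
    by (rule form_superset) (use assms T in \<open>auto simp: T_def\<close>)
  finally show ?thesis .
qed

text \<open>Cauchy-Schwarz with the conductances as weights.\<close>

lemma grad_sq_le:
  assumes "\<And>y. (\<Sum>i\<in>UNIV. inverse (c y (y + e1 i))) \<le> \<nu> y"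
  shows "(grad f y)\<^sup>2 \<le> \<nu> y * edge_energy f y"
proof -
  have "(grad f y)\<^sup>2 = (\<Sum>i\<in>UNIV. sqrt (inverse (c y (y + e1 i))) * (sqrt (c y (y + e1 i)) * \<bar>f (y + e1 i) - f y\<bar>))\<^sup>2"
    using c_edge[of y] by (simp add: grad_def mult.assoc[symmetric] real_sqrt_inverse less_imp_neq[symmetric])
  also have "\<dots> \<le> (\<Sum>i\<in>UNIV. (sqrt (inverse (c y (y + e1 i))))\<^sup>2)
      * (\<Sum>i\<in>UNIV. (sqrt (c y (y + e1 i)) * \<bar>f (y + e1 i) - f y\<bar>)\<^sup>2)"
    by (rule Cauchy_Schwarz_ineq_sum)
  also have "\<dots> = (\<Sum>i\<in>UNIV. inverse (c y (y + e1 i))) * edge_energy f y"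
    using c_edge[of y] by (simp add: edge_energy_def power_mult_distrib less_imp_le c_nonneg)
  also have "\<dots> \<le> \<nu> y * edge_energy f y"
    using assms by (intro mult_right_mono) (simp_all add: edge_energy_def sum_nonneg c_nonneg)
  finally show ?thesis .
qed

end

text \<open>The cut-off at 1 lets the weight at one end of a jump be bounded by that at the other
  end times twice the length of the jump, while the function stays 1-Lipschitz.\<close>

definition weight :: "'d::finite site \<Rightarrow> real" where
  "weight x = max 1 (real_of_int (l1_dist 0 x))"

lemma weight_ge_1: "1 \<le> weight x" by (simp add: weight_def)

lemma weight_diff_le: "\<bar>weight x - weight y\<bar> \<le> real_of_int (l1_dist x y)"
proof -
  have "l1_dist 0 x \<le> l1_dist 0 y + l1_dist x y" "l1_dist 0 y \<le> l1_dist 0 x + l1_dist x y"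
    using l1_dist_triangle[of 0 x y] l1_dist_triangle[of 0 y x] by (auto simp: l1_dist_commute[of y x])
  then have "\<bar>real_of_int (l1_dist 0 x) - real_of_int (l1_dist 0 y)\<bar> \<le> real_of_int (l1_dist x y)" by linarith
  then show ?thesis unfolding weight_def using l1_dist_nonneg[of x y] by linarith
qed

text \<open>Mean value theorem, with the intermediate point bounded by
  \<open>2 * s * \<delta>\<close>. The bound involves the weight at one end only, so that summing
  over the jumps from a site produces its moment of order \<open>m\<close>.\<close>

lemma powr_diff_sq_le:
  fixes s t \<delta> m :: real
  assumes "1 \<le> s" "1 \<le> t" "1 \<le> \<delta>" "\<bar>s - t\<bar> \<le> \<delta>" "2 \<le> m"
  shows "(s powr (m / 2) - t powr (m / 2))\<^sup>2 \<le> (m / 2)\<^sup>2 * 2 powr (m - 2) * s powr (m - 2) * \<delta> powr m"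
proof -
  let ?p = "m / 2"
  have mvt: "y powr ?p - x powr ?p \<le> ?p * y powr (?p - 1) * (y - x)" if "1 \<le> x" "x \<le> y" for x y :: real
  proof (cases "x = y")
    case False
    then have "x < y" using that by simp
    have "\<exists>z. x < z \<and> z < y \<and> y powr ?p - x powr ?p = (y - x) * (?p * z powr (?p - 1))"
    proof (rule MVT2[OF \<open>x < y\<close>])
      fix z assume "x \<le> z" "z \<le> y"
      then show "((\<lambda>a. a powr ?p) has_real_derivative ?p * z powr (?p - 1)) (at z)"
        using that by (intro has_real_derivative_powr) auto
    qed
    then obtain z where z: "x < z" "z < y" "y powr ?p - x powr ?p = (y - x) * (?p * z powr (?p - 1))" by blast
    have "z powr (?p - 1) \<le> y powr (?p - 1)" using z that assms by (intro powr_mono2) auto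
    then show ?thesis unfolding z(3) using that assms by (simp add: mult.commute mult_left_mono)
  qed simp
  have "\<bar>s powr ?p - t powr ?p\<bar> \<le> ?p * (max s t) powr (?p - 1) * \<bar>s - t\<bar>"
  proof (cases "s \<le> t")
    case True
    then have "s powr ?p \<le> t powr ?p" using assms by (intro powr_mono2) auto
    then show ?thesis using mvt[OF assms(1) True] True by (simp add: max_def)
  next
    case False
    then have "t powr ?p \<le> s powr ?p" using assms by (intro powr_mono2) auto
    then show ?thesis using mvt[of t s] assms False by (simp add: max_def)
  qed
  also have "\<dots> \<le> ?p * (2 * s * \<delta>) powr (?p - 1) * \<delta>"
  proof -
    have "0 \<le> (s - 1) * (\<delta> - 1)" using assms by (intro mult_nonneg_nonneg) auto
    then have "s + \<delta> \<le> 2 * s * \<delta>"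
      using mult_mono[of 1 s 1 \<delta>] assms by (simp add: algebra_simps)
    then have "max s t \<le> 2 * s * \<delta>" using assms by (auto simp: max_def)
    then show ?thesis using assms
      by (intro mult_mono powr_mono2) auto
  qed
  finally have "\<bar>s powr ?p - t powr ?p\<bar>\<^sup>2 \<le> (?p * (2 * s * \<delta>) powr (?p - 1) * \<delta>)\<^sup>2"
    by (rule power_mono) simp
  also have "\<dots> = ?p\<^sup>2 * ((2 * s * \<delta>) powr (?p - 1))\<^sup>2 * \<delta> powr 2"
    using assms by (simp add: power_mult_distrib power_divide)
  also have "((2 * s * \<delta>) powr (?p - 1))\<^sup>2 = (2 * s * \<delta>) powr (m - 2)"
    using assms by (simp add: powr_powr algebra_simps flip: powr_numeral)
  also have "?p\<^sup>2 * (2 * s * \<delta>) powr (m - 2) * \<delta> powr 2 = ?p\<^sup>2 * 2 powr (m - 2) * s powr (m - 2) * (\<delta> powr (m - 2) * \<delta> powr 2)"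
    using assms by (simp add: powr_mult mult_ac)
  also have "\<delta> powr (m - 2) * \<delta> powr 2 = \<delta> powr m" by (simp flip: powr_add)
  finally show ?thesis by simp
qed

text \<open>The weight is compared with the diffusive scale sqrt (t / \<epsilon>): beyond it a small
  multiple of the full moment dominates, below it a power of \<open>t\<close>.\<close>

lemma powr_interpolate:
  fixes w t \<epsilon> m :: real
  assumes "0 < w" "0 < t" "0 < \<epsilon>" "2 \<le> m"
  shows "w powr (m - 2) \<le> \<epsilon> / t * w powr m + (t / \<epsilon>) powr (m / 2 - 1)"
proof (cases "t / \<epsilon> \<le> w\<^sup>2")
  case True
  then have "1 \<le> \<epsilon> / t * w\<^sup>2" using assms by (simp add: field_simps)
  then have "w powr (m - 2) \<le> \<epsilon> / t * w\<^sup>2 * w powr (m - 2)"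
    using mult_right_mono[of 1 "\<epsilon> / t * w\<^sup>2" "w powr (m - 2)"] by simp
  also have "w powr m = w powr 2 * w powr (m - 2)" by (simp flip: powr_add)
  then have "\<epsilon> / t * w\<^sup>2 * w powr (m - 2) = \<epsilon> / t * w powr m" using assms by simp
  finally show ?thesis by (simp add: add_increasing2)
next
  case False
  have "w powr (m - 2) = (w\<^sup>2) powr (m / 2 - 1)"
    using assms by (simp add: powr_powr algebra_simps flip: powr_numeral)
  also have "\<dots> \<le> (t / \<epsilon>) powr (m / 2 - 1)" using False assms by (intro powr_mono2) auto
  finally show ?thesis using assms by (simp add: add_increasing)
qed

lemma powr_one_minus_le: "0 \<le> x \<Longrightarrow> x < 1 \<Longrightarrow> 0 < g \<Longrightarrow> g \<le> 1 \<Longrightarrow> (1 - x) powr g \<le> 1 - g * (x::real)"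
  using Youngs_inequality_0[of g "1 - g" "1 - x" 1] by (simp add: algebra_simps)

lemma one_le_powr_neg: "0 \<le> y \<Longrightarrow> y < 1 \<Longrightarrow> 0 \<le> a \<Longrightarrow> 1 + a * y \<le> (1 - y) powr - (a::real)"
proof -
  assume a: "0 \<le> y" "y < 1" "0 \<le> a"
  have "ln (1 - y) \<le> - y" using a ln_le_minus_one[of "1 - y"] by simp
  then have "a * y \<le> - a * ln (1 - y)" using a mult_left_mono[of "ln (1 - y)" "- y" a] by simp
  have "1 + a * y \<le> exp (a * y)" by (rule exp_ge_add_one_self)
  also have "\<dots> \<le> exp (- a * ln (1 - y))" using \<open>a * y \<le> _\<close> by simp
  also have "\<dots> = (1 - y) powr - a" using a by (simp add: powr_def)
  finally show ?thesis .
qed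

text \<open>Splitting at level \<open>h\<close>: small values are paid for by the mass, large ones
  by the norm with exponent \<open>b > 2\<close>. This takes the place of interpolation between the
  two norms.\<close>

lemma sq_le_truncation:
  fixes u h b :: real
  assumes "0 \<le> u" "0 < h" "2 < b"
  shows "u\<^sup>2 \<le> h * u + h powr (2 - b) * u powr b"
proof (cases "u \<le> h")
  case True
  then have "u\<^sup>2 \<le> h * u" using assms by (simp add: power2_eq_square mult_right_mono)
  then show ?thesis by (simp add: add_increasing2)
next
  case False
  have "u\<^sup>2 = u powr (2 - b) * u powr b" using assms by (simp flip: powr_add)
  also have "\<dots> \<le> h powr (2 - b) * u powr b"
    using False assms by (intro mult_right_mono powr_mono2') auto
  finally show ?thesis using assms by (simp add: add_increasing)
qed

text \<open>Expanding squares, \<open>form v\<close> at w^2 v equals the form at w v minus half the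
  sum of c(x,y) v(x) v(y) (w(x) - w(y))^2. The form at w v is nonnegative and may be dropped; the
  product v(x) v(y) is at most the mean of the squares.\<close>

lemma (in killed_chain) weighted_form_le:
  assumes "\<And>x. x \<in> S \<Longrightarrow> 0 \<le> v x"
  shows "- 2 * form v (\<lambda>x. (w x)\<^sup>2 * v x) \<le> (\<Sum>x\<in>S. (v x)\<^sup>2 * (\<Sum>y\<in>S. c x y * (w x - w y)\<^sup>2))"
proof -
  let ?A = "\<Sum>x\<in>S. \<Sum>y\<in>S. c x y * v x * v y * (w x)\<^sup>2"
  let ?B = "\<Sum>x\<in>S. \<Sum>y\<in>S. c x y * (w x * v x) * (w y * v y)"
  have A': "(\<Sum>x\<in>S. \<Sum>y\<in>S. c x y * v x * ((w y)\<^sup>2 * v y)) = ?A"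
    by (subst sum.swap) (simp add: c_commute mult_ac)
  have f1: "form v (\<lambda>x. (w x)\<^sup>2 * v x) = (\<Sum>x\<in>S. r x * v x * ((w x)\<^sup>2 * v x)) - ?A"
    by (simp add: form_def A')
  have f2: "form (\<lambda>x. w x * v x) (\<lambda>x. w x * v x) = (\<Sum>x\<in>S. r x * v x * ((w x)\<^sup>2 * v x)) - ?B"
    by (simp add: form_def power2_eq_square mult_ac)
  have "(\<Sum>x\<in>S. \<Sum>y\<in>S. c x y * v x * v y * (w x - w y)\<^sup>2)
      = ?A + (\<Sum>x\<in>S. \<Sum>y\<in>S. c x y * v x * ((w y)\<^sup>2 * v y)) - 2 * ?B"
    by (simp add: sum.distrib[symmetric] sum_subtractf[symmetric] sum_distrib_left power2_diff power2_eq_square algebra_simps)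
  then have eq: "(\<Sum>x\<in>S. \<Sum>y\<in>S. c x y * v x * v y * (w x - w y)\<^sup>2) = 2 * ?A - 2 * ?B" by (simp add: A')
  have "- 2 * form v (\<lambda>x. (w x)\<^sup>2 * v x) \<le> 2 * ?A - 2 * ?B"
    using form_nonneg[of "\<lambda>x. w x * v x"] f1 f2 by linarith
  also have "\<dots> \<le> (\<Sum>x\<in>S. \<Sum>y\<in>S. c x y * (w x - w y)\<^sup>2 * ((v x)\<^sup>2 + (v y)\<^sup>2) / 2)"
    unfolding eq[symmetric]
  proof (intro sum_mono)
    fix x y
    have "0 \<le> (v x - v y)\<^sup>2" by simp
    then have "v x * v y \<le> ((v x)\<^sup>2 + (v y)\<^sup>2) / 2" by (simp add: power2_diff)
    then have "(c x y * (w x - w y)\<^sup>2) * (v x * v y) \<le> (c x y * (w x - w y)\<^sup>2) * (((v x)\<^sup>2 + (v y)\<^sup>2) / 2)"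
      by (intro mult_left_mono) (simp_all add: c_nonneg)
    then show "c x y * v x * v y * (w x - w y)\<^sup>2 \<le> c x y * (w x - w y)\<^sup>2 * ((v x)\<^sup>2 + (v y)\<^sup>2) / 2"
      by (simp add: mult_ac)
  qed
  also have "\<dots> = ((\<Sum>x\<in>S. \<Sum>y\<in>S. c x y * (w x - w y)\<^sup>2 * (v x)\<^sup>2) + (\<Sum>x\<in>S. \<Sum>y\<in>S. c x y * (w x - w y)\<^sup>2 * (v y)\<^sup>2)) / 2"
    by (simp add: sum.distrib[symmetric] sum_divide_distrib distrib_left add_divide_distrib)
  also have "(\<Sum>x\<in>S. \<Sum>y\<in>S. c x y * (w x - w y)\<^sup>2 * (v y)\<^sup>2) = (\<Sum>x\<in>S. \<Sum>y\<in>S. c x y * (w x - w y)\<^sup>2 * (v x)\<^sup>2)"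
    by (subst sum.swap) (simp add: c_commute power2_commute)
  also have "((\<Sum>x\<in>S. \<Sum>y\<in>S. c x y * (w x - w y)\<^sup>2 * (v x)\<^sup>2) + (\<Sum>x\<in>S. \<Sum>y\<in>S. c x y * (w x - w y)\<^sup>2 * (v x)\<^sup>2)) / 2
      = (\<Sum>x\<in>S. \<Sum>y\<in>S. c x y * (w x - w y)\<^sup>2 * (v x)\<^sup>2)" by simp
  finally show ?thesis by (simp add: sum_distrib_left mult_ac)
qed

section \<open>Moments, dissipation and the bootstrap\<close>

definition moment_rate :: "real \<Rightarrow> real" where
  "moment_rate m = (m / 2)\<^sup>2 * 2 powr (m - 2)"

text \<open>Chosen so that \<open>N_bound\<close> reproduces itself in one step: the second entry
  dominates the source term, the first one the initial value.\<close>

definition moment_const :: "real \<Rightarrow> real \<Rightarrow> real" where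
  "moment_const d m =
     max 1 (moment_rate m * (4 * moment_rate m / (m - d)) powr (m / 2 - 1) * 4 / (m - d))"

text \<open>\<open>\<theta>\<close> is the enlarged speed measure. Dominating the moments of the
  jumps, it makes the moment of the chain grow at a rate free of the environment; dominating 1, it
  gives \<open>E 0 \<le> 1\<close>. The condition \<open>m \<le> d + 2\<close> makes (m - d)/2 at
  most 1, which the concavity argument in \<open>N_bound\<close> requires.\<close>

locale nash_data = conductances c r
  for c :: "'d::finite site \<Rightarrow> 'd site \<Rightarrow> real" and r +
  fixes S :: "'d site set" and \<theta> \<nu> :: "'d site \<Rightarrow> real" and \<tau> d P Q m KV K :: real
  assumes S: "finite S" "0 \<in> S"
    and dim: "d = real CARD('d)" "3 \<le> d"
    and PQ: "0 \<le> P" "0 \<le> Q" "P + Q < 2 / d"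
    and m: "d < m" "m \<le> d + 2"
    and theta_spread: "spread P KV \<theta>" and nu_spread: "spread Q K \<nu>"
    and KV: "1 \<le> KV" and K: "1 \<le> K"
    and nu_ge: "\<And>y. (\<Sum>i\<in>UNIV. inverse (c y (y + e1 i))) \<le> \<nu> y"
    and theta_ge_1: "\<And>x. 1 \<le> \<theta> x"
    and moment: "\<And>x. x \<in> S \<Longrightarrow> (\<Sum>y\<in>S. c x y * real_of_int (l1_dist x y) powr m) \<le> \<theta> x"
    and tau: "0 < \<tau>" "\<tau> \<le> 1"
begin

sublocale speed_chain S c r \<theta> \<tau>
proof -
  interpret killed_chain S c r by (rule killed_chain[OF S(1)])
  show "speed_chain S c r \<theta> \<tau>"
    by unfold_locales (use theta_ge_1 tau in \<open>auto intro: less_le_trans[OF zero_less_one]\<close>)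
qed

abbreviation "u \<equiv> kernel 0"

text \<open>Shifted by 1, so that a bound by t^(-d/2) makes sense at step 0 as well.\<close>

definition t :: "nat \<Rightarrow> real" where "t n = 1 + n * \<tau>"
definition E :: "nat \<Rightarrow> real" where "E n = ip \<theta> (u n) (u n)"
definition N :: "nat \<Rightarrow> real" where "N n = (\<Sum>x\<in>S. \<theta> x * weight x powr m * (u n x)\<^sup>2)"

lemma u_nonneg: "0 \<le> u n x"
  using kernel_nonneg[OF S(2), of x n] kernel_outside[OF S(2), of x n] by (cases "x \<in> S") auto

lemma E_eq: "E n = (\<Sum>x\<in>S. \<theta> x * (u n x)\<^sup>2)"
  by (simp add: E_def ip_def power2_eq_square mult_ac)

lemma E_nonneg: "0 \<le> E n" by (simp add: E_def ip_nonneg)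

lemma N_nonneg: "0 \<le> N n"
  unfolding N_def using theta_pos by (intro sum_nonneg mult_nonneg_nonneg) (auto simp: less_imp_le)

lemma t_ge_1: "1 \<le> t n" using tau by (simp add: t_def)

lemma t_Suc: "t (Suc n) = t n + \<tau>" by (simp add: t_def algebra_simps)

lemma E_antimono: "k \<le> n \<Longrightarrow> E n \<le> E k"
  unfolding E_def ip_kernel[OF S(2)] by (rule kernel_antimono[OF S(2)]) auto

lemma E_0_le: "E 0 \<le> 1"
  unfolding E_def ip_kernel[OF S(2)] using theta_ge_1[of 0]
  by (simp add: kernel_def point_mass_def divide_le_eq)

lemma N_0: "N 0 = E 0"
  unfolding N_def E_eq
  by (intro sum.cong) (auto simp: kernel_def point_mass_def weight_def l1_dist_def)

text \<open>The step is tested with the density times the squared weight. By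
  \<open>weighted_form_le\<close> the growth of the moment is at most an energy of the weight, and a
  jump of length l from x contributes to it a multiple of weight(x)^(m-2) l^m.\<close>

lemma N_step:
  "N (Suc k) \<le> N k + moment_rate m * \<tau> * (\<Sum>x\<in>S. \<theta> x * weight x powr (m - 2) * (u (Suc k) x)\<^sup>2)"
proof -
  let ?w = "\<lambda>x :: 'd site. weight x powr (m / 2)" and ?v = "u (Suc k)"
  have w2: "(?w x)\<^sup>2 = weight x powr m" for x :: "'d site"
    using weight_ge_1[of x] by (simp add: powr_powr flip: powr_numeral)
  have "N (Suc k) - N k = (\<Sum>x\<in>S. \<theta> x * (?w x)\<^sup>2 * ((?v x)\<^sup>2 - (u k x)\<^sup>2))"
    unfolding N_def w2 sum_subtractf[symmetric] by (simp add: algebra_simps)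
  also have "\<dots> \<le> (\<Sum>x\<in>S. \<theta> x * (?w x)\<^sup>2 * (2 * ((?v x - u k x) * ?v x)))"
  proof (intro sum_mono mult_left_mono)
    fix x
    show "(?v x)\<^sup>2 - (u k x)\<^sup>2 \<le> 2 * ((?v x - u k x) * ?v x)"
      using sum_squares_ge_zero[of "?v x - u k x" 0] by (simp add: power2_eq_square algebra_simps)
  qed (auto simp: theta_pos less_imp_le)
  also have "\<dots> = 2 * (ip \<theta> ?v (\<lambda>x. (?w x)\<^sup>2 * ?v x) - ip \<theta> (u k) (\<lambda>x. (?w x)\<^sup>2 * ?v x))"
    by (simp add: ip_def sum_subtractf[symmetric] sum_distrib_left algebra_simps)
  also have "\<dots> = \<tau> * (- 2 * form ?v (\<lambda>x. (?w x)\<^sup>2 * ?v x))"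
    using ip_J[of "u k"] by (simp add: kernel_Suc)
  also have "\<dots> \<le> \<tau> * (\<Sum>x\<in>S. (?v x)\<^sup>2 * (\<Sum>y\<in>S. c x y * (?w x - ?w y)\<^sup>2))"
    using tau by (intro mult_left_mono weighted_form_le u_nonneg) auto
  also have "\<dots> \<le> \<tau> * (\<Sum>x\<in>S. (?v x)\<^sup>2 * (moment_rate m * weight x powr (m - 2) * \<theta> x))"
  proof (intro mult_left_mono sum_mono)
    fix x assume x: "x \<in> S"
    have "(\<Sum>y\<in>S. c x y * (?w x - ?w y)\<^sup>2)
      \<le> (\<Sum>y\<in>S. c x y * (moment_rate m * weight x powr (m - 2) * real_of_int (l1_dist x y) powr m))"
    proof (intro sum_mono mult_left_mono c_nonneg)
      fix y
      show "(?w x - ?w y)\<^sup>2 \<le> moment_rate m * weight x powr (m - 2) * real_of_int (l1_dist x y) powr m"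
      proof (cases "x = y")
        case False
        then show ?thesis unfolding moment_rate_def using l1_dist_ge_1[OF False] m dim
          by (intro powr_diff_sq_le weight_ge_1 weight_diff_le) auto
      qed (simp add: moment_rate_def)
    qed
    also have "\<dots> = moment_rate m * weight x powr (m - 2) * (\<Sum>y\<in>S. c x y * real_of_int (l1_dist x y) powr m)"
      by (simp add: sum_distrib_left mult_ac)
    also have "\<dots> \<le> moment_rate m * weight x powr (m - 2) * \<theta> x"
      by (intro mult_left_mono moment x) (simp add: moment_rate_def)
    finally show "(\<Sum>y\<in>S. c x y * (?w x - ?w y)\<^sup>2) \<le> moment_rate m * weight x powr (m - 2) * \<theta> x" .
  qed (use tau in auto)
  finally show ?thesis by (simp add: sum_distrib_left mult_ac)
qed

text \<open>A discrete Gronwall argument for t^g with g = (m - d)/2. Interpolation splits the growth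
  into a small multiple of the moment over t and a source controlled by \<open>\<Lambda>\<close>.
  The result is linear in \<open>\<Lambda>\<close>, as the bootstrap requires.\<close>

lemma N_bound:
  assumes \<Lambda>: "\<And>k. k \<le> n \<Longrightarrow> E k \<le> \<Lambda> * t k powr (- d / 2)" and "k \<le> n"
  shows "N k \<le> moment_const d m * \<Lambda> * t k powr ((m - d) / 2)"
  using assms(2)
proof (induction k)
  case 0
  have "N 0 \<le> \<Lambda>" using \<Lambda>[of 0] by (simp add: N_0 t_def)
  moreover have "0 \<le> \<Lambda>" using \<Lambda>[of 0] E_nonneg[of 0] by (simp add: t_def)
  ultimately show ?case using mult_right_mono[of 1 "moment_const d m" \<Lambda>]
    by (simp add: t_def moment_const_def)
next
  case (Suc k)
  define g where "g = (m - d) / 2"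
  define C1 where "C1 = moment_rate m"
  define B where "B = moment_const d m"
  \<comment> \<open>Now \<open>C1 * \<epsilon> = g / 2\<close>: half of the relative growth g/t of
    the target is spent on the moment itself, the other half is left for the source.\<close>
  define \<epsilon> where "\<epsilon> = g / (2 * C1)"
  define C2 where "C2 = C1 * (1 / \<epsilon>) powr (m / 2 - 1)"
  let ?t = "t (Suc k)"
  have g: "0 < g" "g \<le> 1" using m by (auto simp: g_def)
  have C1: "0 < C1" using m dim by (simp add: C1_def moment_rate_def)
  have eps: "0 < \<epsilon>" "C1 * \<epsilon> = g / 2" using g C1 by (auto simp: \<epsilon>_def)
  have C2_0: "0 \<le> C2" using C1 by (simp add: C2_def)
  have "C2 * (2 / g) = C1 * (4 * C1 / (m - d)) powr (m / 2 - 1) * 4 / (m - d)"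
    using g C1 by (simp add: C2_def \<epsilon>_def g_def field_simps)
  then have B: "1 \<le> B" "C2 * (2 / g) \<le> B" by (auto simp: B_def moment_const_def C1_def)
  have L0: "0 \<le> \<Lambda>" using \<Lambda>[of 0] E_nonneg[of 0] by (simp add: t_def)
  have t: "1 \<le> ?t" "0 < ?t" "\<tau> < ?t" "t k = ?t * (1 - \<tau> / ?t)" "0 < t k"
    using t_ge_1[of "Suc k"] t_ge_1[of k] tau by (auto simp: t_Suc field_simps)
  let ?x = "\<tau> / ?t"
  have x: "0 < ?x" "?x < 1" using t tau by auto
  have "(\<Sum>x\<in>S. \<theta> x * weight x powr (m - 2) * (u (Suc k) x)\<^sup>2)
      \<le> (\<Sum>x\<in>S. \<theta> x * (\<epsilon> / ?t * weight x powr m + (?t / \<epsilon>) powr (m / 2 - 1)) * (u (Suc k) x)\<^sup>2)"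
    using t eps m dim weight_ge_1 theta_pos
    by (intro sum_mono mult_left_mono mult_right_mono powr_interpolate) (auto intro: less_le_trans[OF zero_less_one] less_imp_le)
  also have "\<dots> = \<epsilon> / ?t * N (Suc k) + (?t / \<epsilon>) powr (m / 2 - 1) * E (Suc k)"
    by (simp add: N_def E_eq sum_distrib_left sum.distrib[symmetric] algebra_simps)
  finally have "N (Suc k) \<le> N k + C1 * \<tau> * (\<epsilon> / ?t * N (Suc k) + (?t / \<epsilon>) powr (m / 2 - 1) * E (Suc k))"
    using N_step[of k] C1 tau by (smt (verit) C1_def mult_left_mono mult_nonneg_nonneg)
  also have "C1 * \<tau> * (\<epsilon> / ?t * N (Suc k) + (?t / \<epsilon>) powr (m / 2 - 1) * E (Suc k))
      = g / 2 * ?x * N (Suc k) + C2 * \<tau> * (?t powr (m / 2 - 1) * E (Suc k))"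
  proof -
    have "C1 * \<tau> * (\<epsilon> / ?t * N (Suc k)) = (C1 * \<epsilon>) * ?x * N (Suc k)" by simp
    moreover have "(?t / \<epsilon>) powr (m / 2 - 1) = (1 / \<epsilon>) powr (m / 2 - 1) * ?t powr (m / 2 - 1)"
      using t eps by (simp add: powr_mult[symmetric])
    ultimately show ?thesis by (simp add: eps C2_def algebra_simps)
  qed
  finally have rec: "N (Suc k) \<le> N k + (g / 2 * ?x * N (Suc k) + C2 * \<tau> * (?t powr (m / 2 - 1) * E (Suc k)))" .
  have "?t powr (m / 2 - 1) * E (Suc k) \<le> ?t powr (m / 2 - 1) * (\<Lambda> * ?t powr (- d / 2))"
    using Suc by (intro mult_left_mono \<Lambda>) auto
  also have "\<dots> = \<Lambda> * ?t powr (g - 1)"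
  proof -
    have "?t powr (m / 2 - 1) * ?t powr (- d / 2) = ?t powr (g - 1)"
    proof -
      have "m / 2 - 1 + - d / 2 = g - 1" by (simp add: g_def diff_divide_distrib)
      then show ?thesis by (simp only: powr_add[symmetric])
    qed
    then show ?thesis by simp
  qed
  finally have "C2 * \<tau> * (?t powr (m / 2 - 1) * E (Suc k)) \<le> C2 * \<tau> * (\<Lambda> * ?t powr (g - 1))"
    using C2_0 tau by (intro mult_left_mono) auto
  with rec have "N (Suc k) \<le> N k + (g / 2 * ?x * N (Suc k) + C2 * \<tau> * (\<Lambda> * ?t powr (g - 1)))" by linarith
  then have main: "N (Suc k) * (1 - g / 2 * ?x) \<le> N k + C2 * \<tau> * (\<Lambda> * ?t powr (g - 1))"
    by (simp add: algebra_simps)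
  have "N k \<le> B * \<Lambda> * t k powr g" using Suc by (simp add: B_def g_def)
  also have "\<dots> = B * \<Lambda> * (?t powr g * (1 - ?x) powr g)"
    using t x by (simp add: powr_mult[symmetric])
  also have "\<dots> \<le> B * \<Lambda> * (?t powr g * (1 - g * ?x))"
    using B L0 x g by (intro mult_left_mono powr_one_minus_le) auto
  finally have "N k \<le> B * \<Lambda> * (?t powr g * (1 - g * ?x))" .
  moreover have "C2 * \<tau> * (\<Lambda> * ?t powr (g - 1)) \<le> B * \<Lambda> * ?t powr g * (g / 2 * ?x)"
  proof -
    have tg: "?t powr g = ?t powr (g - 1) * ?t" using t by (simp add: powr_diff)
    have "C2 \<le> B * (g / 2)" using B g by (simp add: field_simps)
    then have "C2 * (\<tau> * (\<Lambda> * ?t powr (g - 1))) \<le> B * (g / 2) * (\<tau> * (\<Lambda> * ?t powr (g - 1)))"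
      using tau L0 by (intro mult_right_mono) auto
    then show ?thesis unfolding tg using t by (simp add: mult_ac)
  qed
  ultimately have "N (Suc k) * (1 - g / 2 * ?x)
      \<le> B * \<Lambda> * (?t powr g * (1 - g * ?x)) + B * \<Lambda> * ?t powr g * (g / 2 * ?x)"
    using main by linarith
  moreover have "B * \<Lambda> * (T * (1 - g * y)) + B * \<Lambda> * T * (g / 2 * y) = (B * \<Lambda> * T) * (1 - g / 2 * y)" for T y
    by (simp add: algebra_simps)
  ultimately have "N (Suc k) * (1 - g / 2 * ?x) \<le> (B * \<Lambda> * ?t powr g) * (1 - g / 2 * ?x)" by (simp only:)
  moreover have "0 < 1 - g / 2 * ?x"
  proof -
    have "g / 2 * ?x \<le> 1 / 2 * ?x" using g x by (intro mult_right_mono) auto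
    then show ?thesis using x by linarith
  qed
  ultimately show ?case by (simp add: B_def g_def)
qed

text \<open>The form decreases along the scheme, so its value at step \<open>n\<close> is at most
  its mean over the second half of the steps, and what is dissipated there is at most
  \<open>E\<close> at half time.\<close>

lemma form_decay:
  assumes \<Lambda>: "\<And>k. k \<le> n \<Longrightarrow> E k \<le> \<Lambda> * t k powr (- d / 2)" and n: "1 \<le> n * \<tau>"
  shows "form (u n) (u n) \<le> 2 powr (d / 2 + 1) * \<Lambda> * t n powr (- d / 2 - 1)"
proof -
  define j where "j = n div 2"
  have j: "real n \<le> 2 * real j + 1" "2 * real j \<le> real n" "j \<le> n" by (auto simp: j_def)
  have mono: "form (u n) (u n) \<le> form (u i) (u i)" if "i \<le> n" for i
    by (rule lift_Suc_antimono_le[of "\<lambda>n. form (u n) (u n)", OF _ that]) (simp add: kernel_Suc form_J_le)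
  have "E n + 2 * \<tau> * (real (n - i) * form (u n) (u n)) \<le> E i" if "i \<le> n" for i
    using that
  proof (induction rule: inc_induct)
    case (step i)
    have "E (Suc i) + 2 * \<tau> * form (u n) (u n) \<le> E (Suc i) + 2 * \<tau> * form (u (Suc i)) (u (Suc i))"
      using mono[of "Suc i"] step tau by (intro add_left_mono mult_left_mono) auto
    also have "\<dots> \<le> E i" using J_dissipation[of "u i"] by (simp add: E_def kernel_Suc)
    finally show ?case using step
      by (simp add: of_nat_diff algebra_simps)
  qed simp
  from this[OF j(3)] have 1: "2 * \<tau> * (real (n - j) * form (u n) (u n)) \<le> E j" using E_nonneg[of n] by linarith
  have "t n / 2 * form (u n) (u n) \<le> 2 * \<tau> * (real (n - j) * form (u n) (u n))"
  proof -
    have "real n * \<tau> \<le> 2 * \<tau> * real (n - j)" using j tau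
      by (simp add: of_nat_diff algebra_simps)
    moreover have "t n / 2 \<le> real n * \<tau>" using n by (simp add: t_def algebra_simps)
    ultimately have "t n / 2 \<le> 2 * \<tau> * real (n - j)" by (rule order.trans[rotated])
    then show ?thesis using form_nonneg[of "u n"] by (metis mult.assoc mult_right_mono)
  qed
  also note 1
  also have "E j \<le> \<Lambda> * t j powr (- d / 2)" using \<Lambda> j(3) by simp
  also have "\<dots> \<le> \<Lambda> * (t n / 2) powr (- d / 2)"
  proof (intro mult_left_mono powr_mono2')
    have "real n * \<tau> \<le> (2 * real j + 1) * \<tau>" using j(1) tau by (intro mult_right_mono) auto
    then show "t n / 2 \<le> t j" using tau by (simp add: t_def algebra_simps)
    show "0 \<le> \<Lambda>" using \<Lambda>[of 0] E_nonneg[of 0] by (simp add: t_def)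
  qed (use dim t_ge_1[of n] in auto)
  also have "(t n / 2) powr (- d / 2) = 2 powr (d / 2) * t n powr (- d / 2)"
    using t_ge_1[of n] by (simp add: powr_divide powr_minus field_simps)
  finally have "form (u n) (u n) \<le> (2 powr (d / 2) * 2) * \<Lambda> * (t n powr (- d / 2) / t n)"
    using t_ge_1[of n] by (simp add: field_simps)
  then show ?thesis using t_ge_1[of n] by (simp add: powr_add powr_diff)
qed


text \<open>Outside radius \<open>R\<close> the moment controls the squared density. Inside, the
  truncation at \<open>h\<close> uses total mass at most 1 and the Sobolev inequality. Both
  parameters stay free for the bootstrap.\<close>

lemma nash_ineq:
  assumes b: "2 < b" and R: "1 \<le> R" and h: "0 < h"
    and Cs: "\<And>f. sobolev_data d P Q KV K (form f f) \<theta> \<nu> (edge_energy f) f S \<Longrightarrow>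
      (\<Sum>x\<in>nat_ball R. \<theta> x * \<bar>f x\<bar> powr b) \<le> Cs * (KV * K powr (b / 2) * form f f powr (b / 2)) * real R powr (b - b * d / 2 + d)"
  shows "E n \<le> real R powr (- m) * N n + h
    + h powr (2 - b) * (Cs * (KV * K powr (b / 2) * form (u n) (u n) powr (b / 2)) * real R powr (b - b * d / 2 + d))"
proof -
  let ?v = "u n" and ?I = "S \<inter> nat_ball R" and ?O = "S - nat_ball R"
  have th0: "0 \<le> \<theta> x" for x using theta_ge_1[of x] by linarith
  have sob: "sobolev_data d P Q KV K (form ?v ?v) \<theta> \<nu> (edge_energy ?v) ?v S"
    by unfold_locales
      (use dim PQ theta_spread nu_spread S kernel_outside[OF S(2)] in
        \<open>auto intro: sum_edge_energy_le grad_sq_le nu_ge edge_energy_nonneg\<close>)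
  have "E n = (\<Sum>x\<in>?I. \<theta> x * (?v x)\<^sup>2) + (\<Sum>x\<in>?O. \<theta> x * (?v x)\<^sup>2)"
    unfolding E_eq using S(1) by (rule sum.Int_Diff)
  also have "(\<Sum>x\<in>?O. \<theta> x * (?v x)\<^sup>2) \<le> (\<Sum>x\<in>?O. real R powr (- m) * (\<theta> x * weight x powr m * (?v x)\<^sup>2))"
  proof (intro sum_mono)
    fix x assume "x \<in> ?O"
    then have "real R \<le> weight x" by (auto simp: nat_ball_def weight_def)
    then have "real R powr m \<le> weight x powr m" using R m dim by (intro powr_mono2) auto
    then have "1 \<le> real R powr (- m) * weight x powr m" using R by (simp add: powr_minus field_simps)
    then have "1 * (\<theta> x * (?v x)\<^sup>2) \<le> (real R powr (- m) * weight x powr m) * (\<theta> x * (?v x)\<^sup>2)"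
      using th0 by (intro mult_right_mono) auto
    then show "\<theta> x * (?v x)\<^sup>2 \<le> real R powr (- m) * (\<theta> x * weight x powr m * (?v x)\<^sup>2)" by (simp add: mult_ac)
  qed
  also have "\<dots> \<le> real R powr (- m) * N n"
    unfolding N_def sum_distrib_left[symmetric] using S(1) th0
    by (intro mult_left_mono sum_mono2) auto
  also have "(\<Sum>x\<in>?I. \<theta> x * (?v x)\<^sup>2) \<le> (\<Sum>x\<in>?I. \<theta> x * (h * ?v x + h powr (2 - b) * ?v x powr b))"
    using th0 b h u_nonneg by (intro sum_mono mult_left_mono sq_le_truncation) auto
  also have "\<dots> = h * (\<Sum>x\<in>?I. \<theta> x * ?v x) + h powr (2 - b) * (\<Sum>x\<in>?I. \<theta> x * ?v x powr b)"
    by (simp add: sum.distrib sum_distrib_left algebra_simps)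
  also have "(\<Sum>x\<in>?I. \<theta> x * ?v x) \<le> (\<Sum>x\<in>S. \<theta> x * ?v x)"
    using S(1) th0 u_nonneg by (intro sum_mono2) auto
  also have "\<dots> \<le> 1" by (rule kernel_mass_le_1[OF S(2)])
  also have "(\<Sum>x\<in>?I. \<theta> x * ?v x powr b) \<le> (\<Sum>x\<in>nat_ball R. \<theta> x * \<bar>?v x\<bar> powr b)"
    using th0 u_nonneg by (intro order.trans[OF sum_mono sum_mono2]) auto
  also have "\<dots> \<le> Cs * (KV * K powr (b / 2) * form ?v ?v powr (b / 2)) * real R powr (b - b * d / 2 + d)"
    by (rule Cs[OF sob])
  finally show ?thesis using h by (simp add: mult_left_mono)
qed

end

text \<open>The first entry covers times below 1, where \<open>E\<close> at most 1 suffices; the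
  second comes from solving the bootstrap inequality for \<open>\<Lambda>\<close>.\<close>

definition nash_const :: "real \<Rightarrow> real \<Rightarrow> real \<Rightarrow> real \<Rightarrow> real" where
  "nash_const d m b Cs = max (2 powr (d / 2))
     ((2 * (4 powr (b - 2) * Cs * (2 powr (d / 2 + 1)) powr (b / 2)
        * (2 * (4 * moment_const d m) powr (1 / m)) powr \<bar>b - b * d / 2 + d\<bar>)) powr (2 / (b - 2)))"

text \<open>\<open>\<Lambda>\<close> is a maximum over finitely many steps, hence finite for trivial
  reasons. Estimating at a maximising step \<open>k\<close> then bounds it by a constant that does
  not depend on \<open>n\<close>.\<close>

lemma (in nash_data) kernel_decay:
  assumes b: "2 < b" and Cs0: "0 < Cs"
    and Cs: "\<And>f R. 1 \<le> R \<Longrightarrow> sobolev_data d P Q KV K (form f f) \<theta> \<nu> (edge_energy f) f S \<Longrightarrow>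
      (\<Sum>x\<in>nat_ball R. \<theta> x * \<bar>f x\<bar> powr b) \<le> Cs * (KV * K powr (b / 2) * form f f powr (b / 2)) * real R powr (b - b * d / 2 + d)"
  shows "E n \<le> nash_const d m b Cs * (KV * K powr (b / 2)) powr (2 / (b - 2)) * t n powr (- d / 2)"
proof -
  define Z where "Z = KV * K powr (b / 2)"
  define B where "B = moment_const d m"
  define A where "A = (4 * B) powr (1 / m)"
  define e where "e = b - b * d / 2 + d"
  define CC where "CC = 4 powr (b - 2) * Cs * (2 powr (d / 2 + 1)) powr (b / 2) * (2 * A) powr \<bar>e\<bar>"
  have Z: "1 \<le> Z" unfolding Z_def using KV K b mult_mono[of 1 KV 1 "K powr (b / 2)"] by (simp add: ge_one_powr_ge_zero)
  have B: "1 \<le> B" by (simp add: B_def moment_const_def)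
  have m0: "0 < m" using m dim by linarith
  have A: "1 \<le> A" unfolding A_def using B m0 by (intro ge_one_powr_ge_zero) auto
  have Am: "A powr (- m) = 1 / (4 * B)" unfolding A_def using B m0 by (simp add: powr_powr powr_minus_divide)
  have CC: "0 < CC" using Cs0 A by (simp add: CC_def)
  have nc: "nash_const d m b Cs = max (2 powr (d / 2)) ((2 * CC) powr (2 / (b - 2)))"
    by (simp add: nash_const_def CC_def A_def B_def e_def)
  have Z': "1 \<le> Z powr (2 / (b - 2))" using Z b by (intro ge_one_powr_ge_zero) auto
  define L where "L k = t k powr (d / 2) * E k" for k
  define \<Lambda> where "\<Lambda> = Max (L ` {..n})"
  have "\<Lambda> \<in> L ` {..n}" unfolding \<Lambda>_def by (rule Max_in) auto
  then obtain k where k: "k \<le> n" "\<Lambda> = L k" by auto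
  have L_le: "L j \<le> \<Lambda>" if "j \<le> n" for j unfolding \<Lambda>_def using that by (intro Max_ge) auto
  have tp: "0 < t j" for j using t_ge_1[of j] by linarith
  have E_L: "E j = L j * t j powr (- d / 2)" for j
    using tp[of j] by (simp add: L_def powr_minus field_simps)
  have E_le: "E j \<le> \<Lambda> * t j powr (- d / 2)" if "j \<le> k" for j
    unfolding E_L[of j] using L_le[of j] that k(1) by (intro mult_right_mono) auto
  have L0: "0 \<le> \<Lambda>" unfolding k(2) L_def by (simp add: E_nonneg)
  have "\<Lambda> \<le> max (2 powr (d / 2)) ((2 * CC) powr (2 / (b - 2))) * Z powr (2 / (b - 2))"
  proof (cases "1 \<le> k * \<tau> \<and> 0 < \<Lambda>")
    case False
    have "\<Lambda> \<le> 2 powr (d / 2)"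
    proof (cases "0 < \<Lambda>")
      case True
      then have "t k \<le> 2" using False by (simp add: t_def)
      then have "L k \<le> 2 powr (d / 2) * 1"
        unfolding L_def using tp[of k] dim E_0_le E_antimono[of 0 k] E_nonneg[of k]
        by (intro mult_mono powr_mono2) auto
      then show ?thesis by (simp add: k)
    qed (use powr_ge_zero[of 2 "d / 2"] in linarith)
    then have "\<Lambda> \<le> max (2 powr (d / 2)) ((2 * CC) powr (2 / (b - 2))) * 1" by simp
    also have "\<dots> \<le> max (2 powr (d / 2)) ((2 * CC) powr (2 / (b - 2))) * Z powr (2 / (b - 2))"
      using Z' by (intro mult_left_mono) (auto intro: order.trans[OF powr_ge_zero max.cobounded1])
    finally show ?thesis .
  next
    case True
    define T where "T = t k"
    \<comment> \<open>The diffusive radius, where rounding up costs at most a factor 2. The factor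
      \<open>A\<close> makes the contribution from outside the ball at most a quarter of
      \<open>\<Lambda> * T powr (- d / 2)\<close>.\<close>
    define R where "R = nat \<lceil>A * sqrt T\<rceil>"
    define \<rho> where "\<rho> = real R / sqrt T"
    have T: "1 \<le> T" by (simp add: T_def t_ge_1)
    have sT: "1 \<le> sqrt T" using T by simp
    have AT: "1 \<le> A * sqrt T" using mult_mono[of 1 A 1 "sqrt T"] A sT by simp
    have R: "A * sqrt T \<le> real R" "real R \<le> 2 * A * sqrt T" "1 \<le> R"
      using AT unfolding R_def by linarith+
    have rho: "A \<le> \<rho>" "\<rho> \<le> 2 * A" "real R = \<rho> * sqrt T" using R sT by (auto simp: \<rho>_def field_simps)
    have sTp: "sqrt T powr a = T powr (a / 2)" for a
      using T by (simp add: powr_powr flip: powr_half_sqrt)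
    have Rp: "real R powr a = \<rho> powr a * T powr (a / 2)" for a
      using rho A T by (simp add: powr_mult sTp)
    \<comment> \<open>The truncation level takes another quarter, so that half remains for the
      Sobolev term.\<close>
    define h where "h = \<Lambda> * T powr (- d / 2) / 4"
    have h: "0 < h" using True T by (simp add: h_def)
    let ?D = "form (u k) (u k)"
    have "real R powr (- m) * N k \<le> (A powr (- m) * T powr (- m / 2)) * (B * \<Lambda> * T powr ((m - d) / 2))"
    proof (rule mult_mono)
      show "real R powr (- m) \<le> A powr (- m) * T powr (- m / 2)"
        unfolding Rp using rho A m0 by (intro mult_right_mono powr_mono2') auto
      show "N k \<le> B * \<Lambda> * T powr ((m - d) / 2)"
        unfolding B_def T_def by (rule N_bound[OF E_le order_refl])
    qed (simp_all add: N_nonneg)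
    also have "\<dots> = \<Lambda> / 4 * (T powr (- m / 2) * T powr ((m - d) / 2))" using B by (simp add: Am)
    also have "T powr (- m / 2) * T powr ((m - d) / 2) = T powr (- d / 2)"
      unfolding powr_add[symmetric] by (simp add: diff_divide_distrib)
    finally have p1: "real R powr (- m) * N k \<le> \<Lambda> / 4 * T powr (- d / 2)" .
    have D: "?D \<le> 2 powr (d / 2 + 1) * \<Lambda> * T powr (- d / 2 - 1)"
      unfolding T_def by (rule form_decay[OF E_le]) (use True in auto)
    have "h powr (2 - b) * (Cs * (Z * ?D powr (b / 2)) * real R powr e)
      \<le> h powr (2 - b) * (Cs * (Z * (2 powr (d / 2 + 1) * \<Lambda> * T powr (- d / 2 - 1)) powr (b / 2)) * ((2 * A) powr \<bar>e\<bar> * T powr (e / 2)))"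
    proof (intro mult_left_mono mult_mono powr_mono2 D)
      show "real R powr e \<le> (2 * A) powr \<bar>e\<bar> * T powr (e / 2)"
      proof -
        have "\<rho> powr e \<le> \<rho> powr \<bar>e\<bar>" using rho A by (intro powr_mono) auto
        also have "\<dots> \<le> (2 * A) powr \<bar>e\<bar>" using rho A by (intro powr_mono2) auto
        finally show ?thesis unfolding Rp by (intro mult_right_mono) auto
      qed
    qed (use Cs0 Z b form_nonneg in auto)
    \<comment> \<open>The powers of \<open>T\<close> collapse to -d/2, and \<open>\<Lambda>\<close>
      survives with the exponent 2 - b/2 < 1, which is what allows solving for it.\<close>
    also have "\<dots> = CC * Z * \<Lambda> powr (2 - b / 2) * T powr (- d / 2)"
    proof -
      have hp: "h powr (2 - b) = \<Lambda> powr (2 - b) * T powr (- d / 2 * (2 - b)) * 4 powr (b - 2)"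
      proof -
        have "h = \<Lambda> * T powr (- d / 2) * (1 / 4)" by (simp add: h_def)
        moreover have "(1 / 4) powr (2 - b) = (4::real) powr (b - 2)"
          using powr_minus_divide[of 4 "2 - b"] by (simp add: powr_divide)
        ultimately show ?thesis using L0 T by (simp only: powr_mult powr_powr)
      qed
      have Dp: "(2 powr (d / 2 + 1) * \<Lambda> * T powr (- d / 2 - 1)) powr (b / 2)
          = (2 powr (d / 2 + 1)) powr (b / 2) * \<Lambda> powr (b / 2) * T powr ((- d / 2 - 1) * (b / 2))"
        using L0 by (simp add: powr_mult powr_powr)
      have Lp: "\<Lambda> powr (2 - b) * \<Lambda> powr (b / 2) = \<Lambda> powr (2 - b / 2)"
      proof -
        have "2 - b + b / 2 = 2 - b / 2" by simp
        then show ?thesis by (simp only: powr_add[symmetric])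
      qed
      have Tp: "T powr (- d / 2 * (2 - b)) * T powr ((- d / 2 - 1) * (b / 2)) * T powr (e / 2) = T powr (- d / 2)"
      proof -
        have "- d / 2 * (2 - b) + (- d / 2 - 1) * (b / 2) + e / 2 = - d / 2" by (simp add: e_def field_simps)
        then show ?thesis by (simp only: powr_add[symmetric])
      qed
      show ?thesis unfolding hp Dp Lp[symmetric] unfolding Tp[symmetric] CC_def by (simp only: mult_ac)
    qed
    finally have p3: "h powr (2 - b) * (Cs * (Z * ?D powr (b / 2)) * real R powr e)
       \<le> CC * Z * \<Lambda> powr (2 - b / 2) * T powr (- d / 2)" .
    have "E k \<le> real R powr (- m) * N k + h + h powr (2 - b) * (Cs * (Z * ?D powr (b / 2)) * real R powr e)"
      unfolding Z_def e_def by (rule nash_ineq[OF b R(3) h Cs[OF R(3)]])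
    also have "\<dots> \<le> (\<Lambda> / 2 + CC * Z * \<Lambda> powr (2 - b / 2)) * T powr (- d / 2)"
      using p1 p3 by (simp add: h_def algebra_simps)
    finally have "\<Lambda> * T powr (- d / 2) \<le> (\<Lambda> / 2 + CC * Z * \<Lambda> powr (2 - b / 2)) * T powr (- d / 2)"
      unfolding E_L[of k] k(2)[symmetric] T_def .
    then have "\<Lambda> \<le> \<Lambda> / 2 + CC * Z * \<Lambda> powr (2 - b / 2)" using T by simp
    then have "\<Lambda> \<le> 2 * CC * Z * \<Lambda> powr (2 - b / 2)" by linarith
    then have "\<Lambda> powr (b / 2 - 1) \<le> 2 * CC * Z"
    proof -
      have "\<Lambda> = \<Lambda> powr (b / 2 - 1) * \<Lambda> powr (2 - b / 2)" using True by (simp flip: powr_add)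
      moreover assume "\<Lambda> \<le> 2 * CC * Z * \<Lambda> powr (2 - b / 2)"
      ultimately have "\<Lambda> powr (b / 2 - 1) * \<Lambda> powr (2 - b / 2) \<le> 2 * CC * Z * \<Lambda> powr (2 - b / 2)" by simp
      then show ?thesis using True by simp
    qed
    then have "(\<Lambda> powr (b / 2 - 1)) powr (2 / (b - 2)) \<le> (2 * CC * Z) powr (2 / (b - 2))"
      using b by (intro powr_mono2) auto
    moreover have "(b / 2 - 1) * (2 / (b - 2)) = 1" using b by (simp add: field_simps)
    ultimately have "\<Lambda> \<le> (2 * CC) powr (2 / (b - 2)) * Z powr (2 / (b - 2))"
      using True CC Z by (simp add: powr_powr powr_mult)
    also have "\<dots> \<le> max (2 powr (d / 2)) ((2 * CC) powr (2 / (b - 2))) * Z powr (2 / (b - 2))"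
      by (intro mult_right_mono) auto
    finally show ?thesis .
  qed
  then have "L n \<le> nash_const d m b Cs * Z powr (2 / (b - 2))"
    using L_le[of n] by (simp add: nc)
  then show ?thesis unfolding E_L[of n] Z_def by (intro mult_right_mono) auto
qed

text \<open>The kernel at step k is at most \<open>E\<close> at k div 2, and \<open>\<tau>\<close>
  t^(-d/2) is at most a multiple of the decrement of t^(-a) with a = d/2 - 1. Since a > 0 for d
  \<ge> 3, which is transience, the sum telescopes to a finite bound.\<close>

lemma (in nash_data) kernel_sum_le:
  assumes E: "\<And>n. E n \<le> Y * t n powr (- d / 2)" and Y: "0 \<le> Y" and "n \<le> M"
  shows "(\<Sum>k\<in>{n<..M}. \<tau> * u k 0) \<le> Y * (2 powr (d / 2) / (d / 2 - 1)) * t n powr (1 - d / 2)"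
proof -
  define a where "a = d / 2 - 1"
  have a: "0 < a" using dim by (simp add: a_def)
  have tp: "0 < t j" for j using t_ge_1[of j] by linarith
  have stp: "\<tau> * u (Suc k) 0 \<le> Y * (2 powr (d / 2) / a) * (t k powr - a - t (Suc k) powr - a)" for k
  proof -
    \<comment> \<open>Half of the steps, rounded down. The shift by 1 in \<open>t\<close> absorbs
      the rounding because \<open>\<tau> \<le> 1\<close>.\<close>
    define j where "j = Suc k div 2"
    have j: "j + j \<le> Suc k" "real (Suc k) \<le> 2 * real j + 1" by (auto simp: j_def)
    let ?t = "t (Suc k)" and ?x = "\<tau> / t (Suc k)"
    have "u (Suc k) 0 \<le> E j"
      unfolding E_def ip_kernel[OF S(2)] by (rule kernel_antimono[OF S(2) j(1)])
    also have "\<dots> \<le> Y * t j powr (- d / 2)" by (rule E)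
    also have "\<dots> \<le> Y * (?t / 2) powr (- d / 2)"
    proof (intro mult_left_mono powr_mono2' Y)
      have "real (Suc k) * \<tau> \<le> (2 * real j + 1) * \<tau>" using j(2) tau by (intro mult_right_mono) auto
      then have "real (Suc k) * \<tau> \<le> 2 * (real j * \<tau>) + \<tau>" by (simp only: distrib_right mult_1 mult.assoc)
      moreover have "(1 + s) / 2 \<le> 1 + s'" if "s \<le> 2 * s' + \<tau>" for s s' :: real
        using that tau by simp
      ultimately show "?t / 2 \<le> t j" unfolding t_def by blast
    qed (use dim tp[of "Suc k"] in auto)
    also have "(?t / 2) powr (- d / 2) = 2 powr (d / 2) * ?t powr (- d / 2)"
      using tp[of "Suc k"] by (simp add: powr_divide powr_minus field_simps)
    finally have 1: "\<tau> * u (Suc k) 0 \<le> \<tau> * (Y * (2 powr (d / 2) * ?t powr (- d / 2)))"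
      using tau by (intro mult_left_mono) auto
    have x: "0 \<le> ?x" "?x < 1" "t k = ?t * (1 - ?x)"
      using tau tp[of "Suc k"] tp[of k] by (auto simp: t_Suc field_simps)
    have "1 + a * ?x \<le> (1 - ?x) powr - a" using x a by (intro one_le_powr_neg) auto
    then have "?t powr - a * (1 + a * ?x) \<le> ?t powr - a * (1 - ?x) powr - a"
      by (intro mult_left_mono) auto
    also have "\<dots> = t k powr - a" using x tp[of "Suc k"] by (simp add: powr_mult[symmetric])
    finally have "?t powr - a * (a * ?x) \<le> t k powr - a - ?t powr - a" by (simp add: algebra_simps)
    moreover have "?t powr - a * (a * ?x) = a * \<tau> * ?t powr (- d / 2)"
    proof -
      have "- d / 2 = - a - 1" by (simp add: a_def)
      then have "?t powr (- d / 2) = ?t powr - a / ?t" using tp[of "Suc k"] by (simp add: powr_diff)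
      then show ?thesis by simp
    qed
    ultimately have "\<tau> * ?t powr (- d / 2) \<le> (t k powr - a - ?t powr - a) / a" using a by (simp add: field_simps)
    then have "Y * 2 powr (d / 2) * (\<tau> * ?t powr (- d / 2)) \<le> Y * 2 powr (d / 2) * ((t k powr - a - ?t powr - a) / a)"
      using Y by (intro mult_left_mono) auto
    then show ?thesis using 1 by (simp add: mult_ac)
  qed
  have "(\<Sum>k\<in>{n<..M}. \<tau> * u k 0) \<le> Y * (2 powr (d / 2) / a) * (t n powr - a - t M powr - a)"
    using assms(3)
  proof (induction M rule: dec_induct)
    case (step M)
    have "{n<..Suc M} = insert (Suc M) {n<..M}" using step by auto
    then have "(\<Sum>k\<in>{n<..Suc M}. \<tau> * u k 0) = \<tau> * u (Suc M) 0 + (\<Sum>k\<in>{n<..M}. \<tau> * u k 0)" by simp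
    also have "\<dots> \<le> Y * (2 powr (d / 2) / a) * (t M powr - a - t (Suc M) powr - a)
        + Y * (2 powr (d / 2) / a) * (t n powr - a - t M powr - a)"
      by (intro add_mono stp step.IH)
    finally show ?case by (simp only: distrib_left[symmetric]) simp
  qed simp
  also have "\<dots> \<le> Y * (2 powr (d / 2) / a) * t n powr - a"
    using Y a by (intro mult_left_mono) auto
  finally show ?thesis by (simp add: a_def)
qed

text \<open>The tail of the time sum for the enlarged speed is of order t^(1-d/2). By
  \<open>kernel_le_of_larger_speed\<close> it bounds t times the kernel for the given speed, and
  dividing by t restores t^(-d/2).\<close>

theorem kernel_upper_bound:
  fixes d P Q m b :: real
  assumes d: "d = real CARD('d::finite)" "3 \<le> d" and PQ: "0 \<le> P" "0 \<le> Q" "P + Q < 2 / d"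
    and b: "2 < b" "0 < b * (1 - d) + b / 2 * (d * (1 - Q)) + d * (1 - P)"
  shows "\<exists>C>0. \<forall>c r (S :: 'd site set) \<theta> \<theta>' \<nu> \<tau> KV K n.
    nash_data c r S \<theta>' \<nu> \<tau> d P Q m KV K \<and> (\<forall>x\<in>S. 0 < \<theta> x \<and> \<theta> x \<le> \<theta>' x) \<and> 1 \<le> n \<longrightarrow>
    speed_chain.kernel S c r \<theta> \<tau> 0 (n + n) 0
      \<le> C * (KV * K powr (b / 2)) powr (2 / (b - 2)) * (real n * \<tau>) powr (- d / 2)"
proof -
  from weighted_sobolev[OF assms]
  obtain Cs where Cs: "Cs > 0" "\<forall>KV K D V \<nu> \<Gamma> (f :: 'd site \<Rightarrow> real) S R.
    sobolev_data d P Q KV K D V \<nu> \<Gamma> f S \<and> 1 \<le> R \<longrightarrow>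
    (\<Sum>x\<in>nat_ball R. V x * \<bar>f x\<bar> powr b)
      \<le> Cs * (KV * K powr (b / 2) * D powr (b / 2)) * real R powr (b - b * d / 2 + d)"
    by (elim exE conjE) (rule that)
  define C where "C = nash_const d m b Cs * (2 powr (d / 2) / (d / 2 - 1))"
  have nc: "0 < nash_const d m b Cs"
    unfolding nash_const_def by (intro less_le_trans[OF _ max.cobounded1]) simp
  have C: "C > 0" unfolding C_def using nc d(2) by (intro mult_pos_pos divide_pos_pos) auto
  have "speed_chain.kernel S c r \<theta> \<tau> 0 (n + n) 0
      \<le> C * (KV * K powr (b / 2)) powr (2 / (b - 2)) * (real n * \<tau>) powr (- d / 2)"
    if nd: "nash_data c r S \<theta>' \<nu> \<tau> d P Q m KV K" and th: "\<forall>x\<in>S. 0 < \<theta> x \<and> \<theta> x \<le> \<theta>' x" and n: "1 \<le> n"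
    for c r and S :: "'d site set" and \<theta> \<theta>' \<nu> \<tau> KV K and n :: nat
  proof -
    interpret H: nash_data c r S \<theta>' \<nu> \<tau> d P Q m KV K by (fact nd)
    interpret A: speed_chain S c r \<theta> \<tau> by unfold_locales (use th H.tau in auto)
    define Y where "Y = nash_const d m b Cs * (KV * K powr (b / 2)) powr (2 / (b - 2))"
    have Y: "0 \<le> Y" using nc by (simp add: Y_def)
    have E: "H.E k \<le> Y * H.t k powr (- d / 2)" for k
      unfolding Y_def by (rule H.kernel_decay[OF b(1) Cs(1)]) (rule Cs(2)[rule_format], simp)
    have "real n * \<tau> * A.kernel 0 (n + n) 0 \<le> Y * (2 powr (d / 2) / (d / 2 - 1)) * H.t n powr (1 - d / 2)"
      by (rule kernel_le_of_larger_speed[OF A.speed_chain_axioms H.speed_chain_axioms H.S(2)])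
         (use th H.kernel_sum_le[OF E Y] in auto)
    also have "\<dots> \<le> Y * (2 powr (d / 2) / (d / 2 - 1)) * (real n * \<tau>) powr (1 - d / 2)"
      using Y d n H.tau by (intro mult_left_mono powr_mono2') (auto simp: H.t_def)
    also have "(real n * \<tau>) powr (1 - d / 2) = (real n * \<tau>) * (real n * \<tau>) powr (- d / 2)"
    proof -
      have "(real n * \<tau>) powr 1 * (real n * \<tau>) powr (- d / 2) = (real n * \<tau>) powr (1 - d / 2)"
        unfolding powr_add[symmetric] by simp
      then show ?thesis using n H.tau by simp
    qed
    finally have "real n * \<tau> * A.kernel 0 (n + n) 0
      \<le> real n * \<tau> * (Y * (2 powr (d / 2) / (d / 2 - 1)) * (real n * \<tau>) powr (- d / 2))"
      by (simp add: mult_ac)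
    then have "A.kernel 0 (n + n) 0 \<le> Y * (2 powr (d / 2) / (d / 2 - 1)) * (real n * \<tau>) powr (- d / 2)"
      by (rule mult_left_le_imp_le) (use n H.tau in simp)
    then show ?thesis by (simp add: C_def Y_def mult_ac)
  qed
  then show ?thesis using C by blast
qed

section \<open>The closed form and its finite approximations\<close>

locale weighted_l2 =
  fixes \<theta> :: "'d::finite site \<Rightarrow> real"
  assumes theta_pos: "0 < \<theta> x"
begin

abbreviation "H \<equiv> L2 \<theta>"
abbreviation "inner2 \<equiv> L2_inner \<theta>"
abbreviation "nrm \<equiv> L2_nrm \<theta>"

lemma L2_D: "f \<in> H \<Longrightarrow> (\<lambda>x. \<theta> x * f x * f x) summable_on UNIV"
  by (simp add: L2_def power2_eq_square mult.assoc)

lemma prod_summable: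
  assumes "f \<in> H" "g \<in> H"
  shows "(\<lambda>x. \<theta> x * f x * g x) summable_on UNIV"
proof -
  have "(\<lambda>x. \<theta> x * (f x)\<^sup>2 + \<theta> x * (g x)\<^sup>2) summable_on UNIV"
    using assms by (intro summable_on_add) (auto simp: L2_def)
  then have "(\<lambda>x. norm (\<theta> x * f x * g x)) summable_on UNIV"
  proof (rule summable_on_comparison_test)
    fix x
    have "0 \<le> \<bar>f x\<bar> * \<bar>g x\<bar>" by simp
    moreover have "2 * \<bar>f x\<bar> * \<bar>g x\<bar> \<le> (f x)\<^sup>2 + (g x)\<^sup>2"
      using sum_squares_bound[of "\<bar>f x\<bar>" "\<bar>g x\<bar>"] by simp
    ultimately have "\<bar>f x\<bar> * \<bar>g x\<bar> \<le> (f x)\<^sup>2 + (g x)\<^sup>2" by linarith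
    then have "\<theta> x * (\<bar>f x\<bar> * \<bar>g x\<bar>) \<le> \<theta> x * ((f x)\<^sup>2 + (g x)\<^sup>2)"
      using theta_pos[of x] by (intro mult_left_mono) auto
    then show "norm (\<theta> x * f x * g x) \<le> \<theta> x * (f x)\<^sup>2 + \<theta> x * (g x)\<^sup>2"
      using theta_pos[of x] by (simp add: abs_mult algebra_simps)
  qed auto
  then show ?thesis by (rule abs_summable_summable)
qed

lemma L2_scale: "f \<in> H \<Longrightarrow> (\<lambda>x. k * f x) \<in> H"
  using summable_on_cmult_right[of "\<lambda>x. \<theta> x * (f x)\<^sup>2" UNIV "k\<^sup>2"]
  by (simp add: L2_def power_mult_distrib mult_ac)

lemma L2_add: "f \<in> H \<Longrightarrow> g \<in> H \<Longrightarrow> (\<lambda>x. f x + g x) \<in> H"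
proof -
  assume f: "f \<in> H" and g: "g \<in> H"
  have "(\<lambda>x. \<theta> x * (f x)\<^sup>2 + \<theta> x * (g x)\<^sup>2 + 2 * (\<theta> x * f x * g x)) summable_on UNIV"
    using f g by (intro summable_on_add summable_on_cmult_right prod_summable) (auto simp: L2_def)
  then show ?thesis by (simp add: L2_def power2_sum algebra_simps)
qed

lemma L2_diff: "f \<in> H \<Longrightarrow> g \<in> H \<Longrightarrow> (\<lambda>x. f x - g x) \<in> H"
  using L2_add[of f "\<lambda>x. - 1 * g x"] L2_scale[of g "- 1"] by simp

lemma inner_commute: "inner2 f g = inner2 g f"
  by (simp add: L2_inner_def mult_ac)

lemma inner_add_left: "f \<in> H \<Longrightarrow> g \<in> H \<Longrightarrow> h \<in> H \<Longrightarrow> inner2 (\<lambda>x. f x + g x) h = inner2 f h + inner2 g h"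
proof -
  assume "f \<in> H" "g \<in> H" "h \<in> H"
  moreover have "\<theta> x * (f x + g x) * h x = \<theta> x * f x * h x + \<theta> x * g x * h x" for x
    by (simp add: algebra_simps)
  ultimately show ?thesis by (simp only: L2_inner_def infsum_add prod_summable)
qed

lemma inner_add_right: "f \<in> H \<Longrightarrow> g \<in> H \<Longrightarrow> h \<in> H \<Longrightarrow> inner2 h (\<lambda>x. f x + g x) = inner2 h f + inner2 h g"
  by (simp add: inner_commute[of h] inner_add_left)

lemma inner_scale_left: "inner2 (\<lambda>x. k * f x) h = k * inner2 f h"
  unfolding L2_inner_def by (subst infsum_cmult_right'[symmetric]) (simp add: mult_ac)

lemma inner_diff_left: "f \<in> H \<Longrightarrow> g \<in> H \<Longrightarrow> h \<in> H \<Longrightarrow> inner2 (\<lambda>x. f x - g x) h = inner2 f h - inner2 g h"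
  using inner_add_left[of f "\<lambda>x. - 1 * g x" h] L2_scale[of g "- 1"] inner_scale_left[of "- 1" g h] by simp

lemma inner_diff_right: "f \<in> H \<Longrightarrow> g \<in> H \<Longrightarrow> h \<in> H \<Longrightarrow> inner2 h (\<lambda>x. f x - g x) = inner2 h f - inner2 h g"
  by (simp add: inner_commute[of h] inner_diff_left)

lemma inner_scale_right: "inner2 h (\<lambda>x. k * f x) = k * inner2 h f"
  by (simp add: inner_commute[of h] inner_scale_left)

lemma inner_self_nonneg: "0 \<le> inner2 f f"
  unfolding L2_inner_def using theta_pos by (intro infsum_nonneg) (auto simp: mult.assoc less_imp_le)

lemma nrm_nonneg: "0 \<le> nrm f" by (simp add: L2_nrm_def inner_self_nonneg)

lemma nrm_sq: "(nrm f)\<^sup>2 = inner2 f f" by (simp add: L2_nrm_def inner_self_nonneg)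

lemma inner_le_nrm: assumes f: "f \<in> H" and g: "g \<in> H" shows "\<bar>inner2 f g\<bar> \<le> nrm f * nrm g"
proof -
  have quad: "0 \<le> inner2 f f - 2 * k * inner2 f g + k\<^sup>2 * inner2 g g" for k
  proof -
    have "0 \<le> inner2 (\<lambda>x. f x - k * g x) (\<lambda>x. f x - k * g x)" by (rule inner_self_nonneg)
    then show ?thesis using f g L2_scale[OF g, of k] L2_diff[OF f L2_scale[OF g, of k]]
      by (simp add: inner_diff_left inner_diff_right inner_scale_left inner_scale_right
          inner_commute[of g f] power2_eq_square algebra_simps)
  qed
  have "(inner2 f g)\<^sup>2 \<le> inner2 f f * inner2 g g"
  proof (cases "inner2 g g = 0")
    case True
    have "inner2 f g = 0"
    proof (rule ccontr)
      assume "inner2 f g \<noteq> 0"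
      then have "inner2 f f - 2 * ((inner2 f f + 1) / (2 * inner2 f g)) * inner2 f g = - 1" by (simp add: field_simps)
      with quad[of "(inner2 f f + 1) / (2 * inner2 f g)"] True show False by simp
    qed
    then show ?thesis using True by simp
  next
    case False
    then have "0 < inner2 g g" using inner_self_nonneg[of g] by linarith
    then show ?thesis using quad[of "inner2 f g / inner2 g g"]
      by (simp add: field_simps power2_eq_square)
  qed
  then have "sqrt ((inner2 f g)\<^sup>2) \<le> sqrt (inner2 f f * inner2 g g)" by (rule real_sqrt_le_mono)
  then show ?thesis by (simp add: L2_nrm_def real_sqrt_mult)
qed

lemma nrm_add: assumes f: "f \<in> H" and g: "g \<in> H" shows "nrm (\<lambda>x. f x + g x) \<le> nrm f + nrm g"
proof (rule power2_le_imp_le)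
  have "(nrm (\<lambda>x. f x + g x))\<^sup>2 = (nrm f)\<^sup>2 + 2 * inner2 f g + (nrm g)\<^sup>2"
    unfolding nrm_sq using f g L2_add[OF f g]
    by (simp add: inner_add_left inner_add_right inner_commute[of g f])
  also have "\<dots> \<le> (nrm f)\<^sup>2 + 2 * (nrm f * nrm g) + (nrm g)\<^sup>2"
    using inner_le_nrm[OF f g] by simp
  finally show "(nrm (\<lambda>x. f x + g x))\<^sup>2 \<le> (nrm f + nrm g)\<^sup>2" by (simp add: power2_sum)
qed (simp add: nrm_nonneg)

lemma nrm_scale: "nrm (\<lambda>x. k * f x) = \<bar>k\<bar> * nrm f"
proof -
  have "inner2 (\<lambda>x. k * f x) (\<lambda>x. k * f x) = k\<^sup>2 * inner2 f f"
    by (simp add: inner_scale_left inner_scale_right power2_eq_square)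
  then show ?thesis by (simp add: L2_nrm_def real_sqrt_mult)
qed

lemma nrm_diff_commute: "nrm (\<lambda>x. f x - g x) = nrm (\<lambda>x. g x - f x)"
  using nrm_scale[of "- 1" "\<lambda>x. f x - g x"] by simp

lemma nrm_triangle: "f \<in> H \<Longrightarrow> g \<in> H \<Longrightarrow> h \<in> H \<Longrightarrow>
    nrm (\<lambda>x. f x - h x) \<le> nrm (\<lambda>x. f x - g x) + nrm (\<lambda>x. g x - h x)"
  using nrm_add[OF L2_diff[of f g] L2_diff[of g h]] by simp

lemma fin_supp_L2:
  assumes "finite A" "\<And>x. x \<notin> A \<Longrightarrow> f x = 0"
  shows "f \<in> H"
proof -
  have "(\<lambda>x. \<theta> x * (f x)\<^sup>2) summable_on A" using assms(1) by (rule summable_on_finite)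
  moreover have "((\<lambda>x. \<theta> x * (f x)\<^sup>2) summable_on A) = ((\<lambda>x. \<theta> x * (f x)\<^sup>2) summable_on UNIV)"
    by (rule summable_on_cong_neutral) (simp_all add: assms(2))
  ultimately show ?thesis by (simp add: L2_def)
qed

lemma inner_finite:
  assumes "finite A" "\<And>x. x \<notin> A \<Longrightarrow> g x = 0"
  shows "inner2 f g = (\<Sum>x\<in>A. \<theta> x * f x * g x)"
proof -
  have "infsum (\<lambda>x. \<theta> x * f x * g x) UNIV = infsum (\<lambda>x. \<theta> x * f x * g x) A"
    by (rule infsum_cong_neutral) (simp_all add: assms(2))
  then show ?thesis using assms(1) by (simp add: L2_inner_def)
qed

lemma finite_sum_le_nrm:
  assumes "f \<in> H" "finite A"
  shows "(\<Sum>x\<in>A. \<theta> x * (f x)\<^sup>2) \<le> (nrm f)\<^sup>2"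
proof -
  have "(\<Sum>x\<in>A. \<theta> x * f x * f x) \<le> infsum (\<lambda>x. \<theta> x * f x * f x) UNIV"
    by (rule finite_sum_le_infsum[OF L2_D[OF assms(1)] assms(2)])
       (simp_all add: mult.assoc less_imp_le theta_pos)
  then show ?thesis unfolding nrm_sq L2_inner_def by (simp add: power2_eq_square mult.assoc)
qed

lemma L2_of_bounded_sums:
  assumes "\<And>A. finite A \<Longrightarrow> (\<Sum>x\<in>A. \<theta> x * (f x)\<^sup>2) \<le> k"
  shows "f \<in> H" "(nrm f)\<^sup>2 \<le> k"
proof -
  have "(\<lambda>x. \<theta> x * (f x)\<^sup>2) summable_on UNIV"
  proof (rule nonneg_bdd_above_summable_on)
    show "bdd_above (sum (\<lambda>x. \<theta> x * (f x)\<^sup>2) ` {F. F \<subseteq> UNIV \<and> finite F})"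
      using assms by (intro bdd_aboveI[of _ k]) auto
  qed (simp add: theta_pos less_imp_le)
  then show f: "f \<in> H" by (simp add: L2_def)
  have "infsum (\<lambda>x. \<theta> x * f x * f x) UNIV \<le> k"
    by (rule infsum_le_finite_sums[OF L2_D[OF f]])
       (use assms in \<open>simp add: power2_eq_square mult.assoc\<close>)
  then show "(nrm f)\<^sup>2 \<le> k" by (simp add: nrm_sq L2_inner_def)
qed

definition cut :: "'d site set \<Rightarrow> ('d site \<Rightarrow> real) \<Rightarrow> 'd site \<Rightarrow> real" where
  "cut A f x = (if x \<in> A then f x else 0)"

lemma cut_approx:
  assumes f: "f \<in> H" and "0 < e"
  shows "\<exists>A. finite A \<and> nrm (\<lambda>x. f x - cut A f x) < e"
proof -
  let ?g = "\<lambda>x. \<theta> x * f x * f x"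
  have hs: "(?g has_sum infsum ?g UNIV) UNIV" using L2_D[OF f] by (rule has_sum_infsum)
  have "\<forall>\<^sub>F A in finite_subsets_at_top UNIV. dist (sum ?g A) (infsum ?g UNIV) < e\<^sup>2"
    using hs assms(2) unfolding has_sum_def tendsto_iff by simp
  then obtain A where A: "finite A" "dist (sum ?g A) (infsum ?g UNIV) < e\<^sup>2"
    unfolding eventually_finite_subsets_at_top by blast
  have cutH: "cut A f \<in> H" by (rule fin_supp_L2[OF A(1)]) (simp add: cut_def)
  have dH: "(\<lambda>x. f x - cut A f x) \<in> H" by (rule L2_diff[OF f cutH])
  have "inner2 (\<lambda>x. f x - cut A f x) (cut A f) = 0"
    by (subst inner_finite[OF A(1)]) (auto simp: cut_def)
  then have "(nrm (\<lambda>x. f x - cut A f x))\<^sup>2 = inner2 (\<lambda>x. f x - cut A f x) f"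
    unfolding nrm_sq by (simp add: inner_diff_right f cutH dH)
  also have "\<dots> = inner2 f f - inner2 (cut A f) f" by (simp add: inner_diff_left f cutH)
  also have "inner2 (cut A f) f = sum ?g A"
    unfolding inner_commute[of _ f] by (subst inner_finite[OF A(1)]) (auto simp: cut_def)
  finally have "(nrm (\<lambda>x. f x - cut A f x))\<^sup>2 < e\<^sup>2"
    using A(2) by (simp add: L2_inner_def dist_real_def)
  then have "nrm (\<lambda>x. f x - cut A f x) < e" by (rule power_less_imp_less_base) (use assms in auto)
  then show ?thesis using A(1) by blast
qed

end

lemma discriminant_le:
  fixes A B C :: real
  assumes "\<And>k. 0 \<le> A - 2 * k * B + k\<^sup>2 * C" "0 \<le> C"
  shows "B\<^sup>2 \<le> A * C"
proof (cases "C = 0")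
  case True
  have "B = 0"
  proof (rule ccontr)
    assume "B \<noteq> 0"
    then have "A - 2 * ((A + 1) / (2 * B)) * B = - 1" by (simp add: field_simps)
    with assms(1)[of "(A + 1) / (2 * B)"] True show False by simp
  qed
  then show ?thesis using True by simp
next
  case False
  then show ?thesis using assms(1)[of "B / C"] assms(2) by (simp add: field_simps power2_eq_square)
qed

lemma ennreal_sum_le_infsum:
  fixes f :: "'a \<Rightarrow> ennreal"
  shows "finite F \<Longrightarrow> sum f F \<le> infsum f UNIV"
  by (subst nonneg_infsum_complete) (auto intro: SUP_upper)

section \<open>The energy form of one environment\<close>

locale fixed_env = weighted_l2 \<theta> for \<theta> :: "'d::finite site \<Rightarrow> real" +
  fixes \<omega> :: "'d env"
  assumes omega: "\<omega> \<in> space env_space" and finite_rate: "(\<Sum>\<^sub>\<infinity>y. ennreal (cond \<omega> x y)) < \<infinity>"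
begin

abbreviation "c \<equiv> cond \<omega>"

definition rate :: "'d site \<Rightarrow> real" where "rate x = (\<Sum>\<^sub>\<infinity>y. c x y)"

lemma c_pos: "x \<noteq> y \<Longrightarrow> 0 < c x y"
proof -
  assume "x \<noteq> y"
  then have "{x, y} \<in> bonds" by (auto simp: bonds_def)
  moreover have "\<omega> \<in> PiE bonds (\<lambda>_. {0<..})"
    using omega by (simp add: env_space_def space_PiM space_restrict_space)
  ultimately have "\<omega> {x, y} \<in> {0<..}" by (rule PiE_mem[rotated])
  then show ?thesis using \<open>x \<noteq> y\<close> by (simp add: cond_def)
qed

lemma c_self: "c x x = 0" by (simp add: cond_def)

lemma c_commute: "c x y = c y x" by (simp add: cond_def insert_commute)

lemma c_nonneg: "0 \<le> c x y" using c_pos[of x y] c_self[of x] by (cases "x = y") auto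

lemma c_summable: "c x summable_on UNIV"
proof (rule nonneg_bdd_above_summable_on)
  have "sum (c x) F \<le> enn2real (\<Sum>\<^sub>\<infinity>y. ennreal (c x y))" if "finite F" for F
  proof -
    have "(\<Sum>y\<in>F. ennreal (c x y)) \<le> (\<Sum>\<^sub>\<infinity>y. ennreal (c x y))"
      by (rule ennreal_sum_le_infsum[OF that])
    then have "ennreal (sum (c x) F) \<le> (\<Sum>\<^sub>\<infinity>y. ennreal (c x y))"
      by (simp add: sum_ennreal c_nonneg)
    then show ?thesis using finite_rate[of x]
      by (metis c_nonneg enn2real_ennreal enn2real_mono infinity_ennreal_def sum_nonneg)
  qed
  then show "bdd_above (sum (c x) ` {F. F \<subseteq> UNIV \<and> finite F})"
    by (intro bdd_aboveI[of _ "enn2real (\<Sum>\<^sub>\<infinity>y. ennreal (c x y))"]) auto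
qed (simp add: c_nonneg)

lemma c_has_sum: "(c x has_sum rate x) UNIV"
  unfolding rate_def using c_summable by (rule has_sum_infsum)

lemma infinite_sites: "infinite (UNIV :: 'd site set)"
proof
  assume "finite (UNIV :: 'd site set)"
  moreover have "inj (\<lambda>k :: int. axis undefined k :: 'd site)" by (auto simp: inj_on_def axis_eq_axis)
  ultimately have "finite (UNIV :: int set)" using finite_imageD[of "\<lambda>k :: int. axis undefined k :: 'd site" UNIV]
    by (meson finite_subset subset_UNIV)
  then show False using infinite_UNIV_int by simp
qed

text \<open>All conductances are positive and the lattice is infinite, so every finite set is left
  at a positive rate. This is the killing of the finite chains.\<close>

lemma sum_c_less_rate: "finite T \<Longrightarrow> (\<Sum>y\<in>T. c x y) < rate x"
proof -
  assume T: "finite T"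
  obtain z where z: "z \<notin> insert x T" using ex_new_if_finite[OF infinite_sites, of "insert x T"] T by auto
  then have "0 < c x z" by (intro c_pos) auto
  then have "(\<Sum>y\<in>T. c x y) < (\<Sum>y\<in>insert z T. c x y)" using T z by simp
  also have "\<dots> \<le> rate x"
    unfolding rate_def by (rule finite_sum_le_infsum[OF c_summable]) (use T in \<open>auto simp: c_nonneg\<close>)
  finally show ?thesis .
qed

sublocale conductances c rate
  by unfold_locales (auto simp: c_commute c_nonneg sum_c_less_rate intro!: c_pos)

lemma has_sum_pairs:
  assumes "finite S" "\<And>x. x \<notin> S \<Longrightarrow> k x = 0"
  shows "((\<lambda>(x, y). c x y * k x) has_sum (\<Sum>x\<in>S. rate x * k x)) UNIV"
proof -
  have one: "((\<lambda>(x, y). c x y * k x) has_sum (rate x * k x)) ({x} \<times> UNIV)" for x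
  proof -
    have "bij_betw (Pair x) (UNIV :: 'd site set) ({x} \<times> UNIV)"
      by (auto simp: bij_betw_def inj_on_def)
    from has_sum_reindex_bij_betw[OF this, of "\<lambda>(x, y). c x y * k x" "rate x * k x"]
    show ?thesis using has_sum_cmult_left[OF c_has_sum, of x "k x"] by simp
  qed
  have "((\<lambda>(x, y). c x y * k x) has_sum (\<Sum>x\<in>S. rate x * k x)) (S \<times> UNIV)"
    using assms(1)
  proof (induction S rule: finite_induct)
    case empty then show ?case by simp
  next
    case (insert x F)
    have "insert x F \<times> UNIV = ({x} \<times> UNIV) \<union> (F \<times> (UNIV :: 'd site set))" by auto
    moreover have "({x} \<times> UNIV) \<inter> (F \<times> (UNIV :: 'd site set)) = {}" using insert by auto
    ultimately show ?case using has_sum_Un_disjoint[OF one[of x] insert.IH] insert by simp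
  qed
  moreover have "((\<lambda>(x, y). c x y * k x) has_sum (\<Sum>x\<in>S. rate x * k x)) (S \<times> UNIV)
      = ((\<lambda>(x, y). c x y * k x) has_sum (\<Sum>x\<in>S. rate x * k x)) UNIV"
    by (rule has_sum_cong_neutral) (use assms(2) in fastforce)+
  ultimately show ?thesis by simp
qed

text \<open>The product of differences expands into two diagonal terms, summable because the rates
  are finite, and two mixed terms of finite support. So the energy on the whole lattice is the form
  of the chain killed outside \<open>S\<close>.\<close>

lemma energy_has_sum:
  assumes S: "finite S" "\<And>x. x \<notin> S \<Longrightarrow> f x = 0" "\<And>x. x \<notin> S \<Longrightarrow> g x = 0"
  shows "((\<lambda>(x, y). c x y * (f y - f x) * (g y - g x)) has_sum 2 * killed_chain.form S c rate f g) UNIV"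
proof -
  interpret killed_chain S c rate by (rule killed_chain[OF S(1)])
  have a: "((\<lambda>(x, y). c x y * (f x * g x)) has_sum (\<Sum>x\<in>S. rate x * (f x * g x))) UNIV"
    by (rule has_sum_pairs[OF S(1)]) (simp add: S)
  have "((\<lambda>p. (\<lambda>(x, y). c x y * (f x * g x)) (prod.swap p)) has_sum (\<Sum>x\<in>S. rate x * (f x * g x))) UNIV"
    using a by (subst has_sum_reindex_bij_betw[OF bij_swap])
  then have b: "((\<lambda>(x, y). c x y * (f y * g y)) has_sum (\<Sum>x\<in>S. rate x * (f x * g x))) UNIV"
    by (simp add: case_prod_unfold c_commute[of "snd _" "fst _"])
  have fin: "((\<lambda>(x, y). c x y * (f' x * g' y)) has_sum (\<Sum>x\<in>S. \<Sum>y\<in>S. c x y * f' x * g' y)) UNIV"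
    if "\<And>x. x \<notin> S \<Longrightarrow> f' x = 0" "\<And>x. x \<notin> S \<Longrightarrow> g' x = 0" for f' g'
  proof -
    have "((\<lambda>(x, y). c x y * (f' x * g' y)) has_sum (\<Sum>(x, y)\<in>S \<times> S. c x y * (f' x * g' y))) UNIV"
    proof (rule has_sum_finite_neutralI[OF _ _ _ refl])
      fix p assume "p \<in> UNIV - S \<times> S"
      then have "f' (fst p) = 0 \<or> g' (snd p) = 0" using that by (cases p) auto
      then show "(case p of (x, y) \<Rightarrow> c x y * (f' x * g' y)) = 0" by (auto simp: case_prod_unfold)
    qed (use S(1) in auto)
    then show ?thesis by (simp only: sum.cartesian_product mult.assoc)
  qed
  have "((\<lambda>(x, y). c x y * (f x * - g y)) has_sum (\<Sum>x\<in>S. \<Sum>y\<in>S. c x y * f x * - g y)) UNIV"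
    "((\<lambda>(x, y). c x y * (g x * - f y)) has_sum (\<Sum>x\<in>S. \<Sum>y\<in>S. c x y * g x * - f y)) UNIV"
    by (rule fin; simp add: S)+
  from has_sum_add[OF has_sum_add[OF a b] has_sum_add[OF this]]
  have "((\<lambda>p. (case p of (x, y) \<Rightarrow> c x y * (f x * g x)) + (case p of (x, y) \<Rightarrow> c x y * (f y * g y))
      + ((case p of (x, y) \<Rightarrow> c x y * (f x * - g y)) + (case p of (x, y) \<Rightarrow> c x y * (g x * - f y))))
    has_sum form f g + form g f) UNIV"
    by (simp add: form_def sum_negf mult_ac)
  also have "form f g + form g f = 2 * form f g" by (simp add: form_commute[of g f])
  also have "(\<lambda>p. (case p of (x, y) \<Rightarrow> c x y * (f x * g x)) + (case p of (x, y) \<Rightarrow> c x y * (f y * g y))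
      + ((case p of (x, y) \<Rightarrow> c x y * (f x * - g y)) + (case p of (x, y) \<Rightarrow> c x y * (g x * - f y))))
      = (\<lambda>(x, y). c x y * (f y - f x) * (g y - g x))"
    by (auto simp: fun_eq_iff algebra_simps)
  finally show ?thesis .
qed

lemma energy_eq_form:
  assumes "finite S" "\<And>x. x \<notin> S \<Longrightarrow> f x = 0" "\<And>x. x \<notin> S \<Longrightarrow> g x = 0"
  shows "energy \<omega> f g = killed_chain.form S c rate f g"
  using infsumI[OF energy_has_sum[OF assms]] by (simp add: energy_def)

abbreviation "EE f \<equiv> energy \<omega> f f"

lemma fin_supp_common:
  assumes "f \<in> fin_supp" "g \<in> fin_supp"
  shows "\<exists>S. finite S \<and> (\<forall>x. x \<notin> S \<longrightarrow> f x = 0 \<and> g x = 0)"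
  using assms by (intro exI[of _ "{x. f x \<noteq> 0} \<union> {x. g x \<noteq> 0}"]) (auto simp: fin_supp_def)

lemma fin_supp_diff: "f \<in> fin_supp \<Longrightarrow> g \<in> fin_supp \<Longrightarrow> (\<lambda>x. f x - g x) \<in> fin_supp"
proof -
  assume fg: "f \<in> fin_supp" "g \<in> fin_supp"
  obtain S where S: "finite S" "\<And>x. x \<notin> S \<Longrightarrow> f x = 0" "\<And>x. x \<notin> S \<Longrightarrow> g x = 0"
    using fin_supp_common[OF fg] by auto
  have "{x. f x - g x \<noteq> 0} \<subseteq> S" using S(2,3) by fastforce
  then show ?thesis using finite_subset S(1) by (auto simp: fin_supp_def)
qed

lemma fin_supp_scale: "f \<in> fin_supp \<Longrightarrow> (\<lambda>x. k * f x) \<in> fin_supp"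
  by (auto simp: fin_supp_def intro: finite_subset)

lemma fin_supp_in_L2: "f \<in> fin_supp \<Longrightarrow> f \<in> H"
  by (rule fin_supp_L2[of "{x. f x \<noteq> 0}"]) (auto simp: fin_supp_def)

lemma energy_commute: "energy \<omega> f g = energy \<omega> g f"
  by (simp add: energy_def mult_ac)

lemma energy_diff_left:
  assumes "f \<in> fin_supp" "g \<in> fin_supp" "h \<in> fin_supp"
  shows "energy \<omega> (\<lambda>x. f x - g x) h = energy \<omega> f h - energy \<omega> g h"
proof -
  obtain S1 where S1: "finite S1" "\<And>x. x \<notin> S1 \<Longrightarrow> f x = 0" "\<And>x. x \<notin> S1 \<Longrightarrow> g x = 0"
    using fin_supp_common[OF assms(1,2)] by auto
  define S where "S = S1 \<union> {x. h x \<noteq> 0}"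
  have S: "finite S" "\<And>x. x \<notin> S \<Longrightarrow> f x = 0" "\<And>x. x \<notin> S \<Longrightarrow> g x = 0" "\<And>x. x \<notin> S \<Longrightarrow> h x = 0"
    using S1 assms(3) by (auto simp: S_def fin_supp_def)
  interpret killed_chain S c rate by (rule killed_chain[OF S(1)])
  have "energy \<omega> (\<lambda>x. f x - g x) h = form (\<lambda>x. f x - g x) h"
    by (rule energy_eq_form[OF S(1)]) (simp_all add: S)
  then show ?thesis by (simp add: form_diff_left energy_eq_form[OF S(1)] S)
qed

lemma energy_diff_right:
  assumes "f \<in> fin_supp" "g \<in> fin_supp" "h \<in> fin_supp"
  shows "energy \<omega> h (\<lambda>x. f x - g x) = energy \<omega> h f - energy \<omega> h g"
  unfolding energy_commute[of h] by (rule energy_diff_left[OF assms])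

lemma energy_scale_left: "f \<in> fin_supp \<Longrightarrow> g \<in> fin_supp \<Longrightarrow> energy \<omega> (\<lambda>x. k * f x) g = k * energy \<omega> f g"
proof -
  have "(\<Sum>\<^sub>\<infinity>(x, y). c x y * (k * f y - k * f x) * (g y - g x)) = (\<Sum>\<^sub>\<infinity>p. k * (case p of (x, y) \<Rightarrow> c x y * (f y - f x) * (g y - g x)))"
    by (intro infsum_cong) (auto simp: algebra_simps)
  then show ?thesis by (simp add: energy_def infsum_cmult_right')
qed

lemma energy_scale_right: "f \<in> fin_supp \<Longrightarrow> g \<in> fin_supp \<Longrightarrow> energy \<omega> g (\<lambda>x. k * f x) = k * energy \<omega> g f"
  unfolding energy_commute[of g] by (rule energy_scale_left)

lemma EE_nonneg: "0 \<le> EE f"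
proof -
  have "0 \<le> (\<Sum>\<^sub>\<infinity>(x, y). c x y * (f y - f x) * (f y - f x))"
    by (intro infsum_nonneg) (auto simp: mult.assoc c_nonneg)
  then show ?thesis by (simp add: energy_def)
qed

lemma energy_CS:
  assumes f: "f \<in> fin_supp" and g: "g \<in> fin_supp"
  shows "\<bar>energy \<omega> f g\<bar> \<le> sqrt (EE f) * sqrt (EE g)"
proof -
  have "(energy \<omega> f g)\<^sup>2 \<le> EE f * EE g"
  proof (rule discriminant_le)
    fix k
    have kg: "(\<lambda>x. k * g x) \<in> fin_supp" by (rule fin_supp_scale[OF g])
    have "0 \<le> EE (\<lambda>x. f x - k * g x)" by (rule EE_nonneg)
    also have "\<dots> = EE f - energy \<omega> f (\<lambda>x. k * g x) - (energy \<omega> (\<lambda>x. k * g x) f - EE (\<lambda>x. k * g x))"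
      by (simp only: energy_diff_left energy_diff_right f kg fin_supp_diff[OF f kg])
    also have "\<dots> = EE f - k * energy \<omega> f g - (k * energy \<omega> f g - k * (k * EE g))"
      by (simp only: energy_scale_left energy_scale_right f g kg energy_commute[of g f])
    also have "\<dots> = EE f - 2 * k * energy \<omega> f g + k\<^sup>2 * EE g"
      by (simp add: power2_eq_square)
    finally show "0 \<le> EE f - 2 * k * energy \<omega> f g + k\<^sup>2 * EE g" .
  qed (rule EE_nonneg)
  then have "sqrt ((energy \<omega> f g)\<^sup>2) \<le> sqrt (EE f * EE g)" by (rule real_sqrt_le_mono)
  then show ?thesis by (simp add: real_sqrt_mult)
qed

lemma EE_le_2:
  assumes f: "f \<in> fin_supp" and g: "g \<in> fin_supp"
  shows "EE (\<lambda>x. f x - g x) \<le> 2 * EE f + 2 * EE g"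
proof -
  have g': "(\<lambda>x. (-1) * g x) \<in> fin_supp" by (rule fin_supp_scale[OF g])
  have "0 \<le> EE (\<lambda>x. f x - (-1) * g x)" by (rule EE_nonneg)
  also have "\<dots> = EE f - energy \<omega> f (\<lambda>x. (-1) * g x) - (energy \<omega> (\<lambda>x. (-1) * g x) f - EE (\<lambda>x. (-1) * g x))"
    by (simp only: energy_diff_left energy_diff_right f g' fin_supp_diff[OF f g'])
  also have "\<dots> = EE f - (-1) * energy \<omega> f g - ((-1) * energy \<omega> f g - (-1) * ((-1) * EE g))"
    by (simp only: energy_scale_left energy_scale_right f g g' energy_commute[of g f])
  also have "\<dots> = EE f + 2 * energy \<omega> f g + EE g" by simp
  finally have "0 \<le> EE f + 2 * energy \<omega> f g + EE g" .
  moreover have "EE (\<lambda>x. f x - g x) = EE f - 2 * energy \<omega> f g + EE g"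
    by (simp only: energy_diff_left energy_diff_right f g fin_supp_diff[OF f g] energy_commute[of g f])
  ultimately show ?thesis by linarith
qed

lemma pointwise_of_nrm:
  assumes "\<And>n. z n \<in> H" "(\<lambda>n. nrm (z n)) \<longlonglongrightarrow> 0"
  shows "(\<lambda>n. z n x) \<longlonglongrightarrow> 0"
proof -
  have "(z n x)\<^sup>2 \<le> (nrm (z n))\<^sup>2 / \<theta> x" for n
    using finite_sum_le_nrm[OF assms(1)[of n], of "{x}"] theta_pos[of x] by (simp add: field_simps)
  moreover have "(\<lambda>n. (nrm (z n))\<^sup>2 / \<theta> x) \<longlonglongrightarrow> 0\<^sup>2 / \<theta> x"
    using theta_pos[of x] by (intro tendsto_intros assms) auto
  ultimately have "(\<lambda>n. (z n x)\<^sup>2) \<longlonglongrightarrow> 0"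
    by (intro tendsto_sandwich[of "\<lambda>_. 0" "\<lambda>n. (z n x)\<^sup>2" _ "\<lambda>n. (nrm (z n))\<^sup>2 / \<theta> x"]) (auto intro!: always_eventually)
  then show ?thesis by simp
qed

lemma energy_partial_sum_le:
  assumes "f \<in> fin_supp" "finite F"
  shows "(\<Sum>(x, y)\<in>F. c x y * (f y - f x) * (f y - f x)) \<le> 2 * EE f"
proof -
  obtain S where S: "finite S" "\<And>x. x \<notin> S \<Longrightarrow> f x = 0" using fin_supp_common[OF assms(1,1)] by auto
  have "((\<lambda>(x, y). c x y * (f y - f x) * (f y - f x)) has_sum 2 * killed_chain.form S c rate f f) UNIV"
    by (rule energy_has_sum[OF S(1)]) (simp_all add: S)
  moreover have "EE f = killed_chain.form S c rate f f"
    by (rule energy_eq_form[OF S(1)]) (simp_all add: S)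
  ultimately have "((\<lambda>(x, y). c x y * (f y - f x) * (f y - f x)) has_sum 2 * EE f) UNIV" by simp
  then show ?thesis by (rule finite_sum_le_has_sum) (use assms(2) in \<open>auto simp: mult.assoc c_nonneg\<close>)
qed

lemma EE_le_of_partial_sums:
  assumes "f \<in> fin_supp" "\<And>F. finite F \<Longrightarrow> (\<Sum>(x, y)\<in>F. c x y * (f y - f x) * (f y - f x)) \<le> k"
  shows "2 * EE f \<le> k"
proof -
  obtain S where S: "finite S" "\<And>x. x \<notin> S \<Longrightarrow> f x = 0" using fin_supp_common[OF assms(1,1)] by auto
  have "((\<lambda>(x, y). c x y * (f y - f x) * (f y - f x)) has_sum 2 * killed_chain.form S c rate f f) UNIV"
    by (rule energy_has_sum[OF S(1)]) (simp_all add: S)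
  moreover have "EE f = killed_chain.form S c rate f f"
    by (rule energy_eq_form[OF S(1)]) (simp_all add: S)
  ultimately have "((\<lambda>(x, y). c x y * (f y - f x) * (f y - f x)) has_sum 2 * EE f) UNIV" by simp
  then show ?thesis by (rule has_sum_le_finite_sums) (rule assms(2))
qed

text \<open>Convergence in L2 is pointwise, since every site has positive mass. In a finite partial
  sum of the energy of z(n) - z(m) one may therefore let m tend to infinity: Fatou's lemma for the
  double series.\<close>

lemma closability:
  assumes z: "\<And>n. z n \<in> fin_supp" "(\<lambda>n. nrm (z n)) \<longlonglongrightarrow> 0"
    and cauchy: "\<And>e. 0 < e \<Longrightarrow> \<exists>N. \<forall>m\<ge>N. \<forall>n\<ge>N. EE (\<lambda>x. z m x - z n x) < e"
  shows "(\<lambda>n. EE (z n)) \<longlonglongrightarrow> 0"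
proof (rule LIMSEQ_I)
  fix e :: real assume e: "0 < e"
  then obtain N where N: "\<And>m n. m \<ge> N \<Longrightarrow> n \<ge> N \<Longrightarrow> EE (\<lambda>x. z m x - z n x) < e / 2"
    using cauchy[of "e / 2"] by auto
  have pt: "(\<lambda>n. z n x) \<longlonglongrightarrow> 0" for x
    by (rule pointwise_of_nrm[OF fin_supp_in_L2[OF z(1)] z(2)])
  have "EE (z n) < e" if n: "n \<ge> N" for n
  proof -
    have "2 * EE (z n) \<le> e"
    proof (rule EE_le_of_partial_sums[OF z(1)])
      fix F :: "('d site \<times> 'd site) set" assume F: "finite F"
      have "(\<lambda>m. \<Sum>(x, y)\<in>F. c x y * ((z n y - z m y) - (z n x - z m x)) * ((z n y - z m y) - (z n x - z m x)))
         \<longlonglongrightarrow> (\<Sum>(x, y)\<in>F. c x y * ((z n y - 0) - (z n x - 0)) * ((z n y - 0) - (z n x - 0)))"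
        unfolding case_prod_unfold by (intro tendsto_intros pt)
      moreover have "(\<Sum>(x, y)\<in>F. c x y * ((z n y - z m y) - (z n x - z m x)) * ((z n y - z m y) - (z n x - z m x))) \<le> e"
        if "m \<ge> N" for m
        using energy_partial_sum_le[OF fin_supp_diff[OF z(1)[of n] z(1)[of m]] F] N[OF n that] by linarith
      ultimately show "(\<Sum>(x, y)\<in>F. c x y * (z n y - z n x) * (z n y - z n x)) \<le> e"
        by (intro tendsto_upperbound[where F = sequentially]) (auto simp: eventually_sequentially)
    qed
    then show ?thesis using e by linarith
  qed
  then show "\<exists>no. \<forall>n\<ge>no. norm (EE (z n) - 0) < e" using EE_nonneg by auto
qed

end

lemma tendsto_0_of_bound:
  fixes f g :: "nat \<Rightarrow> real"
  assumes "\<And>n. \<bar>f n\<bar> \<le> g n" "g \<longlonglongrightarrow> 0"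
  shows "f \<longlonglongrightarrow> 0"
  by (rule Lim_null_comparison[OF always_eventually assms(2)]) (simp add: assms(1))

section \<open>The closure of the energy form and its resolvent\<close>

context fixed_env begin

lemma form_approxD:
  assumes "form_approx \<omega> \<theta> u un"
  shows "un n \<in> fin_supp" "(\<lambda>n. nrm (\<lambda>x. un n x - u x)) \<longlonglongrightarrow> 0"
    "0 < e \<Longrightarrow> \<exists>N. \<forall>m\<ge>N. \<forall>n\<ge>N. EE (\<lambda>x. un m x - un n x) < e"
  using assms by (auto simp: form_approx_def)

lemma form_approx_const: "g \<in> fin_supp \<Longrightarrow> form_approx \<omega> \<theta> g (\<lambda>_. g)"
  by (auto simp: form_approx_def energy_def L2_nrm_def L2_inner_def case_prod_unfold)

lemma EE_bounded:
  assumes "form_approx \<omega> \<theta> u un"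
  shows "\<exists>B>0. \<forall>n. EE (un n) \<le> B"
proof -
  note D = form_approxD[OF assms]
  obtain N where N: "\<And>m n. m \<ge> N \<Longrightarrow> n \<ge> N \<Longrightarrow> EE (\<lambda>x. un m x - un n x) < 1"
    using D(3)[of 1] by auto
  define B where "B = Max ((\<lambda>n. EE (un n)) ` {..N}) + 2 * EE (un N) + 3"
  have mx: "EE (un n) \<le> Max ((\<lambda>n. EE (un n)) ` {..N})" if "n \<le> N" for n
    using that by (intro Max_ge) auto
  have "0 \<le> Max ((\<lambda>n. EE (un n)) ` {..N})" using mx[of N] EE_nonneg[of "un N"] by linarith
  then have B: "B > 0" using EE_nonneg[of "un N"] by (simp add: B_def)
  have "EE (un n) \<le> B" for n
  proof (cases "n \<le> N")
    case True then show ?thesis unfolding B_def using mx[OF True] EE_nonneg[of "un N"] by linarith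
  next
    case False
    have dn: "(\<lambda>x. un N x - un n x) \<in> fin_supp" by (rule fin_supp_diff[OF D(1) D(1)])
    have "EE (\<lambda>x. un N x - (un N x - un n x)) \<le> 2 * EE (un N) + 2 * EE (\<lambda>x. un N x - un n x)"
      by (rule EE_le_2[OF D(1) dn])
    also have "\<dots> \<le> B" using N[of N n] False \<open>0 \<le> Max _\<close> by (simp add: B_def)
    finally show ?thesis by simp
  qed
  then show ?thesis using B by blast
qed

text \<open>The difference of two approximating sequences is Cauchy in energy and null in L2, so
  closability applies.\<close>

lemma form_approx_diff_tendsto_0:
  assumes a: "form_approx \<omega> \<theta> u un" and b: "form_approx \<omega> \<theta> u un'" and u: "u \<in> H"
  shows "(\<lambda>n. EE (\<lambda>x. un n x - un' n x)) \<longlonglongrightarrow> 0"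
proof (rule closability)
  note A = form_approxD[OF a] and B = form_approxD[OF b]
  show "(\<lambda>x. un n x - un' n x) \<in> fin_supp" for n by (rule fin_supp_diff[OF A(1) B(1)])
  show "(\<lambda>n. nrm (\<lambda>x. un n x - un' n x)) \<longlonglongrightarrow> 0"
  proof (rule tendsto_0_of_bound)
    show "\<bar>nrm (\<lambda>x. un n x - un' n x)\<bar> \<le> nrm (\<lambda>x. un n x - u x) + nrm (\<lambda>x. un' n x - u x)" for n
      using nrm_triangle[OF fin_supp_in_L2[OF A(1)] u fin_supp_in_L2[OF B(1)], of n n]
      unfolding nrm_diff_commute[of u "un' n"] by (simp add: nrm_nonneg)
    show "(\<lambda>n. nrm (\<lambda>x. un n x - u x) + nrm (\<lambda>x. un' n x - u x)) \<longlonglongrightarrow> 0"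
      using tendsto_add[OF A(2) B(2)] by simp
  qed
  fix e :: real assume e: "0 < e"
  obtain N1 where N1: "\<And>m n. m \<ge> N1 \<Longrightarrow> n \<ge> N1 \<Longrightarrow> EE (\<lambda>x. un m x - un n x) < e / 4"
    using A(3)[of "e / 4"] e by auto
  obtain N2 where N2: "\<And>m n. m \<ge> N2 \<Longrightarrow> n \<ge> N2 \<Longrightarrow> EE (\<lambda>x. un' m x - un' n x) < e / 4"
    using B(3)[of "e / 4"] e by auto
  show "\<exists>N. \<forall>m\<ge>N. \<forall>n\<ge>N. EE (\<lambda>x. (un m x - un' m x) - (un n x - un' n x)) < e"
  proof (intro exI[of _ "max N1 N2"] allI impI)
    fix m n assume mn: "max N1 N2 \<le> m" "max N1 N2 \<le> n"
    have "EE (\<lambda>x. (un m x - un n x) - (un' m x - un' n x))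
        \<le> 2 * EE (\<lambda>x. un m x - un n x) + 2 * EE (\<lambda>x. un' m x - un' n x)"
      by (rule EE_le_2[OF fin_supp_diff[OF A(1) A(1)] fin_supp_diff[OF B(1) B(1)]])
    also have "\<dots> < e" using N1[of m n] N2[of m n] mn by simp
    finally show "EE (\<lambda>x. (un m x - un' m x) - (un n x - un' n x)) < e"
      by (simp add: algebra_simps)
  qed
qed

lemma energy_diff_le:
  assumes "f \<in> fin_supp" "g \<in> fin_supp" "f' \<in> fin_supp" "g' \<in> fin_supp"
  shows "\<bar>energy \<omega> f g - energy \<omega> f' g'\<bar>
    \<le> sqrt (EE (\<lambda>x. f x - f' x)) * sqrt (EE g) + sqrt (EE f') * sqrt (EE (\<lambda>x. g x - g' x))"
proof -
  have "energy \<omega> f g - energy \<omega> f' g' = energy \<omega> (\<lambda>x. f x - f' x) g + energy \<omega> f' (\<lambda>x. g x - g' x)"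
    by (simp only: energy_diff_left energy_diff_right assms)
  then show ?thesis
    using energy_CS[OF fin_supp_diff[OF assms(1,3)] assms(2)] energy_CS[OF assms(3) fin_supp_diff[OF assms(2,4)]]
    by linarith
qed

text \<open>Energies along approximating sequences are bounded, so bilinearity makes the limit exist
  and be the same for all such sequences. This is what gives a meaning to the definite description
  in \<open>closed_form\<close>.\<close>

lemma closed_form_tendsto:
  assumes u: "form_approx \<omega> \<theta> u un" "u \<in> H" and v: "form_approx \<omega> \<theta> v vn" "v \<in> H"
  shows "(\<lambda>n. energy \<omega> (un n) (vn n)) \<longlonglongrightarrow> closed_form \<omega> \<theta> u v"
proof -
  have cmp: "(\<lambda>n. energy \<omega> (un n) (vn n) - energy \<omega> (un' n) (vn' n)) \<longlonglongrightarrow> 0"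
    if u': "form_approx \<omega> \<theta> u un'" and v': "form_approx \<omega> \<theta> v vn'" for un' vn'
  proof -
    obtain B1 where B1: "B1 > 0" "\<And>n. EE (un' n) \<le> B1" using EE_bounded[OF u'] by blast
    obtain B2 where B2: "B2 > 0" "\<And>n. EE (vn n) \<le> B2" using EE_bounded[OF v(1)] by blast
    let ?b = "\<lambda>n. sqrt (EE (\<lambda>x. un n x - un' n x)) * sqrt B2 + sqrt B1 * sqrt (EE (\<lambda>x. vn n x - vn' n x))"
    have "\<bar>energy \<omega> (un n) (vn n) - energy \<omega> (un' n) (vn' n)\<bar> \<le> ?b n" for n
    proof -
      have "\<bar>energy \<omega> (un n) (vn n) - energy \<omega> (un' n) (vn' n)\<bar>
        \<le> sqrt (EE (\<lambda>x. un n x - un' n x)) * sqrt (EE (vn n)) + sqrt (EE (un' n)) * sqrt (EE (\<lambda>x. vn n x - vn' n x))"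
        by (rule energy_diff_le) (rule form_approxD u u' v v')+
      also have "\<dots> \<le> ?b n"
        using B1 B2 by (intro add_mono mult_left_mono mult_right_mono real_sqrt_le_mono real_sqrt_ge_zero) (auto simp: EE_nonneg)
      finally show ?thesis .
    qed
    moreover have "?b \<longlonglongrightarrow> sqrt 0 * sqrt B2 + sqrt B1 * sqrt 0"
      by (intro tendsto_intros form_approx_diff_tendsto_0[OF u(1) u' u(2)] form_approx_diff_tendsto_0[OF v(1) v' v(2)])
    then have "?b \<longlonglongrightarrow> 0" by simp
    ultimately show ?thesis by (rule tendsto_0_of_bound)
  qed
  have "Cauchy (\<lambda>n. energy \<omega> (un n) (vn n))"
  proof (rule metric_CauchyI)
    fix e :: real assume e: "0 < e"
    obtain B1 where B1: "B1 > 0" "\<And>n. EE (un n) \<le> B1" using EE_bounded[OF u(1)] by blast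
    obtain B2 where B2: "B2 > 0" "\<And>n. EE (vn n) \<le> B2" using EE_bounded[OF v(1)] by blast
    define s where "s = e / (2 * (sqrt B1 + sqrt B2))"
    have s: "0 < s" using e B1(1) B2(1) by (simp add: s_def add_pos_pos)
    obtain N1 where N1: "\<And>m n. m \<ge> N1 \<Longrightarrow> n \<ge> N1 \<Longrightarrow> EE (\<lambda>x. un m x - un n x) < s\<^sup>2"
      using form_approxD(3)[OF u(1), of "s\<^sup>2"] s by auto
    obtain N2 where N2: "\<And>m n. m \<ge> N2 \<Longrightarrow> n \<ge> N2 \<Longrightarrow> EE (\<lambda>x. vn m x - vn n x) < s\<^sup>2"
      using form_approxD(3)[OF v(1), of "s\<^sup>2"] s by auto
    show "\<exists>M. \<forall>m\<ge>M. \<forall>n\<ge>M. dist (energy \<omega> (un m) (vn m)) (energy \<omega> (un n) (vn n)) < e"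
    proof (intro exI[of _ "max N1 N2"] allI impI)
      fix m n assume mn: "max N1 N2 \<le> m" "max N1 N2 \<le> n"
      have r1: "sqrt (EE (\<lambda>x. un m x - un n x)) \<le> s" using N1[of m n] mn s by (intro real_le_lsqrt) auto
      have r2: "sqrt (EE (\<lambda>x. vn m x - vn n x)) \<le> s" using N2[of m n] mn s by (intro real_le_lsqrt) auto
      have "\<bar>energy \<omega> (un m) (vn m) - energy \<omega> (un n) (vn n)\<bar>
        \<le> sqrt (EE (\<lambda>x. un m x - un n x)) * sqrt (EE (vn m)) + sqrt (EE (un n)) * sqrt (EE (\<lambda>x. vn m x - vn n x))"
        by (rule energy_diff_le) (rule form_approxD u v)+
      also have "\<dots> \<le> s * sqrt B2 + sqrt B1 * s"
        using B1 B2 r1 r2 s by (intro add_mono mult_mono) (auto simp: EE_nonneg)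
      also have "\<dots> = s * (sqrt B1 + sqrt B2)" by (simp add: algebra_simps)
      also have "\<dots> = e / 2"
      proof -
        have "sqrt B1 + sqrt B2 > 0" using B1(1) B2(1) by (simp add: add_pos_pos)
        then show ?thesis by (simp add: s_def field_simps)
      qed
      finally show "dist (energy \<omega> (un m) (vn m)) (energy \<omega> (un n) (vn n)) < e"
        using e by (simp add: dist_real_def)
    qed
  qed
  then obtain R where R: "(\<lambda>n. energy \<omega> (un n) (vn n)) \<longlonglongrightarrow> R"
    using Cauchy_convergent convergent_def by blast
  have "closed_form \<omega> \<theta> u v = R"
    unfolding closed_form_def
  proof (rule the_equality)
    show "\<exists>un vn. form_approx \<omega> \<theta> u un \<and> form_approx \<omega> \<theta> v vn \<and> (\<lambda>n. energy \<omega> (un n) (vn n)) \<longlonglongrightarrow> R"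
      using u v R by blast
    fix r assume "\<exists>un vn. form_approx \<omega> \<theta> u un \<and> form_approx \<omega> \<theta> v vn \<and> (\<lambda>n. energy \<omega> (un n) (vn n)) \<longlonglongrightarrow> r"
    then obtain un' vn' where *: "form_approx \<omega> \<theta> u un'" "form_approx \<omega> \<theta> v vn'"
      "(\<lambda>n. energy \<omega> (un' n) (vn' n)) \<longlonglongrightarrow> r" by blast
    have "(\<lambda>n. energy \<omega> (un n) (vn n) - energy \<omega> (un' n) (vn' n)) \<longlonglongrightarrow> R - r"
      by (intro tendsto_diff R *)
    from LIMSEQ_unique[OF this cmp[OF *(1,2)]] show "r = R" by simp
  qed
  then show ?thesis using R by simp
qed

text \<open>The sets that exhaust the lattice are the balls \<open>nat_ball N\<close>, and the walk
  is killed on leaving them.\<close>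

definition cube_euler :: "real \<Rightarrow> nat \<Rightarrow> ('d site \<Rightarrow> real) \<Rightarrow> 'd site \<Rightarrow> real" where
  "cube_euler \<tau> N = killed_chain.euler (nat_ball N) c rate \<theta> \<tau>"

lemma speed_chain_ball: "0 < \<tau> \<Longrightarrow> speed_chain (nat_ball N) c rate \<theta> \<tau>"
  by (intro speed_chain.intro killed_chain finite_nat_ball speed_chain_axioms.intro theta_pos)

lemma ip_eq_inner:
  assumes "finite S" "\<And>x. x \<notin> S \<Longrightarrow> g x = 0"
  shows "killed_chain.ip S \<theta> f g = inner2 f g"
  using assms by (simp add: killed_chain.ip_def[OF killed_chain] inner_finite)

lemma cube_euler_outside: "0 < \<tau> \<Longrightarrow> x \<notin> nat_ball N \<Longrightarrow> cube_euler \<tau> N f x = 0"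
  unfolding cube_euler_def using speed_chain.J_outside[OF speed_chain_ball] by blast

lemma cube_euler_fin_supp: "0 < \<tau> \<Longrightarrow> cube_euler \<tau> N f \<in> fin_supp"
  using cube_euler_outside[of \<tau> _ N f] finite_subset[of "{x. cube_euler \<tau> N f x \<noteq> 0}" "nat_ball N"]
  by (auto simp: fin_supp_def)

lemma cube_euler_diff:
  "0 < \<tau> \<Longrightarrow> cube_euler \<tau> N (\<lambda>x. f x - g x) = (\<lambda>x. cube_euler \<tau> N f x - cube_euler \<tau> N g x)"
  unfolding cube_euler_def using speed_chain.J_diff[OF speed_chain_ball] by blast

lemma cube_euler_contraction:
  assumes "0 < \<tau>" "f \<in> H" shows "nrm (cube_euler \<tau> N f) \<le> nrm f"
proof (rule power2_le_imp_le)
  interpret speed_chain "nat_ball N" c rate \<theta> \<tau> by (rule speed_chain_ball[OF assms(1)])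
  have "(nrm (cube_euler \<tau> N f))\<^sup>2 = ip \<theta> (J f) (J f)"
    unfolding nrm_sq cube_euler_def by (rule ip_eq_inner[symmetric]) (auto simp: J_outside)
  also have "\<dots> \<le> ip \<theta> f f" by (rule J_contraction)
  also have "\<dots> = (\<Sum>x\<in>nat_ball N. \<theta> x * (f x)\<^sup>2)" by (simp add: ip_def power2_eq_square mult.assoc)
  also have "\<dots> \<le> (nrm f)\<^sup>2" by (rule finite_sum_le_nrm[OF assms(2) finite_nat_ball])
  finally show "(nrm (cube_euler \<tau> N f))\<^sup>2 \<le> (nrm f)\<^sup>2" .
qed (rule nrm_nonneg)

text \<open>The Galerkin equation: the resolvent equation on the whole lattice, tested with
  functions supported in the ball.\<close>

lemma cube_euler_weak:
  assumes "0 < \<tau>" "\<And>x. x \<notin> nat_ball N \<Longrightarrow> g x = 0"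
  shows "inner2 (cube_euler \<tau> N f) g + \<tau> * energy \<omega> (cube_euler \<tau> N f) g = inner2 f g"
proof -
  interpret speed_chain "nat_ball N" c rate \<theta> \<tau> by (rule speed_chain_ball[OF assms(1)])
  have "ip \<theta> (J f) g - ip \<theta> f g = - \<tau> * form (J f) g" by (rule ip_J)
  moreover have "energy \<omega> (J f) g = form (J f) g"
    by (rule energy_eq_form) (auto simp: J_outside assms)
  ultimately show ?thesis
    by (simp add: cube_euler_def ip_eq_inner assms)
qed

lemma fin_supp_in_ball:
  assumes "f \<in> fin_supp" shows "\<exists>N0. \<forall>N\<ge>N0. \<forall>x. x \<notin> nat_ball N \<longrightarrow> f x = 0"
proof -
  have fin: "finite {x. f x \<noteq> 0}" using assms by (simp add: fin_supp_def)
  define N0 where "N0 = Max (insert 0 ((\<lambda>x. nat (l1_dist 0 x)) ` {x. f x \<noteq> 0}))"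
  have "x \<in> nat_ball N" if "f x \<noteq> 0" "N0 \<le> N" for x N
  proof -
    have "nat (l1_dist 0 x) \<le> N0" unfolding N0_def using fin that by (intro Max_ge) auto
    then show ?thesis using that(2) by (simp add: nat_ball_def)
  qed
  then show ?thesis by blast
qed

text \<open>Galerkin approximation of the resolvent by the finite killed chains: finitely supported
  functions are a form core.\<close>

lemma cube_euler_tendsto:
  assumes tau: "0 < \<tau>" and u: "u \<in> H" and w: "w \<in> H" and dom: "u \<in> form_dom \<omega> \<theta>"
    and gen: "\<And>g. g \<in> form_dom \<omega> \<theta> \<Longrightarrow> closed_form \<omega> \<theta> u g = - inner2 w g"
  shows "(\<lambda>N. nrm (\<lambda>x. cube_euler \<tau> N (\<lambda>x. u x - \<tau> * w x) x - u x)) \<longlonglongrightarrow> 0"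
proof -
  define F where "F = (\<lambda>x. u x - \<tau> * w x)"
  have F: "F \<in> H" unfolding F_def by (intro L2_diff L2_scale u w)
  obtain un where un: "form_approx \<omega> \<theta> u un" using dom by (auto simp: form_dom_def)
  note D = form_approxD[OF un]
  have unH: "un n \<in> H" for n by (rule fin_supp_in_L2[OF D(1)])
  \<comment> \<open>The form of the resolvent equation: \<open>u\<close> solves
    \<open>BB u g = inner2 F g\<close> in the sense of the closure, and \<open>v N\<close> solves it
    among functions supported in the ball.\<close>
  define BB where "BB f g = inner2 f g + \<tau> * energy \<omega> f g" for f g
  have inner_F: "inner2 F g = inner2 u g - \<tau> * inner2 w g" if "g \<in> H" for g
    unfolding F_def using that by (simp add: inner_diff_left L2_scale u w inner_scale_left)
  have lim_inner: "(\<lambda>n. inner2 (un n) g) \<longlonglongrightarrow> inner2 u g" if g: "g \<in> H" for g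
  proof -
    have "\<bar>inner2 (un n) g - inner2 u g\<bar> \<le> nrm (\<lambda>x. un n x - u x) * nrm g" for n
      using inner_le_nrm[OF L2_diff[OF unH[of n] u] g] by (simp add: inner_diff_left unH u g)
    moreover have "(\<lambda>n. nrm (\<lambda>x. un n x - u x) * nrm g) \<longlonglongrightarrow> 0"
      by (rule tendsto_mult_left_zero[OF D(2)])
    ultimately have "(\<lambda>n. inner2 (un n) g - inner2 u g) \<longlonglongrightarrow> 0"
      by (rule tendsto_0_of_bound)
    then show ?thesis by (simp add: LIM_zero_iff)
  qed
  have lim_nrm: "(\<lambda>n. nrm (\<lambda>x. un n x - g x)) \<longlonglongrightarrow> nrm (\<lambda>x. u x - g x)" if g: "g \<in> H" for g
  proof -
    have "\<bar>nrm (\<lambda>x. un n x - g x) - nrm (\<lambda>x. u x - g x)\<bar> \<le> nrm (\<lambda>x. un n x - u x)" for n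
      using nrm_triangle[OF unH[of n] u g] nrm_triangle[OF u unH[of n] g] nrm_diff_commute[of u "un n"] by linarith
    then have "(\<lambda>n. nrm (\<lambda>x. un n x - g x) - nrm (\<lambda>x. u x - g x)) \<longlonglongrightarrow> 0"
      by (rule tendsto_0_of_bound[OF _ D(2)])
    then show ?thesis by (simp add: LIM_zero_iff)
  qed
  have zeroH: "(\<lambda>_. 0) \<in> H" by (simp add: L2_def)
  have lim_self: "(\<lambda>n. inner2 (un n) (un n)) \<longlonglongrightarrow> inner2 u u"
    using tendsto_power[OF lim_nrm[OF zeroH], of 2] by (simp add: nrm_sq)
  have lim_B: "(\<lambda>n. BB (un n) g) \<longlonglongrightarrow> inner2 F g" if g: "g \<in> fin_supp" for g
  proof -
    have gH: "g \<in> H" and gdom: "g \<in> form_dom \<omega> \<theta>"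
      using fin_supp_in_L2[OF g] form_approx_const[OF g] by (auto simp: form_dom_def)
    have "(\<lambda>n. BB (un n) g) \<longlonglongrightarrow> inner2 u g + \<tau> * closed_form \<omega> \<theta> u g"
      unfolding BB_def by (intro tendsto_intros lim_inner gH closed_form_tendsto[OF un u form_approx_const[OF g] gH])
    then show ?thesis by (simp add: inner_F[OF gH] gen[OF gdom])
  qed
  have lim_BB: "(\<lambda>n. BB (un n) (un n)) \<longlonglongrightarrow> inner2 F u"
  proof -
    have "(\<lambda>n. BB (un n) (un n)) \<longlonglongrightarrow> inner2 u u + \<tau> * closed_form \<omega> \<theta> u u"
      unfolding BB_def by (intro tendsto_intros lim_self closed_form_tendsto[OF un u un u])
    then show ?thesis by (simp add: inner_F[OF u] gen[OF dom])
  qed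
  have BB_sq: "nrm (\<lambda>x. f x - g x) ^ 2 \<le> BB f f - 2 * BB f g + BB g g" if f: "f \<in> fin_supp" and g: "g \<in> fin_supp" for f g
  proof -
    have fH: "f \<in> H" "g \<in> H" using fin_supp_in_L2 f g by auto
    have "nrm (\<lambda>x. f x - g x) ^ 2 + \<tau> * EE (\<lambda>x. f x - g x) = BB f f - 2 * BB f g + BB g g"
      unfolding nrm_sq BB_def
      by (simp only: inner_diff_left inner_diff_right energy_diff_left energy_diff_right f g fH
          L2_diff[OF fH] fin_supp_diff[OF f g] energy_commute[of g f] inner_commute[of g f]) (simp add: algebra_simps)
    moreover have "0 \<le> \<tau> * EE (\<lambda>x. f x - g x)" using tau by (simp add: EE_nonneg)
    ultimately show ?thesis by linarith
  qed
  define v where "v N = cube_euler \<tau> N F" for N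
  have v: "v N \<in> fin_supp" for N unfolding v_def by (rule cube_euler_fin_supp[OF tau])
  have vH: "v N \<in> H" for N by (rule fin_supp_in_L2[OF v])
  have Bv: "BB (v N) g = inner2 F g" if "\<And>x. x \<notin> nat_ball N \<Longrightarrow> g x = 0" for N g
    unfolding BB_def v_def by (rule cube_euler_weak[OF tau that])
  have BB_commute: "BB f g = BB g f" for f g by (simp add: BB_def inner_commute[of f g] energy_commute[of f g])
  have Bvv: "BB (v N) (v N) = inner2 F (v N)" for N
    by (rule Bv) (simp add: v_def cube_euler_outside tau)
  \<comment> \<open>\<open>BB\<close> of u - v(N), with the mixed term evaluated by the equation of
    \<open>u\<close> and the last term by that of \<open>v N\<close>. What remains is a difference
    of two values of one linear functional.\<close>
  have bound1: "nrm (\<lambda>x. u x - v N x) ^ 2 \<le> inner2 F u - inner2 F (v N)" for N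
  proof (rule LIMSEQ_le)
    show "(\<lambda>n. nrm (\<lambda>x. un n x - v N x) ^ 2) \<longlonglongrightarrow> nrm (\<lambda>x. u x - v N x) ^ 2"
      by (intro tendsto_power lim_nrm vH)
    show "(\<lambda>n. BB (un n) (un n) - 2 * BB (un n) (v N) + BB (v N) (v N)) \<longlonglongrightarrow> inner2 F u - inner2 F (v N)"
    proof -
      have "(\<lambda>n. BB (un n) (un n) - 2 * BB (un n) (v N) + BB (v N) (v N))
          \<longlonglongrightarrow> inner2 F u - 2 * inner2 F (v N) + BB (v N) (v N)"
        by (intro tendsto_intros lim_BB lim_B v)
      then show ?thesis by (simp add: Bvv)
    qed
    show "\<exists>N'. \<forall>n\<ge>N'. nrm (\<lambda>x. un n x - v N x) ^ 2 \<le> BB (un n) (un n) - 2 * BB (un n) (v N) + BB (v N) (v N)"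
      using BB_sq[OF D(1) v] by blast
  qed
  have lim_F: "(\<lambda>m. inner2 F (un m)) \<longlonglongrightarrow> inner2 F u"
    using lim_inner[OF F] by (simp only: inner_commute[of F])
  have "(\<lambda>m. inner2 F u + (BB (un m) (un m) - 2 * inner2 F (un m))) \<longlonglongrightarrow> inner2 F u + (inner2 F u - 2 * inner2 F u)"
    by (intro tendsto_intros lim_BB lim_F)
  then have lim0: "(\<lambda>m. inner2 F u + (BB (un m) (un m) - 2 * inner2 F (un m))) \<longlonglongrightarrow> 0" by simp
  show ?thesis
  proof (rule LIMSEQ_I)
    fix e :: real assume e: "0 < e"
    then have "0 < e\<^sup>2" by simp
    from order_tendstoD(2)[OF lim0 this]
    obtain m where m: "inner2 F u + (BB (un m) (un m) - 2 * inner2 F (un m)) < e\<^sup>2"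
      by (auto simp: eventually_sequentially)
    obtain N0 where N0: "\<And>N x. N \<ge> N0 \<Longrightarrow> x \<notin> nat_ball N \<Longrightarrow> un m x = 0"
      using fin_supp_in_ball[OF D(1)[of m]] by blast
    have "norm (nrm (\<lambda>x. v N x - u x) - 0) < e" if N: "N \<ge> N0" for N
    proof -
      \<comment> \<open>Positivity at v(N) - un(m), combined with the Galerkin equation, bounds
        \<open>inner2 F (v N)\<close> from below by nearly \<open>inner2 F u\<close>, by the choice
        of \<open>m\<close>.\<close>
      have "0 \<le> BB (v N) (v N) - 2 * BB (v N) (un m) + BB (un m) (un m)"
        using BB_sq[OF v[of N] D(1)[of m]] by (smt (verit) zero_le_power2)
      also have "BB (v N) (un m) = inner2 F (un m)" by (rule Bv) (rule N0[OF N])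
      finally have "inner2 F u - inner2 F (v N) < e\<^sup>2" using m by (simp add: Bvv)
      then have "nrm (\<lambda>x. u x - v N x) ^ 2 < e\<^sup>2" using bound1[of N] by linarith
      then have "nrm (\<lambda>x. u x - v N x) < e" by (rule power_less_imp_less_base) (use e in simp)
      then show ?thesis by (simp add: nrm_diff_commute[of "v N"] nrm_nonneg)
    qed
    then show "\<exists>no. \<forall>N\<ge>no. norm (nrm (\<lambda>x. cube_euler \<tau> N (\<lambda>x. u x - \<tau> * w x) x - u x) - 0) < e"
      unfolding v_def F_def by blast
  qed
qed

end

section \<open>The semigroup as a limit of the implicit Euler scheme\<close>

locale env_semigroup = fixed_env \<theta> \<omega> for \<theta> :: "'d::finite site \<Rightarrow> real" and \<omega> +
  fixes T :: "real \<Rightarrow> ('d site \<Rightarrow> real) \<Rightarrow> 'd site \<Rightarrow> real"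
  assumes T: "form_semigroup \<omega> \<theta> T"
begin

lemmas T_unfolded = T[unfolded form_semigroup_def]

lemma T_H: "0 < t \<Longrightarrow> f \<in> H \<Longrightarrow> T t f \<in> H"
  and T_contraction: "0 < t \<Longrightarrow> f \<in> H \<Longrightarrow> nrm (T t f) \<le> nrm f"
  using conjunct1[OF T_unfolded] by simp_all

lemma T_linear: "0 < t \<Longrightarrow> f \<in> H \<Longrightarrow> g \<in> H \<Longrightarrow>
    T t (\<lambda>x. a * f x + b * g x) = (\<lambda>x. a * T t f x + b * T t g x)"
  using conjunct1[OF conjunct2[OF T_unfolded]] by simp

lemma T_symmetric: "0 < t \<Longrightarrow> f \<in> H \<Longrightarrow> g \<in> H \<Longrightarrow> inner2 (T t f) g = inner2 f (T t g)"
  using conjunct1[OF conjunct2[OF conjunct2[OF T_unfolded]]] by simp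

lemma T_semigroup: "0 < s \<Longrightarrow> 0 < t \<Longrightarrow> f \<in> H \<Longrightarrow> T (s + t) f = T s (T t f)"
  using conjunct1[OF conjunct2[OF conjunct2[OF conjunct2[OF T_unfolded]]]] by simp

lemma T_continuous: "f \<in> H \<Longrightarrow> ((\<lambda>t. nrm (\<lambda>x. T t f x - f x)) \<longlongrightarrow> 0) (at_right 0)"
  using conjunct1[OF conjunct2[OF conjunct2[OF conjunct2[OF conjunct2[OF T_unfolded]]]]] by simp

lemma T_generator: "u \<in> H \<Longrightarrow> w \<in> H \<Longrightarrow>
      ((\<lambda>t. nrm (\<lambda>x. (T t u x - u x) / t - w x)) \<longlongrightarrow> 0) (at_right 0) \<Longrightarrow>
      u \<in> form_dom \<omega> \<theta> \<and> (\<forall>v\<in>form_dom \<omega> \<theta>. closed_form \<omega> \<theta> u v = - inner2 w v)"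
  using conjunct2[OF conjunct2[OF conjunct2[OF conjunct2[OF conjunct2[OF T_unfolded]]]]] by simp

lemma T_diff: "0 < t \<Longrightarrow> f \<in> H \<Longrightarrow> g \<in> H \<Longrightarrow> T t (\<lambda>x. f x - g x) = (\<lambda>x. T t f x - T t g x)"
  using T_linear[of t f g 1 "- 1"] by simp

lemma T_scale: "0 < t \<Longrightarrow> f \<in> H \<Longrightarrow> T t (\<lambda>x. a * f x) = (\<lambda>x. a * T t f x)"
  using T_linear[of t f f a 0] by simp

text \<open>The graph of the strong generator of \<open>T\<close> on L2.\<close>

definition generates :: "('d site \<Rightarrow> real) \<Rightarrow> ('d site \<Rightarrow> real) \<Rightarrow> bool" where
  "generates u w \<longleftrightarrow> u \<in> H \<and> w \<in> H \<and>
     ((\<lambda>t. nrm (\<lambda>x. (T t u x - u x) / t - w x)) \<longlongrightarrow> 0) (at_right 0)"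

lemma generates_T:
  assumes "generates u w" "0 < s"
  shows "generates (T s u) (T s w)"
proof -
  have u: "u \<in> H" and w: "w \<in> H" using assms by (auto simp: generates_def)
  have le: "nrm (\<lambda>x. (T t (T s u) x - T s u x) / t - T s w x) \<le> nrm (\<lambda>x. (T t u x - u x) / t - w x)"
    if t: "0 < t" for t
  proof -
    have Tu: "T t u \<in> H" by (rule T_H[OF t u])
    have d: "(\<lambda>x. T t u x - u x) \<in> H" by (rule L2_diff[OF Tu u])
    have q: "(\<lambda>x. 1 / t * (T t u x - u x)) \<in> H" by (rule L2_scale[OF d])
    have "T t (T s u) = T s (T t u)"
      using T_semigroup[OF t assms(2) u] T_semigroup[OF assms(2) t u] by (simp add: add.commute)
    then have "(\<lambda>x. (T t (T s u) x - T s u x) / t - T s w x) = T s (\<lambda>x. 1 / t * (T t u x - u x) - w x)"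
      unfolding T_diff[OF assms(2) q w] T_scale[OF assms(2) d] T_diff[OF assms(2) Tu u] by simp
    then show ?thesis using T_contraction[OF assms(2) L2_diff[OF q w]] by simp
  qed
  have "((\<lambda>t. nrm (\<lambda>x. (T t (T s u) x - T s u x) / t - T s w x)) \<longlongrightarrow> 0) (at_right 0)"
  proof (rule Lim_null_comparison)
    show "((\<lambda>t. nrm (\<lambda>x. (T t u x - u x) / t - w x)) \<longlongrightarrow> 0) (at_right 0)"
      using assms(1) by (simp add: generates_def)
    show "\<forall>\<^sub>F t in at_right 0. norm (nrm (\<lambda>x. (T t (T s u) x - T s u x) / t - T s w x))
        \<le> nrm (\<lambda>x. (T t u x - u x) / t - w x)"
      by (rule eventually_at_rightI[of 0 1]) (simp_all add: le nrm_nonneg)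
  qed
  then show ?thesis using u w assms(2) by (simp add: generates_def T_H)
qed

text \<open>Nothing is assumed about \<open>T\<close> at times t \<le> 0, so the initial value is
  supplied here.\<close>

definition orbit :: "('d site \<Rightarrow> real) \<Rightarrow> real \<Rightarrow> 'd site \<Rightarrow> real" where
  "orbit f s = (if s \<le> 0 then f else T s f)"

lemma orbit_H: "f \<in> H \<Longrightarrow> orbit f s \<in> H" by (simp add: orbit_def T_H)

lemma orbit_contraction: "f \<in> H \<Longrightarrow> nrm (orbit f s) \<le> nrm f" by (simp add: orbit_def T_contraction)

lemma T_orbit: "f \<in> H \<Longrightarrow> 0 < h \<Longrightarrow> 0 \<le> s \<Longrightarrow> T h (orbit f s) = orbit f (s + h)"
  using T_semigroup[of h s f] by (auto simp: orbit_def add.commute)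

lemma orbit_continuous_at_0: "f \<in> H \<Longrightarrow> 0 < e \<Longrightarrow> \<exists>d>0. \<forall>s. s < d \<longrightarrow> nrm (\<lambda>x. orbit f s x - f x) < e"
proof -
  assume f: "f \<in> H" and e: "0 < e"
  have "\<forall>\<^sub>F t in at_right 0. nrm (\<lambda>x. T t f x - f x) < e"
    using order_tendstoD(2)[OF T_continuous[OF f] e] .
  then obtain d where d: "d > 0" "\<And>t. 0 < t \<Longrightarrow> t < d \<Longrightarrow> nrm (\<lambda>x. T t f x - f x) < e"
    by (auto simp: eventually_at_right_field)
  have "nrm (\<lambda>x. orbit f s x - f x) < e" if "s < d" for s
  proof (cases "s \<le> 0")
    case True
    have "nrm (\<lambda>x. 0) = 0" by (simp add: L2_nrm_def L2_inner_def)
    then show ?thesis using True e by (simp add: orbit_def)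
  qed (use d that in \<open>simp add: orbit_def\<close>)
  then show ?thesis using d(1) by blast
qed

lemma orbit_diff_le:
  assumes "f \<in> H" "0 \<le> s" "0 \<le> h"
  shows "nrm (\<lambda>x. orbit f (s + h) x - orbit f s x) \<le> nrm (\<lambda>x. orbit f h x - f x)"
proof (cases "s = 0")
  case False
  then have s: "0 < s" using assms by simp
  have "orbit f (s + h) = T s (orbit f h)" using T_orbit[OF assms(1) s assms(3)] by (simp add: add.commute)
  moreover have "orbit f s = T s f" using s by (simp add: orbit_def)
  ultimately have "(\<lambda>x. orbit f (s + h) x - orbit f s x) = T s (\<lambda>x. orbit f h x - f x)"
    by (simp add: T_diff[OF s orbit_H[OF assms(1)] assms(1)])
  then show ?thesis using T_contraction[OF s L2_diff[OF orbit_H[OF assms(1)] assms(1)], of h] by simp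
qed (simp add: orbit_def)

text \<open>The semigroup law and the contraction property carry every increment back to time 0, so
  strong right continuity there gives continuity from both sides, uniformly in time.\<close>

lemma inner_orbit_continuous:
  assumes f: "f \<in> H" and g: "g \<in> H"
  shows "continuous_on {0..} (\<lambda>s. inner2 (orbit f s) g)"
proof (rule continuous_onI)
  fix s e :: real assume s: "s \<in> {0..}" and e: "0 < e"
  obtain d where d: "d > 0" "\<And>s. s < d \<Longrightarrow> nrm (\<lambda>x. orbit f s x - f x) < e / (nrm g + 1)"
    using orbit_continuous_at_0[OF f, of "e / (nrm g + 1)"] e nrm_nonneg[of g] by (auto simp: add_nonneg_pos)
  have le: "\<bar>inner2 (orbit f (a + h)) g - inner2 (orbit f a) g\<bar> \<le> e" if "0 \<le> a" "0 \<le> h" "h < d" for a h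
  proof -
    have "\<bar>inner2 (orbit f (a + h)) g - inner2 (orbit f a) g\<bar> \<le> nrm (\<lambda>x. orbit f (a + h) x - orbit f a x) * nrm g"
      using inner_le_nrm[OF L2_diff[OF orbit_H[OF f] orbit_H[OF f]] g, of "a + h" a]
      by (simp add: inner_diff_left orbit_H f g)
    also have "\<dots> \<le> e / (nrm g + 1) * nrm g"
      using orbit_diff_le[OF f that(1,2)] d(2)[OF that(3)] nrm_nonneg[of g] by (intro mult_right_mono) auto
    also have "\<dots> \<le> e" using e nrm_nonneg[of g] by (simp add: field_simps)
    finally show ?thesis .
  qed
  show "\<exists>d>0. \<forall>s'\<in>{0..}. dist s' s < d \<longrightarrow> dist (inner2 (orbit f s') g) (inner2 (orbit f s) g) \<le> e"
  proof (intro exI[of _ d] conjI d(1) ballI impI)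
    fix s' assume "s' \<in> {0..}" "dist s' s < d"
    then show "dist (inner2 (orbit f s') g) (inner2 (orbit f s) g) \<le> e"
      using le[of s "s' - s"] le[of s' "s - s'"] s by (cases "s \<le> s'") (auto simp: dist_real_def abs_minus_commute)
  qed
qed

text \<open>The time average is a real integral at each site instead of an integral with values in
  L2. Its L2 properties are recovered by pairing with test functions.\<close>

definition average :: "real \<Rightarrow> ('d site \<Rightarrow> real) \<Rightarrow> 'd site \<Rightarrow> real" where
  "average \<epsilon> f x = integral {0..\<epsilon>} (\<lambda>s. orbit f s x) / \<epsilon>"

lemma pointwise_inner: "f x = inner2 f (\<lambda>y. if y = x then 1 / \<theta> x else 0)"
  by (subst inner_finite[of "{x}"]) (use theta_pos[of x] in auto)

lemma point_H: "(\<lambda>y. if y = x then a else 0) \<in> H"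
  by (rule fin_supp_L2[of "{x}"]) auto

lemma orbit_integrable:
  assumes "f \<in> H" "0 \<le> a"
  shows "(\<lambda>s. orbit f s x) integrable_on {a..b}"
proof -
  have "continuous_on {a..b} (\<lambda>s. inner2 (orbit f s) (\<lambda>y. if y = x then 1 / \<theta> x else 0))"
    by (rule continuous_on_subset[OF inner_orbit_continuous[OF assms(1) point_H]]) (use assms in auto)
  then show ?thesis unfolding pointwise_inner[symmetric] by (rule integrable_continuous_real)
qed

lemma inner_orbit_integrable:
  assumes "f \<in> H" "g \<in> H" "0 \<le> a"
  shows "(\<lambda>s. inner2 (orbit f s) g) integrable_on {a..b}"
  by (rule integrable_continuous_real)
     (rule continuous_on_subset[OF inner_orbit_continuous[OF assms(1,2)]], use assms in auto)

lemma integral_abs_le: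
  fixes \<phi> :: "real \<Rightarrow> real"
  assumes "\<phi> integrable_on {a..b}" "a \<le> b" "\<And>s. a \<le> s \<Longrightarrow> s \<le> b \<Longrightarrow> \<bar>\<phi> s\<bar> \<le> k"
  shows "\<bar>integral {a..b} \<phi>\<bar> \<le> k * (b - a)"
proof -
  have "norm (integral {a..b} \<phi>) \<le> integral {a..b} (\<lambda>_. k)"
    by (rule integral_norm_bound_integral) (use assms in auto)
  then show ?thesis using assms(2) by (simp add: mult.commute)
qed

lemma inner_average_finite:
  assumes f: "f \<in> H" and A: "finite A" "\<And>x. x \<notin> A \<Longrightarrow> g x = 0"
  shows "inner2 (average \<epsilon> f) g = integral {0..\<epsilon>} (\<lambda>s. inner2 (orbit f s) g) / \<epsilon>"
proof -
  have "integral {0..\<epsilon>} (\<lambda>s. inner2 (orbit f s) g) = integral {0..\<epsilon>} (\<lambda>s. \<Sum>x\<in>A. \<theta> x * orbit f s x * g x)"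
    by (simp add: inner_finite[OF A])
  also have "\<dots> = (\<Sum>x\<in>A. integral {0..\<epsilon>} (\<lambda>s. \<theta> x * orbit f s x * g x))"
    by (rule integral_sum[OF A(1)]) (intro integrable_on_mult_left integrable_on_mult_right orbit_integrable f order_refl)
  also have "\<dots> = (\<Sum>x\<in>A. \<theta> x * integral {0..\<epsilon>} (\<lambda>s. orbit f s x) * g x)"
    by simp
  finally show ?thesis by (simp add: inner_finite[OF A] average_def sum_divide_distrib)
qed

text \<open>Duality with a cut-off of the average itself: its squared norm on a finite set is a
  pairing, to which the contraction property applies under the integral.\<close>

lemma average_H:
  assumes f: "f \<in> H" and e: "0 < \<epsilon>"
  shows "average \<epsilon> f \<in> H" "nrm (average \<epsilon> f) \<le> nrm f"
proof -
  have "(\<Sum>x\<in>A. \<theta> x * (average \<epsilon> f x)\<^sup>2) \<le> (nrm f)\<^sup>2" if A: "finite A" for A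
  proof -
    define g where "g = cut A (average \<epsilon> f)"
    have g0: "\<And>x. x \<notin> A \<Longrightarrow> g x = 0" by (simp add: g_def cut_def)
    have gH: "g \<in> H" by (rule fin_supp_L2[OF A]) (simp add: g0)
    have ig: "inner2 h g = (\<Sum>x\<in>A. \<theta> x * h x * g x)" for h by (rule inner_finite[OF A]) (simp add: g0)
    have ia: "inner2 (average \<epsilon> f) g = integral {0..\<epsilon>} (\<lambda>s. inner2 (orbit f s) g) / \<epsilon>"
      by (rule inner_average_finite[OF f A]) (simp add: g0)
    have 1: "(nrm g)\<^sup>2 = (\<Sum>x\<in>A. \<theta> x * (average \<epsilon> f x)\<^sup>2)"
      unfolding nrm_sq ig by (rule sum.cong) (auto simp: g_def cut_def power2_eq_square)
    also have "\<dots> = inner2 (average \<epsilon> f) g"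
      unfolding ig by (rule sum.cong) (auto simp: g_def cut_def power2_eq_square)
    also have "\<dots> \<le> nrm f * nrm g"
    proof -
      have "\<bar>integral {0..\<epsilon>} (\<lambda>s. inner2 (orbit f s) g)\<bar> \<le> nrm f * nrm g * (\<epsilon> - 0)"
      proof (rule integral_abs_le[OF inner_orbit_integrable[OF f gH order_refl]])
        fix s show "\<bar>inner2 (orbit f s) g\<bar> \<le> nrm f * nrm g"
          using inner_le_nrm[OF orbit_H[OF f] gH, of s] mult_right_mono[OF orbit_contraction[OF f] nrm_nonneg, of s g] by linarith
      qed (use e in auto)
      then show ?thesis unfolding ia using e
        by (simp add: divide_le_eq)
    qed
    finally have "nrm g * nrm g \<le> nrm f * nrm g" by (simp add: power2_eq_square)
    then have "nrm g \<le> nrm f" using nrm_nonneg[of g] nrm_nonneg[of f] by (cases "nrm g = 0") auto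
    then show ?thesis using 1 nrm_nonneg[of g] by (metis power_mono)
  qed
  from L2_of_bounded_sums[OF this]
  show "average \<epsilon> f \<in> H" "nrm (average \<epsilon> f) \<le> nrm f"
    using nrm_nonneg[of f] by (auto intro: power2_le_imp_le)
qed

text \<open>For finitely supported test functions sum and integral commute. Truncating a general
  \<open>g\<close> leaves an error bounded by the norm of \<open>f\<close> times that of the part
  cut off.\<close>

lemma inner_average:
  assumes f: "f \<in> H" and g: "g \<in> H" and e: "0 < \<epsilon>"
  shows "inner2 (average \<epsilon> f) g = integral {0..\<epsilon>} (\<lambda>s. inner2 (orbit f s) g) / \<epsilon>"
proof -
  let ?I = "\<lambda>g. integral {0..\<epsilon>} (\<lambda>s. inner2 (orbit f s) g) / \<epsilon>"
  have "\<bar>inner2 (average \<epsilon> f) g - ?I g\<bar> \<le> 0 + d" if d: "0 < d" for d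
  proof -
    define k where "k = d / (2 * (nrm f + 1))"
    have k: "0 < k" using d nrm_nonneg[of f] by (simp add: k_def add_nonneg_pos)
    obtain A where A: "finite A" "nrm (\<lambda>x. g x - cut A g x) < k" using cut_approx[OF g k] by blast
    have c0: "\<And>x. x \<notin> A \<Longrightarrow> cut A g x = 0" by (simp add: cut_def)
    have cH: "cut A g \<in> H" by (rule fin_supp_L2[OF A(1) c0])
    have rH: "(\<lambda>x. g x - cut A g x) \<in> H" by (rule L2_diff[OF g cH])
    have "inner2 (average \<epsilon> f) g - ?I g
        = inner2 (average \<epsilon> f) (\<lambda>x. g x - cut A g x) - ?I (\<lambda>x. g x - cut A g x)"
    proof -
      have "integral {0..\<epsilon>} (\<lambda>s. inner2 (orbit f s) (\<lambda>x. g x - cut A g x))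
          = integral {0..\<epsilon>} (\<lambda>s. inner2 (orbit f s) g) - integral {0..\<epsilon>} (\<lambda>s. inner2 (orbit f s) (cut A g))"
        by (simp add: inner_diff_right orbit_H f g cH integral_diff inner_orbit_integrable)
      then show ?thesis
        by (simp add: inner_diff_right average_H f e g cH inner_average_finite[OF f A(1) c0] diff_divide_distrib)
    qed
    moreover have "\<bar>inner2 (average \<epsilon> f) (\<lambda>x. g x - cut A g x)\<bar> \<le> nrm f * k"
      using inner_le_nrm[OF average_H(1)[OF f e] rH]
        mult_mono[OF average_H(2)[OF f e] less_imp_le[OF A(2)] nrm_nonneg nrm_nonneg] by linarith
    moreover have "\<bar>?I (\<lambda>x. g x - cut A g x)\<bar> \<le> nrm f * k"
    proof -
      have "\<bar>integral {0..\<epsilon>} (\<lambda>s. inner2 (orbit f s) (\<lambda>x. g x - cut A g x))\<bar> \<le> nrm f * k * (\<epsilon> - 0)"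
      proof (rule integral_abs_le[OF inner_orbit_integrable[OF f rH order_refl]])
        fix s show "\<bar>inner2 (orbit f s) (\<lambda>x. g x - cut A g x)\<bar> \<le> nrm f * k"
          using inner_le_nrm[OF orbit_H[OF f] rH, of s]
            mult_mono[OF orbit_contraction[OF f] less_imp_le[OF A(2)] nrm_nonneg nrm_nonneg, of s] by linarith
      qed (use e in auto)
      then show ?thesis using e by (simp add: divide_le_eq)
    qed
    moreover have "nrm f * k + nrm f * k \<le> d"
    proof -
      have "nrm f * k + nrm f * k \<le> k * (2 * (nrm f + 1))" using k by (simp add: algebra_simps)
      also have "\<dots> = d" using nrm_nonneg[of f] by (simp add: k_def)
      finally show ?thesis .
    qed
    ultimately show ?thesis by linarith
  qed
  then have "\<bar>inner2 (average \<epsilon> f) g - ?I g\<bar> \<le> 0" by (rule field_le_epsilon)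
  then show ?thesis by simp
qed

lemma nrm_le_of_inner:
  assumes "h \<in> H" "\<And>g. g \<in> H \<Longrightarrow> \<bar>inner2 h g\<bar> \<le> k * nrm g" "0 \<le> k"
  shows "nrm h \<le> k"
proof (cases "nrm h = 0")
  case False
  have "nrm h * nrm h \<le> k * nrm h"
    using assms(2)[OF assms(1)] nrm_sq[of h] by (simp add: power2_eq_square)
  then show ?thesis using False nrm_nonneg[of h] by simp
qed (use assms in simp)

lemma average_approx:
  assumes f: "f \<in> H" and e: "0 < e"
  shows "\<exists>\<epsilon>>0. nrm (\<lambda>x. average \<epsilon> f x - f x) \<le> e"
proof -
  obtain d where d: "d > 0" "\<And>s. s < d \<Longrightarrow> nrm (\<lambda>x. orbit f s x - f x) < e"
    using orbit_continuous_at_0[OF f e] by blast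
  define \<epsilon> where "\<epsilon> = d / 2"
  have eps: "0 < \<epsilon>" "\<epsilon> < d" using d by (auto simp: \<epsilon>_def)
  have "nrm (\<lambda>x. average \<epsilon> f x - f x) \<le> e"
  proof (rule nrm_le_of_inner)
    show "(\<lambda>x. average \<epsilon> f x - f x) \<in> H" by (rule L2_diff[OF average_H(1)[OF f eps(1)] f])
    fix g assume g: "g \<in> H"
    have "inner2 (\<lambda>x. average \<epsilon> f x - f x) g = (integral {0..\<epsilon>} (\<lambda>s. inner2 (orbit f s) g) - integral {0..\<epsilon>} (\<lambda>s. inner2 f g)) / \<epsilon>"
      using eps by (simp add: inner_diff_left average_H f g inner_average diff_divide_distrib)
    also have "integral {0..\<epsilon>} (\<lambda>s. inner2 (orbit f s) g) - integral {0..\<epsilon>} (\<lambda>s. inner2 f g)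
        = integral {0..\<epsilon>} (\<lambda>s. inner2 (orbit f s) g - inner2 f g)"
      by (rule integral_diff[symmetric]) (auto intro: inner_orbit_integrable f g)
    also have "\<bar>\<dots> / \<epsilon>\<bar> \<le> e * nrm g"
    proof -
      have "\<bar>integral {0..\<epsilon>} (\<lambda>s. inner2 (orbit f s) g - inner2 f g)\<bar> \<le> e * nrm g * (\<epsilon> - 0)"
      proof (rule integral_abs_le)
        show "(\<lambda>s. inner2 (orbit f s) g - inner2 f g) integrable_on {0..\<epsilon>}"
          by (intro integrable_diff inner_orbit_integrable f g) auto
        fix s assume "0 \<le> s" "s \<le> \<epsilon>"
        then show "\<bar>inner2 (orbit f s) g - inner2 f g\<bar> \<le> e * nrm g"
          using inner_le_nrm[OF L2_diff[OF orbit_H[OF f] f] g, of s] d(2)[of s] eps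
            mult_right_mono[OF _ nrm_nonneg, of "nrm (\<lambda>x. orbit f s x - f x)" e g]
          by (simp add: inner_diff_left orbit_H f g)
      qed (use eps in auto)
      then show ?thesis using eps by (simp add: divide_le_eq)
    qed
    finally show "\<bar>inner2 (\<lambda>x. average \<epsilon> f x - f x) g\<bar> \<le> e * nrm g" .
  qed (use e in simp)
  then show ?thesis using eps by blast
qed

text \<open>The difference quotient of the average compares the orbit over two intervals of length
  h, near \<epsilon> and near 0. The computation is done weakly, with \<open>T h\<close> moved to
  the test function by symmetry, and the error is uniform over test functions of norm one.\<close>

lemma average_generates:
  assumes f: "f \<in> H" and e: "0 < \<epsilon>"
  shows "generates (average \<epsilon> f) (\<lambda>x. 1 / \<epsilon> * (T \<epsilon> f x - f x))"
proof -
  define w where "w = (\<lambda>x. 1 / \<epsilon> * (T \<epsilon> f x - f x))"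
  define v where "v = average \<epsilon> f"
  have v: "v \<in> H" unfolding v_def by (rule average_H(1)[OF f e])
  have dH: "(\<lambda>x. T \<epsilon> f x - f x) \<in> H" by (rule L2_diff[OF T_H[OF e f] f])
  have w: "w \<in> H" unfolding w_def by (rule L2_scale[OF dH])
  \<comment> \<open>\<open>k\<close> bounds the increments of the orbit up to time \<open>h\<close>
    and thereby the errors at both end intervals.\<close>
  have key: "nrm (\<lambda>x. (T h v x - v x) / h - w x) \<le> 2 * k / \<epsilon>"
    if h: "0 < h" and k: "\<And>s. s \<le> h \<Longrightarrow> nrm (\<lambda>x. orbit f s x - f x) \<le> k" for h k
  proof (rule nrm_le_of_inner)
    have TvH: "T h v \<in> H" by (rule T_H[OF h v])
    have qH: "(\<lambda>x. 1 / h * (T h v x - v x)) \<in> H" by (rule L2_scale[OF L2_diff[OF TvH v]])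
    show "(\<lambda>x. (T h v x - v x) / h - w x) \<in> H" using L2_diff[OF qH w] by simp
    have k0: "0 \<le> k" using k[of 0] h nrm_nonneg order_trans by (metis less_imp_le)
    then show "0 \<le> 2 * k / \<epsilon>" using e by simp
    fix g assume g: "g \<in> H"
    define \<phi> where "\<phi> s = inner2 (orbit f s) g" for s
    have int: "\<phi> integrable_on {a..b}" if "0 \<le> a" for a b
      unfolding \<phi>_def by (rule inner_orbit_integrable[OF f g that])
    have phi: "\<bar>\<phi> (a + s) - \<phi> a\<bar> \<le> k * nrm g" if "0 \<le> a" "0 \<le> s" "s \<le> h" for a s
    proof -
      have "\<bar>\<phi> (a + s) - \<phi> a\<bar> \<le> nrm (\<lambda>x. orbit f (a + s) x - orbit f a x) * nrm g"
        using inner_le_nrm[OF L2_diff[OF orbit_H[OF f] orbit_H[OF f]] g, of "a + s" a]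
        by (simp add: \<phi>_def inner_diff_left orbit_H f g)
      also have "\<dots> \<le> k * nrm g"
        using orbit_diff_le[OF f that(1,2)] k[OF that(3)] nrm_nonneg[of g] by (intro mult_right_mono) auto
      finally show ?thesis .
    qed
    have iv: "inner2 v g = integral {0..\<epsilon>} \<phi> / \<epsilon>"
      unfolding v_def \<phi>_def by (rule inner_average[OF f g e])
    have "inner2 (T h v) g = inner2 v (T h g)" by (rule T_symmetric[OF h v g])
    also have "\<dots> = integral {0..\<epsilon>} (\<lambda>s. inner2 (orbit f s) (T h g)) / \<epsilon>"
      unfolding v_def by (rule inner_average[OF f T_H[OF h g] e])
    also have "integral {0..\<epsilon>} (\<lambda>s. inner2 (orbit f s) (T h g)) = integral {0..\<epsilon>} (\<lambda>s. \<phi> (s + h))"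
    proof (rule integral_cong)
      fix s assume "s \<in> {0..\<epsilon>}"
      then show "inner2 (orbit f s) (T h g) = \<phi> (s + h)"
        using T_symmetric[OF h orbit_H[OF f] g, of s] T_orbit[OF f h, of s] by (simp add: \<phi>_def)
    qed
    also have "\<dots> = integral {h..\<epsilon> + h} \<phi>"
    proof -
      have "(\<phi> has_integral integral {h..\<epsilon> + h} \<phi>) {0 + h..\<epsilon> + h}" using int h by (simp add: integrable_integral)
      from has_integral_affinity[OF this[unfolded cbox_interval[symmetric]], of 1 h]
      have "((\<lambda>s. \<phi> (s + h)) has_integral integral {h..\<epsilon> + h} \<phi>) {0..\<epsilon>}"
        by (simp add: cbox_interval)
      then show ?thesis by (rule integral_unique)
    qed
    finally have iT: "inner2 (T h v) g = integral {h..\<epsilon> + h} \<phi> / \<epsilon>" .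
    have "integral {0..h} \<phi> + integral {h..\<epsilon> + h} \<phi> = integral {0..\<epsilon> + h} \<phi>"
      using h e by (intro Henstock_Kurzweil_Integration.integral_combine int) auto
    moreover have "integral {0..\<epsilon>} \<phi> + integral {\<epsilon>..\<epsilon> + h} \<phi> = integral {0..\<epsilon> + h} \<phi>"
      using h e by (intro Henstock_Kurzweil_Integration.integral_combine int) auto
    ultimately have split: "integral {h..\<epsilon> + h} \<phi> - integral {0..\<epsilon>} \<phi> = integral {\<epsilon>..\<epsilon> + h} \<phi> - integral {0..h} \<phi>"
      by linarith
    have dev: "\<bar>integral {a..a + h} \<phi> - h * \<phi> a\<bar> \<le> k * nrm g * h" if "0 \<le> a" for a
    proof -
      have "integral {a..a + h} \<phi> - h * \<phi> a = integral {a..a + h} (\<lambda>s. \<phi> s - \<phi> a)"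
        using h by (subst integral_diff) (auto intro: int that)
      also have "\<bar>\<dots>\<bar> \<le> k * nrm g * (a + h - a)"
      proof (rule integral_abs_le)
        show "(\<lambda>s. \<phi> s - \<phi> a) integrable_on {a..a + h}" by (intro integrable_diff int that) auto
        fix s assume "a \<le> s" "s \<le> a + h"
        then show "\<bar>\<phi> s - \<phi> a\<bar> \<le> k * nrm g" using phi[OF that, of "s - a"] by simp
      qed (use h in simp)
      finally show ?thesis by simp
    qed
    have "inner2 (\<lambda>x. (T h v x - v x) / h - w x) g = inner2 (\<lambda>x. 1 / h * (T h v x - v x) - w x) g" by simp
    also have "\<dots> = 1 / h * (inner2 (T h v) g - inner2 v g) - inner2 w g"
      by (simp only: inner_diff_left[OF qH w g] inner_scale_left inner_diff_left[OF TvH v g])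
    also have "inner2 w g = 1 / \<epsilon> * (\<phi> \<epsilon> - \<phi> 0)"
      unfolding w_def inner_scale_left inner_diff_left[OF T_H[OF e f] f g] \<phi>_def using e by (simp add: orbit_def)
    also have "1 / h * (inner2 (T h v) g - inner2 v g) - 1 / \<epsilon> * (\<phi> \<epsilon> - \<phi> 0)
        = ((integral {\<epsilon>..\<epsilon> + h} \<phi> - h * \<phi> \<epsilon>) - (integral {0..0 + h} \<phi> - h * \<phi> 0)) / (h * \<epsilon>)"
      unfolding iT iv diff_divide_distrib[symmetric] split using h e by (simp add: field_simps)
    finally have "\<bar>inner2 (\<lambda>x. (T h v x - v x) / h - w x) g\<bar>
        = \<bar>(integral {\<epsilon>..\<epsilon> + h} \<phi> - h * \<phi> \<epsilon>) - (integral {0..0 + h} \<phi> - h * \<phi> 0)\<bar> / (h * \<epsilon>)"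
      using h e by (simp add: abs_divide)
    also have "\<dots> \<le> (2 * (k * nrm g * h)) / (h * \<epsilon>)"
      using dev[of \<epsilon>] dev[of 0] h e by (intro divide_right_mono) auto
    also have "\<dots> = 2 * k / \<epsilon> * nrm g" using h by (simp add: field_simps)
    finally show "\<bar>inner2 (\<lambda>x. (T h v x - v x) / h - w x) g\<bar> \<le> 2 * k / \<epsilon> * nrm g" .
  qed
  have "((\<lambda>h. nrm (\<lambda>x. (T h v x - v x) / h - w x)) \<longlongrightarrow> 0) (at_right 0)"
  proof (rule tendstoI)
    fix d :: real assume d: "0 < d"
    define k where "k = d * \<epsilon> / 4"
    have k: "0 < k" using d e by (simp add: k_def)
    obtain \<delta> where \<delta>: "\<delta> > 0" "\<And>s. s < \<delta> \<Longrightarrow> nrm (\<lambda>x. orbit f s x - f x) < k"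
      using orbit_continuous_at_0[OF f k] by blast
    have "dist (nrm (\<lambda>x. (T h v x - v x) / h - w x)) 0 < d" if "h \<in> {0<..<\<delta>}" for h
    proof -
      have "nrm (\<lambda>x. (T h v x - v x) / h - w x) \<le> 2 * k / \<epsilon>"
        using that \<delta>(2) by (intro key) (auto intro: less_imp_le)
      also have "\<dots> < d" using d e by (simp add: k_def)
      finally show ?thesis by (simp add: nrm_nonneg)
    qed
    then show "\<forall>\<^sub>F h in at_right 0. dist (nrm (\<lambda>x. (T h v x - v x) / h - w x)) 0 < d"
      by (rule eventually_at_rightI[OF _ \<delta>(1)])
  qed
  then show ?thesis using v w by (simp add: generates_def v_def w_def)
qed

end

section \<open>Convergence of the implicit Euler scheme\<close>

context env_semigroup begin

lemma generates_cube_euler_tendsto: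
  assumes "generates u w" "0 < \<tau>"
  shows "(\<lambda>N. nrm (\<lambda>x. cube_euler \<tau> N (\<lambda>x. u x - \<tau> * w x) x - u x)) \<longlonglongrightarrow> 0"
  using assms T_generator[of u w] by (intro cube_euler_tendsto) (auto simp: generates_def)

lemma cube_euler_H: "0 < \<tau> \<Longrightarrow> cube_euler \<tau> N f \<in> H"
  by (rule fin_supp_in_L2[OF cube_euler_fin_supp])

lemma cube_euler_pow_H: "0 < \<tau> \<Longrightarrow> f \<in> H \<Longrightarrow> (cube_euler \<tau> N ^^ n) f \<in> H"
  by (cases n) (auto simp: cube_euler_H)

lemma cube_euler_pow_diff_le:
  assumes "0 < \<tau>" "f \<in> H" "g \<in> H"
  shows "nrm (\<lambda>x. (cube_euler \<tau> N ^^ n) f x - (cube_euler \<tau> N ^^ n) g x) \<le> nrm (\<lambda>x. f x - g x)"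
proof (induction n)
  case (Suc n)
  let ?F = "(cube_euler \<tau> N ^^ n) f" and ?G = "(cube_euler \<tau> N ^^ n) g"
  have "nrm (cube_euler \<tau> N (\<lambda>x. ?F x - ?G x)) \<le> nrm (\<lambda>x. ?F x - ?G x)"
    by (intro cube_euler_contraction L2_diff cube_euler_pow_H assms)
  then show ?case using Suc by (simp add: cube_euler_diff[OF assms(1)])
qed simp

text \<open>Consistency of the implicit Euler scheme: for an orbit starting in the domain of the
  generator, each step is exact up to the defect \<open>r\<close>, which is \<open>o(\<tau>)\<close>.\<close>

lemma euler_consistency:
  assumes g: "generates v w" and tau: "0 < \<tau>"
    and r: "r = nrm (\<lambda>x. T \<tau> v x - v x - \<tau> * T \<tau> w x)" and e: "0 < e"
  shows "\<exists>N0. \<forall>N\<ge>N0. nrm (\<lambda>x. (cube_euler \<tau> N ^^ n) v x - orbit v (n * \<tau>) x) \<le> n * r + e"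
  using e
proof (induction n arbitrary: e)
  case 0
  have "nrm (\<lambda>x. 0) = 0" by (simp add: L2_nrm_def L2_inner_def)
  then show ?case using 0 by (simp add: orbit_def less_imp_le)
next
  case (Suc n)
  have v: "v \<in> H" and w: "w \<in> H" using g by (auto simp: generates_def)
  define U where "U = orbit v (n * \<tau>)"
  define U' where "U' = orbit v (Suc n * \<tau>)"
  define W where "W = orbit w (Suc n * \<tau>)"
  have s: "0 < real (Suc n) * \<tau>" using tau by simp
  have UH: "U \<in> H" "U' \<in> H" "W \<in> H" by (auto simp: U_def U'_def W_def orbit_H v w)
  have "generates U' W" using generates_T[OF g s] s by (simp add: U'_def W_def orbit_def)
  from LIMSEQ_D[OF generates_cube_euler_tendsto[OF this tau], of "e / 2"] Suc.prems
  obtain N1 where N1: "\<And>N. N \<ge> N1 \<Longrightarrow> nrm (\<lambda>x. cube_euler \<tau> N (\<lambda>x. U' x - \<tau> * W x) x - U' x) < e / 2"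
    by (auto simp: nrm_nonneg)
  obtain N2 where N2: "\<And>N. N \<ge> N2 \<Longrightarrow> nrm (\<lambda>x. (cube_euler \<tau> N ^^ n) v x - U x) \<le> n * r + e / 2"
    using Suc.IH[of "e / 2"] Suc.prems by (auto simp: U_def)
  have FH: "(\<lambda>x. U' x - \<tau> * W x) \<in> H" by (intro L2_diff L2_scale UH)
  \<comment> \<open>In the limit of large balls the resolvent maps \<open>U' - \<tau> * W\<close> to
    \<open>U'\<close>, with the generator taken at the end of the step. How far \<open>U\<close> is
    from this function is the first defect transported along the orbit, so each step adds at most
    \<open>r\<close>.\<close>
  have defect: "nrm (\<lambda>x. U x - (U' x - \<tau> * W x)) \<le> r"
  proof -
    have tv: "T \<tau> v \<in> H" "T \<tau> w \<in> H" by (auto intro: T_H tau v w)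
    have dH: "(\<lambda>x. T \<tau> v x - v x) \<in> H" by (rule L2_diff[OF tv(1) v])
    have eH: "(\<lambda>x. T \<tau> v x - v x - \<tau> * T \<tau> w x) \<in> H" by (rule L2_diff[OF dH L2_scale[OF tv(2)]])
    have eq: "(\<lambda>x. U' x - U x - \<tau> * W x) = orbit (\<lambda>x. T \<tau> v x - v x - \<tau> * T \<tau> w x) (n * \<tau>)"
    proof (cases "n = 0")
      case True then show ?thesis using tau by (simp add: U_def U'_def W_def orbit_def)
    next
      case False
      then have p: "0 < real n * \<tau>" using tau by simp
      have sh: "T (real (Suc n) * \<tau>) f = T (real n * \<tau>) (T \<tau> f)" if "f \<in> H" for f
        using T_semigroup[OF p tau that] by (simp add: algebra_simps)
      show ?thesis unfolding U_def U'_def W_def orbit_def using p s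
        by (simp add: sh v w T_diff[OF p dH L2_scale[OF tv(2)]] T_diff[OF p tv(1) v] T_scale[OF p tv(2)] del: of_nat_Suc)
    qed
    have "nrm (\<lambda>x. U x - (U' x - \<tau> * W x)) = nrm (\<lambda>x. (U' x - \<tau> * W x) - U x)"
      by (rule nrm_diff_commute)
    also have "(\<lambda>x. (U' x - \<tau> * W x) - U x) = (\<lambda>x. U' x - U x - \<tau> * W x)" by (simp add: fun_eq_iff)
    also have "nrm \<dots> \<le> r" unfolding eq r by (rule orbit_contraction[OF eH])
    finally show ?thesis .
  qed
  show ?case
  proof (intro exI[of _ "max N1 N2"] allI impI)
    fix N assume N: "max N1 N2 \<le> N"
    let ?K = "cube_euler \<tau> N" and ?F = "(cube_euler \<tau> N ^^ n) v"
    have FnH: "?F \<in> H" by (rule cube_euler_pow_H[OF tau v])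
    have "nrm (\<lambda>x. ?K ?F x - U' x) \<le> nrm (\<lambda>x. ?K ?F x - ?K (\<lambda>x. U' x - \<tau> * W x) x) + nrm (\<lambda>x. ?K (\<lambda>x. U' x - \<tau> * W x) x - U' x)"
      by (rule nrm_triangle) (auto intro: cube_euler_H tau UH)
    also have "(\<lambda>x. ?K ?F x - ?K (\<lambda>x. U' x - \<tau> * W x) x) = ?K (\<lambda>x. ?F x - (U' x - \<tau> * W x))"
      by (simp add: cube_euler_diff[OF tau])
    also have "nrm \<dots> \<le> nrm (\<lambda>x. ?F x - (U' x - \<tau> * W x))"
      by (intro cube_euler_contraction tau L2_diff FnH FH)
    also have "\<dots> \<le> nrm (\<lambda>x. ?F x - U x) + nrm (\<lambda>x. U x - (U' x - \<tau> * W x))"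
      by (rule nrm_triangle) (auto intro: FnH UH FH)
    also have "\<dots> \<le> (n * r + e / 2) + r" using N2[of N] N defect by (intro add_mono) auto
    finally have "nrm (\<lambda>x. ?K ?F x - U' x) \<le> (n * r + e / 2) + r + nrm (\<lambda>x. ?K (\<lambda>x. U' x - \<tau> * W x) x - U' x)" by simp
    also have "\<dots> \<le> real (Suc n) * r + e" using N1[of N] N by (simp add: algebra_simps)
    finally show "nrm (\<lambda>x. (cube_euler \<tau> N ^^ Suc n) v x - orbit v (real (Suc n) * \<tau>) x) \<le> real (Suc n) * r + e"
      by (simp add: U'_def)
  qed
qed

text \<open>Divided by \<open>\<tau>\<close>, the defect is the difference quotient at time 0 minus
  the generator at time \<open>\<tau>\<close>, and both tend to \<open>w\<close>.\<close>

lemma defect_small: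
  assumes g: "generates v w" and e: "0 < e"
  shows "\<exists>d>0. \<forall>\<tau>. 0 < \<tau> \<and> \<tau> < d \<longrightarrow> nrm (\<lambda>x. T \<tau> v x - v x - \<tau> * T \<tau> w x) \<le> \<tau> * e"
proof -
  have v: "v \<in> H" and w: "w \<in> H" using g by (auto simp: generates_def)
  have "\<forall>\<^sub>F t in at_right 0. nrm (\<lambda>x. (T t v x - v x) / t - w x) < e / 2"
    using g e by (intro order_tendstoD) (auto simp: generates_def)
  then obtain d1 where d1: "d1 > 0" "\<And>t. 0 < t \<Longrightarrow> t < d1 \<Longrightarrow> nrm (\<lambda>x. (T t v x - v x) / t - w x) < e / 2"
    by (auto simp: eventually_at_right_field)
  obtain d2 where d2: "d2 > 0" "\<And>s. s < d2 \<Longrightarrow> nrm (\<lambda>x. orbit w s x - w x) < e / 2"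
    using orbit_continuous_at_0[OF w, of "e / 2"] e by auto
  have "nrm (\<lambda>x. T \<tau> v x - v x - \<tau> * T \<tau> w x) \<le> \<tau> * e" if t: "0 < \<tau>" "\<tau> < min d1 d2" for \<tau>
  proof -
    have q: "(\<lambda>x. (T \<tau> v x - v x) / \<tau>) \<in> H"
      using L2_scale[OF L2_diff[OF T_H[OF t(1) v] v], of "1 / \<tau>"] by simp
    have "(\<lambda>x. T \<tau> v x - v x - \<tau> * T \<tau> w x) = (\<lambda>x. \<tau> * ((T \<tau> v x - v x) / \<tau> - T \<tau> w x))"
      using t by (simp add: fun_eq_iff field_simps)
    then have "nrm (\<lambda>x. T \<tau> v x - v x - \<tau> * T \<tau> w x) = \<tau> * nrm (\<lambda>x. (T \<tau> v x - v x) / \<tau> - T \<tau> w x)"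
      using t nrm_scale[of \<tau>] by simp
    also have "nrm (\<lambda>x. (T \<tau> v x - v x) / \<tau> - T \<tau> w x)
        \<le> nrm (\<lambda>x. (T \<tau> v x - v x) / \<tau> - w x) + nrm (\<lambda>x. w x - T \<tau> w x)"
      by (rule nrm_triangle[OF q w T_H[OF t(1) w]])
    also have "nrm (\<lambda>x. w x - T \<tau> w x) = nrm (\<lambda>x. orbit w \<tau> x - w x)"
      using t by (simp add: orbit_def nrm_diff_commute[of w])
    finally have "nrm (\<lambda>x. T \<tau> v x - v x - \<tau> * T \<tau> w x) \<le> \<tau> * (nrm (\<lambda>x. (T \<tau> v x - v x) / \<tau> - w x) + nrm (\<lambda>x. orbit w \<tau> x - w x))"
      using t by simp
    also have "\<dots> \<le> \<tau> * e" using d1(2)[of \<tau>] d2(2)[of \<tau>] t by (intro mult_left_mono) auto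
    finally show ?thesis .
  qed
  then show ?thesis using d1 d2 by (intro exI[of _ "min d1 d2"]) auto
qed

text \<open>Averages are dense, so it suffices to start in the domain, where n defects of size
  o(t/n) add up to o(1); contractivity carries this over to all \<open>f\<close>. The number of
  steps is fixed before the ball is chosen.\<close>

theorem exponential_formula:
  assumes f: "f \<in> H" and t: "0 < t" and e: "0 < e"
  shows "\<exists>n0. \<forall>n\<ge>n0. 1 \<le> n \<longrightarrow> (\<exists>N0. \<forall>N\<ge>N0. nrm (\<lambda>x. (cube_euler (t / n) N ^^ n) f x - T t f x) \<le> e)"
proof -
  obtain \<epsilon> where eps: "\<epsilon> > 0" "nrm (\<lambda>x. average \<epsilon> f x - f x) \<le> e / 4"
    using average_approx[OF f, of "e / 4"] e by auto
  define v where "v = average \<epsilon> f"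
  define w where "w = (\<lambda>x. 1 / \<epsilon> * (T \<epsilon> f x - f x))"
  have g: "generates v w" unfolding v_def w_def by (rule average_generates[OF f eps(1)])
  have v: "v \<in> H" using g by (simp add: generates_def)
  have vf: "nrm (\<lambda>x. v x - f x) \<le> e / 4" "nrm (\<lambda>x. f x - v x) \<le> e / 4"
    using eps(2) nrm_diff_commute[of v f] by (simp_all add: v_def)
  obtain d where d: "d > 0" "\<And>\<tau>. 0 < \<tau> \<Longrightarrow> \<tau> < d \<Longrightarrow> nrm (\<lambda>x. T \<tau> v x - v x - \<tau> * T \<tau> w x) \<le> \<tau> * (e / (4 * t))"
    using defect_small[OF g, of "e / (4 * t)"] e t by auto
  obtain n0 :: nat where n0: "t / d < real n0" using reals_Archimedean2 by blast
  have "\<exists>N0. \<forall>N\<ge>N0. nrm (\<lambda>x. (cube_euler (t / n) N ^^ n) f x - T t f x) \<le> e" if n: "n0 \<le> n" "1 \<le> n" for n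
  proof -
    let ?\<tau> = "t / real n"
    have tau: "0 < ?\<tau>" using t n by simp
    have "t / d < real n" using n0 n(1) by linarith
    then have taud: "?\<tau> < d" using d(1) n by (simp add: field_simps)
    define r where "r = nrm (\<lambda>x. T ?\<tau> v x - v x - ?\<tau> * T ?\<tau> w x)"
    have "r \<le> ?\<tau> * (e / (4 * t))" unfolding r_def by (rule d(2)[OF tau taud])
    then have "n * r \<le> n * (?\<tau> * (e / (4 * t)))" by (intro mult_left_mono) auto
    also have "\<dots> = e / 4" using t n by simp
    finally have nr: "n * r \<le> e / 4" .
    obtain N0 where N0: "\<And>N. N \<ge> N0 \<Longrightarrow> nrm (\<lambda>x. (cube_euler ?\<tau> N ^^ n) v x - orbit v (n * ?\<tau>) x) \<le> n * r + e / 4"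
      using euler_consistency[OF g tau r_def, of "e / 4" n] e by auto
    have orb: "orbit v (n * ?\<tau>) = T t v" using n t by (simp add: orbit_def)
    have "nrm (\<lambda>x. (cube_euler ?\<tau> N ^^ n) f x - T t f x) \<le> e" if N: "N \<ge> N0" for N
    proof -
      let ?K = "cube_euler ?\<tau> N ^^ n"
      have KH: "?K f \<in> H" "?K v \<in> H" by (auto intro: cube_euler_pow_H[OF tau] f v)
      have TH: "T t f \<in> H" "T t v \<in> H" by (auto intro: T_H[OF t] f v)
      have "nrm (\<lambda>x. ?K f x - T t f x) \<le> nrm (\<lambda>x. ?K f x - ?K v x) + nrm (\<lambda>x. ?K v x - T t f x)"
        by (rule nrm_triangle[OF KH TH(1)])
      also have "nrm (\<lambda>x. ?K v x - T t f x) \<le> nrm (\<lambda>x. ?K v x - T t v x) + nrm (\<lambda>x. T t v x - T t f x)"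
        by (rule nrm_triangle[OF KH(2) TH(2,1)])
      also have "nrm (\<lambda>x. ?K f x - ?K v x) \<le> e / 4"
        using order.trans[OF cube_euler_pow_diff_le[OF tau f v] vf(2)] .
      also have "nrm (\<lambda>x. T t v x - T t f x) \<le> e / 4"
        using T_contraction[OF t L2_diff[OF v f]] vf(1) unfolding T_diff[OF t v f] by linarith
      also have "nrm (\<lambda>x. ?K v x - T t v x) \<le> e / 4 + e / 4"
        using N0[OF N] nr unfolding orb by linarith
      finally show ?thesis by simp
    qed
    then show ?thesis by blast
  qed
  then show ?thesis by blast
qed

end

section \<open>The heat kernel\<close>

lemma epowr_ennreal: "0 \<le> x \<Longrightarrow> epowr (ennreal x) r = ennreal (x powr r)"
  by (simp add: epowr_def)

lemma epowr_finite_iff: "epowr x r < \<infinity> \<longleftrightarrow> x < \<infinity>"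
  by (auto simp: epowr_def less_top)

lemma epowr_mono: "x \<le> y \<Longrightarrow> 0 \<le> r \<Longrightarrow> epowr x r \<le> epowr y r"
  by (cases x; cases y) (auto simp: epowr_def top_unique intro!: ennreal_leI powr_mono2)

lemma le_truncation:
  fixes g h r :: real
  assumes "0 \<le> g" "0 < h" "1 \<le> r"
  shows "g \<le> h + h powr (1 - r) * g powr r"
proof (cases "g \<le> h")
  case False
  then have "g = g powr (1 - r) * g powr r" using assms by (simp flip: powr_add)
  also have "\<dots> \<le> h powr (1 - r) * g powr r"
    using False assms by (intro mult_right_mono powr_mono2') auto
  finally show ?thesis using assms by simp
qed (simp add: add_increasing2)

text \<open>Hoelder's inequality against the indicator of \<open>A\<close>, up to a factor 2,
  obtained by truncating at the best level.\<close>

lemma sum_le_of_avg_norm: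
  fixes f :: "'a \<Rightarrow> ennreal"
  assumes p: "1 \<le> p" and B: "finite B" "A \<subseteq> B" and M: "0 < M" "avg_norm p B f \<le> ennreal M"
  shows "(\<Sum>x\<in>A. enn2real (f x)) \<le> 2 * M * real (card A) powr (1 - enn2real (1 / p)) * real (card B) powr enn2real (1 / p)"
    and "x \<in> B \<Longrightarrow> f x < \<infinity>"
proof -
  have finA: "finite A" using B finite_subset by blast
  have "(\<forall>x\<in>B. f x < \<infinity>) \<and> (\<Sum>x\<in>A. enn2real (f x)) \<le> 2 * M * real (card A) powr (1 - enn2real (1 / p)) * real (card B) powr enn2real (1 / p)"
  proof (cases "p = \<infinity>")
    case True
    have fx: "f x \<le> ennreal M" if "x \<in> B" for x
      using M(2) B that by (auto simp: avg_norm_def True intro: order.trans[OF Max_ge])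
    then have fin: "\<forall>x\<in>B. f x < \<infinity>" by (auto intro: order.strict_trans1[OF _ ennreal_less_top])
    have "(\<Sum>x\<in>A. enn2real (f x)) \<le> (\<Sum>x\<in>A. M)"
      using fx B M(1) by (intro sum_mono enn2real_leI) auto
    also have "\<dots> \<le> 2 * M * real (card A)" using M(1) by simp
    also have "\<dots> = 2 * M * real (card A) powr (1 - enn2real (1 / p)) * real (card B) powr enn2real (1 / p)"
    \<comment> \<open>Here 1/p = 0. The empty set is treated apart because
      \<open>0 powr 0 = 0\<close>, so the last factor is 1 only for a nonempty
      \<open>B\<close>.\<close>
    proof (cases "A = {}")
      case False
      then have "card B \<noteq> 0" using B by auto
      then show ?thesis by (simp add: True)
    qed simp
    finally show ?thesis using fin by simp
  next
    case False
    define r where "r = enn2real p"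
    have pr: "p = ennreal r" using False by (simp add: r_def less_top)
    have r: "1 \<le> r" using p pr by (metis enn2real_1 enn2real_mono ennreal_less_top r_def ennreal_one_less_top le_less less_top not_le)
    have P: "enn2real (1 / p) = 1 / r" using r by (simp add: pr flip: ennreal_1 add: divide_ennreal)
    have finf: "\<forall>x\<in>B. f x < \<infinity>"
    proof (rule ballI, rule ccontr)
      fix x assume "x \<in> B" "\<not> f x < \<infinity>"
      then have "epowr (f x) r = \<infinity>" by (simp add: epowr_def less_top)
      then have "(\<Sum>y\<in>B. epowr (f y) r) = \<infinity>" using B \<open>x \<in> B\<close> by auto
      then have "avg_norm p B f = \<infinity>" using False
        by (simp add: avg_norm_def r_def[symmetric] epowr_def ennreal_top_divide)
      then show False using M(2) by (simp add: top_unique)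
    qed
    show ?thesis
    proof (cases "A = {}")
      case Ane: False
      have cA: "0 < card A" "0 < card B" using Ane finA B by (auto simp: card_gt_0_iff)
      define g where "g x = enn2real (f x)" for x
      have fg: "f x = ennreal (g x)" "0 \<le> g x" if "x \<in> B" for x
        using finf that by (auto simp: g_def less_top)
      define s where "s = (\<Sum>y\<in>B. g y powr r)"
      have s0: "0 \<le> s" by (simp add: s_def sum_nonneg)
      have "(\<Sum>y\<in>B. epowr (f y) r) = (\<Sum>y\<in>B. ennreal (g y powr r))"
        by (rule sum.cong) (auto simp: fg epowr_ennreal)
      also have "\<dots> = ennreal s" by (simp add: s_def sum_ennreal)
      finally have "avg_norm p B f = epowr (ennreal s / ennreal (card B)) (1 / r)"
        using False by (simp add: avg_norm_def r_def[symmetric] ennreal_of_nat_eq_real_of_nat)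
      also have "\<dots> = ennreal ((s / card B) powr (1 / r))"
        using cA s0 by (simp add: divide_ennreal epowr_ennreal)
      finally have "(s / card B) powr (1 / r) \<le> M" using M by simp
      then have "((s / card B) powr (1 / r)) powr r \<le> M powr r" using r by (intro powr_mono2) auto
      then have s_le: "s \<le> M powr r * card B" using r s0 cA by (simp add: powr_powr field_simps)
      \<comment> \<open>The level at which the bounds for the two parts of the truncation
        agree.\<close>
      define h where "h = M * (card B / card A) powr (1 / r)"
      have h: "0 < h" using M cA by (simp add: h_def)
      have "(\<Sum>x\<in>A. g x) \<le> (\<Sum>x\<in>A. h + h powr (1 - r) * g x powr r)"
        using h r B fg by (intro sum_mono le_truncation) auto
      also have "\<dots> = card A * h + h powr (1 - r) * (\<Sum>x\<in>A. g x powr r)"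
        by (simp add: sum.distrib sum_distrib_left)
      also have "(\<Sum>x\<in>A. g x powr r) \<le> s" unfolding s_def using B by (intro sum_mono2) auto
      also have "s \<le> M powr r * card B" by (rule s_le)
      also have "h powr (1 - r) * (M powr r * card B) = card A * h"
      proof -
        have "h powr (1 - r) = h / h powr r" using h by (simp add: powr_diff)
        also have "h powr r = M powr r * (card B / card A)"
          using M cA r by (simp add: h_def powr_mult powr_powr)
        finally show ?thesis using M cA by simp
      qed
      finally have "(\<Sum>x\<in>A. g x) \<le> 2 * (card A * h)"
        by (simp add: mult_left_mono) (simp add: mult.commute)
      also have "card A * h = M * (card A powr (1 - 1 / r) * card B powr (1 / r))"
        using cA by (simp add: h_def powr_divide powr_diff)
      finally show ?thesis using finf by (simp add: P g_def mult_ac)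
    qed (use finf in simp)
  qed
  then show "(\<Sum>x\<in>A. enn2real (f x)) \<le> 2 * M * real (card A) powr (1 - enn2real (1 / p)) * real (card B) powr enn2real (1 / p)"
    "x \<in> B \<Longrightarrow> f x < \<infinity>" by auto
qed

lemma nat_ball_exhausts: "\<exists>n\<ge>1. x \<in> nat_ball n"
  by (intro exI[of _ "Suc (nat (l1_dist 0 x))"]) (auto simp: nat_ball_def)

text \<open>The constants are the 2 of \<open>sum_le_of_avg_norm\<close> and the volume bound
  (3n)^d, raised to the power 1/p.\<close>

lemma spread_of_avg_norm:
  fixes f :: "'d::finite site \<Rightarrow> ennreal"
  assumes p: "1 \<le> p" and M: "0 < M" "\<And>n. 1 \<le> n \<Longrightarrow> avg_norm p (nat_ball n) f \<le> ennreal M"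
  shows "spread (enn2real (1 / p)) (2 * 3 powr (real CARD('d) * enn2real (1 / p)) * M) (\<lambda>x. enn2real (f x))"
    and "f x < \<infinity>"
proof -
  let ?P = "enn2real (1 / p)" and ?d = "real CARD('d)"
  show "spread ?P (2 * 3 powr (?d * ?P) * M) (\<lambda>x. enn2real (f x))"
    unfolding spread_def
  proof (intro conjI allI impI)
    fix n :: nat and A :: "'d site set" assume n: "1 \<le> n" and A: "A \<subseteq> nat_ball n"
    have "real (card (nat_ball n :: 'd site set)) \<le> real ((3 * n) ^ CARD('d))"
      by (rule of_nat_mono[OF card_nat_ball_le[OF n]])
    also have "\<dots> = (3 * real n) powr ?d" using n by (simp add: powr_realpow)
    finally have c: "real (card (nat_ball n :: 'd site set)) powr ?P \<le> ((3 * real n) powr ?d) powr ?P"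
      by (intro powr_mono2) auto
    have "(\<Sum>x\<in>A. enn2real (f x)) \<le> 2 * M * real (card A) powr (1 - ?P) * real (card (nat_ball n :: 'd site set)) powr ?P"
      by (rule sum_le_of_avg_norm(1)[OF p finite_nat_ball A M(1) M(2)[OF n]])
    also have "\<dots> \<le> 2 * M * real (card A) powr (1 - ?P) * ((3 * real n) powr ?d) powr ?P"
      using M(1) by (intro mult_left_mono c) auto
    also have "((3 * real n) powr ?d) powr ?P = 3 powr (?d * ?P) * real n powr (?d * ?P)"
      by (simp add: powr_powr powr_mult)
    finally show "(\<Sum>x\<in>A. enn2real (f x)) \<le> 2 * 3 powr (?d * ?P) * M * real (card A) powr (1 - ?P) * real n powr (?d * ?P)"
      by (simp add: mult_ac)
  qed (use M in auto)
  obtain n where "1 \<le> n" "x \<in> nat_ball n" using nat_ball_exhausts by blast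
  then show "f x < \<infinity>" by (intro sum_le_of_avg_norm(2)[OF p finite_nat_ball subset_refl M(1) M(2)]) auto
qed

lemma spread_add: "spread P K1 V1 \<Longrightarrow> spread P K2 V2 \<Longrightarrow> spread P (K1 + K2) (\<lambda>x. V1 x + V2 x)"
  by (auto simp: spread_def sum.distrib algebra_simps intro!: add_mono)

lemma avg_norm_ge_1:
  assumes "finite A" "A \<noteq> {}" "\<And>x. 1 \<le> f x" "1 \<le> p"
  shows "1 \<le> avg_norm p A f"
proof (cases "p = \<infinity>")
  case True
  obtain a where "a \<in> A" using assms by blast
  then show ?thesis using assms by (auto simp: avg_norm_def True intro: order.trans[OF assms(3) Max_ge])
next
  case False
  define r where "r = enn2real p"
  have e1: "epowr 1 s = 1" for s by (simp add: epowr_def)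
  have c: "card A \<noteq> 0" using assms by simp
  have "1 = (of_nat (card A) :: ennreal) / of_nat (card A)"
    using c by (subst ennreal_divide_self) (simp_all add: of_nat_less_top)
  also have "\<dots> \<le> (\<Sum>y\<in>A. epowr (f y) r) / of_nat (card A)"
  proof (rule divide_right_mono_ennreal)
    have "(of_nat (card A) :: ennreal) = (\<Sum>y\<in>A. epowr 1 r)" by (simp add: e1)
    also have "\<dots> \<le> (\<Sum>y\<in>A. epowr (f y) r)" by (intro sum_mono epowr_mono assms) (simp add: r_def)
    finally show "of_nat (card A) \<le> (\<Sum>y\<in>A. epowr (f y) r)" .
  qed
  finally have "epowr 1 (1 / r) \<le> epowr ((\<Sum>y\<in>A. epowr (f y) r) / of_nat (card A)) (1 / r)"
    by (intro epowr_mono) (simp_all add: r_def)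
  then show ?thesis using False by (simp add: avg_norm_def r_def[symmetric] e1)
qed

lemma (in fixed_env) sum_edges_le_nu: "(\<Sum>i\<in>UNIV. inverse (c y (y + e1 i))) \<le> nu \<omega> y"
proof -
  have inj: "inj (\<lambda>i :: 'd. y + e1 i)" by (auto simp: inj_on_def axis_eq_axis)
  have "finite {z. l1_dist y z = 1}"
  proof (rule finite_subset)
    show "{z. l1_dist y z = 1} \<subseteq> (+) y ` nat_ball 1"
    proof
      fix z assume "z \<in> {z. l1_dist y z = 1}"
      then have "z - y \<in> nat_ball 1" using l1_dist_self_add[of y "z - y"] by (simp add: nat_ball_def)
      then show "z \<in> (+) y ` nat_ball 1" by (rule rev_image_eqI) simp
    qed
  qed simp
  moreover have "(\<lambda>i. y + e1 i) ` UNIV \<subseteq> {z. l1_dist y z = 1}" by (auto simp: l1_dist_self_add)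
  ultimately have "(\<Sum>z\<in>(\<lambda>i. y + e1 i) ` UNIV. inverse (c y z)) \<le> (\<Sum>z | l1_dist y z = 1. inverse (c y z))"
    by (intro sum_mono2) (auto simp: c_nonneg)
  then show ?thesis by (simp add: sum.reindex[OF inj] nu_def)
qed

lemma (in fixed_env) sum_moment_le:
  assumes "m \<le> m0" "finite S" "mu m0 \<omega> x < \<infinity>"
  shows "(\<Sum>y\<in>S. c x y * real_of_int (l1_dist x y) powr m) \<le> enn2real (mu m0 \<omega> x)"
proof -
  have "(\<Sum>y\<in>S. c x y * real_of_int (l1_dist x y) powr m) \<le> (\<Sum>y\<in>S. c x y * real_of_int (l1_dist x y) powr m0)"
  proof (intro sum_mono)
    fix y
    show "c x y * real_of_int (l1_dist x y) powr m \<le> c x y * real_of_int (l1_dist x y) powr m0"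
    proof (cases "x = y")
      case False
      then show ?thesis using l1_dist_ge_1[OF False] assms(1)
        by (intro mult_left_mono powr_mono c_nonneg) auto
    qed (simp add: c_self)
  qed
  moreover have "ennreal (\<Sum>y\<in>S. c x y * real_of_int (l1_dist x y) powr m0) \<le> mu m0 \<omega> x"
  proof -
    have "(\<Sum>y\<in>S. ennreal (c x y * real_of_int (l1_dist x y) powr m0)) \<le> mu m0 \<omega> x"
      unfolding mu_def by (rule ennreal_sum_le_infsum[OF assms(2)])
    then show ?thesis by (simp add: sum_ennreal c_nonneg)
  qed
  then have "enn2real (ennreal (\<Sum>y\<in>S. c x y * real_of_int (l1_dist x y) powr m0)) \<le> enn2real (mu m0 \<omega> x)"
    by (rule enn2real_mono) (use assms(3) in simp)
  then have "(\<Sum>y\<in>S. c x y * real_of_int (l1_dist x y) powr m0) \<le> enn2real (mu m0 \<omega> x)"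
    by (simp add: sum_nonneg c_nonneg)
  ultimately show ?thesis by linarith
qed

lemma heat_kernel_eq_semigroup:
  assumes hp: "hunt_process P" and t: "0 < t"
    and T: "\<forall>t>0. \<forall>f\<in>L2 \<theta>. bounded (range f) \<longrightarrow>
           (\<forall>x. T t f x = (\<integral>w. (case w (ennreal t) of None \<Rightarrow> 0 | Some y \<Rightarrow> f y) \<partial>P (Some x)))"
    and d: "point_mass 0 \<in> L2 \<theta>"
  shows "heat_kernel \<theta> P t 0 0 = T t (point_mass 0) 0 / \<theta> 0"
proof -
  let ?A = "{w \<in> paths. w (ennreal t) = Some 0}"
  have sp: "space (P (Some 0)) = paths" and st: "sets (P (Some 0)) = sets (path_sigma \<infinity>)"
    using hp unfolding hunt_process_def by blast+
  have "bounded (range (point_mass (0 :: 'a site)))"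
    by (rule finite_imp_bounded, rule finite_subset[of _ "{0, 1}"]) (auto simp: point_mass_def)
  then have "T t (point_mass 0) 0 = (\<integral>w. (case w (ennreal t) of None \<Rightarrow> 0 | Some y \<Rightarrow> point_mass 0 y) \<partial>P (Some 0))"
    using T t d by blast
  also have "\<dots> = (\<integral>w. indicator ?A w \<partial>P (Some 0))"
    by (rule Bochner_Integration.integral_cong[OF refl])
       (auto simp: sp point_mass_def indicator_def split: option.split)
  also have "\<dots> = measure (P (Some 0)) (?A \<inter> space (P (Some 0)))"
    by (rule Bochner_Integration.integral_indicator)
  also have "?A \<inter> space (P (Some 0)) = ?A" by (auto simp: sp)
  finally show ?thesis by (simp add: heat_kernel_def)
qed

lemma dim_ratio_eq: "dim_ratio n s = real n * enn2real (1 / s)"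
proof -
  have "of_nat n / s = of_nat n * (1 / s)" by (simp add: ennreal_times_divide)
  then show ?thesis by (simp add: dim_ratio_def enn2real_mult)
qed

lemma exp_a'_pos:
  assumes n: "0 < n" and pq: "1 / p + 1 / q < ennreal (2 / real n)"
  shows "0 < exp_a' n p q"
proof -
  have fin: "1 / p + 1 / q < \<top>" by (rule less_trans[OF pq ennreal_less_top])
  then have "enn2real (1 / p + 1 / q) = enn2real (1 / p) + enn2real (1 / q)"
    by (intro enn2real_plus) (simp_all add: less_top)
  moreover have "enn2real (1 / p + 1 / q) < 2 / real n"
    using pq by (simp only: enn2real_less_iff[OF fin])
  ultimately have "enn2real (1 / p) + enn2real (1 / q) < 2 / real n" by simp
  then show ?thesis using n by (simp add: exp_a'_def dim_ratio_eq field_simps)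
qed

theorem heat_kernel_bound:
  fixes m0 :: real and p q :: ennreal
  assumes d: "3 \<le> CARD('d::finite)" and m0: "real CARD('d) < m0"
    and p: "1 \<le> p" and q: "1 \<le> q" and pq: "1 / p + 1 / q < ennreal (2 / real CARD('d))"
  shows "\<exists>C>0. \<forall>\<omega> (\<theta> :: 'd env \<Rightarrow> 'd site \<Rightarrow> real) P t. \<omega> \<in> space env_space \<and> (\<forall>x. 0 < \<theta> \<omega> x) \<and>
     (\<forall>x. (\<Sum>\<^sub>\<infinity>y. ennreal (cond \<omega> x y)) < \<infinity>) \<and> M0 m0 p q \<theta> \<omega> < \<infinity> \<and>
     hunt_process_of_form \<omega> (\<theta> \<omega>) P \<and> 0 < t \<longrightarrow>
     heat_kernel (\<theta> \<omega>) P t 0 0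
       \<le> C * enn2real (M0 m0 p q \<theta> \<omega>) powr (1 + 4 * real CARD('d) / exp_a' CARD('d) p q) * t powr (- real CARD('d) / 2)"
proof -
  define dd where "dd = real CARD('d)"
  define P' where "P' = enn2real (1 / p)"
  define Q' where "Q' = enn2real (1 / q)"
  define a' where "a' = 2 - dd * P' - dd * Q'"
  \<comment> \<open>The Sobolev inequality needs b - 2 < 2 a' / (d - 2 + d Q'). As d Q' < 2, the
    value a'/d is less than half of the right hand side.\<close>
  define b where "b = 2 + a' / dd"
  \<comment> \<open>Jumps have length at least 1, so a smaller moment is controlled by the given
    one; the cap d + 2 is what \<open>nash_data\<close> requires.\<close>
  define m where "m = min m0 (dd + 2)"
  have d3: "3 \<le> dd" using d by (simp add: dd_def)
  have PQ0: "0 \<le> P'" "0 \<le> Q'" by (simp_all add: P'_def Q'_def)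
  have fin: "1 / p < \<infinity>" "1 / q < \<infinity>"
    using pq by (auto simp: less_top[symmetric] intro: le_less_trans ennreal_less_top)
  have eP: "1 / p = ennreal P'" "1 / q = ennreal Q'" using fin by (auto simp: P'_def Q'_def)
  have PQ: "P' + Q' < 2 / dd"
    using pq PQ0 unfolding eP by (simp add: dd_def ennreal_less_iff flip: ennreal_plus)
  have a': "0 < a'" using PQ d3 by (simp add: a'_def field_simps)
  have ea: "exp_a' CARD('d) p q = a'"
    by (simp add: exp_a'_def a'_def P'_def Q'_def dim_ratio_eq dd_def)
  have b2: "2 < b" using a' d3 by (simp add: b_def)
  have eta: "0 < b * (1 - dd) + b / 2 * (dd * (1 - Q')) + dd * (1 - P')"
  proof -
    have "b * (1 - dd) + b / 2 * (dd * (1 - Q')) + dd * (1 - P') = a' * (dd + 2 - dd * Q') / (2 * dd)"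
      using d3 unfolding b_def a'_def by (simp add: field_simps power2_eq_square)
    moreover have "Q' < 2 / dd" using PQ PQ0 by linarith
    then have "dd * Q' < 2" using d3 by (simp add: field_simps)
    ultimately show ?thesis using a' d3 by simp
  qed
  have mm: "dd < m" "m \<le> dd + 2" "m \<le> m0" using m0 by (auto simp: m_def dd_def)
  from kernel_upper_bound[OF dd_def d3 PQ0 PQ b2 eta, of m]
  obtain C where C: "C > 0" "\<forall>c r (S :: 'd site set) \<theta> \<theta>' \<nu> \<tau> KV K n.
    nash_data c r S \<theta>' \<nu> \<tau> dd P' Q' m KV K \<and> (\<forall>x\<in>S. 0 < \<theta> x \<and> \<theta> x \<le> \<theta>' x) \<and> 1 \<le> n \<longrightarrow>
    speed_chain.kernel S c r \<theta> \<tau> 0 (n + n) 0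
      \<le> C * (KV * K powr (b / 2)) powr (2 / (b - 2)) * (real n * \<tau>) powr (- dd / 2)"
    by (elim exE conjE) (rule that)
  define kV where "kV = 4 * 3 powr (dd * P')"
  define k where "k = 2 * 3 powr (dd * Q')"
  define C' where "C' = C * (kV * k powr (b / 2)) powr (2 / (b - 2)) * (1 / 2) powr (- dd / 2)"
  have C': "C' > 0" using C(1) by (simp add: C'_def kV_def k_def)
  have "heat_kernel (\<theta> \<omega>) PP t 0 0 \<le> C' * enn2real (M0 m0 p q \<theta> \<omega>) powr (1 + 4 * dd / a') * t powr (- dd / 2)"
    if om: "\<omega> \<in> space env_space" and th: "\<forall>x. 0 < \<theta> \<omega> x"
      and rates: "\<forall>x. (\<Sum>\<^sub>\<infinity>y. ennreal (cond \<omega> x y)) < \<infinity>" and M0: "M0 m0 p q \<theta> \<omega> < \<infinity>"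
      and hp: "hunt_process_of_form \<omega> (\<theta> \<omega>) PP" and t: "0 < t"
    for \<omega> PP t and \<theta> :: "'d env \<Rightarrow> 'd site \<Rightarrow> real"
  proof -
    obtain T where Tsem: "form_semigroup \<omega> (\<theta> \<omega>) T" "hunt_process PP"
      "\<forall>t>0. \<forall>f\<in>L2 (\<theta> \<omega>). bounded (range f) \<longrightarrow>
           (\<forall>x. T t f x = (\<integral>w. (case w (ennreal t) of None \<Rightarrow> 0 | Some y \<Rightarrow> f y) \<partial>PP (Some x)))"
      using hp unfolding hunt_process_of_form_def by blast
    interpret env_semigroup "\<theta> \<omega>" \<omega> T
      by unfold_locales (use om th rates Tsem(1) in auto)
    define M where "M = enn2real (M0 m0 p q \<theta> \<omega>)"
    let ?mu = "\<lambda>x. max 1 (mu m0 \<omega> x)" and ?th = "\<lambda>x. max 1 (ennreal (\<theta> \<omega> x))" and ?nu = "\<lambda>x. max 1 (ennreal (nu \<omega> x))"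
    have ball: "lattice_ball (real n) = (nat_ball n :: 'd site set)" for n
      by (simp add: lattice_ball_eq_nat_ball)
    have M0_ge: "(avg_norm p (nat_ball n) ?mu + avg_norm p (nat_ball n) ?th) * avg_norm q (nat_ball n) ?nu \<le> M0 m0 p q \<theta> \<omega>"
      if "1 \<le> n" for n
      unfolding M0_def ball[symmetric] by (rule SUP_upper) (use that in auto)
    have ne: "nat_ball n \<noteq> ({} :: 'd site set)" for n using zero_in_nat_ball by blast
    have ge1: "1 \<le> avg_norm p (nat_ball n) ?mu" "1 \<le> avg_norm p (nat_ball n) ?th" "1 \<le> avg_norm q (nat_ball n) ?nu" for n
      by (intro avg_norm_ge_1 finite_nat_ball ne p q; simp)+
    have eM: "M0 m0 p q \<theta> \<omega> = ennreal M" using M0 by (simp add: M_def)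
    have prod: "avg_norm p (nat_ball n) ?mu \<le> ennreal M" "avg_norm p (nat_ball n) ?th \<le> ennreal M"
      "avg_norm q (nat_ball n) ?nu \<le> ennreal M" if n: "1 \<le> n" for n
    proof -
      let ?a = "avg_norm p (nat_ball n) ?mu" and ?b = "avg_norm p (nat_ball n) ?th" and ?c = "avg_norm q (nat_ball n) ?nu"
      have "?a * 1 \<le> (?a + ?b) * ?c" using ge1 by (intro mult_mono) auto
      moreover have "?b * 1 \<le> (?a + ?b) * ?c" using ge1 by (intro mult_mono) auto
      moreover have "1 * ?c \<le> (?a + ?b) * ?c" using ge1(1)[of n] by (intro mult_mono) (auto intro: add_increasing2)
      ultimately show "?a \<le> ennreal M" "?b \<le> ennreal M" "?c \<le> ennreal M"
        using M0_ge[OF n] unfolding eM by (auto intro: order.trans)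
    qed
    have "ennreal 1 \<le> ennreal M" using order.trans[OF ge1(1)[of 1] prod(1)[of 1]] by simp
    then have M1: "1 \<le> M" by (simp add: ennreal_le_iff2)
    then have M: "0 < M" by simp
    \<comment> \<open>A sum instead of a maximum, because \<open>spread\<close> is additive; this is
      why \<open>kV\<close> is twice the constant of a single weight.\<close>
    define V where "V x = enn2real (?mu x) + enn2real (?th x)" for x
    define \<nu> where "\<nu> x = enn2real (?nu x)" for x
    have sV: "spread P' (kV * M) V"
      using spread_add[OF spread_of_avg_norm(1)[OF p M prod(1)] spread_of_avg_norm(1)[OF p M prod(2)]]
      unfolding V_def kV_def P'_def dd_def by (simp add: algebra_simps)
    have sN: "spread Q' (k * M) \<nu>"
      using spread_of_avg_norm(1)[OF q M prod(3)] unfolding \<nu>_def k_def Q'_def dd_def by simp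
    have mu_fin: "?mu x < \<infinity>" for x by (rule spread_of_avg_norm(2)[OF p M prod(1)])
    then have mu_fin': "mu m0 \<omega> x < \<infinity>" for x by (meson le_less_trans max.cobounded2)
    have V_ge: "enn2real (mu m0 \<omega> x) \<le> V x" "\<theta> \<omega> x \<le> V x" "1 \<le> V x" for x
    proof -
      have "enn2real (mu m0 \<omega> x) \<le> enn2real (?mu x)" by (rule enn2real_mono) (use mu_fin in auto)
      moreover have "enn2real (?th x) = max 1 (\<theta> \<omega> x)"
        using th by (auto simp: max_def ennreal_ge_1 less_imp_le)
      ultimately show "enn2real (mu m0 \<omega> x) \<le> V x" "\<theta> \<omega> x \<le> V x" "1 \<le> V x"
        unfolding V_def by (auto simp: max_def intro: add_increasing)
    qed
    have nu_nonneg: "0 \<le> nu \<omega> x" for x by (simp add: nu_def sum_nonneg c_nonneg)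
    have nu_ge: "nu \<omega> x \<le> \<nu> x" for x
    proof -
      have "enn2real (ennreal (nu \<omega> x)) \<le> enn2real (?nu x)" by (rule enn2real_mono) auto
      then show ?thesis by (simp add: \<nu>_def nu_nonneg)
    qed
    have KV1: "1 \<le> kV * M" and K1: "1 \<le> k * M"
    proof -
      have "1 \<le> kV" using ge_one_powr_ge_zero[of 3 "dd * P'"] d3 PQ0 by (simp add: kV_def)
      moreover have "1 \<le> k" using ge_one_powr_ge_zero[of 3 "dd * Q'"] d3 PQ0 by (simp add: k_def)
      ultimately show "1 \<le> kV * M" "1 \<le> k * M" using M1 mult_mono[of 1 _ 1 M] by force+
    qed
    define f where "f = (point_mass 0 :: 'd site \<Rightarrow> real)"
    have f: "f \<in> L2 (\<theta> \<omega>)" unfolding f_def point_mass_def by (rule point_H)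
    define R where "R = C * (kV * M * (k * M) powr (b / 2)) powr (2 / (b - 2)) * (t / 2) powr (- dd / 2)"
    have "T t f 0 / \<theta> \<omega> 0 \<le> R"
    proof (rule field_le_epsilon)
      fix e :: real assume e: "0 < e"
      \<comment> \<open>Passing from the norm to the value at 0 costs a factor 1 / sqrt
        (\<theta>(0)), and passing to a density one more factor 1 / \<theta>(0).\<close>
      define \<epsilon> where "\<epsilon> = e * \<theta> \<omega> 0 * sqrt (\<theta> \<omega> 0)"
      have eps: "0 < \<epsilon>" using e th by (simp add: \<epsilon>_def)
      obtain n0 where n0: "\<And>n. n0 \<le> n \<Longrightarrow> 1 \<le> n \<Longrightarrow> \<exists>N0. \<forall>N\<ge>N0. nrm (\<lambda>x. (cube_euler (t / real n) N ^^ n) f x - T t f x) \<le> \<epsilon>"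
        using exponential_formula[OF f t eps] by blast
      \<comment> \<open>The number of steps is 2j because the kernel bound is stated for
        \<open>n + n\<close>; j \<ge> t keeps the step size below 1.\<close>
      define j where "j = max 1 (max n0 (nat \<lceil>t\<rceil>))"
      have j: "1 \<le> j" "n0 \<le> j + j" "t \<le> real j" unfolding j_def by linarith+
      define \<tau> where "\<tau> = t / real (j + j)"
      have j0: "0 < real j" using j(1) by simp
      have tau1: "0 < \<tau>" using t j0 by (simp add: \<tau>_def)
      have tau2: "\<tau> \<le> 1" using j(3) j0 by (simp add: \<tau>_def)
      have tau3: "real j * \<tau> = t / 2" using j0 by (simp add: \<tau>_def)
      note tau = tau1 tau2 tau3
      have "1 \<le> j + j" using j(1) by simp
      from n0[OF j(2) this] obtain N where
        "\<forall>N'\<ge>N. nrm (\<lambda>x. (cube_euler \<tau> N' ^^ (j + j)) f x - T t f x) \<le> \<epsilon>"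
        unfolding \<tau>_def by (elim exE)
      then have N: "nrm (\<lambda>x. (cube_euler \<tau> N ^^ (j + j)) f x - T t f x) \<le> \<epsilon>"
        by (elim allE[of _ N]) simp
      interpret A: speed_chain "nat_ball N" c rate "\<theta> \<omega>" \<tau> by (rule speed_chain_ball[OF tau(1)])
      have edges: "(\<Sum>i\<in>UNIV. inverse (c y (y + e1 i))) \<le> \<nu> y" for y
        by (rule order.trans[OF sum_edges_le_nu nu_ge])
      have moments: "(\<Sum>y\<in>nat_ball N. c x y * real_of_int (l1_dist x y) powr m) \<le> V x" for x
        by (rule order.trans[OF sum_moment_le[OF mm(3) finite_nat_ball mu_fin'] V_ge(1)])
      have nd: "nash_data c rate (nat_ball N) V \<nu> \<tau> dd P' Q' m (kV * M) (k * M)"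
        by unfold_locales
          (rule finite_nat_ball zero_in_nat_ball dd_def d3 PQ0 PQ mm sV sN KV1 K1 edges V_ge moments tau)+
      have ker: "A.kernel 0 (j + j) 0 \<le> R"
        unfolding R_def tau(3)[symmetric] by (rule C(2)[rule_format, OF conjI[OF nd]]) (use j(1) in \<open>simp add: th V_ge(2)\<close>)
      have pow: "(cube_euler \<tau> N ^^ (j + j)) f 0 / \<theta> \<omega> 0 = A.kernel 0 (j + j) 0"
      proof -
        have sc: "(A.J ^^ n) (\<lambda>x. s * g x) = (\<lambda>x. s * (A.J ^^ n) g x)" for n s g
          by (induction n) (simp_all add: A.J_scale)
        show ?thesis using sc[of "j + j" "1 / \<theta> \<omega> 0" f]
          by (simp add: A.kernel_def cube_euler_def f_def)
      qed
      have KH: "(cube_euler \<tau> N ^^ (j + j)) f \<in> L2 (\<theta> \<omega>)" by (rule cube_euler_pow_H[OF tau(1) f])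
      let ?\<Delta> = "(cube_euler \<tau> N ^^ (j + j)) f 0 - T t f 0"
      have "\<theta> \<omega> 0 * ?\<Delta>\<^sup>2 \<le> (nrm (\<lambda>x. (cube_euler \<tau> N ^^ (j + j)) f x - T t f x))\<^sup>2"
        using finite_sum_le_nrm[OF L2_diff[OF KH T_H[OF t f]], of "{0}"] by simp
      also have "\<dots> \<le> \<epsilon>\<^sup>2" using N nrm_nonneg by (intro power_mono) auto
      finally have "sqrt (\<theta> \<omega> 0 * ?\<Delta>\<^sup>2) \<le> \<epsilon>" using eps by (intro real_le_lsqrt) auto
      then have "sqrt (\<theta> \<omega> 0) * \<bar>?\<Delta>\<bar> \<le> sqrt (\<theta> \<omega> 0) * (e * \<theta> \<omega> 0)"
        by (simp add: real_sqrt_mult \<epsilon>_def mult_ac)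
      then have "\<bar>?\<Delta>\<bar> \<le> e * \<theta> \<omega> 0" using th by simp
      then have "T t f 0 \<le> (cube_euler \<tau> N ^^ (j + j)) f 0 + e * \<theta> \<omega> 0" by linarith
      then have "T t f 0 / \<theta> \<omega> 0 \<le> (cube_euler \<tau> N ^^ (j + j)) f 0 / \<theta> \<omega> 0 + e"
        using th[rule_format, of 0] by (simp add: field_simps)
      then show "T t f 0 / \<theta> \<omega> 0 \<le> R + e" using pow ker by linarith
    qed
    also have "R = C' * M powr (1 + 4 * dd / a') * t powr (- dd / 2)"
    proof -
      have k0: "0 \<le> k" "0 \<le> kV" by (simp_all add: k_def kV_def)
      have b4: "(1 + b / 2) * (2 / (b - 2)) = 1 + 4 * dd / a'"
      proof -
        have "dd \<noteq> 0" "a' \<noteq> 0" using a' d3 by auto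
        then show ?thesis by (simp add: b_def divide_simps)
      qed
      have "kV * M * (k * M) powr (b / 2) = kV * k powr (b / 2) * (M * M powr (b / 2))"
        using k0 M by (simp add: powr_mult)
      also have "M * M powr (b / 2) = M powr (1 + b / 2)" unfolding powr_add using M by simp
      finally have "(kV * M * (k * M) powr (b / 2)) powr (2 / (b - 2))
          = (kV * k powr (b / 2)) powr (2 / (b - 2)) * M powr (1 + 4 * dd / a')"
        by (simp only: powr_mult powr_powr b4)
      moreover have "(t / 2) powr (- dd / 2) = (1 / 2) powr (- dd / 2) * t powr (- dd / 2)"
        using powr_mult[of "1 / 2" t "- dd / 2"] t by simp
      ultimately show ?thesis unfolding R_def C'_def by (simp only: mult_ac)
    qed
    also have "T t f 0 / \<theta> \<omega> 0 = heat_kernel (\<theta> \<omega>) PP t 0 0"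
      unfolding f_def by (rule heat_kernel_eq_semigroup[OF Tsem(2) t Tsem(3) f[unfolded f_def], symmetric])
    finally show ?thesis by (simp add: M_def)
  qed
  then show ?thesis unfolding ea dd_def[symmetric] by (intro exI[of _ C'] conjI allI impI C') (elim conjE, assumption)
qed

section \<open>The maximal inequality\<close>

lemma env_shift_bond:
  assumes "x \<noteq> y" shows "env_shift z \<omega> {x, y} = \<omega> {x + z, y + z}"
proof -
  have "{x, y} \<in> bonds" unfolding bonds_def using assms by blast
  then show ?thesis by (simp add: env_shift_def)
qed

lemma cond_env_shift: "cond (env_shift z \<omega>) x y = cond \<omega> (x + z) (y + z)"
  by (simp add: cond_def env_shift_bond)

lemma mu_env_shift: "mu m (env_shift z \<omega>) x = mu m \<omega> (x + z)"
proof -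
  have b: "bij_betw (\<lambda>y. y + z) UNIV UNIV"
    by (rule bij_betw_byWitness[where f' = "\<lambda>y. y - z"]) auto
  show ?thesis
    using infsum_reindex_bij_betw[OF b, of "\<lambda>y. ennreal (cond \<omega> (x + z) y * of_int (l1_dist (x + z) y) powr m)"]
    by (simp add: mu_def cond_env_shift l1_dist_add_right)
qed

lemma nu_env_shift: "nu (env_shift z \<omega>) x = nu \<omega> (x + z)"
proof -
  have "l1_dist x (y - z) = l1_dist (x + z) y" for y
    using l1_dist_add_right[of x z "y - z"] by simp
  then have "bij_betw (\<lambda>y. y + z) {y. l1_dist x y = 1} {y. l1_dist (x + z) y = 1}"
    by (intro bij_betw_byWitness[where f' = "\<lambda>y. y - z"]) (auto simp: l1_dist_add_right)
  from sum.reindex_bij_betw[OF this, of "\<lambda>y. inverse (cond \<omega> (x + z) y)"]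
  show ?thesis by (simp add: nu_def cond_env_shift)
qed

lemma bond_translate: "(\<lambda>v. v + z) ` e \<in> bonds \<longleftrightarrow> e \<in> bonds" for z :: "'d::finite site"
proof
  assume "(\<lambda>v. v + z) ` e \<in> bonds"
  then obtain x y where "(\<lambda>v. v + z) ` e = {x, y}" "x \<noteq> y" by (auto simp: bonds_def)
  then have "(\<lambda>v. v - z) ` (\<lambda>v. v + z) ` e = {x - z, y - z}" by simp
  then have "e = {x - z, y - z}" by (simp add: image_image)
  moreover have "x - z \<noteq> y - z" using \<open>x \<noteq> y\<close> by simp
  ultimately show "e \<in> bonds" unfolding bonds_def by (intro CollectI exI conjI)
next
  assume "e \<in> bonds"
  then obtain x y where "e = {x, y}" "x \<noteq> y" by (auto simp: bonds_def)
  then have "(\<lambda>v. v + z) ` e = {x + z, y + z}" "x + z \<noteq> y + z" by simp_all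
  then show "(\<lambda>v. v + z) ` e \<in> bonds" unfolding bonds_def by (intro CollectI exI conjI)
qed

lemma env_shift_env_shift: "env_shift y (env_shift x \<omega>) = env_shift (x + y) \<omega>"
proof
  fix e
  show "env_shift y (env_shift x \<omega>) e = env_shift (x + y) \<omega> e"
  proof (cases "e \<in> bonds")
    case True
    then have "(\<lambda>v. v + y) ` e \<in> bonds" by (simp only: bond_translate)
    moreover have "(\<lambda>v. v + x) ` (\<lambda>v. v + y) ` e = (\<lambda>v. v + (x + y)) ` e"
      unfolding image_image by (rule image_cong) (simp_all only: add_ac)
    ultimately show ?thesis using True unfolding env_shift_def by (simp only: restrict_apply if_True)
  next
    case False
    then show ?thesis unfolding env_shift_def by (simp only: restrict_apply if_False)
  qed
qed

lemma measurable_env_shift: "env_shift z \<in> measurable env_space env_space"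
  unfolding env_space_def env_shift_def
  by (intro measurable_restrict measurable_component_singleton) (simp add: bond_translate)

text \<open>Vitali's selection: take an element with the largest \<open>n\<close>, discard
  everything that meets it, and continue with the rest.\<close>

lemma greedy_disjoint:
  fixes n :: "'a \<Rightarrow> nat"
  assumes "finite E" and meets: "\<And>x. M x x" "\<And>x y. M x y \<Longrightarrow> M y x"
  shows "\<exists>D\<subseteq>E. (\<forall>x\<in>D. \<forall>y\<in>D. x \<noteq> y \<longrightarrow> \<not> M x y) \<and> (\<forall>x\<in>E. \<exists>y\<in>D. n x \<le> n y \<and> M x y)"
  using assms(1)
proof (induction E rule: finite_psubset_induct)
  case (psubset E)
  show ?case
  proof (cases "E = {}")
    case False
    have "Max (n ` E) \<in> n ` E" using psubset.hyps False by (intro Max_in) auto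
    then obtain y where y0: "y \<in> E" "Max (n ` E) = n y" by (elim imageE) simp
    have y: "y \<in> E" "\<And>x. x \<in> E \<Longrightarrow> n x \<le> n y"
      using y0(1) Max_ge[OF finite_imageI[OF psubset.hyps(1)] imageI, of _ n] unfolding y0(2) by simp_all
    let ?E = "{x \<in> E. \<not> M x y}"
    have "?E \<subset> E" using y(1) meets(1)[of y] by blast
    from psubset.IH[OF this] obtain D where D: "D \<subseteq> ?E" "\<forall>x\<in>D. \<forall>y\<in>D. x \<noteq> y \<longrightarrow> \<not> M x y" "\<forall>x\<in>?E. \<exists>y\<in>D. n x \<le> n y \<and> M x y"
      by (elim exE conjE)
    show ?thesis
    proof (intro exI[of _ "insert y D"] conjI ballI impI)
      show "insert y D \<subseteq> E" using y(1) D(1) by auto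
      fix x z assume "x \<in> insert y D" "z \<in> insert y D" "x \<noteq> z"
      then show "\<not> M x z" using D meets(2) by blast
    next
      fix x assume x: "x \<in> E"
      show "\<exists>z\<in>insert y D. n x \<le> n z \<and> M x z"
      proof (cases "M x y")
        case True then show ?thesis using y(2)[OF x] by blast
      next
        case False then show ?thesis using D(3) x by blast
      qed
    qed
  qed simp
qed

lemma nat_ball_doubling:
  assumes "1 \<le> n"
  shows "real (card (nat_ball (n + n) :: 'd::finite site set)) \<le> (6 * real CARD('d)) ^ CARD('d) * real (card (nat_ball n :: 'd site set))"
proof -
  have "real (card (nat_ball (n + n) :: 'd site set)) \<le> real ((3 * (n + n)) ^ CARD('d))"
    by (rule of_nat_mono[OF card_nat_ball_le]) (use assms in simp)
  also have "\<dots> = (6 * real CARD('d) * (real n / real CARD('d))) ^ CARD('d)" by simp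
  also have "\<dots> = (6 * real CARD('d)) ^ CARD('d) * (real n / real CARD('d)) ^ CARD('d)"
    by (rule power_mult_distrib)
  also have "\<dots> \<le> (6 * real CARD('d)) ^ CARD('d) * real (card (nat_ball n :: 'd site set))"
    by (intro mult_left_mono card_nat_ball_ge) auto
  finally show ?thesis .
qed

text \<open>Only the centres have to be covered, not the balls, so doubling the selected balls
  suffices where Vitali's lemma triples them. The selected balls are disjoint, so their sums of
  \<open>g\<close> add up inside one large ball.\<close>

lemma vitali_count:
  fixes g :: "'d::finite site \<Rightarrow> ennreal" and n :: "'d site \<Rightarrow> nat"
  assumes E: "E \<subseteq> nat_ball N" and n: "\<And>y. y \<in> E \<Longrightarrow> 1 \<le> n y \<and> n y \<le> N"
    and dens: "\<And>y. y \<in> E \<Longrightarrow> lv * of_nat (card (nat_ball (n y) :: 'd site set)) \<le> (\<Sum>z\<in>nat_ball (n y). g (y + z))"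
  shows "lv * of_nat (card E) \<le> ennreal ((6 * real CARD('d)) ^ CARD('d)) * (\<Sum>x\<in>nat_ball (N + N). g x)"
proof -
  let ?K = "(6 * real CARD('d)) ^ CARD('d)"
  let ?B = "\<lambda>y. (+) y ` nat_ball (n y)"
  have finE: "finite E" using E finite_subset finite_nat_ball by blast
  let ?M = "\<lambda>x y. ?B x \<inter> ?B y \<noteq> {}"
  have "nat_ball k \<noteq> ({} :: 'd site set)" for k using zero_in_nat_ball[of k] by (metis empty_iff)
  then have refl: "?M x x" for x by simp
  have sym: "?M y x" if "?M x y" for x y using that by (simp add: Int_commute)
  have "\<exists>D\<subseteq>E. (\<forall>x\<in>D. \<forall>y\<in>D. x \<noteq> y \<longrightarrow> \<not> ?M x y) \<and> (\<forall>x\<in>E. \<exists>y\<in>D. n x \<le> n y \<and> ?M x y)"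
    by (rule greedy_disjoint[where M = ?M and n = n, OF finE refl]) (rule sym)
  then obtain D where D: "D \<subseteq> E" "\<forall>x\<in>D. \<forall>y\<in>D. x \<noteq> y \<longrightarrow> \<not> ?M x y"
    "\<forall>x\<in>E. \<exists>y\<in>D. n x \<le> n y \<and> ?M x y" by (elim exE conjE)
  have finD: "finite D" using D(1) finE finite_subset by blast
  have cover: "E \<subseteq> (\<Union>y\<in>D. (+) y ` nat_ball (n y + n y))"
  proof
    fix x assume "x \<in> E"
    from D(3)[rule_format, OF this] obtain y where y: "y \<in> D" "n x \<le> n y" "?B x \<inter> ?B y \<noteq> {}" by blast
    then obtain a b where ab: "a \<in> nat_ball (n x)" "b \<in> nat_ball (n y)" "x + a = y + b" by blast
    have "x - y = b - a" using ab(3) by (simp add: algebra_simps)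
    moreover have "l1_dist 0 (b - a) \<le> l1_dist 0 b + l1_dist 0 a"
      using l1_dist_zero_add_le[of b "- a"] by (simp add: l1_dist_def)
    ultimately have "x - y \<in> nat_ball (n y + n y)" using ab y(2) by (simp add: nat_ball_def)
    then show "x \<in> (\<Union>y\<in>D. (+) y ` nat_ball (n y + n y))"
      by (intro UN_I[OF y(1)] image_eqI[of _ _ "x - y"]) simp_all
  qed
  have "card E \<le> (\<Sum>y\<in>D. card ((+) y ` nat_ball (n y + n y)))"
    by (rule order.trans[OF card_mono[OF _ cover] card_UN_le]) (use finD in auto)
  also have "\<dots> = (\<Sum>y\<in>D. card (nat_ball (n y + n y) :: 'd site set))"
    by (simp add: card_image)
  finally have "card E \<le> (\<Sum>y\<in>D. card (nat_ball (n y + n y) :: 'd site set))" .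
  then have "real (card E) \<le> real (\<Sum>y\<in>D. card (nat_ball (n y + n y) :: 'd site set))" by (rule of_nat_mono)
  also have "\<dots> = (\<Sum>y\<in>D. real (card (nat_ball (n y + n y) :: 'd site set)))" by (rule of_nat_sum)
  also have "\<dots> \<le> (\<Sum>y\<in>D. ?K * real (card (nat_ball (n y) :: 'd site set)))"
    using D(1) n by (intro sum_mono nat_ball_doubling) auto
  also have "\<dots> = ?K * real (\<Sum>y\<in>D. card (nat_ball (n y) :: 'd site set))"
    by (simp add: sum_distrib_left)
  finally have "ennreal (real (card E)) \<le> ennreal (?K * real (\<Sum>y\<in>D. card (nat_ball (n y) :: 'd site set)))"
    by (rule ennreal_leI)
  then have "of_nat (card E) \<le> ennreal ?K * (of_nat (\<Sum>y\<in>D. card (nat_ball (n y) :: 'd site set)) :: ennreal)"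
    by (simp only: ennreal_mult'' of_nat_0_le_iff ennreal_of_nat_eq_real_of_nat)
  then have "lv * of_nat (card E) \<le> lv * (ennreal ?K * of_nat (\<Sum>y\<in>D. card (nat_ball (n y) :: 'd site set)))"
    by (rule mult_left_mono) simp
  also have "\<dots> = ennreal ?K * (\<Sum>y\<in>D. lv * of_nat (card (nat_ball (n y) :: 'd site set)))"
    unfolding of_nat_sum sum_distrib_left[symmetric] by (simp only: mult_ac)
  also have "\<dots> \<le> ennreal ?K * (\<Sum>y\<in>D. \<Sum>x\<in>?B y. g x)"
  proof (intro mult_left_mono sum_mono)
    fix y assume "y \<in> D"
    then have "y \<in> E" using D(1) by (rule subsetD[rotated])
    then show "lv * of_nat (card (nat_ball (n y) :: 'd site set)) \<le> (\<Sum>x\<in>?B y. g x)"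
      using dens by (simp add: sum.reindex)
  qed simp
  also have "(\<Sum>y\<in>D. \<Sum>x\<in>?B y. g x) = (\<Sum>x\<in>(\<Union>y\<in>D. ?B y). g x)"
    by (rule sum.UNION_disjoint[symmetric]) (use finD D(2) in auto)
  also have "\<dots> \<le> (\<Sum>x\<in>nat_ball (N + N). g x)"
  proof (rule sum_mono2)
    show "(\<Union>y\<in>D. ?B y) \<subseteq> nat_ball (N + N)"
    proof
      fix x assume "x \<in> (\<Union>y\<in>D. ?B y)"
      then obtain y z where yz: "y \<in> D" "z \<in> nat_ball (n y)" "x = y + z" by blast
      then have "y \<in> nat_ball N" "n y \<le> N" using D(1) E n by blast+
      then show "x \<in> nat_ball (N + N)" using yz l1_dist_zero_add_le[of y z] by (simp add: nat_ball_def)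
    qed
  qed auto
  finally show ?thesis by (simp add: mult_left_mono)
qed

section \<open>Transfer to the probability space\<close>

locale stationary_env =
  fixes PP :: "'d::finite env measure"
  assumes prob: "prob_space PP" and sets_PP: "sets PP = sets env_space" and stat: "stationary_law PP"
begin

lemma space_PP: "space PP = space env_space" using sets_PP by (rule sets_eq_imp_space_eq)

lemma shift_measurable: "env_shift z \<in> measurable PP PP"
  using measurable_env_shift measurable_cong_sets[OF sets_PP sets_PP] by blast

lemma distr_shift: "distr PP PP (env_shift z) = PP"
proof -
  have "distr PP PP (env_shift z) = distr PP env_space (env_shift z)"
    by (rule distr_cong) (simp_all add: sets_PP)
  then show ?thesis using stat by (simp add: stationary_law_def)
qed

lemma nn_integral_shift: "h \<in> borel_measurable PP \<Longrightarrow> (\<integral>\<^sup>+ \<omega>. h (env_shift z \<omega>) \<partial>PP) = (\<integral>\<^sup>+ \<omega>. h \<omega> \<partial>PP)"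
  using nn_integral_distr[OF shift_measurable, of h z] by (simp add: distr_shift)

lemma AE_shift: "(AE \<omega> in PP. Q \<omega>) \<Longrightarrow> AE \<omega> in PP. Q (env_shift z \<omega>)"
proof -
  assume "AE \<omega> in PP. Q \<omega>"
  then obtain N where N: "N \<in> null_sets PP" "{\<omega> \<in> space PP. \<not> Q \<omega>} \<subseteq> N" by (auto simp: eventually_ae_filter)
  have "emeasure PP (env_shift z -` N \<inter> space PP) = emeasure (distr PP PP (env_shift z)) N"
    by (rule emeasure_distr[symmetric, OF shift_measurable]) (use N in auto)
  also have "\<dots> = 0" using N by (simp add: distr_shift null_sets_def)
  finally have "env_shift z -` N \<inter> space PP \<in> null_sets PP"
    using measurable_sets[OF shift_measurable] N by (auto simp: null_sets_def)
  moreover have "{\<omega> \<in> space PP. \<not> Q (env_shift z \<omega>)} \<subseteq> env_shift z -` N \<inter> space PP"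
    using N(2) measurable_space[OF shift_measurable] by auto
  ultimately show ?thesis unfolding eventually_ae_filter by blast
qed

lemma AE_all_sites: "(\<And>y. AE \<omega> in PP. Q y \<omega>) \<Longrightarrow> AE \<omega> in PP. \<forall>y :: 'd site. Q y \<omega>"
proof -
  have "(\<Union>n. nat_ball n) = (UNIV :: 'd site set)" using nat_ball_exhausts by blast
  moreover have "countable (\<Union>n. nat_ball n :: 'd site set)"
    by (intro countable_UN countableI_type countable_finite finite_nat_ball)
  ultimately have "countable (UNIV :: 'd site set)" by (simp only:)
  then show "(\<And>y. AE \<omega> in PP. Q y \<omega>) \<Longrightarrow> AE \<omega> in PP. \<forall>y :: 'd site. Q y \<omega>"
    using AE_ball_countable[of "UNIV :: 'd site set" "\<lambda>\<omega> y. Q y \<omega>" PP] by simp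
qed

definition ball_sum :: "('d env \<Rightarrow> ennreal) \<Rightarrow> nat \<Rightarrow> 'd env \<Rightarrow> ennreal" where
  "ball_sum h n \<omega> = (\<Sum>z\<in>nat_ball n. h (env_shift z \<omega>))"

lemma ball_sum_measurable: "h \<in> borel_measurable PP \<Longrightarrow> ball_sum h n \<in> borel_measurable PP"
  unfolding ball_sum_def
  by (intro borel_measurable_sum) (rule measurable_compose[OF shift_measurable])

text \<open>The level is multiplied by the volume to avoid dividing in \<open>ennreal\<close>.
  Truncation at \<open>N\<close> keeps the covering balls within radius 2N.\<close>

definition exceed :: "('d env \<Rightarrow> ennreal) \<Rightarrow> ennreal \<Rightarrow> nat \<Rightarrow> 'd env set" where
  "exceed h lv N = {\<omega> \<in> space PP. \<exists>n\<in>{1..N}. lv * of_nat (card (nat_ball n :: 'd site set)) \<le> ball_sum h n \<omega>}"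

lemma exceed_sets: "h \<in> borel_measurable PP \<Longrightarrow> exceed h lv N \<in> sets PP"
proof -
  assume h: "h \<in> borel_measurable PP"
  have "exceed h lv N = (\<Union>n\<in>{1..N}. {\<omega> \<in> space PP. lv * of_nat (card (nat_ball n :: 'd site set)) \<le> ball_sum h n \<omega>})"
    by (auto simp: exceed_def)
  also have "\<dots> \<in> sets PP"
    by (intro sets.finite_UN borel_measurable_le ball_sum_measurable h borel_measurable_const) auto
  finally show ?thesis .
qed

text \<open>Wiener's maximal inequality: the covering argument along the orbit, integrated over the
  ball of radius \<open>N\<close>, transfers to the probability space by stationarity.\<close>

lemma maximal_inequality_finite:
  assumes h: "h \<in> borel_measurable PP" and N: "1 \<le> N"
  shows "lv * emeasure PP (exceed h lv N) \<le> ennreal (((6 * real CARD('d)) ^ CARD('d))\<^sup>2) * (\<integral>\<^sup>+ \<omega>. h \<omega> \<partial>PP)"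
proof -
  let ?K = "(6 * real CARD('d)) ^ CARD('d)"
  let ?I = "\<integral>\<^sup>+ \<omega>. h \<omega> \<partial>PP"
  have pt: "lv * (\<Sum>y\<in>nat_ball N. indicator (exceed h lv N) (env_shift y \<omega>)) \<le> ennreal ?K * ball_sum h (N + N) \<omega>"
    if om: "\<omega> \<in> space PP" for \<omega>
  proof -
    define E where "E = {y \<in> nat_ball N. env_shift y \<omega> \<in> exceed h lv N}"
    have "\<forall>y\<in>E. \<exists>n. 1 \<le> n \<and> n \<le> N \<and> lv * of_nat (card (nat_ball n :: 'd site set)) \<le> ball_sum h n (env_shift y \<omega>)"
      by (auto simp: E_def exceed_def)
    then obtain n where n: "\<And>y. y \<in> E \<Longrightarrow> 1 \<le> n y \<and> n y \<le> N \<and> lv * of_nat (card (nat_ball (n y) :: 'd site set)) \<le> ball_sum h (n y) (env_shift y \<omega>)"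
      by metis
    have "lv * of_nat (card E) \<le> ennreal ?K * (\<Sum>x\<in>nat_ball (N + N). h (env_shift x \<omega>))"
    proof (rule vitali_count[where n = n])
      show "E \<subseteq> nat_ball N" by (auto simp: E_def)
      fix y assume y: "y \<in> E"
      then show "1 \<le> n y \<and> n y \<le> N" using n by blast
      show "lv * of_nat (card (nat_ball (n y) :: 'd site set)) \<le> (\<Sum>z\<in>nat_ball (n y). h (env_shift (y + z) \<omega>))"
        using n[OF y] by (simp add: ball_sum_def env_shift_env_shift)
    qed
    moreover have "(\<Sum>y\<in>nat_ball N. indicator (exceed h lv N) (env_shift y \<omega>)) = (of_nat (card E) :: ennreal)"
      by (simp add: E_def indicator_def of_bool_def sum.If_cases Int_def)
    ultimately show ?thesis by (simp add: ball_sum_def)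
  qed
  have iE: "(\<integral>\<^sup>+ \<omega>. indicator (exceed h lv N) (env_shift y \<omega>) \<partial>PP) = emeasure PP (exceed h lv N)" for y
    using nn_integral_shift[of "indicator (exceed h lv N)" y] exceed_sets[OF h] by simp
  have m: "(\<lambda>\<omega>. indicator (exceed h lv N) (env_shift y \<omega>) :: ennreal) \<in> borel_measurable PP" for y
    using measurable_compose[OF shift_measurable borel_measurable_indicator[OF exceed_sets[OF h]]] .
  have "lv * (of_nat (card (nat_ball N :: 'd site set)) * emeasure PP (exceed h lv N)) = lv * (\<Sum>y\<in>nat_ball N. (\<integral>\<^sup>+ \<omega>. indicator (exceed h lv N) (env_shift y \<omega>) \<partial>PP))"
    by (simp add: iE)
  also have "\<dots> = (\<integral>\<^sup>+ \<omega>. lv * (\<Sum>y\<in>nat_ball N. indicator (exceed h lv N) (env_shift y \<omega>)) \<partial>PP)"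
    by (subst nn_integral_cmult) (auto intro!: borel_measurable_sum m simp: nn_integral_sum m)
  also have "\<dots> \<le> (\<integral>\<^sup>+ \<omega>. ennreal ?K * ball_sum h (N + N) \<omega> \<partial>PP)"
    by (rule nn_integral_mono) (rule pt)
  also have "\<dots> = ennreal ?K * (\<Sum>z\<in>nat_ball (N + N). (\<integral>\<^sup>+ \<omega>. h (env_shift z \<omega>) \<partial>PP))"
    by (simp add: nn_integral_cmult ball_sum_measurable h)
       (simp add: ball_sum_def nn_integral_sum measurable_compose[OF shift_measurable h])
  also have "\<dots> = ennreal ?K * (of_nat (card (nat_ball (N + N) :: 'd site set)) * ?I)" by (simp add: nn_integral_shift h)
  \<comment> \<open>The second factor of the constant: the covering balls reach out to radius 2N,
    while the events are averaged over radius \<open>N\<close>.\<close>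
  also have "\<dots> \<le> ennreal ?K * ((ennreal ?K * of_nat (card (nat_ball N :: 'd site set))) * ?I)"
  proof (intro mult_left_mono mult_right_mono)
    have "ennreal (real (card (nat_ball (N + N) :: 'd site set))) \<le> ennreal (?K * real (card (nat_ball N :: 'd site set)))"
      by (rule ennreal_leI[OF nat_ball_doubling[OF N]])
    then show "of_nat (card (nat_ball (N + N) :: 'd site set)) \<le> ennreal ?K * of_nat (card (nat_ball N :: 'd site set))"
      by (simp only: ennreal_mult'' of_nat_0_le_iff ennreal_of_nat_eq_real_of_nat)
  qed auto
  finally have "of_nat (card (nat_ball N :: 'd site set)) * (lv * emeasure PP (exceed h lv N)) \<le> of_nat (card (nat_ball N :: 'd site set)) * (ennreal (?K\<^sup>2) * ?I)"
    by (simp add: power2_eq_square ennreal_mult mult_ac)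
  moreover have "(of_nat (card (nat_ball N :: 'd site set)) :: ennreal) \<noteq> 0"
    using card_nat_ball_pos[of N, where 'd = 'd] by (simp only: of_nat_eq_0_iff neq0_conv)
  ultimately show ?thesis
    using ennreal_mult_le_mult_iff[of "of_nat (card (nat_ball N :: 'd site set))"] by (simp add: of_nat_less_top)
qed

text \<open>On the set \<open>Z\<close> where the maximal function is infinite every integer level k
  is exceeded, so k times its probability is at most a fixed finite \<open>K\<close>.\<close>

lemma maximal_function_finite:
  assumes h: "h \<in> borel_measurable PP" and int: "(\<integral>\<^sup>+ \<omega>. h \<omega> \<partial>PP) < \<infinity>"
  shows "AE \<omega> in PP. (SUP n\<in>{1..}. ball_sum h n \<omega> / of_nat (card (nat_ball n :: 'd site set))) < \<infinity>"
proof -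
  define K where "K = ennreal (((6 * real CARD('d)) ^ CARD('d))\<^sup>2) * (\<integral>\<^sup>+ \<omega>. h \<omega> \<partial>PP)"
  have K: "K < \<infinity>" using int by (simp add: K_def ennreal_mult_less_top)
  define Z where "Z = {\<omega> \<in> space PP. (SUP n\<in>{1..}. ball_sum h n \<omega> / of_nat (card (nat_ball n :: 'd site set))) = \<infinity>}"
  have Zs: "Z \<in> sets PP" unfolding Z_def
    by (intro borel_measurable_eq borel_measurable_SUP ball_sum_measurable[THEN borel_measurable_divide_ennreal] h
        borel_measurable_const) auto
  have bound: "of_nat k * emeasure PP Z \<le> K" for k :: nat
  proof -
    have sub: "Z \<subseteq> (\<Union>N. exceed h (of_nat k) (Suc N))"
    proof
      fix \<omega> assume w: "\<omega> \<in> Z"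
      then have "of_nat k < (SUP n\<in>{1..}. ball_sum h n \<omega> / of_nat (card (nat_ball n :: 'd site set)))" unfolding Z_def by (elim CollectE conjE) (simp only: infinity_ennreal_def of_nat_less_top)
      then obtain n where n: "1 \<le> n" "of_nat k < ball_sum h n \<omega> / of_nat (card (nat_ball n :: 'd site set))" by (auto simp: less_SUP_iff)
      define v :: ennreal where "v = of_nat (card (nat_ball n :: 'd site set))"
      have v: "v \<noteq> 0" "v < \<infinity>"
        using card_nat_ball_pos[of n, where 'd = 'd] unfolding v_def infinity_ennreal_def
        by (simp only: of_nat_eq_0_iff neq0_conv) (rule of_nat_less_top)
      have "of_nat k * v \<le> ball_sum h n \<omega> / v * v" using n(2) unfolding v_def by (intro mult_right_mono) auto
      also have "\<dots> = ball_sum h n \<omega>" using v ennreal_divide_times[of "ball_sum h n \<omega>" v v]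
        by (simp add: ennreal_divide_self flip: ennreal_times_divide)
      finally have "\<omega> \<in> exceed h (of_nat k) (Suc n)" using w n(1) by (auto simp: exceed_def Z_def v_def)
      then show "\<omega> \<in> (\<Union>N. exceed h (of_nat k) (Suc N))" by blast
    qed
    have inc: "incseq (\<lambda>N. exceed h (of_nat k) (Suc N))" by (auto simp: incseq_def exceed_def)
    have "of_nat k * emeasure PP Z \<le> of_nat k * emeasure PP (\<Union>N. exceed h (of_nat k) (Suc N))"
      by (intro mult_left_mono emeasure_mono sub) (auto intro: exceed_sets h)
    also have "emeasure PP (\<Union>N. exceed h (of_nat k) (Suc N)) = (SUP N. emeasure PP (exceed h (of_nat k) (Suc N)))"
      by (rule SUP_emeasure_incseq[symmetric]) (use inc exceed_sets[OF h] in auto)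
    also have "of_nat k * \<dots> = (SUP N. of_nat k * emeasure PP (exceed h (of_nat k) (Suc N)))"
      by (rule SUP_mult_left_ennreal)
    also have "\<dots> \<le> K" unfolding K_def by (rule SUP_least) (rule maximal_inequality_finite[OF h], simp)
    finally show ?thesis .
  qed
  have "emeasure PP Z = 0"
  proof (rule ccontr)
    assume "emeasure PP Z \<noteq> 0"
    interpret prob_space PP by (rule prob)
    define z where "z = measure PP Z"
    have z: "emeasure PP Z = ennreal z" by (simp add: z_def emeasure_eq_measure)
    then have z0: "0 < z" using \<open>emeasure PP Z \<noteq> 0\<close> by (metis ennreal_neg linorder_not_less)
    obtain \<kappa> where \<kappa>: "K = ennreal \<kappa>" "0 \<le> \<kappa>" using K by (cases K) auto
    obtain k :: nat where "\<kappa> / z < real k" using reals_Archimedean2 by blast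
    then have "\<kappa> < real k * z" using z0 by (simp add: field_simps)
    moreover have "ennreal (real k * z) \<le> ennreal \<kappa>"
      using bound[of k] z0 by (simp add: z \<kappa> ennreal_mult ennreal_of_nat_eq_real_of_nat)
    ultimately show False using \<kappa>(2) by (simp add: ennreal_le_iff)
  qed
  then have "Z \<in> null_sets PP" using Zs by (simp add: null_sets_def)
  then show ?thesis by (rule AE_I') (unfold Z_def infinity_ennreal_def, use less_top in blast)
qed

end

lemma borel_measurable_epowr:
  assumes [measurable]: "f \<in> borel_measurable M"
  shows "(\<lambda>x. epowr (f x) r) \<in> borel_measurable M"
  unfolding epowr_def by measurable

context stationary_env
begin

lemma in_Lp_finite:
  assumes "in_Lp PP p F"
  shows "AE \<omega> in PP. F \<omega> < \<infinity>"
proof (cases "p = \<infinity>")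
  case True
  then have "esssup PP F < \<infinity>" using assms by (simp add: in_Lp_def)
  with esssup_AE[of F PP] show ?thesis by (auto elim!: eventually_mono)
next
  case False
  have "(\<lambda>\<omega>. epowr (F \<omega>) (enn2real p)) \<in> borel_measurable PP"
    using assms by (intro borel_measurable_epowr) (simp add: in_Lp_def)
  moreover have "(\<integral>\<^sup>+ \<omega>. epowr (F \<omega>) (enn2real p) \<partial>PP) \<noteq> \<infinity>"
    using assms False by (auto simp: in_Lp_def)
  ultimately have "AE \<omega> in PP. epowr (F \<omega>) (enn2real p) \<noteq> \<infinity>" by (rule nn_integral_PInf_AE)
  then show ?thesis
  proof (rule eventually_mono)
    fix \<omega> assume "epowr (F \<omega>) (enn2real p) \<noteq> \<infinity>"
    then have "epowr (F \<omega>) (enn2real p) < \<infinity>" by (simp add: less_top)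
    then show "F \<omega> < \<infinity>" by (simp only: epowr_finite_iff)
  qed
qed

text \<open>For finite \<open>p\<close> the maximal function is that of max(1, F)^p, and taking
  roots is monotone. For \<open>p = \<infinity>\<close> the essential supremum bounds
  \<open>F\<close> at all shifts simultaneously, as there are countably many.\<close>

lemma maximal_avg_norm_finite:
  assumes F: "in_Lp PP p F"
  shows "AE \<omega> in PP. (SUP n\<in>{1..}. avg_norm p (nat_ball n) (\<lambda>y :: 'd site. max 1 (F (env_shift y \<omega>)))) < \<infinity>"
proof (cases "p = \<infinity>")
  case True
  define E where "E = max 1 (esssup PP F)"
  have E: "E < \<infinity>" using F by (simp add: E_def True in_Lp_def)
  have "AE \<omega> in PP. \<forall>y :: 'd site. F (env_shift y \<omega>) \<le> esssup PP F"
    by (intro AE_all_sites AE_shift esssup_AE)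
  then show ?thesis
  proof (rule eventually_mono)
    fix \<omega> assume w: "\<forall>y :: 'd site. F (env_shift y \<omega>) \<le> esssup PP F"
    have "avg_norm p (nat_ball n) (\<lambda>y :: 'd site. max 1 (F (env_shift y \<omega>))) \<le> E" for n
    proof -
      have "nat_ball n \<noteq> ({} :: 'd site set)" using zero_in_nat_ball by blast
      moreover have "max 1 (F (env_shift y \<omega>)) \<le> E" for y :: "'d site"
        unfolding E_def by (intro max.mono order.refl) (use w in blast)
      ultimately show ?thesis unfolding avg_norm_def True if_P[OF refl]
        by (intro Max.boundedI) auto
    qed
    then have "(SUP n\<in>{1..}. avg_norm p (nat_ball n) (\<lambda>y :: 'd site. max 1 (F (env_shift y \<omega>)))) \<le> E"
      by (rule SUP_least)
    then show "(SUP n\<in>{1..}. avg_norm p (nat_ball n) (\<lambda>y :: 'd site. max 1 (F (env_shift y \<omega>)))) < \<infinity>"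
      using E by (rule le_less_trans)
  qed
next
  case False
  interpret prob_space PP by (rule prob)
  define r where "r = enn2real p"
  have r: "0 \<le> r" by (simp add: r_def)
  define h where "h \<omega> = epowr (max 1 (F \<omega>)) r" for \<omega>
  have Fm [measurable]: "F \<in> borel_measurable PP" and Fi: "(\<integral>\<^sup>+ \<omega>. epowr (F \<omega>) r \<partial>PP) < \<infinity>"
    using F False by (simp_all add: in_Lp_def r_def)
  have eF: "(\<lambda>\<omega>. epowr (F \<omega>) r) \<in> borel_measurable PP" by (rule borel_measurable_epowr[OF Fm])
  have hm: "h \<in> borel_measurable PP" unfolding h_def by (intro borel_measurable_epowr) measurable
  have "h \<omega> \<le> 1 + epowr (F \<omega>) r" for \<omega>
  proof (cases "F \<omega> \<le> 1")
    case True
    then have "h \<omega> = 1" by (simp add: h_def max_absorb1 epowr_def)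
    then show ?thesis by simp
  next
    case False
    then have "h \<omega> = epowr (F \<omega>) r" by (simp add: h_def max_absorb2)
    then show ?thesis by simp
  qed
  then have "(\<integral>\<^sup>+ \<omega>. h \<omega> \<partial>PP) \<le> (\<integral>\<^sup>+ \<omega>. 1 + epowr (F \<omega>) r \<partial>PP)" by (intro nn_integral_mono)
  also have "\<dots> = 1 + (\<integral>\<^sup>+ \<omega>. epowr (F \<omega>) r \<partial>PP)"
    by (subst nn_integral_add) (simp_all add: eF emeasure_space_1)
  also have "\<dots> < \<infinity>" using Fi by (simp add: less_top)
  finally have "AE \<omega> in PP. (SUP n\<in>{1..}. ball_sum h n \<omega> / of_nat (card (nat_ball n :: 'd site set))) < \<infinity>"
    by (rule maximal_function_finite[OF hm])
  then show ?thesis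
  proof (rule eventually_mono)
    fix \<omega>
    define S where "S = (SUP n\<in>{1..}. ball_sum h n \<omega> / of_nat (card (nat_ball n :: 'd site set)))"
    assume "(SUP n\<in>{1..}. ball_sum h n \<omega> / of_nat (card (nat_ball n :: 'd site set))) < \<infinity>"
    then have S: "epowr S (1 / r) < \<infinity>" unfolding S_def[symmetric] by (simp only: epowr_finite_iff)
    have "avg_norm p (nat_ball n) (\<lambda>y :: 'd site. max 1 (F (env_shift y \<omega>))) \<le> epowr S (1 / r)"
      if n: "n \<in> {1..}" for n
    proof -
      have "ball_sum h n \<omega> / of_nat (card (nat_ball n :: 'd site set)) \<le> S"
        unfolding S_def using n by (rule SUP_upper)
      then show ?thesis unfolding avg_norm_def if_not_P[OF False] r_def[symmetric]
        using r by (intro epowr_mono) (simp_all add: ball_sum_def h_def)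
    qed
    then have "(SUP n\<in>{1..}. avg_norm p (nat_ball n) (\<lambda>y :: 'd site. max 1 (F (env_shift y \<omega>)))) \<le> epowr S (1 / r)"
      by (rule SUP_least)
    then show "(SUP n\<in>{1..}. avg_norm p (nat_ball n) (\<lambda>y :: 'd site. max 1 (F (env_shift y \<omega>)))) < \<infinity>"
      using S by (rule le_less_trans)
  qed
qed

text \<open>Stationarity turns averages over sites into averages over shifts of functions at the
  origin. Real radii reduce to integer ones, and the product of the separate suprema bounds the
  supremum of the products.\<close>

lemma M1_finite:
  assumes pos: "\<And>\<omega> x. \<omega> \<in> space env_space \<Longrightarrow> 0 < \<theta> \<omega> x" and speed: "stationary_speed PP \<theta>"
    and Lp: "in_Lp PP p (\<lambda>\<omega>. ennreal (\<theta> \<omega> 0))" "in_Lp PP p (\<lambda>\<omega>. mu m0 \<omega> 0)"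
      "in_Lp PP q (\<lambda>\<omega>. ennreal (nu \<omega> 0))"
  shows "AE \<omega> in PP. M1 m0 p q \<theta> \<omega> < \<infinity>"
proof -
  have "AE \<omega> in PP. \<theta> \<omega> y = \<theta> (env_shift y \<omega>) 0" for y
    using speed unfolding stationary_speed_def by (elim allE[of _ 0] allE[of _ y]) simp
  then have "AE \<omega> in PP. \<forall>y. \<theta> \<omega> y = \<theta> (env_shift y \<omega>) 0" by (rule AE_all_sites)
  moreover note maximal_avg_norm_finite[OF Lp(1)] maximal_avg_norm_finite[OF Lp(2)]
    maximal_avg_norm_finite[OF Lp(3)] in_Lp_finite[OF Lp(2)] AE_space
  ultimately show ?thesis
  proof eventually_elim
    case (elim \<omega>)
    define A where "A = (SUP n\<in>{1..}. avg_norm p (nat_ball n) (\<lambda>y :: 'd site. max 1 (mu m0 (env_shift y \<omega>) 0)))"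
    define B where "B = (SUP n\<in>{1..}. avg_norm p (nat_ball n) (\<lambda>y :: 'd site. max 1 (ennreal (\<theta> (env_shift y \<omega>) 0))))"
    define C where "C = (SUP n\<in>{1..}. avg_norm q (nat_ball n) (\<lambda>y :: 'd site. max 1 (ennreal (nu (env_shift y \<omega>) 0))))"
    have fin: "A < \<infinity>" "B < \<infinity>" "C < \<infinity>" unfolding A_def B_def C_def by (fact elim)+
    have "M0 m0 p q \<theta> \<omega> \<le> (A + B) * C"
      unfolding M0_def
    proof (rule SUP_least)
      fix R :: real assume "R \<in> {1..}"
      then have R: "nat \<lfloor>R\<rfloor> \<in> {1..}" "lattice_ball R = (nat_ball (nat \<lfloor>R\<rfloor>) :: 'd site set)"
        by (auto simp: lattice_ball_eq_nat_ball le_nat_iff)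
      have "mu m0 \<omega> x = mu m0 (env_shift x \<omega>) 0" "nu \<omega> x = nu (env_shift x \<omega>) 0" for x
        by (simp_all add: mu_env_shift nu_env_shift)
      note eqs = this elim(1)[rule_format]
      show "(avg_norm p (lattice_ball R) (\<lambda>x. max 1 (mu m0 \<omega> x)) +
        avg_norm p (lattice_ball R) (\<lambda>x. max 1 (ennreal (\<theta> \<omega> x)))) *
        avg_norm q (lattice_ball R) (\<lambda>x. max 1 (ennreal (nu \<omega> x))) \<le> (A + B) * C"
        unfolding R(2) A_def B_def C_def
        by (subst eqs(1), subst eqs(2), subst eqs(3), intro mult_mono add_mono SUP_upper R(1)) auto
    qed
    also have "\<dots> < \<infinity>" using fin by (simp add: ennreal_mult_less_top)
    finally have M0: "epowr (M0 m0 p q \<theta> \<omega>) k < \<infinity>" for k by (simp only: epowr_finite_iff)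
    have "0 < \<theta> \<omega> 0" by (rule pos) (use elim(6) in \<open>simp add: space_PP\<close>)
    then have "mu m0 \<omega> 0 / ennreal (\<theta> \<omega> 0) < \<infinity>"
      using elim(5) by (simp add: ennreal_divide_eq_top_iff less_top[symmetric])
    then show ?case using M0 unfolding M1_def by (simp add: ennreal_mult_less_top)
  qed
qed

end

lemma M0_ge_1:
  assumes "1 \<le> p" "1 \<le> q"
  shows "1 \<le> M0 m0 p q \<theta> (\<omega> :: 'd::finite env)"
proof -
  let ?B = "lattice_ball 1 :: 'd site set"
  have B: "finite ?B" "?B \<noteq> {}"
    using zero_in_nat_ball[of 1, where 'a = 'd] by (auto simp: lattice_ball_eq_nat_ball simp del: zero_in_nat_ball)
  let ?a = "avg_norm p ?B (\<lambda>x. max 1 (mu m0 \<omega> x))" and ?b = "avg_norm p ?B (\<lambda>x. max 1 (ennreal (\<theta> \<omega> x)))"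
    and ?c = "avg_norm q ?B (\<lambda>x. max 1 (ennreal (nu \<omega> x)))"
  have "1 \<le> ?a" "1 \<le> ?c" using assms by (intro avg_norm_ge_1 B; simp)+
  then have "1 * 1 \<le> (?a + ?b) * ?c" by (intro mult_mono add_increasing2) auto
  also have "\<dots> \<le> M0 m0 p q \<theta> \<omega>" unfolding M0_def by (rule SUP_upper) simp
  finally show ?thesis by simp
qed

text \<open>Over the common denominator a' m0, and with a' = 2 - a, the numerators differ by a d m0
  + 2 a d + a' d, which is nonnegative.\<close>

lemma kernel_exponent_le:
  assumes a': "0 < exp_a' d p q" and m0: "0 < m0"
  shows "1 + 4 * real d / exp_a' d p q \<le> (1 + m0 * exp_gamma d m0 p q) / exp_beta d m0 p q"
proof -
  define a' where "a' = exp_a' d p q"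
  define a where "a = exp_a d p q"
  define \<sigma> where "\<sigma> = exp_sigma d m0 p q"
  have pos: "0 < a'" "0 \<le> a" using a' by (simp_all add: a'_def a_def exp_a_def dim_ratio_def)
  have aa: "a' = 2 - a" by (simp add: a_def a'_def exp_a_def exp_a'_def)
  have s: "\<sigma> = 2 * d * m0 + a' * m0 + 2 * a * d + a' * d" by (simp add: \<sigma>_def exp_sigma_def a_def a'_def)
  have "0 < a' * m0" using pos m0 by simp
  moreover have "0 \<le> 2 * d * m0 + 2 * a * d + a' * d" using pos m0 by simp
  ultimately have s0: "0 < \<sigma>" unfolding s by linarith
  have "(1 + m0 * exp_gamma d m0 p q) / exp_beta d m0 p q = (\<sigma> + m0 * (2 * a * d + a' * d)) / (a' * m0)"
  proof -
    have "1 + m0 * (G / \<sigma>) = (\<sigma> + m0 * G) / \<sigma>" for G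
      using s0 by (simp add: add_divide_distrib)
    then show ?thesis
      using s0 unfolding exp_gamma_def exp_beta_def a'_def[symmetric] a_def[symmetric] \<sigma>_def[symmetric]
      by simp
  qed
  moreover have "a' * m0 + 4 * d * m0 \<le> \<sigma> + m0 * (2 * a * d + a' * d)"
  proof -
    have "\<sigma> + m0 * (2 * a * d + a' * d) = a' * m0 + 4 * d * m0 + (a * d * m0 + 2 * a * d + a' * d)"
      by (simp add: s aa algebra_simps)
    moreover have "0 \<le> a * d * m0 + 2 * a * d + a' * d" using pos m0 by simp
    ultimately show ?thesis by linarith
  qed
  then have "(a' * m0 + 4 * d * m0) / (a' * m0) \<le> (\<sigma> + m0 * (2 * a * d + a' * d)) / (a' * m0)"
    using pos m0 by (intro divide_right_mono) auto
  moreover have "(a' * m0 + 4 * d * m0) / (a' * m0) = 1 + 4 * d / a'"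
    using pos m0 by (simp add: field_simps)
  ultimately show ?thesis by (simp add: a'_def)
qed

theorem theorem1p8:
  fixes PP :: "'d::finite env measure"
    and \<theta> :: "'d env \<Rightarrow> 'd site \<Rightarrow> real"
    and m0 :: real and p q :: ennreal
  assumes "CARD('d) \<ge> 3"
    and "prob_space PP"
    and "sets PP = sets env_space"
    and "stationary_law PP"
    and "ergodic_law PP"
    and "\<And>\<omega> x. \<omega> \<in> space env_space \<Longrightarrow> 0 < \<theta> \<omega> x"
    and "stationary_speed PP \<theta>"
    and "real CARD('d) < m0"
    and "max 1 (ennreal (real CARD('d) / (m0 - 2))) < p"
    and "1 < q"
    and "1 / p + 1 / q < ennreal (2 / real CARD('d))"
    and "in_Lp PP p (\<lambda>\<omega>. ennreal (\<theta> \<omega> 0))"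
    and "in_Lp PP p (\<lambda>\<omega>. mu m0 \<omega> 0)"
    and "in_Lp PP q (\<lambda>\<omega>. ennreal (nu \<omega> 0))"
  shows "(AE \<omega> in PP. M1 m0 p q \<theta> \<omega> < \<infinity>) \<and>
    (\<exists>C4>0. \<forall>\<omega>\<in>space env_space. (\<forall>x. (\<Sum>\<^sub>\<infinity>y. ennreal (cond \<omega> x y)) < \<infinity>) \<longrightarrow>
      (\<forall>P. hunt_process_of_form \<omega> (\<theta> \<omega>) P \<longrightarrow>
        (\<forall>t>0. ennreal (heat_kernel (\<theta> \<omega>) P t 0 0)
               \<le> ennreal C4 * M1 m0 p q \<theta> \<omega> * ennreal (t powr (- real CARD('d) / 2)))))"
proof
  interpret stationary_env PP using assms(2-4) by (rule stationary_env.intro)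
  show "AE \<omega> in PP. M1 m0 p q \<theta> \<omega> < \<infinity>"
    by (rule M1_finite[OF assms(6) assms(7) assms(12-14)])
next
  let ?k = "1 + 4 * real CARD('d) / exp_a' CARD('d) p q"
  let ?\<kappa> = "(1 + m0 * exp_gamma CARD('d) m0 p q) / exp_beta CARD('d) m0 p q"
  have p: "1 \<le> p" and q: "1 \<le> q" using assms(9,10) by (simp_all add: less_imp_le)
  have k: "?k \<le> ?\<kappa>"
    using assms(1,8) by (intro kernel_exponent_le exp_a'_pos assms(11)) auto
  obtain C where C: "C > 0" and
    bound: "\<forall>\<omega> (\<theta> :: 'd env \<Rightarrow> 'd site \<Rightarrow> real) P t. \<omega> \<in> space env_space \<and> (\<forall>x. 0 < \<theta> \<omega> x) \<and>
     (\<forall>x. (\<Sum>\<^sub>\<infinity>y. ennreal (cond \<omega> x y)) < \<infinity>) \<and> M0 m0 p q \<theta> \<omega> < \<infinity> \<and>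
     hunt_process_of_form \<omega> (\<theta> \<omega>) P \<and> 0 < t \<longrightarrow>
     heat_kernel (\<theta> \<omega>) P t 0 0 \<le> C * enn2real (M0 m0 p q \<theta> \<omega>) powr ?k * t powr (- real CARD('d) / 2)"
    using heat_kernel_bound[OF assms(1) assms(8) p q assms(11)] by (elim exE conjE) (rule that)
  show "\<exists>C4>0. \<forall>\<omega>\<in>space env_space. (\<forall>x. (\<Sum>\<^sub>\<infinity>y. ennreal (cond \<omega> x y)) < \<infinity>) \<longrightarrow>
      (\<forall>P. hunt_process_of_form \<omega> (\<theta> \<omega>) P \<longrightarrow>
        (\<forall>t>0. ennreal (heat_kernel (\<theta> \<omega>) P t 0 0)
               \<le> ennreal C4 * M1 m0 p q \<theta> \<omega> * ennreal (t powr (- real CARD('d) / 2))))"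
  proof (intro exI[of _ C] conjI ballI allI impI C)
    fix \<omega> P and t :: real
    assume om: "\<omega> \<in> space env_space" and rates: "\<forall>x. (\<Sum>\<^sub>\<infinity>y. ennreal (cond \<omega> x y)) < \<infinity>"
      and hp: "hunt_process_of_form \<omega> (\<theta> \<omega>) P" and t: "0 < t"
    have le_M1: "epowr (M0 m0 p q \<theta> \<omega>) ?\<kappa> \<le> M1 m0 p q \<theta> \<omega>"
      unfolding M1_def using mult_left_mono[of 1 "1 + mu m0 \<omega> 0 / ennreal (\<theta> \<omega> 0)" "epowr (M0 m0 p q \<theta> \<omega>) ?\<kappa>"]
      by simp
    show "ennreal (heat_kernel (\<theta> \<omega>) P t 0 0) \<le> ennreal C * M1 m0 p q \<theta> \<omega> * ennreal (t powr (- real CARD('d) / 2))"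
    proof (cases "M0 m0 p q \<theta> \<omega> < \<infinity>")
      case True
      define M where "M = enn2real (M0 m0 p q \<theta> \<omega>)"
      have eM: "M0 m0 p q \<theta> \<omega> = ennreal M" using True by (simp add: M_def)
      have M: "1 \<le> M" using M0_ge_1[OF p q, of m0 \<theta> \<omega>] unfolding eM by simp
      have "heat_kernel (\<theta> \<omega>) P t 0 0 \<le> C * M powr ?k * t powr (- real CARD('d) / 2)"
        unfolding M_def by (rule bound[rule_format]) (use om assms(6) rates True hp t in simp)
      also have "\<dots> \<le> C * M powr ?\<kappa> * t powr (- real CARD('d) / 2)"
        using C M by (intro mult_right_mono mult_left_mono powr_mono k) auto
      finally have "ennreal (heat_kernel (\<theta> \<omega>) P t 0 0) \<le> ennreal (C * M powr ?\<kappa> * t powr (- real CARD('d) / 2))"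
        by (rule ennreal_leI)
      also have "\<dots> = ennreal C * epowr (M0 m0 p q \<theta> \<omega>) ?\<kappa> * ennreal (t powr (- real CARD('d) / 2))"
        using C M by (simp add: eM epowr_ennreal ennreal_mult)
      also have "\<dots> \<le> ennreal C * M1 m0 p q \<theta> \<omega> * ennreal (t powr (- real CARD('d) / 2))"
        by (intro mult_right_mono mult_left_mono le_M1) auto
      finally show ?thesis .
    next
      case False
      then have "M0 m0 p q \<theta> \<omega> = \<top>" by (simp add: less_top[symmetric])
      then have "M1 m0 p q \<theta> \<omega> = \<top>" using le_M1 by (simp add: epowr_def top_unique)
      \<comment> \<open>Positivity of \<open>C\<close> and of the power of \<open>t\<close> matters:
        in \<open>ennreal\<close> an infinite factor times 0 would be 0.\<close>
      then show ?thesis using C t by (simp add: ennreal_mult_top ennreal_top_mult)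
    qed
  qed
qed

end
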